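(* Let $(u_h,\hat u_h)\in \mathcal{X}_h^k$, and let $\Gamma=\bigcup_{i=1}^N e_i$ be a union of distinct boundary faces $e_1,\dots,e_N\in\partial\mathcal{T}_h^b$ having positive $(d-1)$-dimensional measure. Then the following inequalities hold: $$\|u_h\|^2_{L^2(\mathcal{T}_h)}\lesssim h^2|u_h|_{H^1(\mathcal{T}_h)}^2+h\|u_h-\hat u_h\|^2_{L^2(\partial\mathcal{T}_h)}+\left|\mathcal{L}^{\mathcal{CR}}_h(\bar{\hat u}_h)\right|_{H^1(\mathcal{T}_h)}^2+\left(\int_\Omega \mathcal{L}^{\mathcal{CR}}_h(\bar{\hat u}_h)\,dx\right)^2,$$ $$\|u_h\|^2_{L^2(\mathcal{T}_h)}\lesssim h^2|u_h|_{H^1(\mathcal{T}_h)}^2+h\|u_h-\hat u_h\|^2_{L^2(\partial\mathcal{T}_h)}+\left|\mathcal{L}^{\mathcal{CR}}_h(\bar{\hat u}_h)\right|_{H^1(\mathcal{T}_h)}^2+\left(\int_\Gamma \hat u_h\,ds\right)^2,$$ and $$\|u_h\|^2_{L^2(\mathcal{T}_h)}\lesssim h^2|u_h|_{H^1(\mathcal{T}_h)}^2+h\|u_h-\hat u_h\|^2_{L^2(\partial\mathcal{T}_h)}+\left|\mathcal{L}^{\mathcal{CR}}_h(\bar{\hat u}_h)\right|_{H^1(\mathcal{T}_h)}^2+\left(\int_\Omega u_h\,dx\right)^2.$$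
   Context: $\Omega\subset\mathbb{R}^d$, $d\in\{2,3\}$, is a connected, bounded, open polyhedral domain; $k\ge 0$ is an integer. $\mathcal{T}_h$ is a triangulation of $\Omega$ into simplices $K$ (triangles if $d=2$, tetrahedra if $d=3$), with no hanging nodes, which is shape regular, $\min_{K\in\mathcal{T}_h}|K|/\mathrm{diam}(K)^d\ge\kappa_{\mathcal{T}}>0$, and quasi-uniform, $\mathrm{diam}(K)/\mathrm{diam}(K')\le A_{\mathrm{qu}}$ for all $K,K'\in\mathcal{T}_h$, with constants $\kappa_{\mathcal{T}},A_{\mathrm{qu}}$ not depending on the mesh. $h_K=\mathrm{diam}(K)$ and $h=\max_K h_K$. $\partial\mathcal{T}_h=\partial\mathcal{T}_h^i\cup\partial\mathcal{T}_h^b$ is the set of all faces (the skeleton), split into interior and boundary faces; $|e|$ is the $(d-1)$-dimensional measure of a face $e$. Spaces: $\mathcal{P}^k$ denotes polynomials of degree at most $k$; $\mathcal{U}_h^k=\{f\in L^2(\mathcal{T}_h): f|_K\in\mathcal{P}^k(K)\ \forall K\in\mathcal{T}_h\}$; $\mathcal{F}_h^k=\{\hat f\in L^2(\partial\mathcal{T}_h):\hat f|_e\in\mathcal{P}^k(e)\ \forall e\in\partial\mathcal{T}_h\}$ (one value on each face); $\mathcal{X}_h^k=\mathcal{U}_h^k\times\mathcal{F}_h^k$. Norms: $\|u\|_{L^2(\mathcal{T}_h)}^2=\sum_K\|u\|_{L^2(K)}^2$; $|u|_{H^1(\mathcal{T}_h)}^2=\sum_K\|\nabla u\|_{L^2(K)}^2$;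 $\|w\|_{L^2(\partial\mathcal{T}_h)}^2=\sum_{K}\|w\|_{L^2(\partial K)}^2$, where on $\partial K$ the trace of $u_h|_K$ is used (so each interior face is counted twice, once from each side). Face averages: $\bar{\hat u}_h$ is the piecewise constant function on the skeleton with $\bar{\hat u}_h|_e=\frac1{|e|}\int_e\hat u_h\,ds$ for each face $e$. Crouzeix–Raviart lifting: $\mathcal{CR}(\mathcal{T}_h)=\{f\in L^2(\mathcal{T}_h): f|_K\in\mathcal{P}^1(K)\ \forall K,\ \int_e[[f]]_e\,ds=0\ \forall e\in\partial\mathcal{T}_h^i\}$, where $[[f]]_e=f^+\mathbf{n}^++f^-\mathbf{n}^-$ is the jump across $e$ ($f^\pm$ and $\mathbf{n}^\pm$ being the traces and outward unit normals from the two sides). $\mathcal{P}^0(\partial\mathcal{T}_h)$ is the space of piecewise constant functions on the skeleton, and $\mathcal{L}^{\mathcal{CR}}_h:\mathcal{P}^0(\partial\mathcal{T}_h)\to\mathcal{CR}(\mathcal{T}_h)$ is defined by $\mathcal{L}^{\mathcal{CR}}_h(\hat\mu)(c_e)=\hat\mu|_e$ for every face $e$, where $c_e$ is the center (barycenter) of $e$. Convention: $A\lesssim B$ means $A\le CB$ with a constant $C>0$ independent of the functions involved and of the mesh (hence of $h$); it may depend on $\Omega$, $d$, $k$, $\kappa_{\mathcal{T}}$, $A_{\mathrm{qu}}$ and, where $\Gamma$ appears, on the set $\Gamma\subset\partial\Omega$. *)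

theory Defs
  imports "HOL-Analysis.Analysis"
begin

section \<open>Domains and meshes\<close>

definition polyhedral_domain :: "'a::euclidean_space set \<Rightarrow> bool" where
  "polyhedral_domain \<Omega> \<longleftrightarrow>
     \<Omega> \<noteq> {} \<and> open \<Omega> \<and> connected \<Omega> \<and> bounded \<Omega> \<and>
     (\<exists>P. finite P \<and> (\<forall>p\<in>P. polytope p) \<and> \<Omega> = interior (\<Union>P))"

text \<open>
  The constant \<^term>\<open>triangulation\<close> of the library requires any two cells to meet in a common
  face (possibly empty); this is the absence of hanging nodes. Cells are closed simplices.
\<close>

definition simplicial_mesh :: "'a::euclidean_space set \<Rightarrow> 'a set set \<Rightarrow> bool" where
  "simplicial_mesh \<Omega> T \<longleftrightarrow>
     triangulation T \<and> (\<forall>K\<in>T. int DIM('a) simplex K) \<and> \<Union>T = closure \<Omega>"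

definition shape_regular :: "real \<Rightarrow> 'a::euclidean_space set set \<Rightarrow> bool" where
  "shape_regular \<kappa> T \<longleftrightarrow> (\<forall>K\<in>T. measure lebesgue K / diameter K ^ DIM('a) \<ge> \<kappa>)"

definition quasi_uniform :: "real \<Rightarrow> 'a::euclidean_space set set \<Rightarrow> bool" where
  "quasi_uniform A T \<longleftrightarrow> (\<forall>K\<in>T. \<forall>K'\<in>T. diameter K / diameter K' \<le> A)"

definition admissible_mesh ::
  "'a::euclidean_space set \<Rightarrow> real \<Rightarrow> real \<Rightarrow> 'a set set \<Rightarrow> bool" where
  "admissible_mesh \<Omega> \<kappa> A T \<longleftrightarrow>
     simplicial_mesh \<Omega> T \<and> shape_regular \<kappa> T \<and> quasi_uniform A T"

definition mesh_size :: "'a::euclidean_space set set \<Rightarrow> real" where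
  "mesh_size T = Max (diameter ` T)"

definition faces :: "'a::euclidean_space set set \<Rightarrow> 'a set set" where
  "faces T = {e. \<exists>K\<in>T. e facet_of K}"

definition boundary_faces :: "'a::euclidean_space set \<Rightarrow> 'a set set \<Rightarrow> 'a set set" where
  "boundary_faces \<Omega> T = {e \<in> faces T. e \<subseteq> frontier \<Omega>}"

definition barycenter :: "'a::euclidean_space set \<Rightarrow> 'a" where
  "barycenter S =
     (\<Sum>v | v extreme_point_of S. v) /\<^sub>R real (card {v. v extreme_point_of S})"

section \<open>Surface measure on flat faces\<close>

text \<open>
  The \<open>(d - 1)\<close>-dimensional measure on a hyperplane \<open>H\<close>: the push-forward, under the orthogonal
  projection onto \<open>H\<close>, of Lebesgue measure on the slab of thickness 1 around \<open>H\<close>. The measure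
  of \<open>S \<subseteq> H\<close> is thus the volume of the right prism of height 1 over \<open>S\<close>, which by Fubini
  is the \<open>(d - 1)\<close>-dimensional measure of \<open>S\<close>.
\<close>

definition hyperplane_measure :: "'a::euclidean_space set \<Rightarrow> 'a measure" where
  "hyperplane_measure H =
     distr (restrict_space lborel {x. infdist x H \<le> 1 / 2}) borel (closest_point H)"

definition face_integral ::
  "'a::euclidean_space set \<Rightarrow> ('a \<Rightarrow> 'b::{banach, second_countable_topology}) \<Rightarrow> 'b" where
  "face_integral e f = (LINT x:e|hyperplane_measure (affine hull e). f x)"

definition face_area :: "'a::euclidean_space set \<Rightarrow> real" where
  "face_area e = measure (hyperplane_measure (affine hull e)) e"

section \<open>Piecewise polynomial spaces\<close>

text \<open>
  Polynomials in the coordinates \<open>x \<bullet> i\<close>, with one coefficient for each multi-index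
  of total degree at most \<open>k\<close>.
\<close>

definition polynomial_of_degree_le :: "nat \<Rightarrow> ('a::euclidean_space \<Rightarrow> real) \<Rightarrow> bool" where
  "polynomial_of_degree_le k p \<longleftrightarrow>
     (\<exists>c. \<forall>x. p x =
        (\<Sum>\<alpha> \<in> {\<alpha> \<in> Basis \<rightarrow>\<^sub>E {..k}. (\<Sum>i\<in>Basis. \<alpha> i) \<le> k}.
           c \<alpha> * (\<Prod>i\<in>Basis. (x \<bullet> i) ^ \<alpha> i)))"

definition poly_space :: "nat \<Rightarrow> 'a::euclidean_space set \<Rightarrow> ('a \<Rightarrow> real) set" where
  "poly_space k S = {f. \<exists>p. polynomial_of_degree_le k p \<and> (\<forall>x\<in>S. f x = p x)}"

text \<open>
  An element of \<open>L\<^sup>2(T) = \<Prod>\<^sub>K L\<^sup>2(K)\<close> is represented by the family of its restrictions to the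
  cells, and a function on the skeleton by the family of its restrictions to the faces. So
  \<open>u K\<close> is the function on the closed cell \<open>K\<close>, including its trace on the boundary
  of \<open>K\<close>; only the values of \<open>u K\<close> on \<open>K\<close>, for \<open>K \<in> T\<close>, are meaningful. Square
  integrability is automatic for piecewise polynomials.
\<close>

definition cell_space ::
  "nat \<Rightarrow> 'a::euclidean_space set set \<Rightarrow> ('a set \<Rightarrow> 'a \<Rightarrow> real) set" where
  "cell_space k T = {u. \<forall>K\<in>T. u K \<in> poly_space k K}"

definition face_space ::
  "nat \<Rightarrow> 'a::euclidean_space set set \<Rightarrow> ('a set \<Rightarrow> 'a \<Rightarrow> real) set" where
  "face_space k T = {u. \<forall>e\<in>faces T. u e \<in> poly_space k e}"

definition hdg_space ::
  "nat \<Rightarrow> 'a::euclidean_space set set \<Rightarrow> (('a set \<Rightarrow> 'a \<Rightarrow> real) \<times> ('a set \<Rightarrow> 'a \<Rightarrow> real)) set" where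
  "hdg_space k T = cell_space k T \<times> face_space k T"

section \<open>Integrals and norms\<close>

definition domain_integral ::
  "'a::euclidean_space set set \<Rightarrow> ('a set \<Rightarrow> 'a \<Rightarrow> real) \<Rightarrow> real" where
  "domain_integral T u = (\<Sum>K\<in>T. LINT x:K|lebesgue. u K x)"

text \<open>
  On the boundary of a cell \<open>K\<close>, a null set, \<open>gradient (u K)\<close> is not meaningful; it only
  enters through Lebesgue integrals over \<open>K\<close>.
\<close>

definition gradient :: "('a::euclidean_space \<Rightarrow> real) \<Rightarrow> 'a \<Rightarrow> 'a" where
  "gradient f x = (\<Sum>i\<in>Basis. frechet_derivative f (at x) i *\<^sub>R i)"

definition L2_norm :: "'a::euclidean_space set set \<Rightarrow> ('a set \<Rightarrow> 'a \<Rightarrow> real) \<Rightarrow> real" where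
  "L2_norm T u = sqrt (\<Sum>K\<in>T. LINT x:K|lebesgue. (u K x)\<^sup>2)"

definition H1_seminorm :: "'a::euclidean_space set set \<Rightarrow> ('a set \<Rightarrow> 'a \<Rightarrow> real) \<Rightarrow> real" where
  "H1_seminorm T u = sqrt (\<Sum>K\<in>T. LINT x:K|lebesgue. (norm (gradient (u K) x))\<^sup>2)"

text \<open>
  \<open>w K e\<close> is the function seen from the cell \<open>K\<close> on its face \<open>e\<close>; interior faces contribute
  once from each side.
\<close>

definition L2_skeleton_norm ::
  "'a::euclidean_space set set \<Rightarrow> ('a set \<Rightarrow> 'a set \<Rightarrow> 'a \<Rightarrow> real) \<Rightarrow> real" where
  "L2_skeleton_norm T w =
     sqrt (\<Sum>K\<in>T. \<Sum>e | e facet_of K. face_integral e (\<lambda>x. (w K e x)\<^sup>2))"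

definition face_average :: "('a::euclidean_space set \<Rightarrow> 'a \<Rightarrow> real) \<Rightarrow> 'a set \<Rightarrow> 'a \<Rightarrow> real" where
  "face_average u = (\<lambda>e x. face_integral e (u e) / face_area e)"

section \<open>Crouzeix--Raviart lifting\<close>

definition outward_normal :: "'a::euclidean_space set \<Rightarrow> 'a set \<Rightarrow> 'a" where
  "outward_normal K e = (THE n. norm n = 1 \<and> (\<forall>x\<in>e. \<forall>y\<in>K. n \<bullet> (y - x) \<le> 0))"

definition jump ::
  "('a::euclidean_space set \<Rightarrow> 'a \<Rightarrow> real) \<Rightarrow> 'a set \<Rightarrow> 'a set \<Rightarrow> 'a set \<Rightarrow> 'a \<Rightarrow> 'a" where
  "jump f K K' e x =
     f K x *\<^sub>R outward_normal K e + f K' x *\<^sub>R outward_normal K' e"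

text \<open>The interior faces are the common facets of two distinct cells.\<close>

definition CR_space :: "'a::euclidean_space set set \<Rightarrow> ('a set \<Rightarrow> 'a \<Rightarrow> real) set" where
  "CR_space T =
     {f \<in> cell_space 1 T.
        \<forall>K\<in>T. \<forall>K'\<in>T. \<forall>e. K \<noteq> K' \<and> e facet_of K \<and> e facet_of K' \<longrightarrow>
          face_integral e (jump f K K' e) = 0}"

text \<open>
  The conditions determine \<open>CR_lift T \<mu> K\<close> on every cell \<open>K \<in> T\<close>; the choice operator only
  selects the meaningless values off \<open>K\<close>.
\<close>

definition CR_lift ::
  "'a::euclidean_space set set \<Rightarrow> ('a set \<Rightarrow> 'a \<Rightarrow> real) \<Rightarrow> 'a set \<Rightarrow> 'a \<Rightarrow> real" where
  "CR_lift T \<mu> =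
     (SOME f. f \<in> CR_space T \<and>
        (\<forall>K\<in>T. \<forall>e. e facet_of K \<longrightarrow> f K (barycenter e) = \<mu> e (barycenter e)))"

end

theory Submission
  imports Defs "HOL-Computational_Algebra.Polynomial"
begin

text \<open>
  On a cell, a polynomial differs from its mean over a facet by at most \<open>h\<close> times its gradient (an
  inverse estimate), so \<open>u\<close> is close to the Crouzeix--Raviart lifting, which in turn is close to the
  piecewise constant function with one value \<open>a K\<close> of the lifting per cell. Values of neighbouring
  cells differ by at most \<open>h\<close> times the two gradients, because the lifting is continuous at the
  barycenters of the facets. It remains to prove a discrete Poincare inequality for piecewise constant
  functions, with jumps across facets on the right-hand side, uniformly over the meshes.

  Along a generic segment of the closed domain the function jumps only across the \<open>O(1/h)\<close> facets
  that the segment meets, and for a fixed translation vector the starting points of segments that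
  meet a given facet fill a volume \<open>O(h\<^sup>d / h)\<close>. Integrating over all pairs of points bounds the
  variation on convex pieces, and overlapping open convex sets chain the pieces of the connected
  domain together. Near the boundary the starting points in the layer of cells touching the
  boundary only fill a volume \<open>O(h\<^sup>d)\<close>; the gain of one power of \<open>h\<close> is a discrete trace
  inequality, which gives the version with the integral over \<open>\<Gamma>\<close>.
\<close>

section \<open>Polynomials along lines\<close>

text \<open>The powers of h balance exactly: Cauchy-Schwarz along a segment costs the number of
  facets met, and its product with the volume of starting points is h^(d-2), the weight that a
  squared jump has in the energy. A face integral costs 1/h against a cell integral, and this is the
  power that the boundary layer estimate must win back.

  Uniformity dictates the form of the statements. Every constant has to be named before a mesh is
  given, so it may see the mesh only through the volume ratio \<mu> and the diameter D that the
  locale \<open>uniform_mesh\<close> retains. For \<Gamma> this means that one face of one reference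
  mesh must bound the area from below on all meshes with the same \<Gamma>.

  Since the area of a face is encoded as the volume of a prism, the barycenter rule for affine
  functions comes from symmetry: the exchange of two vertices of a face extends to an affine
  involution of the whole space that preserves the prism and Lebesgue measure.\<close>

definition line_polynomial :: "nat \<Rightarrow> ('a::euclidean_space \<Rightarrow> real) \<Rightarrow> bool" where
  "line_polynomial k p \<longleftrightarrow> (\<forall>x v. \<exists>q. degree q \<le> k \<and> (\<forall>t. p (x + t *\<^sub>R v) = poly q t))"

lemma degree_prod_le_sum: "degree (\<Prod>i\<in>I. f i) \<le> (\<Sum>i\<in>I. degree (f i))" for f :: "'b \<Rightarrow> real poly"
  by (induction I rule: infinite_finite_induct) (auto intro: degree_mult_le[THEN order_trans])

lemma line_polynomial_polynomial:
  assumes "polynomial_of_degree_le k p" shows "line_polynomial k p"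
  unfolding line_polynomial_def
proof (intro allI)
  fix x v :: 'a
  define I where "I = {\<alpha> \<in> Basis \<rightarrow>\<^sub>E {..k}. (\<Sum>i\<in>(Basis::'a set). \<alpha> i) \<le> k}"
  obtain c where c: "\<And>x. p x = (\<Sum>\<alpha>\<in>I. c \<alpha> * (\<Prod>i\<in>Basis. (x \<bullet> i) ^ \<alpha> i))"
    using assms unfolding polynomial_of_degree_le_def I_def by auto
  define q where "q = (\<Sum>\<alpha>\<in>I. smult (c \<alpha>) (\<Prod>i\<in>Basis. [:x \<bullet> i, v \<bullet> i:] ^ \<alpha> i))"
  have "degree q \<le> k"
    unfolding q_def
  proof (rule degree_sum_le)
    show "finite I" unfolding I_def by (intro finite_subset[OF _ finite_PiE[of Basis "\<lambda>_. {..k}"]]) auto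
    fix \<alpha> assume "\<alpha> \<in> I"
    then have "(\<Sum>i\<in>Basis. \<alpha> i) \<le> k" by (simp add: I_def)
    moreover have "degree (\<Prod>i\<in>Basis. [:x \<bullet> i, v \<bullet> i:] ^ \<alpha> i) \<le> (\<Sum>i\<in>Basis. degree ([:x \<bullet> i, v \<bullet> i:] ^ \<alpha> i))"
      by (rule degree_prod_le_sum)
    moreover have "\<dots> \<le> (\<Sum>i\<in>Basis. \<alpha> i)"
      by (intro sum_mono order_trans[OF degree_power_le]) simp
    ultimately show "degree (smult (c \<alpha>) (\<Prod>i\<in>Basis. [:x \<bullet> i, v \<bullet> i:] ^ \<alpha> i)) \<le> k"
      using degree_smult_le le_trans by blast
  qed
  moreover have "p (x + t *\<^sub>R v) = poly q t" for t
    unfolding c q_def by (simp add: poly_sum poly_prod inner_add_left mult.commute)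
  ultimately show "\<exists>q. degree q \<le> k \<and> (\<forall>t. p (x + t *\<^sub>R v) = poly q t)" by blast
qed

text \<open>Together with closure under linear combinations this is what the class is made for:
  partial derivatives become members of it as combinations of translates, without any computation
  with the coefficients of multi-indices.\<close>

lemma line_polynomial_translate:
  assumes "line_polynomial k p" shows "line_polynomial k (\<lambda>x. p (x + a))"
  unfolding line_polynomial_def
proof (intro allI)
  fix x v
  show "\<exists>q. degree q \<le> k \<and> (\<forall>t. p (x + t *\<^sub>R v + a) = poly q t)"
    using assms unfolding line_polynomial_def by (metis add.assoc add.commute)
qed

lemma line_polynomial_lincomb:
  assumes "\<And>j. j \<in> J \<Longrightarrow> line_polynomial k (f j)"
  shows "line_polynomial k (\<lambda>x. \<Sum>j\<in>J. c j * f j x)"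
  unfolding line_polynomial_def
proof (intro allI)
  fix x v
  have "\<forall>j\<in>J. \<exists>q. degree q \<le> k \<and> (\<forall>t. f j (x + t *\<^sub>R v) = poly q t)"
    using assms unfolding line_polynomial_def by blast
  then obtain q where q: "\<And>j. j \<in> J \<Longrightarrow> degree (q j) \<le> k \<and> (\<forall>t. f j (x + t *\<^sub>R v) = poly (q j) t)"
    by metis
  have "degree (\<Sum>j\<in>J. smult (c j) (q j)) \<le> k"
  proof (cases "finite J")
    case True
    then show ?thesis
      by (intro degree_sum_le) (use q degree_smult_le le_trans in blast)+
  qed simp
  moreover have "(\<Sum>j\<in>J. c j * f j (x + t *\<^sub>R v)) = poly (\<Sum>j\<in>J. smult (c j) (q j)) t" for t
    using q by (simp add: poly_sum)
  ultimately show "\<exists>q. degree q \<le> k \<and> (\<forall>t. (\<Sum>j\<in>J. c j * f j (x + t *\<^sub>R v)) = poly q t)" by blast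
qed

text \<open>The denominator \<open>Suc k\<close> keeps the nodes well defined also for
  \<open>k = 0\<close>. They lie in [0,1], the interval on which the polynomials below are assumed
  to be bounded.\<close>

definition node :: "nat \<Rightarrow> nat \<Rightarrow> real" where "node k j = real j / real (Suc k)"

definition lagrange_basis :: "nat \<Rightarrow> nat \<Rightarrow> real poly" where
  "lagrange_basis k j = (\<Prod>i\<in>{..k}-{j}. smult (1 / (node k j - node k i)) [:- node k i, 1:])"

lemma node_inj: "node k i = node k j \<longleftrightarrow> i = j"
  by (simp add: node_def field_simps)

lemma node_range: "j \<le> k \<Longrightarrow> 0 \<le> node k j \<and> node k j \<le> 1"
  by (simp add: node_def field_simps)

lemma lagrange_interpolation:
  assumes "degree q \<le> k"
  shows "q = (\<Sum>j\<le>k. smult (poly q (node k j)) (lagrange_basis k j))"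
proof (rule poly_eqI_degree[where A = "node k ` {..k}"])
  have c: "card (node k ` {..k}) = Suc k"
    by (subst card_image) (auto simp: inj_on_def node_inj)
  have L: "poly (lagrange_basis k j) (node k i) = (if i = j then 1 else 0)" if "i \<le> k" "j \<le> k" for i j
  proof (cases "i = j")
    case True
    then show ?thesis
      by (simp add: lagrange_basis_def poly_prod) (intro prod.neutral, auto simp: node_inj divide_simps)
  next
    case False
    have "\<exists>a\<in>{..k}-{j}. poly (smult (1 / (node k j - node k a)) [:- node k a, 1:]) (node k i) = 0"
      using that False by (intro bexI[of _ i]) auto
    with False show ?thesis
      unfolding lagrange_basis_def poly_prod by (subst prod_zero) auto
  qed
  fix x assume "x \<in> node k ` {..k}"
  then obtain i where i: "i \<le> k" "x = node k i" by auto
  have "(\<Sum>j\<le>k. poly q (node k j) * poly (lagrange_basis k j) (node k i)) = (\<Sum>j\<le>k. if i = j then poly q (node k j) else 0)"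
    by (intro sum.cong) (auto simp: L i)
  then show "poly q x = poly (\<Sum>j\<le>k. smult (poly q (node k j)) (lagrange_basis k j)) x"
    using i by (simp add: poly_sum)
next
  have "degree (lagrange_basis k j) \<le> k" if "j \<le> k" for j
  proof -
    have "degree (lagrange_basis k j) \<le> (\<Sum>i\<in>{..k}-{j}. degree (smult (1 / (node k j - node k i)) [:- node k i, 1:]))"
      unfolding lagrange_basis_def by (rule degree_prod_le_sum)
    also have "\<dots> \<le> (\<Sum>i\<in>{..k}-{j}. 1)" by (intro sum_mono) (auto intro: degree_smult_le[THEN order_trans])
    also have "\<dots> = k" using that by simp
    finally show ?thesis .
  qed
  then have "degree (\<Sum>j\<le>k. smult (poly q (node k j)) (lagrange_basis k j)) \<le> k"
    by (intro degree_sum_le) (auto intro: degree_smult_le[THEN order_trans])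
  moreover have "card (node k ` {..k}) = Suc k"
    by (subst card_image) (auto simp: inj_on_def node_inj)
  ultimately show "degree (\<Sum>j\<le>k. smult (poly q (node k j)) (lagrange_basis k j)) < card (node k ` {..k})"
    "degree q < card (node k ` {..k})" using assms by auto
qed

lemma pderiv_lagrange:
  assumes "degree q \<le> k"
  shows "pderiv q = (\<Sum>j\<le>k. smult (poly q (node k j)) (pderiv (lagrange_basis k j)))"
  using arg_cong[OF lagrange_interpolation[OF assms], of pderiv] higher_pderiv_sum[of 1 "\<lambda>j. smult (poly q (node k j)) (lagrange_basis k j)" "{..k}"]
  by (simp add: pderiv_smult del: sum.atMost_Suc)

text \<open>The values at the nodes determine \<open>q\<close> linearly, and the finitely many
  Lagrange basis polynomials and their derivatives are bounded on the compact interval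
  \<open>{0..R}\<close>. Hence the constant is the same for all polynomials of degree at most
  \<open>k\<close>.\<close>

lemma poly_growth_bound:
  fixes k :: nat and R :: real
  obtains C where "C \<ge> 1" "\<And>(q::real poly) M t. degree q \<le> k \<Longrightarrow> (\<And>t. t \<in> {0..1} \<Longrightarrow> \<bar>poly q t\<bar> \<le> M) \<Longrightarrow> t \<in> {0..R}
     \<Longrightarrow> \<bar>poly q t\<bar> \<le> C * M"
    "\<And>(q::real poly) M t. degree q \<le> k \<Longrightarrow> (\<And>t. t \<in> {0..1} \<Longrightarrow> \<bar>poly q t\<bar> \<le> M) \<Longrightarrow> t \<in> {0..R}
     \<Longrightarrow> \<bar>poly (pderiv q) t\<bar> \<le> C * M"
proof -
  have "\<exists>B. \<forall>t\<in>{0..R}. \<bar>poly p t\<bar> \<le> B" for p :: "real poly"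
  proof -
    have "compact (poly p ` {0..R})" by (intro compact_continuous_image continuous_intros) simp
    then have "bounded (poly p ` {0..R})" by (rule compact_imp_bounded)
    then show ?thesis unfolding bounded_iff by auto
  qed
  then obtain B where B: "\<And>p t. t\<in>{0..R} \<Longrightarrow> \<bar>poly (p::real poly) t\<bar> \<le> B p" by metis
  define D where "D = (\<Sum>j\<le>k. \<bar>B (lagrange_basis k j)\<bar>) + (\<Sum>j\<le>k. \<bar>B (pderiv (lagrange_basis k j))\<bar>) + 1"
  have main: "\<bar>\<Sum>j\<le>k. poly q (node k j) * poly (f j) t\<bar> \<le> D * M"
    if "\<And>t. t \<in> {0..1} \<Longrightarrow> \<bar>poly q t\<bar> \<le> M" "t \<in> {0..R}" "(\<Sum>j\<le>k. \<bar>B (f j)\<bar>) \<le> D" for q M t f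
  proof -
    have M: "M \<ge> 0" using that(1)[of 0] by auto
    have "\<bar>\<Sum>j\<le>k. poly q (node k j) * poly (f j) t\<bar> \<le> (\<Sum>j\<le>k. \<bar>poly q (node k j) * poly (f j) t\<bar>)"
      by (rule sum_abs)
    also have "\<dots> \<le> (\<Sum>j\<le>k. M * \<bar>B (f j)\<bar>)"
      unfolding abs_mult
    proof (intro sum_mono mult_mono)
      fix j assume "j \<in> {..k}"
      then show "\<bar>poly q (node k j)\<bar> \<le> M" using node_range by (intro that(1)) auto
      show "\<bar>poly (f j) t\<bar> \<le> \<bar>B (f j)\<bar>" using B[OF that(2), of "f j"] by linarith
    qed (use M in auto)
    also have "\<dots> \<le> D * M" using mult_right_mono[OF that(3) M] by (simp add: sum_distrib_left mult.commute)
    finally show ?thesis .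
  qed
  show ?thesis
  proof (rule that[of D])
    show "D \<ge> 1" unfolding D_def by (simp add: sum_nonneg)
    fix q :: "real poly" and M t
    assume q: "degree q \<le> k" "\<And>t. t \<in> {0..1} \<Longrightarrow> \<bar>poly q t\<bar> \<le> M" "t \<in> {0..R}"
    have eq: "q = (\<Sum>j\<le>k. smult (poly q (node k j)) (lagrange_basis k j))" by (rule lagrange_interpolation[OF q(1)])
    have "poly q t = (\<Sum>j\<le>k. poly q (node k j) * poly (lagrange_basis k j) t)"
      by (subst eq) (simp add: poly_sum)
    then show "\<bar>poly q t\<bar> \<le> D * M"
      using main[OF q(2,3), of "lagrange_basis k"] by (simp add: D_def add_increasing2 sum_nonneg)
    have "pderiv q = (\<Sum>j\<le>k. smult (poly q (node k j)) (pderiv (lagrange_basis k j)))"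
      by (rule pderiv_lagrange[OF q(1)])
    then have "poly (pderiv q) t = (\<Sum>j\<le>k. poly q (node k j) * poly (pderiv (lagrange_basis k j)) t)"
      by (simp add: poly_sum)
    then show "\<bar>poly (pderiv q) t\<bar> \<le> D * M"
      using main[OF q(2,3), of "\<lambda>j. pderiv (lagrange_basis k j)"] by (simp add: D_def sum_nonneg)
  qed
qed

lemma line_polynomial_growth:
  fixes k :: nat and R :: real
  obtains C where "C \<ge> 1"
    "\<And>(p :: 'a::euclidean_space \<Rightarrow> real) M x v t. line_polynomial k p \<Longrightarrow> (\<And>t. t \<in> {0..1} \<Longrightarrow> \<bar>p (x + t *\<^sub>R v)\<bar> \<le> M) \<Longrightarrow>
       t \<in> {0..R} \<Longrightarrow> \<bar>p (x + t *\<^sub>R v)\<bar> \<le> C * M"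
    "\<And>(p :: 'a::euclidean_space \<Rightarrow> real) M x v t. line_polynomial k p \<Longrightarrow> (\<And>t. t \<in> {0..1} \<Longrightarrow> \<bar>p (x + t *\<^sub>R v)\<bar> \<le> M) \<Longrightarrow>
       t \<in> {0..1} \<Longrightarrow> \<bar>p (x + t *\<^sub>R v) - p x\<bar> \<le> C * M * t"
proof -
  \<comment> \<open>The range is enlarged to contain [0,1], because the increment estimate needs the
    derivative there whatever \<open>R\<close> is.\<close>
  obtain C where C: "C \<ge> 1" "\<And>(q::real poly) M t. degree q \<le> k \<Longrightarrow> (\<And>t. t \<in> {0..1} \<Longrightarrow> \<bar>poly q t\<bar> \<le> M) \<Longrightarrow> t \<in> {0..max R 1}
     \<Longrightarrow> \<bar>poly q t\<bar> \<le> C * M"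
    "\<And>(q::real poly) M t. degree q \<le> k \<Longrightarrow> (\<And>t. t \<in> {0..1} \<Longrightarrow> \<bar>poly q t\<bar> \<le> M) \<Longrightarrow> t \<in> {0..max R 1}
     \<Longrightarrow> \<bar>poly (pderiv q) t\<bar> \<le> C * M"
    using poly_growth_bound[of k "max R 1"] by metis
  show ?thesis
  proof (rule that[OF C(1)])
    fix p :: "'a \<Rightarrow> real" and M x v t
    assume *: "line_polynomial k p" "\<And>t. t \<in> {0..1} \<Longrightarrow> \<bar>p (x + t *\<^sub>R v)\<bar> \<le> M"
    obtain q where q: "degree q \<le> k" "\<And>t. p (x + t *\<^sub>R v) = poly q t"
      using *(1) unfolding line_polynomial_def by metis
    have qM: "\<bar>poly q t\<bar> \<le> M" if "t \<in> {0..1}" for t using *(2)[OF that] q by simp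
    show "\<bar>p (x + t *\<^sub>R v)\<bar> \<le> C * M" if "t \<in> {0..R}"
      unfolding q(2) by (rule C(2)[OF q(1) qM]) (use that in auto)
    show "\<bar>p (x + t *\<^sub>R v) - p x\<bar> \<le> C * M * t" if "t \<in> {0..1}"
    proof -
      have "norm (poly q t - poly q 0) \<le> C * M * norm (t - 0)"
      proof (rule field_differentiable_bound[where S = "{0..1}" and f' = "poly (pderiv q)"])
        show "norm (poly (pderiv q) z) \<le> C * M" if "z \<in> {0..1}" for z
          unfolding real_norm_def by (rule C(3)[OF q(1) qM]) (use that in auto)
      qed (use that in \<open>auto intro: poly_DERIV has_field_derivative_at_within\<close>)
      moreover have "p x = poly q 0" using q(2)[of 0] by simp
      ultimately show ?thesis using that by (simp add: q(2))
    qed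
  qed
qed

section \<open>Set integrals and the inverse estimate for polynomials\<close>

lemma set_integrable_continuous_compact:
  fixes f :: "'a::euclidean_space \<Rightarrow> real"
  assumes "compact S" "continuous_on S f" shows "set_integrable lebesgue S f"
proof -
  have "integrable lborel (\<lambda>x. indicator S x *\<^sub>R f x)"
    by (rule borel_integrable_compact[OF assms])
  then show ?thesis unfolding set_integrable_def by (subst integrable_completion) auto
qed

lemma set_integral_const_lebesgue:
  fixes c :: real
  assumes "S \<in> lmeasurable" shows "(LINT x:S|lebesgue. c) = measure lebesgue S * c"
  using assms by (subst set_integral_const) (auto simp: fmeasurable_def)

lemma set_lebesgue_integral_sum:
  fixes f :: "'i \<Rightarrow> 'b \<Rightarrow> real"
  assumes "\<And>i. i \<in> I \<Longrightarrow> set_integrable M S (f i)"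
  shows "(LINT x:S|M. (\<Sum>i\<in>I. f i x)) = (\<Sum>i\<in>I. LINT x:S|M. f i x)"
  using assms unfolding set_lebesgue_integral_def set_integrable_def scaleR_sum_right
  by (intro Bochner_Integration.integral_sum)

lemma set_lebesgue_integral_mono_subset:
  fixes f :: "'b \<Rightarrow> real"
  assumes "set_integrable M T f" "S \<in> sets M" "S \<subseteq> T" "\<And>x. x \<in> T \<Longrightarrow> 0 \<le> f x"
  shows "(LINT x:S|M. f x) \<le> (LINT x:T|M. f x)"
proof -
  have "set_integrable M S f" using set_integrable_subset assms by blast
  then show ?thesis using assms unfolding set_lebesgue_integral_def set_integrable_def
    by (intro integral_mono) (auto simp: indicator_def)
qed

text \<open>
  The maximum of the polynomial over the ball is attained at some point. Moving from it towards the
  center by a fixed fraction of the radius, the derivative bound keeps the polynomial above half of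
  its maximum on a whole ball of comparable radius.
\<close>

lemma polynomial_inverse_estimate:
  fixes k :: nat and R :: real
  obtains C where "C > 0"
    "\<And>(p :: 'a::euclidean_space \<Rightarrow> real) c r x. line_polynomial k p \<Longrightarrow> continuous_on UNIV p \<Longrightarrow> r > 0 \<Longrightarrow>
       x \<in> cball c (R * r) \<Longrightarrow> (p x)\<^sup>2 \<le> C / r ^ DIM('a) * (LINT x:cball c r|lebesgue. (p x)\<^sup>2)"
proof -
  obtain D where D: "D \<ge> 1"
    "\<And>(p :: 'a \<Rightarrow> real) M x v t. line_polynomial k p \<Longrightarrow> (\<And>t. t \<in> {0..1} \<Longrightarrow> \<bar>p (x + t *\<^sub>R v)\<bar> \<le> M) \<Longrightarrow>
       t \<in> {0..R} \<Longrightarrow> \<bar>p (x + t *\<^sub>R v)\<bar> \<le> D * M"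
    "\<And>(p :: 'a \<Rightarrow> real) M x v t. line_polynomial k p \<Longrightarrow> (\<And>t. t \<in> {0..1} \<Longrightarrow> \<bar>p (x + t *\<^sub>R v)\<bar> \<le> M) \<Longrightarrow>
       t \<in> {0..1} \<Longrightarrow> \<bar>p (x + t *\<^sub>R v) - p x\<bar> \<le> D * M * t"
    using line_polynomial_growth[where k=k and R=R and ?'a='a] by metis
  \<comment> \<open>Moving by the parameter \<open>\<tau>\<close> changes the polynomial by at most
    \<open>D * M * \<tau> = M / 4\<close>; two such moves from the maximum still leave
    \<open>M / 2\<close>.\<close>
  define \<tau> where "\<tau> = 1 / (4 * D)"
  have \<tau>: "0 < \<tau>" "\<tau> \<le> 1" using D(1) by (auto simp: \<tau>_def field_simps)
  define \<omega> where "\<omega> = unit_ball_vol (real DIM('a)) * (\<tau>\<^sup>2) ^ DIM('a)"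
  have \<omega>: "\<omega> > 0" using \<tau> by (simp add: \<omega>_def)
  show ?thesis
  proof (rule that[of "4 * D\<^sup>2 / \<omega>"])
    show "0 < 4 * D\<^sup>2 / \<omega>" using D(1) \<omega> by simp
    fix p :: "'a \<Rightarrow> real" and c :: 'a and r :: real and x
    assume p: "line_polynomial k p" "continuous_on UNIV p" and r: "r > 0" and x: "x \<in> cball c (R * r)"
    obtain x0 where x0: "x0 \<in> cball c r" "\<And>y. y \<in> cball c r \<Longrightarrow> \<bar>p y\<bar> \<le> \<bar>p x0\<bar>"
      using continuous_attains_sup[of "cball c r" "\<lambda>x. \<bar>p x\<bar>"] r
      by (metis cball_eq_empty compact_cball continuous_on_rabs continuous_on_subset not_less_iff_gr_or_eq p(2) top_greatest)
    define M where "M = \<bar>p x0\<bar>"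
    have M: "\<bar>p y\<bar> \<le> M" if "norm (y - c) \<le> r" for y
      using x0(2)[of y] that by (simp add: M_def dist_norm norm_minus_commute)
    have M0: "M \<ge> 0" by (simp add: M_def)
    have n0: "norm (x0 - c) \<le> r" using x0(1) by (simp add: dist_norm norm_minus_commute)
    define x1 where "x1 = x0 + \<tau> *\<^sub>R (c - x0)"
    have "\<bar>p x1 - p x0\<bar> \<le> D * M * \<tau>" unfolding x1_def
    proof (rule D(3)[OF p(1)])
      fix t :: real assume t: "t \<in> {0..1}"
      have "norm ((1 - t) *\<^sub>R (x0 - c)) \<le> r" using t n0 r mult_mono[of "1-t" 1 "norm (x0 - c)" r] by simp
      then have "norm (x0 + t *\<^sub>R (c - x0) - c) \<le> r" by (simp add: algebra_simps)
      then show "\<bar>p (x0 + t *\<^sub>R (c - x0))\<bar> \<le> M" by (rule M)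
    qed (use \<tau> in auto)
    also have "D * M * \<tau> = M / 4" using D(1) by (simp add: \<tau>_def)
    finally have p1: "\<bar>p x1\<bar> \<ge> 3 / 4 * M" using M_def by linarith
    have n1: "norm (x1 - c) \<le> r - \<tau> * r"
    proof -
      have "x1 - c = (1 - \<tau>) *\<^sub>R (x0 - c)" by (simp add: x1_def algebra_simps)
      then have "norm (x1 - c) = (1 - \<tau>) * norm (x0 - c)" using \<tau> by simp
      also have "\<dots> \<le> (1 - \<tau>) * r" using \<tau> n0 by (intro mult_left_mono) auto
      finally show ?thesis by (simp add: algebra_simps)
    qed
    have p2: "\<bar>p y\<bar> \<ge> M / 2" if "y \<in> cball x1 (\<tau>\<^sup>2 * r)" for y
    proof -
      \<comment> \<open>The direction is stretched by \<open>1 / \<tau>\<close>, so that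
        \<open>y\<close> is reached at parameter \<open>\<tau>\<close>. Its length is at most
        \<open>\<tau> * r\<close>, the room gained by the first move, so the whole segment stays in
        the ball where \<open>M\<close> is a bound.\<close>
      define w where "w = (1 / \<tau>) *\<^sub>R (y - x1)"
      have w: "norm w \<le> \<tau> * r" using that \<tau> unfolding w_def norm_scaleR
        by (simp add: dist_norm norm_minus_commute power2_eq_square field_simps)
      have y: "y = x1 + \<tau> *\<^sub>R w" using \<tau> by (simp add: w_def)
      have "\<bar>p y - p x1\<bar> \<le> D * M * \<tau>" unfolding y
      proof (rule D(3)[OF p(1)])
        fix t :: real assume t: "t \<in> {0..1}"
        have "norm (x1 + t *\<^sub>R w - c) \<le> norm (x1 - c) + norm (t *\<^sub>R w)"
          by (metis add_diff_eq add.commute add_diff_eq norm_triangle_ineq)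
        also have "norm (t *\<^sub>R w) \<le> norm w" using t by (simp add: mult_left_le_one_le)
        finally have "norm (x1 + t *\<^sub>R w - c) \<le> r" using w n1 by linarith
        then show "\<bar>p (x1 + t *\<^sub>R w)\<bar> \<le> M" by (rule M)
      qed (use \<tau> in auto)
      also have "D * M * \<tau> = M / 4" using D(1) by (simp add: \<tau>_def)
      finally show ?thesis using p1 by linarith
    qed
    have sub: "cball x1 (\<tau>\<^sup>2 * r) \<subseteq> cball c r"
    proof
      fix y assume "y \<in> cball x1 (\<tau>\<^sup>2 * r)"
      moreover have "\<tau>\<^sup>2 * r \<le> \<tau> * r" using \<tau> r by (simp add: power2_eq_square)
      ultimately show "y \<in> cball c r" using n1 dist_triangle[of c y x1]
        by (simp add: dist_norm norm_minus_commute)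
    qed
    have cont: "continuous_on S (\<lambda>x. (p x)\<^sup>2)" for S
      by (intro continuous_intros continuous_on_subset[OF p(2)]) auto
    have int: "set_integrable lebesgue S (\<lambda>x. (p x)\<^sup>2)" if "compact S" for S
      by (rule set_integrable_continuous_compact[OF that cont])
    have "(M / 2)\<^sup>2 * (\<omega> * r ^ DIM('a)) = (LINT x:cball x1 (\<tau>\<^sup>2 * r)|lebesgue. (M / 2)\<^sup>2)"
      using r by (simp add: set_integral_const_lebesgue content_cball \<omega>_def power_mult_distrib)
    also have "\<dots> \<le> (LINT x:cball x1 (\<tau>\<^sup>2 * r)|lebesgue. (p x)\<^sup>2)"
    proof (rule set_integral_mono)
      show "set_integrable lebesgue (cball x1 (\<tau>\<^sup>2 * r)) (\<lambda>x. (p x)\<^sup>2)" by (rule int) simp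
      show "set_integrable lebesgue (cball x1 (\<tau>\<^sup>2 * r)) (\<lambda>x. (M / 2)\<^sup>2)"
        by (intro set_integrable_continuous_compact) auto
      fix y assume "y \<in> cball x1 (\<tau>\<^sup>2 * r)"
      from p2[OF this] show "(M / 2)\<^sup>2 \<le> (p y)\<^sup>2" using M0 by (metis abs_le_square_iff abs_of_nonneg divide_nonneg_nonneg zero_le_numeral)
    qed
    also have "\<dots> \<le> (LINT x:cball c r|lebesgue. (p x)\<^sup>2)"
      by (rule set_lebesgue_integral_mono_subset[OF int]) (use sub in auto)
    finally have 1: "(M / 2)\<^sup>2 * (\<omega> * r ^ DIM('a)) \<le> (LINT x:cball c r|lebesgue. (p x)\<^sup>2)" .
    have "\<bar>p x\<bar> \<le> D * M"
    proof (cases "x = c")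
      case True
      have "\<bar>p c\<bar> \<le> M" using r by (intro M) auto
      then show ?thesis using True D(1) M0 by (smt (verit) mult_left_le mult_le_cancel_right1)
    next
      case False
      \<comment> \<open>Radial direction of length \<open>r\<close>: parameters in [0,1] stay in the
        ball, and \<open>x\<close> is reached at a parameter of at most \<open>R\<close>.\<close>
      define w where "w = (r / norm (x - c)) *\<^sub>R (x - c)"
      have x: "x = c + (norm (x - c) / r) *\<^sub>R w" using False r by (simp add: w_def)
      show ?thesis
      proof (subst x, rule D(2)[OF p(1)])
        fix t :: real assume "t \<in> {0..1}"
        then have "norm (c + t *\<^sub>R w - c) \<le> r" using r False by (simp add: w_def mult_left_le_one_le)
        then show "\<bar>p (c + t *\<^sub>R w)\<bar> \<le> M" by (rule M)
      qed (use \<open>x \<in> cball c (R * r)\<close> r in \<open>simp add: dist_norm norm_minus_commute field_simps\<close>)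
    qed
    then have "(p x)\<^sup>2 \<le> (D * M)\<^sup>2" using D(1) M0 by (simp add: abs_le_square_iff[symmetric])
    also have "\<dots> = 4 * D\<^sup>2 / \<omega> / r ^ DIM('a) * ((M / 2)\<^sup>2 * (\<omega> * r ^ DIM('a)))"
      using \<omega> r by (simp add: field_simps)
    also have "\<dots> \<le> 4 * D\<^sup>2 / \<omega> / r ^ DIM('a) * (LINT x:cball c r|lebesgue. (p x)\<^sup>2)"
      using \<omega> r by (intro mult_left_mono 1) auto
    finally show "(p x)\<^sup>2 \<le> 4 * D\<^sup>2 / \<omega> / r ^ DIM('a) * (LINT x:cball c r|lebesgue. (p x)\<^sup>2)" .
  qed
qed

section \<open>Derivatives of polynomials and oscillation on a cell\<close>

lemma differentiable_polynomial:
  assumes "polynomial_of_degree_le k p" shows "p differentiable (at x)"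
proof -
  define I where "I = {\<alpha> \<in> Basis \<rightarrow>\<^sub>E {..k}. (\<Sum>i\<in>(Basis::'a::euclidean_space set). \<alpha> i) \<le> k}"
  obtain c where c: "\<And>x. p x = (\<Sum>\<alpha>\<in>I. c \<alpha> * (\<Prod>i\<in>Basis. (x \<bullet> i) ^ \<alpha> i))"
    using assms unfolding polynomial_of_degree_le_def I_def by auto
  have I: "finite I" unfolding I_def by (intro finite_subset[OF _ finite_PiE[of Basis "\<lambda>_. {..k}"]]) auto
  have "(\<lambda>x. \<Prod>i\<in>(Basis::'a set). (x \<bullet> i) ^ \<alpha> i) differentiable (at x)" for \<alpha> :: "'a \<Rightarrow> nat"
  proof -
    have "((\<lambda>x. \<Prod>i\<in>(Basis::'a set). (x \<bullet> i) ^ \<alpha> i) has_derivative (\<lambda>y. \<Sum>i\<in>Basis. (\<lambda>y. of_nat (\<alpha> i) * (y \<bullet> i) * (x \<bullet> i) ^ (\<alpha> i - 1)) y *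
      (\<Prod>j\<in>Basis - {i}. (x \<bullet> j) ^ \<alpha> j))) (at x)"
      by (rule has_derivative_prod) (auto intro!: derivative_eq_intros)
    then show ?thesis unfolding differentiable_def by blast
  qed
  then have "(\<lambda>x. \<Sum>\<alpha>\<in>I. c \<alpha> * (\<Prod>i\<in>Basis. (x \<bullet> i) ^ \<alpha> i)) differentiable (at x)"
    using I by (intro differentiable_sum differentiable_mult) auto
  moreover have "p = (\<lambda>x. \<Sum>\<alpha>\<in>I. c \<alpha> * (\<Prod>i\<in>Basis. (x \<bullet> i) ^ \<alpha> i))" using c by (rule ext)
  ultimately show ?thesis by metis
qed

lemma continuous_on_polynomial:
  assumes "polynomial_of_degree_le k p" shows "continuous_on S p"
  using differentiable_polynomial[OF assms]
  by (meson continuous_at_imp_continuous_on differentiable_imp_continuous_within)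

text \<open>
  Differentiating the Lagrange interpolation formula along a line exhibits a partial derivative as a
  fixed linear combination of translates of the polynomial.
\<close>

lemma partial_derivative_polynomial:
  assumes "polynomial_of_degree_le k p"
  shows "line_polynomial k (\<lambda>x. frechet_derivative p (at x) i) \<and> continuous_on S (\<lambda>x. frechet_derivative p (at x) i)"
proof -
  define d where "d j = poly (pderiv (lagrange_basis k j)) 0" for j
  have eq: "frechet_derivative p (at x) i = (\<Sum>j\<le>k. d j * p (x + node k j *\<^sub>R i))" for x
  proof -
    obtain q where q: "degree q \<le> k" "\<And>t. p (x + t *\<^sub>R i) = poly q t"
      using line_polynomial_polynomial[OF assms] unfolding line_polynomial_def by metis
    have D: "(p has_derivative frechet_derivative p (at x)) (at x)"
      using differentiable_polynomial[OF assms] frechet_derivative_works by blast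
    then have D': "(p has_derivative frechet_derivative p (at x)) (at (x + 0 *\<^sub>R i))" by simp
    have "((\<lambda>t. p (x + t *\<^sub>R i)) has_derivative (\<lambda>t. frechet_derivative p (at x) (t *\<^sub>R i))) (at 0)"
      by (rule has_derivative_compose[where g = p and f = "\<lambda>t. x + t *\<^sub>R i", OF _ D']) (auto intro!: derivative_eq_intros)
    then have "(poly q has_derivative (\<lambda>t. frechet_derivative p (at x) (t *\<^sub>R i))) (at 0)"
      unfolding q(2) by simp
    moreover have "(poly q has_derivative (*) (poly (pderiv q) 0)) (at 0)"
      using poly_DERIV[of q 0] by (simp add: has_field_derivative_def)
    ultimately have "(\<lambda>t. frechet_derivative p (at x) (t *\<^sub>R i)) = (*) (poly (pderiv q) 0)"
      by (rule has_derivative_unique)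
    then have "frechet_derivative p (at x) i = poly (pderiv q) 0"
      by (metis mult.right_neutral scaleR_one)
    also have "pderiv q = (\<Sum>j\<le>k. smult (poly q (node k j)) (pderiv (lagrange_basis k j)))"
      by (rule pderiv_lagrange[OF q(1)])
    also have "poly \<dots> 0 = (\<Sum>j\<le>k. d j * p (x + node k j *\<^sub>R i))"
      by (simp add: poly_sum d_def q(2) mult.commute)
    finally show ?thesis .
  qed
  show ?thesis
    unfolding eq
  proof
    show "line_polynomial k (\<lambda>x. \<Sum>j\<le>k. d j * p (x + node k j *\<^sub>R i))"
      by (intro line_polynomial_lincomb line_polynomial_translate line_polynomial_polynomial assms)
    have "continuous_on S (\<lambda>x. p (x + a))" for a
      by (rule continuous_on_compose2[OF continuous_on_polynomial[OF assms, of UNIV]]) (auto intro!: continuous_intros)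
    then show "continuous_on S (\<lambda>x. \<Sum>j\<le>k. d j * p (x + node k j *\<^sub>R i))"
      by (intro continuous_intros)
  qed
qed

lemma norm_gradient:
  fixes f :: "'a::euclidean_space \<Rightarrow> real"
  shows "(norm (gradient f x))\<^sup>2 = (\<Sum>i\<in>Basis. (frechet_derivative f (at x) i)\<^sup>2)"
proof -
  have "gradient f x \<bullet> j = frechet_derivative f (at x) j" if "j \<in> Basis" for j
    using that by (simp add: gradient_def inner_sum_left inner_Basis if_distrib[where f="\<lambda>x. _ * x"] sum.delta' cong: if_cong)
  then show ?thesis unfolding power2_norm_eq_inner by (subst euclidean_inner) (simp add: power2_eq_square)
qed

lemma continuous_on_gradient:
  assumes "polynomial_of_degree_le k p" shows "continuous_on S (\<lambda>x. (norm (gradient p x))\<^sup>2)"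
  unfolding norm_gradient using partial_derivative_polynomial[OF assms]
  by (intro continuous_intros) auto

text \<open>The components of the gradient are again polynomial along lines, so the inverse estimate
  bounds the gradient at every point of \<open>K\<close> by its mean square over the inscribed ball;
  the mean value inequality on the convex set \<open>K\<close> does the rest. The shape of
  \<open>K\<close> enters only through an inner and an outer ball of comparable radii.\<close>

lemma polynomial_oscillation:
  fixes k :: nat and R :: real
  obtains C where "C > 0"
    "\<And>(p :: 'a::euclidean_space \<Rightarrow> real) K c r x y. polynomial_of_degree_le k p \<Longrightarrow> r > 0 \<Longrightarrow> convex K \<Longrightarrow> compact K \<Longrightarrow>
      cball c r \<subseteq> K \<Longrightarrow> K \<subseteq> cball c (R * r) \<Longrightarrow> x \<in> K \<Longrightarrow> y \<in> K \<Longrightarrow>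
      (p x - p y)\<^sup>2 \<le> C * r\<^sup>2 / r ^ DIM('a) * (LINT x:K|lebesgue. (norm (gradient p x))\<^sup>2)"
proof -
  obtain C where C: "C > 0"
    "\<And>(p :: 'a \<Rightarrow> real) c r x. line_polynomial k p \<Longrightarrow> continuous_on UNIV p \<Longrightarrow> r > 0 \<Longrightarrow>
       x \<in> cball c (R * r) \<Longrightarrow> (p x)\<^sup>2 \<le> C / r ^ DIM('a) * (LINT x:cball c r|lebesgue. (p x)\<^sup>2)"
    using polynomial_inverse_estimate[where k=k and R=R and ?'a='a] by metis
  show ?thesis
  \<comment> \<open>The summand 1 keeps the constant positive when \<open>R = 0\<close>.\<close>
  proof (rule that[of "C * (2 * R)\<^sup>2 + 1"])
    show "C * (2 * R)\<^sup>2 + 1 > 0" using C(1) by (simp add: add_nonneg_pos)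
    fix p :: "'a \<Rightarrow> real" and K :: "'a set" and c x y :: 'a and r :: real
    assume p: "polynomial_of_degree_le k p" and r: "r > 0" and K: "convex K" "compact K"
      "cball c r \<subseteq> K" "K \<subseteq> cball c (R * r)" and xy: "x \<in> K" "y \<in> K"
    define I where "I = (LINT x:K|lebesgue. (norm (gradient p x))\<^sup>2)"
    have I0: "I \<ge> 0" unfolding I_def set_lebesgue_integral_def by (intro integral_nonneg_AE) auto
    have g: "(norm (gradient p z))\<^sup>2 \<le> C / r ^ DIM('a) * I" if "z \<in> K" for z
    proof -
      note pd = partial_derivative_polynomial[OF p, THEN conjunct1] partial_derivative_polynomial[OF p, THEN conjunct2]
      have "(norm (gradient p z))\<^sup>2 \<le> (\<Sum>i\<in>Basis. C / r ^ DIM('a) * (LINT x:cball c r|lebesgue. (frechet_derivative p (at x) i)\<^sup>2))"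
        unfolding norm_gradient by (intro sum_mono C(2) pd r) (use that K in auto)
      also have "\<dots> = C / r ^ DIM('a) * (\<Sum>i\<in>Basis. (LINT x:cball c r|lebesgue. (frechet_derivative p (at x) i)\<^sup>2))"
        by (simp add: sum_distrib_left)
      also have "(\<Sum>i\<in>Basis. (LINT x:cball c r|lebesgue. (frechet_derivative p (at x) i)\<^sup>2)) =
         (LINT x:cball c r|lebesgue. (norm (gradient p x))\<^sup>2)"
        unfolding norm_gradient by (subst set_lebesgue_integral_sum) (auto intro!: set_integrable_continuous_compact continuous_intros pd)
      also have "C / r ^ DIM('a) * (LINT x:cball c r|lebesgue. (norm (gradient p x))\<^sup>2) \<le> C / r ^ DIM('a) * I"
        unfolding I_def using C(1) r
        by (intro mult_left_mono set_lebesgue_integral_mono_subset set_integrable_continuous_compact continuous_on_gradient[OF p] K) (use K in auto)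
      finally show ?thesis .
    qed
    have R: "R * r \<ge> 0" using K(4) xy by (metis cball_empty empty_iff not_less subset_empty)
    define B where "B = sqrt (C / r ^ DIM('a) * I)"
    have "norm (p x - p y) \<le> B * norm (x - y)"
    proof (rule differentiable_bound[OF K(1) _ _ xy, where f' = "\<lambda>x. frechet_derivative p (at x)"])
      fix z assume z: "z \<in> K"
      show D: "(p has_derivative frechet_derivative p (at z)) (at z within K)"
        using differentiable_polynomial[OF p] frechet_derivative_works has_derivative_at_withinI by blast
      have bl: "bounded_linear (frechet_derivative p (at z))" using D by (rule has_derivative_bounded_linear)
      have fd: "frechet_derivative p (at z) v = gradient p z \<bullet> v" for v
      proof -
        have "frechet_derivative p (at z) v = frechet_derivative p (at z) (\<Sum>i\<in>Basis. (v \<bullet> i) *\<^sub>R i)" by (simp add: euclidean_representation)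
        also have "\<dots> = (\<Sum>i\<in>Basis. (v \<bullet> i) * frechet_derivative p (at z) i)"
          using bounded_linear.linear[OF bl] by (simp add: linear_sum linear_cmul)
        also have "\<dots> = gradient p z \<bullet> v" by (simp add: gradient_def inner_sum_left inner_commute[of v] mult.commute)
        finally show ?thesis .
      qed
      have "norm (gradient p z) \<le> B" unfolding B_def using g[OF z] by (simp add: real_le_rsqrt)
      then show "onorm (frechet_derivative p (at z)) \<le> B"
        by (intro onorm_le) (metis fd Cauchy_Schwarz_ineq2 mult_right_mono norm_ge_zero order_trans real_norm_def)
    qed
    also have "\<dots> \<le> B * (2 * (R * r))"
    proof (intro mult_left_mono)
      have "dist x y \<le> dist x c + dist c y" by (rule dist_triangle)
      moreover have "dist x c \<le> R * r" "dist c y \<le> R * r" using xy K(4) by (auto simp: dist_commute)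
      ultimately show "norm (x - y) \<le> 2 * (R * r)" by (simp add: dist_norm)
      show "0 \<le> B" using C(1) r I0 by (simp add: B_def)
    qed
    finally have "(p x - p y)\<^sup>2 \<le> (B * (2 * (R * r)))\<^sup>2" by (metis abs_le_square_iff abs_ge_self order_trans real_norm_def)
    also have "\<dots> = C * (2 * R)\<^sup>2 * (r\<^sup>2 / r ^ DIM('a) * I)"
      using C(1) r I0 by (simp add: B_def power_mult_distrib)
    also have "\<dots> \<le> (C * (2 * R)\<^sup>2 + 1) * (r\<^sup>2 / r ^ DIM('a) * I)"
      using r I0 by (intro mult_right_mono) auto
    finally show "(p x - p y)\<^sup>2 \<le> (C * (2 * R)\<^sup>2 + 1) * r\<^sup>2 / r ^ DIM('a) * (LINT x:K|lebesgue. (norm (gradient p x))\<^sup>2)"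
      by (simp add: I_def)
  qed
qed

section \<open>Affine involutions preserve Lebesgue measure\<close>

text \<open>
  Lebesgue measure and its image are both translation invariant, so Fubini makes them proportional;
  the factor is 1 because they agree on a bounded open set that the involution maps to itself.
\<close>

lemma lborel_distr_affine_involution:
  fixes L :: "'a::euclidean_space \<Rightarrow> 'a"
  assumes lin: "linear L" and inv: "\<And>x. L (L x + a) + a = x"
  shows "distr lborel borel (\<lambda>x. L x + a) = lborel"
proof (rule measure_eqI)
  let ?f = "\<lambda>x. L x + a"
  have cont: "continuous_on UNIV ?f" using lin by (intro continuous_intros linear_continuous_on) (simp add: linear_linear)
  have meas[measurable]: "?f \<in> borel_measurable borel" using cont by (rule borel_measurable_continuous_onI)
  have L[measurable]: "L \<in> borel_measurable borel"
    using lin by (intro borel_measurable_continuous_onI linear_continuous_on) (simp add: linear_linear)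
  \<comment> \<open>Evaluating the involution at 0 gives \<open>L a + a = 0\<close>, so the linear
    part alone is an involution.\<close>
  have LL: "L (L x) = x" for x
  proof -
    have "L (L x + a) + a = L (L 0 + a) + a + x" by (simp add: inv)
    then show ?thesis using lin by (simp add: linear_add linear_0)
  qed
  have trans: "(\<integral>\<^sup>+x. g x \<partial>lborel) = (\<integral>\<^sup>+x. g (x - t) \<partial>lborel)" if [measurable]: "g \<in> borel_measurable borel" for g :: "'a \<Rightarrow> ennreal" and t
  proof -
    have "(\<integral>\<^sup>+x. g x \<partial>lborel) = (\<integral>\<^sup>+x. g x \<partial>distr lborel borel ((+) (- t)))" by (simp add: lborel_distr_plus)
    also have "\<dots> = (\<integral>\<^sup>+x. g (x - t) \<partial>lborel)" by (subst nn_integral_distr) simp_all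
    finally show ?thesis .
  qed
  have refl: "(\<integral>\<^sup>+y. g (t - y) \<partial>lborel) = (\<integral>\<^sup>+x. g x \<partial>lborel)" if [measurable]: "g \<in> borel_measurable borel" for g :: "'a \<Rightarrow> ennreal" and t
  proof -
    have "distr lborel borel (\<lambda>x. t - x) = (lborel :: 'a measure)"
      using lborel_affine[of "-1 :: real" t, symmetric] by (simp add: density_1)
    then have "(\<integral>\<^sup>+x. g x \<partial>lborel) = (\<integral>\<^sup>+x. g x \<partial>distr lborel borel (\<lambda>x. t - x))" by simp
    also have "\<dots> = (\<integral>\<^sup>+y. g (t - y) \<partial>lborel)" by (subst nn_integral_distr) simp_all
    finally show ?thesis by simp
  qed
  \<comment> \<open>Fubini writes the left side as a double integral over \<open>x\<close> and
    \<open>y\<close> in which \<open>A\<close> is tested at \<open>?f x\<close> and \<open>B\<close>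
    at \<open>?f x + y\<close>. A translation of \<open>x\<close> moves the free variable from
    \<open>B\<close> to \<open>A\<close>, and reading the integrals backwards gives the right
    side.\<close>
  have key: "emeasure lborel (?f -` A) * emeasure lborel B = emeasure lborel (?f -` B) * emeasure lborel A"
    if [measurable]: "A \<in> sets borel" "B \<in> sets borel" for A B
  proof -
    have pre: "?f -` S \<in> sets borel" if "S \<in> sets borel" for S
      using measurable_sets[OF meas that] by simp
    have "emeasure lborel (?f -` A) * emeasure lborel B = (\<integral>\<^sup>+x. indicator A (?f x) * emeasure lborel B \<partial>lborel)"
    proof (subst nn_integral_multc)
      have "emeasure lborel (?f -` A) = (\<integral>\<^sup>+x. indicator (?f -` A) x \<partial>lborel)" using pre that by simp
      also have "\<dots> = (\<integral>\<^sup>+x. indicator A (?f x) \<partial>lborel)" by (simp add: indicator_def)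
      finally show "emeasure lborel (?f -` A) * emeasure lborel B = (\<integral>\<^sup>+x. indicator A (?f x) \<partial>lborel) * emeasure lborel B" by simp
    qed simp
    also have "\<dots> = (\<integral>\<^sup>+x. (\<integral>\<^sup>+y. indicator A (?f x) * indicator B (?f x + y) \<partial>lborel) \<partial>lborel)"
    proof (rule nn_integral_cong)
      fix x
      have "emeasure lborel B = (\<integral>\<^sup>+y. indicator B y \<partial>lborel)" using that by simp
      also have "\<dots> = (\<integral>\<^sup>+y. indicator B (y - (- ?f x)) \<partial>lborel)" by (rule trans) simp
      also have "\<dots> = (\<integral>\<^sup>+y. indicator B (?f x + y) \<partial>lborel)" by (simp only: diff_minus_eq_add add.commute)
      finally have "emeasure lborel B = (\<integral>\<^sup>+y. indicator B (?f x + y) \<partial>lborel)" .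
      then show "indicator A (?f x) * emeasure lborel B = (\<integral>\<^sup>+y. indicator A (?f x) * indicator B (?f x + y) \<partial>lborel)"
        by (subst nn_integral_cmult) simp_all
    qed
    also have "\<dots> = (\<integral>\<^sup>+y. (\<integral>\<^sup>+x. indicator A (?f x) * indicator B (?f x + y) \<partial>lborel) \<partial>lborel)"
      by (rule lborel_pair.Fubini') simp
    also have "\<dots> = (\<integral>\<^sup>+y. (\<integral>\<^sup>+x. indicator A (?f x - y) * indicator B (?f x) \<partial>lborel) \<partial>lborel)"
    proof (rule nn_integral_cong)
      fix y
      \<comment> \<open>Translating \<open>x\<close> by \<open>L y\<close> moves the image by
        \<open>y\<close>, since \<open>L\<close> is its own inverse.\<close>
      have e: "?f (x - L y) = ?f x - y" "?f x - y + y = ?f x" for x using lin LL by (simp_all add: linear_diff)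
      have "(\<integral>\<^sup>+x. indicator A (?f x) * indicator B (?f x + y) \<partial>lborel) =
          (\<integral>\<^sup>+x. indicator A (?f (x - L y)) * indicator B (?f (x - L y) + y) \<partial>lborel)"
        by (rule trans) simp
      then show "(\<integral>\<^sup>+x. indicator A (?f x) * indicator B (?f x + y) \<partial>lborel) = (\<integral>\<^sup>+x. indicator A (?f x - y) * indicator B (?f x) \<partial>lborel)"
        by (simp only: e)
    qed
    also have "\<dots> = (\<integral>\<^sup>+x. (\<integral>\<^sup>+y. indicator A (?f x - y) * indicator B (?f x) \<partial>lborel) \<partial>lborel)"
      by (rule lborel_pair.Fubini') simp
    also have "\<dots> = (\<integral>\<^sup>+x. indicator B (?f x) * emeasure lborel A \<partial>lborel)"
    proof (rule nn_integral_cong)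
      fix x
      have "(\<integral>\<^sup>+y. indicator A (?f x - y) \<partial>lborel) = (\<integral>\<^sup>+y. indicator A y \<partial>lborel)" by (rule refl) simp
      then show "(\<integral>\<^sup>+y. indicator A (?f x - y) * indicator B (?f x) \<partial>lborel) = indicator B (?f x) * emeasure lborel A"
        by (subst nn_integral_multc) (simp_all add: mult.commute that)
    qed
    also have "\<dots> = emeasure lborel (?f -` B) * emeasure lborel A"
    proof (subst nn_integral_multc)
      have "emeasure lborel (?f -` B) = (\<integral>\<^sup>+x. indicator (?f -` B) x \<partial>lborel)" using pre that by simp
      also have "\<dots> = (\<integral>\<^sup>+x. indicator B (?f x) \<partial>lborel)" by (simp add: indicator_def)
      finally show "(\<integral>\<^sup>+x. indicator B (?f x) \<partial>lborel) * emeasure lborel A = emeasure lborel (?f -` B) * emeasure lborel A" by simp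
    qed simp
    finally show ?thesis .
  qed
  define B where "B = ball (0::'a) 1 \<union> ?f -` ball 0 1"
  have ob: "open (?f -` ball 0 1)" using open_vimage[OF open_ball cont] .
  have B: "B \<in> sets borel" using ob by (auto simp: B_def)
  have "?f -` ball 0 1 = ?f ` ball 0 1"
  proof -
    have "x \<in> ?f ` ball 0 1" if "?f x \<in> ball 0 1" for x
      using that inv[of x] by (metis image_eqI)
    then show ?thesis using inv by auto
  qed
  moreover have "bounded (?f ` ball 0 1)"
    by (rule bounded_subset[OF compact_imp_bounded[OF compact_continuous_image[OF continuous_on_subset[OF cont] compact_cball[of 0 1]]]]) auto
  ultimately have "bounded B" by (simp add: B_def)
  then have "emeasure lborel B \<noteq> \<infinity>" using emeasure_bounded_finite[of B] by (simp add: less_top)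
  moreover have "emeasure lborel B \<noteq> 0"
  proof
    assume "emeasure lborel B = 0"
    then have "negligible B" using B by (simp add: negligible_iff_emeasure0)
    moreover have "open B" "B \<noteq> {}" using ob by (auto simp: B_def)
    ultimately show False using open_not_negligible by blast
  qed
  moreover have "?f -` B = B" using inv by (auto simp: B_def)
  ultimately have "emeasure lborel (?f -` A) = emeasure lborel A" if "A \<in> sets borel" for A
    using key[OF that B] by (metis ennreal_mult_cancel_left infinity_ennreal_def mult.commute)
  then show "emeasure (distr lborel borel ?f) A = emeasure lborel A" if "A \<in> sets (distr lborel borel ?f)" for A
    using that by (simp add: emeasure_distr)
qed simp

section \<open>Affine functions on simplices\<close>

definition affine_function :: "('a::euclidean_space \<Rightarrow> real) \<Rightarrow> bool" where
  "affine_function f \<longleftrightarrow> (\<exists>a b. \<forall>x. f x = a + b \<bullet> x)"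

lemma affine_function_combination:
  assumes f: "affine_function f" and "sum \<mu> C = 1" and x: "x = (\<Sum>v\<in>C. \<mu> v *\<^sub>R v)"
  shows "f x = (\<Sum>v\<in>C. \<mu> v * f v)"
proof -
  obtain a b where f: "\<And>x. f x = a + b \<bullet> x" using f unfolding affine_function_def by blast
  have "(\<Sum>v\<in>C. \<mu> v * f v) = sum \<mu> C * a + (\<Sum>v\<in>C. \<mu> v * (b \<bullet> v))"
    by (simp add: f sum_distrib_right distrib_left sum.distrib)
  also have "\<dots> = f x" using assms(2) by (simp add: f x inner_sum_right)
  finally show ?thesis by simp
qed

lemma affine_function_eq_on_hull:
  assumes "affine_function f" "affine_function g" "finite C" "\<And>v. v \<in> C \<Longrightarrow> f v = g v" "x \<in> affine hull C"
  shows "f x = g x"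
proof -
  obtain \<mu> where \<mu>: "sum \<mu> C = 1" "x = (\<Sum>v\<in>C. \<mu> v *\<^sub>R v)"
    using assms(5) affine_hull_finite[OF assms(3)] by auto
  show ?thesis
    using affine_function_combination[OF assms(1) \<mu>] affine_function_combination[OF assms(2) \<mu>] assms(4) by simp
qed

lemma affine_function_continuous: "affine_function f \<Longrightarrow> continuous_on S f"
proof -
  assume "affine_function f"
  then obtain a b where "f = (\<lambda>x. a + b \<bullet> x)" unfolding affine_function_def by blast
  then show ?thesis by (simp add: continuous_intros)
qed

text \<open>Any linear interpolant on the independent edge vectors is represented by a vector, which
  is then projected orthogonally onto the span of the edges; the discarded component is orthogonal
  to all differences of vertices.\<close>

lemma affine_interpolation_inner:
  fixes C :: "'a::euclidean_space set" and g :: "'a \<Rightarrow> real"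
  assumes "\<not> affine_dependent C" "w \<in> C"
  obtains b where "b \<in> span ((\<lambda>x. x - w) ` C)" "\<And>v. v \<in> C \<Longrightarrow> b \<bullet> (v - w) = g v - g w"
proof -
  let ?B = "(\<lambda>x. x - w) ` (C - {w})"
  have ind: "independent ?B"
    using assms affine_dependent_iff_dependent2[of w C] by (metis (no_types, lifting) add.commute diff_conv_add_uminus image_cong)
  obtain h where h: "linear h" "\<And>x. x \<in> ?B \<Longrightarrow> h x = g (x + w) - g w"
    using linear_independent_extend[OF ind, of "\<lambda>x. g (x + w) - g w"] by blast
  define b0 where "b0 = (\<Sum>i\<in>Basis. h i *\<^sub>R i)"
  have b0: "b0 \<bullet> x = h x" for x
  proof -
    have "h x = h (\<Sum>i\<in>Basis. (x \<bullet> i) *\<^sub>R i)" by (simp add: euclidean_representation)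
    also have "\<dots> = (\<Sum>i\<in>Basis. (x \<bullet> i) * h i)" using h(1) by (simp add: linear_sum linear_cmul)
    finally show ?thesis by (simp add: b0_def inner_sum_left inner_commute[of x] mult.commute)
  qed
  obtain b c where bc: "b \<in> span ((\<lambda>x. x - w) ` C)" "\<And>y. y \<in> span ((\<lambda>x. x - w) ` C) \<Longrightarrow> orthogonal c y" "b0 = b + c"
    using orthogonal_subspace_decomp_exists[of "(\<lambda>x. x - w) ` C" b0] by metis
  show ?thesis
  proof (rule that[OF bc(1)])
    fix v assume v: "v \<in> C"
    have "c \<bullet> (v - w) = 0" using bc(2) v by (simp add: orthogonal_def span_base)
    then have "b \<bullet> (v - w) = b0 \<bullet> (v - w)" using bc(3) by (simp add: inner_add_left)
    also have "\<dots> = g v - g w"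
    proof (cases "v = w")
      case False
      then have "v - w \<in> ?B" using v by blast
      from h(2)[OF this] show ?thesis by (simp add: b0)
    qed simp
    finally show "b \<bullet> (v - w) = g v - g w" .
  qed
qed

lemma affine_interpolation:
  fixes C :: "'a::euclidean_space set" and g :: "'a \<Rightarrow> real"
  assumes "\<not> affine_dependent C"
  obtains f where "affine_function f" "\<And>v. v \<in> C \<Longrightarrow> f v = g v"
proof (cases "C = {}")
  case True
  have "affine_function (\<lambda>x. 0 :: real)"
    unfolding affine_function_def by (intro exI[of _ 0]) simp
  with True show ?thesis by (intro that) auto
next
  case False
  then obtain w where w: "w \<in> C" by blast
  obtain b where b: "\<And>v. v \<in> C \<Longrightarrow> b \<bullet> (v - w) = g v - g w"
    using affine_interpolation_inner[OF assms w, of g] by metis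
  show ?thesis
  proof (rule that[of "\<lambda>x. (g w - b \<bullet> w) + b \<bullet> x"])
    show "affine_function (\<lambda>x. (g w - b \<bullet> w) + b \<bullet> x)" unfolding affine_function_def by blast
    show "(g w - b \<bullet> w) + b \<bullet> v = g v" if "v \<in> C" for v using b[OF that] by (simp add: inner_diff_right)
  qed
qed

text \<open>The coordinates are affine functions on the whole space, so that they have a gradient
  there. Outside the affine hull of \<open>C\<close> the conditions do not determine them.\<close>

definition is_barycentric :: "'a::euclidean_space set \<Rightarrow> ('a \<Rightarrow> 'a \<Rightarrow> real) \<Rightarrow> bool" where
  "is_barycentric C \<beta> \<longleftrightarrow> (\<forall>v\<in>C. affine_function (\<beta> v) \<and> (\<forall>w\<in>C. \<beta> v w = (if w = v then 1 else 0)))"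

lemma barycentric_exists:
  fixes C :: "'a::euclidean_space set"
  assumes "\<not> affine_dependent C" obtains \<beta> where "is_barycentric C \<beta>"
proof -
  have "\<exists>f. affine_function f \<and> (\<forall>w\<in>C. f w = (if w = v then 1 else 0))" for v
    using affine_interpolation[OF assms, of "\<lambda>w. if w = v then 1 else 0"] by metis
  then obtain \<beta> where "\<And>v. affine_function (\<beta> v) \<and> (\<forall>w\<in>C. \<beta> v w = (if w = v then 1 else 0))" by metis
  then show ?thesis by (intro that) (auto simp: is_barycentric_def)
qed

lemma barycentric_combination:
  assumes b: "is_barycentric C \<beta>" and C: "finite C" and x: "x \<in> affine hull C"
  shows "(\<Sum>v\<in>C. \<beta> v x) = 1" "(\<Sum>v\<in>C. \<beta> v x *\<^sub>R v) = x"
    and "affine_function f \<Longrightarrow> f x = (\<Sum>v\<in>C. \<beta> v x * f v)"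
    and "x \<in> convex hull C \<longleftrightarrow> (\<forall>v\<in>C. 0 \<le> \<beta> v x)"
    and "sum \<mu> C = 1 \<Longrightarrow> x = (\<Sum>v\<in>C. \<mu> v *\<^sub>R v) \<Longrightarrow> v \<in> C \<Longrightarrow> \<beta> v x = \<mu> v"
proof -
  have eq: "\<beta> v x = \<mu> v" if "sum \<mu> C = 1" "x = (\<Sum>v\<in>C. \<mu> v *\<^sub>R v)" "v \<in> C" for \<mu> v
  proof -
    have "\<beta> v x = (\<Sum>w\<in>C. \<mu> w * \<beta> v w)"
      using b that by (intro affine_function_combination) (auto simp: is_barycentric_def)
    also have "\<dots> = (\<Sum>w\<in>C. if w = v then \<mu> w else 0)"
      using b that by (intro sum.cong) (auto simp: is_barycentric_def)
    finally show ?thesis using C that by simp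
  qed
  then show "sum \<mu> C = 1 \<Longrightarrow> x = (\<Sum>v\<in>C. \<mu> v *\<^sub>R v) \<Longrightarrow> v \<in> C \<Longrightarrow> \<beta> v x = \<mu> v" .
  obtain \<mu> where \<mu>: "sum \<mu> C = 1" "x = (\<Sum>v\<in>C. \<mu> v *\<^sub>R v)"
    using x affine_hull_finite[OF C] by auto
  have e: "\<beta> v x = \<mu> v" if "v \<in> C" for v using eq[OF \<mu> that] .
  show 1: "(\<Sum>v\<in>C. \<beta> v x) = 1" using \<mu> e by simp
  show 2: "(\<Sum>v\<in>C. \<beta> v x *\<^sub>R v) = x" using \<mu> e by simp
  show "f x = (\<Sum>v\<in>C. \<beta> v x * f v)" if "affine_function f"
    using affine_function_combination[OF that 1 2[symmetric]] .
  show "x \<in> convex hull C \<longleftrightarrow> (\<forall>v\<in>C. 0 \<le> \<beta> v x)"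
  proof
    assume "x \<in> convex hull C"
    then obtain \<nu> where \<nu>: "\<forall>v\<in>C. 0 \<le> \<nu> v" "sum \<nu> C = 1" "(\<Sum>v\<in>C. \<nu> v *\<^sub>R v) = x"
      using convex_hull_finite[OF C] by auto
    then show "\<forall>v\<in>C. 0 \<le> \<beta> v x" using eq[of \<nu>] by auto
  next
    assume "\<forall>v\<in>C. 0 \<le> \<beta> v x"
    then have "(\<forall>v\<in>C. 0 \<le> \<beta> v x) \<and> (\<Sum>v\<in>C. \<beta> v x) = 1 \<and> (\<Sum>v\<in>C. \<beta> v x *\<^sub>R v) = x"
      using 1 2 by simp
    then have "\<exists>u. (\<forall>v\<in>C. 0 \<le> u v) \<and> sum u C = 1 \<and> (\<Sum>v\<in>C. u v *\<^sub>R v) = x"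
      by (rule exI[of _ "\<lambda>v. \<beta> v x"])
    then show "x \<in> convex hull C" unfolding convex_hull_finite[OF C] by simp
  qed
qed

section \<open>Integration over faces\<close>

lemma closest_point_affine_eq:
  fixes H :: "'a::euclidean_space set"
  assumes "affine H" "y \<in> H" "\<And>z. z \<in> H \<Longrightarrow> (x - y) \<bullet> (z - y) = 0"
  shows "closest_point H x = y"
proof -
  have "dist x y \<le> dist x z" if "z \<in> H" for z
  proof -
    have "(norm (x - z))\<^sup>2 = (norm (x - y))\<^sup>2 + (norm (z - y))\<^sup>2"
      using assms(3)[OF that] by (simp add: power2_norm_eq_inner algebra_simps inner_commute)
    then show ?thesis by (simp add: dist_norm norm_le_square power2_norm_eq_inner[symmetric] power2_le_imp_le)
  qed
  then show ?thesis
    using closest_point_unique[of H y x] assms affine_imp_convex affine_closed by metis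
qed

lemma closest_point_affine_orthogonal:
  fixes H :: "'a::euclidean_space set"
  assumes "affine H" "z \<in> H"
  shows "closest_point H x \<in> H" "(x - closest_point H x) \<bullet> (z - closest_point H x) = 0"
proof -
  let ?y = "closest_point H x"
  have H: "convex H" "closed H" "H \<noteq> {}" using assms affine_imp_convex affine_closed by auto
  show y: "?y \<in> H" using H closest_point_in_set by blast
  \<comment> \<open>The reflection of \<open>z\<close> in the foot point also lies in
    \<open>H\<close>; the obtuse angle inequalities for both points combine to an equality.\<close>
  have "?y + (-1) *\<^sub>R (z - ?y) \<in> H" using mem_affine_3_minus[OF assms(1) y assms(2) y] .
  from closest_point_dot[OF H(1,2) this, of x] closest_point_dot[OF H(1,2) assms(2), of x]
  show "(x - ?y) \<bullet> (z - ?y) = 0" by (simp add: inner_diff_right inner_add_right)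
qed

text \<open>The part of the slab of thickness 1 that projects into \<open>e\<close>. Its Lebesgue
  measure is the area of the face, and face integrals become Lebesgue integrals over it.\<close>

definition prism :: "'a::euclidean_space set \<Rightarrow> 'a set" where
  "prism e = {x. infdist x (affine hull e) \<le> 1 / 2 \<and> closest_point (affine hull e) x \<in> e}"

lemma continuous_on_closest_point_affine_hull:
  fixes e :: "'a::euclidean_space set"
  assumes "e \<noteq> {}" shows "continuous_on S (closest_point (affine hull e))"
  using assms by (intro continuous_on_closest_point) (auto simp: affine_imp_convex affine_affine_hull closed_affine_hull)

lemma infdist_closest_point_affine_hull:
  fixes e :: "'a::euclidean_space set"
  assumes "e \<noteq> {}" shows "infdist x (affine hull e) = dist x (closest_point (affine hull e) x)"
  using assms setdist_closest_point[of "affine hull e" x] by (simp add: infdist_eq_setdist closed_affine_hull)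

lemma compact_prism:
  fixes e :: "'a::euclidean_space set"
  assumes "compact e" "e \<noteq> {}" shows "compact (prism e)"
proof -
  have "closed (prism e)"
    unfolding prism_def
  proof (intro closed_Collect_conj closed_Collect_le continuous_intros)
    have "closed (closest_point (affine hull e) -` e)"
      using continuous_on_closest_point_affine_hull[OF assms(2)] assms(1) by (intro closed_vimage) (auto simp: compact_imp_closed)
    then show "closed {x. closest_point (affine hull e) x \<in> e}" by (simp add: vimage_def)
  qed
  moreover have "bounded (prism e)"
  proof -
    obtain c R where R: "e \<subseteq> cball c R" using compact_imp_bounded[OF assms(1)] bounded_subset_cball by blast
    have "prism e \<subseteq> cball c (R + 1/2)"
    proof
      fix x assume "x \<in> prism e"
      then have "dist x (closest_point (affine hull e) x) \<le> 1/2" "closest_point (affine hull e) x \<in> cball c R"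
        using R infdist_closest_point_affine_hull[OF assms(2), of x] by (auto simp: prism_def)
      then show "x \<in> cball c (R + 1/2)" using dist_triangle[of c x "closest_point (affine hull e) x"] by (simp add: dist_commute)
    qed
    then show ?thesis using bounded_subset bounded_cball by blast
  qed
  ultimately show ?thesis by (simp add: compact_eq_bounded_closed)
qed

lemma face_integral_prism:
  fixes f :: "'a::euclidean_space \<Rightarrow> real"
  assumes e: "closed e" "e \<noteq> {}" and f[measurable]: "f \<in> borel_measurable borel"
  shows "face_integral e f = (LINT x:prism e|lborel. f (closest_point (affine hull e) x))"
proof -
  let ?\<pi> = "closest_point (affine hull e)"
  let ?S = "{x. infdist x (affine hull e) \<le> 1 / 2}"
  have [measurable]: "?\<pi> \<in> borel_measurable borel"
    by (intro borel_measurable_continuous_onI continuous_on_closest_point_affine_hull e)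
  have "closed ?S" by (intro closed_Collect_le continuous_intros)
  then have S: "?S \<in> sets borel" by simp
  have e': "e \<in> sets borel" using e by simp
  note [measurable] = S e'
  have "?\<pi> \<in> measurable (restrict_space lborel ?S) borel"
    by (rule measurable_restrict_space1) simp
  then have "face_integral e f = (\<integral>x. indicator e (?\<pi> x) *\<^sub>R f (?\<pi> x) \<partial>restrict_space lborel ?S)"
    unfolding face_integral_def set_lebesgue_integral_def hyperplane_measure_def
    by (subst integral_distr) simp_all
  also have "\<dots> = (LINT x:?S|lborel. indicator e (?\<pi> x) *\<^sub>R f (?\<pi> x))"
    unfolding set_lebesgue_integral_def using S by (subst integral_restrict_space) simp_all
  also have "\<dots> = (LINT x:prism e|lborel. f (?\<pi> x))"
    unfolding set_lebesgue_integral_def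
    by (intro Bochner_Integration.integral_cong) (auto simp: prism_def indicator_def)
  finally show ?thesis .
qed

lemma face_area_prism:
  fixes e :: "'a::euclidean_space set"
  assumes e: "closed e" "e \<noteq> {}" "S \<in> sets borel"
  shows "emeasure (hyperplane_measure (affine hull e)) S =
    emeasure lborel {x. infdist x (affine hull e) \<le> 1 / 2 \<and> closest_point (affine hull e) x \<in> S}"
proof -
  let ?\<pi> = "closest_point (affine hull e)"
  let ?S = "{x. infdist x (affine hull e) \<le> 1 / 2}"
  have [measurable]: "?\<pi> \<in> borel_measurable borel"
    by (intro borel_measurable_continuous_onI continuous_on_closest_point_affine_hull e)
  have "closed ?S" by (intro closed_Collect_le continuous_intros)
  then have S: "?S \<in> sets borel" by simp
  have "?\<pi> \<in> measurable (restrict_space lborel ?S) borel"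
    by (rule measurable_restrict_space1) simp
  then have "emeasure (hyperplane_measure (affine hull e)) S = emeasure (restrict_space lborel ?S) (?\<pi> -` S \<inter> space (restrict_space lborel ?S))"
    unfolding hyperplane_measure_def using e by (intro emeasure_distr) auto
  also have "\<dots> = emeasure lborel (?\<pi> -` S \<inter> space (restrict_space lborel ?S))"
    using S by (intro emeasure_restrict_space) (auto simp: space_restrict_space)
  also have "?\<pi> -` S \<inter> space (restrict_space lborel ?S) = {x. infdist x (affine hull e) \<le> 1 / 2 \<and> ?\<pi> x \<in> S}"
    by (auto simp: space_restrict_space)
  finally show ?thesis .
qed

lemma face_area_eq_prism:
  fixes e :: "'a::euclidean_space set"
  assumes e: "closed e" "e \<noteq> {}" shows "face_area e = measure lborel (prism e)"
  using face_area_prism[OF e, of e] e unfolding face_area_def measure_def prism_def by simp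

lemma face_integral_cong:
  assumes "\<And>x. x \<in> e \<Longrightarrow> f x = g x" shows "face_integral e f = face_integral e g"
  unfolding face_integral_def set_lebesgue_integral_def
  by (intro Bochner_Integration.integral_cong) (auto simp: indicator_def assms)

text \<open>
  The gradient \<open>b\<close> is taken in the direction space of the affine hull, which makes the map commute
  with the orthogonal projection onto the hull and so preserve the prism over the simplex.
\<close>

lemma vertex_swap:
  fixes C :: "'a::euclidean_space set"
  assumes C: "\<not> affine_dependent C" "v \<in> C" "w \<in> C" "v \<noteq> w"
  obtains L a where "linear L" "\<And>x. L (L x + a) + a = x"
    "L v + a = w" "L w + a = v" "\<And>u. u \<in> C \<Longrightarrow> u \<noteq> v \<Longrightarrow> u \<noteq> w \<Longrightarrow> L u + a = u"
    "\<And>x. closest_point (affine hull C) (L x + a) = L (closest_point (affine hull C) x) + a"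
    "\<And>x. infdist (L x + a) (affine hull C) = infdist x (affine hull C)"
proof -
  define g where "g u = (if u = v then 1 else if u = w then -1 else 0 :: real)" for u
  obtain b where b: "b \<in> span ((\<lambda>x. x - w) ` C)" "\<And>u. u \<in> C \<Longrightarrow> b \<bullet> (u - w) = g u - g w"
    using affine_interpolation_inner[OF C(1,3), of g] by metis
  define L where "L x = x + (b \<bullet> x) *\<^sub>R (w - v)" for x
  define a where "a = (- (b \<bullet> w) - 1) *\<^sub>R (w - v)"
  have La: "L x + a = x + (b \<bullet> (x - w) - 1) *\<^sub>R (w - v)" for x
    by (simp add: L_def a_def algebra_simps inner_diff_right)
  have bvw: "b \<bullet> (w - v) = -2" using b(2)[OF C(2)] C(4) by (simp add: g_def inner_diff_right)
  have lin: "linear L" unfolding L_def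
    by (intro linearI) (simp_all add: inner_add_right algebra_simps)
  define t where "t x = b \<bullet> (x - w) - 1" for x
  have inv: "L (L x + a) + a = x" for x
  proof -
    have "t (x + t x *\<^sub>R (w - v)) = t x + t x * (b \<bullet> (w - v))"
      by (simp add: t_def inner_add_right inner_diff_right algebra_simps)
    then have 1: "t (x + t x *\<^sub>R (w - v)) = - t x" using bvw by simp
    have "L (L x + a) + a = (x + t x *\<^sub>R (w - v)) + t (x + t x *\<^sub>R (w - v)) *\<^sub>R (w - v)"
      unfolding La t_def ..
    then show ?thesis unfolding 1 by simp
  qed
  let ?H = "affine hull C"
  have H: "affine ?H" "w \<in> ?H" "v \<in> ?H" "closed ?H" "?H \<noteq> {}" using C by (auto simp: hull_inc closed_affine_hull)
  have cp: "closest_point ?H (L x + a) = L (closest_point ?H x) + a \<and>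
      L x + a - (L (closest_point ?H x) + a) = x - closest_point ?H x" for x
  proof -
    define y where "y = closest_point ?H x"
    have y: "y \<in> ?H" "\<And>z. z \<in> ?H \<Longrightarrow> (x - y) \<bullet> (z - y) = 0"
      unfolding y_def using closest_point_affine_orthogonal[OF H(1)] H(2) by auto
    have o: "(x - y) \<bullet> (z - z') = 0" if "z \<in> ?H" "z' \<in> ?H" for z z'
      using y(2)[OF that(1)] y(2)[OF that(2)] by (simp add: inner_diff_right)
    have "orthogonal (x - y) b"
    proof (rule orthogonal_to_span[OF b(1)])
      fix z assume "z \<in> (\<lambda>x. x - w) ` C"
      then show "orthogonal (x - y) z" using o H(2) by (auto simp: orthogonal_def hull_inc)
    qed
    then have "b \<bullet> (x - y) = 0" by (simp add: orthogonal_def inner_commute)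
    then have d: "L x + a - (L y + a) = x - y" by (simp add: L_def algebra_simps inner_diff_right)
    have "L y + a \<in> ?H" unfolding La by (rule mem_affine_3_minus[OF H(1) y(1) H(2,3)])
    moreover have "(L x + a - (L y + a)) \<bullet> (z - (L y + a)) = 0" if "z \<in> ?H" for z
      unfolding d by (rule o[OF that]) fact
    ultimately have "closest_point ?H (L x + a) = L y + a" by (intro closest_point_affine_eq H)
    with d show ?thesis by (simp add: y_def)
  qed
  show ?thesis
  proof (rule that[OF lin inv])
    have "b \<bullet> (v - w) = 2" using bvw by (simp add: inner_diff_right)
    then show "L v + a = w" "L w + a = v" unfolding La by simp_all
    show "L u + a = u" if "u \<in> C" "u \<noteq> v" "u \<noteq> w" for u
      unfolding La using b(2)[OF that(1)] that C(4) by (simp add: g_def)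
    show "closest_point ?H (L x + a) = L (closest_point ?H x) + a" for x using cp by blast
    show "infdist (L x + a) ?H = infdist x ?H" for x
      using C(2) cp[of x] by (subst (1 2) infdist_closest_point_affine_hull) (auto simp: dist_norm)
  qed
qed

lemma affine_function_comp:
  assumes "affine_function f" "linear L" shows "affine_function (\<lambda>x. f (L x + a))"
proof -
  obtain c b where f: "\<And>x. f x = c + b \<bullet> x" using assms unfolding affine_function_def by blast
  have "f (L x + a) = (c + b \<bullet> a) + adjoint L b \<bullet> x" for x
    using adjoint_works[OF assms(2)] by (simp add: f inner_add_right inner_commute)
  then show ?thesis unfolding affine_function_def by blast
qed

lemma barycenter_convex_hull:
  assumes "\<not> affine_dependent C" shows "barycenter (convex hull C) = (\<Sum>v\<in>C. v) /\<^sub>R real (card C)"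
  using extreme_point_of_convex_hull_affine_independent[OF assms] by (simp add: barycenter_def)

lemma set_integrable_lborel_compact:
  fixes f :: "'a::euclidean_space \<Rightarrow> real"
  assumes "compact S" "continuous_on S f" shows "set_integrable lborel S f"
  unfolding set_integrable_def by (rule borel_integrable_compact[OF assms])

text \<open>Exchanging two vertices preserves the prism and Lebesgue measure and exchanges the two
  barycentric coordinates, so all coordinates have the same integral. Expanding \<open>f\<close> in
  them leaves the mean of its vertex values, which is its value at the barycenter.\<close>

lemma face_integral_affine_function:
  fixes C :: "'a::euclidean_space set"
  assumes C: "\<not> affine_dependent C" "C \<noteq> {}" and f: "affine_function f"
  shows "face_integral (convex hull C) f = face_area (convex hull C) * f (barycenter (convex hull C))"
proof -
  have fin: "finite C" using C aff_independent_finite by blast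
  let ?e = "convex hull C" and ?\<pi> = "closest_point (affine hull C)"
  have H: "affine hull ?e = affine hull C" by simp
  have e: "closed ?e" "?e \<noteq> {}" "compact ?e" using fin C(2) by (auto simp: finite_imp_compact_convex_hull compact_imp_closed)
  obtain \<beta> where \<beta>: "is_barycentric C \<beta>" using barycentric_exists[OF C(1)] by blast
  have \<beta>a: "affine_function (\<beta> v)" if "v \<in> C" for v using \<beta> that by (auto simp: is_barycentric_def)
  have meas: "f \<in> borel_measurable borel" if "affine_function f" for f :: "'a \<Rightarrow> real"
    using affine_function_continuous[OF that] by (rule borel_measurable_continuous_onI)
  have pi: "?\<pi> x \<in> affine hull C" for x
    using closest_point_affine_orthogonal(1)[of "affine hull C"] C(2) by (metis affine_affine_hull affine_hull_eq_empty ex_in_conv)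
  have c: "continuous_on UNIV ?\<pi>" using continuous_on_closest_point_affine_hull[OF e(2), of UNIV] by simp
  have int: "set_integrable lborel (prism ?e) (\<lambda>x. f (?\<pi> x))" if "affine_function f" for f
    by (intro set_integrable_lborel_compact compact_prism e
        continuous_on_compose2[OF affine_function_continuous[OF that, of UNIV] continuous_on_subset[OF c]]) auto
  have eq: "face_integral ?e (\<beta> v) = face_integral ?e (\<beta> w)" if vw: "v \<in> C" "w \<in> C" for v w
  proof (cases "v = w")
    case False
    obtain L a where L: "linear L" "\<And>x. L (L x + a) + a = x"
      "L v + a = w" "L w + a = v" "\<And>u. u \<in> C \<Longrightarrow> u \<noteq> v \<Longrightarrow> u \<noteq> w \<Longrightarrow> L u + a = u"
      "\<And>x. ?\<pi> (L x + a) = L (?\<pi> x) + a"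
      "\<And>x. infdist (L x + a) (affine hull C) = infdist x (affine hull C)"
      using vertex_swap[OF C(1) vw False] by metis
    let ?f = "\<lambda>x. L x + a"
    have swap: "\<beta> u (?f y) = \<beta> (?f u) y" if "y \<in> affine hull C" "u \<in> C" for u y
    proof (rule affine_function_eq_on_hull[OF _ _ fin _ that(1)])
      show "affine_function (\<lambda>y. \<beta> u (?f y))" by (intro affine_function_comp \<beta>a that L)
      have fu: "?f u' \<in> C" if "u' \<in> C" for u' using L(3-5) that vw by metis
      then show "affine_function (\<beta> (?f u))" using that by (intro \<beta>a)
      fix z assume z: "z \<in> C"
      have "?f z = u \<longleftrightarrow> z = ?f u" using L(2) by metis
      then show "\<beta> u (?f z) = \<beta> (?f u) z" using \<beta> fu that z by (auto simp: is_barycentric_def)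
    qed
    have fC: "?f u \<in> C" if "u \<in> C" for u using L(3-5) that vw by metis
    have mem: "?f y \<in> ?e \<longleftrightarrow> y \<in> ?e" if y: "y \<in> affine hull C" for y
    proof -
      have fy: "?f y \<in> affine hull C"
      proof -
        have "?\<pi> y = y" using y by (simp add: closest_point_self)
        then show ?thesis using L(6)[of y] pi by metis
      qed
      have "?f y \<in> ?e \<longleftrightarrow> (\<forall>u\<in>C. 0 \<le> \<beta> u (?f y))" by (rule barycentric_combination(4)[OF \<beta> fin fy])
      also have "\<dots> \<longleftrightarrow> (\<forall>u\<in>C. 0 \<le> \<beta> (?f u) y)" using swap y by auto
      also have "\<dots> \<longleftrightarrow> (\<forall>u\<in>C. 0 \<le> \<beta> u y)" using fC L(2) by metis
      also have "\<dots> \<longleftrightarrow> y \<in> ?e" by (rule barycentric_combination(4)[OF \<beta> fin y, symmetric])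
      finally show ?thesis .
    qed
    have P: "?f x \<in> prism ?e \<longleftrightarrow> x \<in> prism ?e" for x
      unfolding prism_def H by (simp add: L mem pi)
    have cont: "continuous_on UNIV ?f" using L(1) by (intro continuous_intros linear_continuous_on) (simp add: linear_linear)
    have "face_integral ?e (\<beta> v) = (\<integral>x. indicator (prism ?e) x *\<^sub>R \<beta> v (?\<pi> x) \<partial>lborel)"
      using face_integral_prism[OF e(1,2) meas[OF \<beta>a[OF vw(1)]]] by (simp add: set_lebesgue_integral_def)
    also have "\<dots> = (\<integral>x. indicator (prism ?e) x *\<^sub>R \<beta> v (?\<pi> x) \<partial>distr lborel borel ?f)"
      using lborel_distr_affine_involution[OF L(1,2)] by simp
    also have "\<dots> = (\<integral>x. indicator (prism ?e) (?f x) *\<^sub>R \<beta> v (?\<pi> (?f x)) \<partial>lborel)"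
      using int[OF \<beta>a[OF vw(1)]] borel_measurable_continuous_onI[OF cont]
      by (subst integral_distr) (auto simp: set_integrable_def borel_measurable_integrable)
    also have "\<dots> = (\<integral>x. indicator (prism ?e) x *\<^sub>R \<beta> w (?\<pi> x) \<partial>lborel)"
      using P swap[OF pi vw(1)] by (intro Bochner_Integration.integral_cong) (auto simp: indicator_def L)
    also have "\<dots> = face_integral ?e (\<beta> w)"
      using face_integral_prism[OF e(1,2) meas[OF \<beta>a[OF vw(2)]]] by (simp add: set_lebesgue_integral_def)
    finally show ?thesis .
  qed simp
  obtain v0 where v0: "v0 \<in> C" using C by blast
  define I where "I = face_integral ?e (\<beta> v0)"
  have comb: "face_integral ?e f = (\<Sum>v\<in>C. f v) * I" if f: "affine_function f" for f
  proof -
    have "face_integral ?e f = (LINT x:prism ?e|lborel. f (?\<pi> x))"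
      using face_integral_prism[OF e(1,2) meas[OF f]] by simp
    also have "\<dots> = (LINT x:prism ?e|lborel. (\<Sum>v\<in>C. f v * \<beta> v (?\<pi> x)))"
      using barycentric_combination(3)[OF \<beta> fin pi f] by (simp add: mult.commute)
    also have "\<dots> = (\<Sum>v\<in>C. LINT x:prism ?e|lborel. f v * \<beta> v (?\<pi> x))"
      by (rule set_lebesgue_integral_sum) (rule set_integrable_mult_right, rule int[OF \<beta>a])
    also have "\<dots> = (\<Sum>v\<in>C. f v * I)"
    proof (intro sum.cong refl)
      fix v assume v: "v \<in> C"
      have "(LINT x:prism ?e|lborel. f v * \<beta> v (?\<pi> x)) = f v * (LINT x:prism ?e|lborel. \<beta> v (?\<pi> x))" by simp
      also have "(LINT x:prism ?e|lborel. \<beta> v (?\<pi> x)) = I"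
        using face_integral_prism[OF e(1,2) meas[OF \<beta>a[OF v]]] eq[OF v v0] by (simp add: I_def)
      finally show "(LINT x:prism ?e|lborel. f v * \<beta> v (?\<pi> x)) = f v * I" .
    qed
    finally show ?thesis by (simp add: sum_distrib_right)
  qed
  \<comment> \<open>The expansion of the constant 1 identifies the common integral of the
    coordinates as the area divided by the number of vertices.\<close>
  have one: "affine_function (\<lambda>x::'a. 1)" unfolding affine_function_def by (intro exI[of _ 1] exI[of _ 0]) simp
  have "face_integral ?e (\<lambda>x. 1 :: real) = (LINT x:prism ?e|lborel. 1)"
    using face_integral_prism[OF e(1,2), of "\<lambda>x. 1"] by simp
  also have "\<dots> = measure lborel (prism ?e)"
    by (simp add: set_lebesgue_integral_def compact_prism[OF e(3,2)] compact_imp_closed)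
  finally have "face_area ?e = face_integral ?e (\<lambda>x. 1)" using face_area_eq_prism[OF e(1,2)] by simp
  then have area: "face_area ?e = real (card C) * I" using comb[OF one] by simp
  have "f (barycenter ?e) = (\<Sum>v\<in>C. 1 / real (card C) * f v)"
    unfolding barycenter_convex_hull[OF C(1)] using C fin
    by (intro affine_function_combination f) (auto simp: scaleR_sum_right divide_inverse)
  then have "face_area ?e * f (barycenter ?e) = (\<Sum>v\<in>C. f v) * I"
    using C fin unfolding area by (simp add: sum_divide_distrib[symmetric])
  then show ?thesis using comb[OF f] by simp
qed

section \<open>Translation estimate on a mesh\<close>

text \<open>Ordered pairs: the relation is symmetric, as the path argument requires, and
  \<open>jump_energy\<close> counts each pair of neighbours twice.\<close>

definition adjacent_cells :: "'a::euclidean_space set set \<Rightarrow> ('a set \<times> 'a set) set" where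
  "adjacent_cells T = {(K, K'). K \<in> T \<and> K' \<in> T \<and> K \<noteq> K' \<and> (K \<inter> K') facet_of K \<and> (K \<inter> K') facet_of K'}"

definition jump_energy :: "'a::euclidean_space set set \<Rightarrow> ('a set \<Rightarrow> real) \<Rightarrow> real" where
  "jump_energy T a = (\<Sum>(K, K')\<in>adjacent_cells T. (a K - a K')\<^sup>2)"

text \<open>
  Every level strictly between the two end values is straddled by some edge of the path, so the
  intervals spanned by the edges cover the interval between the end values.
\<close>

lemma path_variation:
  fixes a :: "'b \<Rightarrow> real"
  assumes "finite R" "sym R" "(x, y) \<in> R\<^sup>*"
  shows "\<bar>a x - a y\<bar> \<le> (\<Sum>(u, v)\<in>R. \<bar>a u - a v\<bar>)"
proof -
  have str: "\<exists>(u, v)\<in>R. a u < t \<and> t \<le> a v" if "(x, y) \<in> R\<^sup>*" "a x < t" "t \<le> a y" for x y t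
    using that
  proof (induction arbitrary: t rule: rtrancl_induct)
    case (step y z)
    show ?case
    proof (cases "t \<le> a y")
      case True
      then show ?thesis using step.IH step.prems by blast
    next
      case False
      then show ?thesis using step.hyps(2) step.prems by (intro bexI[of _ "(y, z)"]) auto
    qed
  qed simp
  have main: "a y - a x \<le> (\<Sum>(u, v)\<in>R. \<bar>a u - a v\<bar>)" if "(x, y) \<in> R\<^sup>*" for x y
  proof (cases "a x \<le> a y")
    case True
    have "{a x<..a y} \<subseteq> (\<Union>(u, v)\<in>R. {a u<..a v})" using str[OF that] by force
    then have "emeasure lborel {a x<..a y} \<le> emeasure lborel (\<Union>(u, v)\<in>R. {a u<..a v})"
      using assms(1) by (intro emeasure_mono) auto
    also have "\<dots> \<le> (\<Sum>r\<in>R. emeasure lborel (case r of (u, v) \<Rightarrow> {a u<..a v}))"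
      using assms(1) by (intro emeasure_subadditive_finite) auto
    also have "\<dots> \<le> (\<Sum>r\<in>R. ennreal (case r of (u, v) \<Rightarrow> \<bar>a u - a v\<bar>))"
    proof (intro sum_mono)
      fix r assume "r \<in> R"
      obtain u v where r: "r = (u, v)" by fastforce
      show "emeasure lborel (case r of (u, v) \<Rightarrow> {a u<..a v}) \<le> ennreal (case r of (u, v) \<Rightarrow> \<bar>a u - a v\<bar>)"
        by (cases "a u \<le> a v") (auto simp: r ennreal_leI)
    qed
    also have "\<dots> = ennreal (\<Sum>(u, v)\<in>R. \<bar>a u - a v\<bar>)" by (intro sum_ennreal) auto
    finally show ?thesis using True by (simp add: ennreal_le_iff sum_nonneg split_beta)
  next
    case False
    moreover have "0 \<le> (\<Sum>(u, v)\<in>R. \<bar>a u - a v\<bar>)" by (intro sum_nonneg) auto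
    ultimately show ?thesis by linarith
  qed
  have "(y, x) \<in> R\<^sup>*" using assms by (meson sym_rtrancl symE)
  with main[OF assms(3)] main[of y x] show ?thesis by linarith
qed

text \<open>Fubini after the substitution \<open>y = x + z\<close>. Pairs of points are regrouped by
  their difference \<open>z\<close>, so that parallel segments can be treated together.\<close>

lemma product_measure_eq_translation_integral:
  fixes X Y :: "'a::euclidean_space set"
  assumes [measurable]: "X \<in> sets borel" "Y \<in> sets borel"
  shows "emeasure lborel X * emeasure lborel Y = (\<integral>\<^sup>+z. (\<integral>\<^sup>+x. indicator X x * indicator Y (x + z) \<partial>lborel) \<partial>lborel)"
proof -
  have "emeasure lborel X * emeasure lborel Y = (\<integral>\<^sup>+x. indicator X x * emeasure lborel Y \<partial>lborel)"
    by (subst nn_integral_multc) simp_all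
  also have "\<dots> = (\<integral>\<^sup>+x. (\<integral>\<^sup>+z. indicator X x * indicator Y (x + z) \<partial>lborel) \<partial>lborel)"
  proof (rule nn_integral_cong)
    fix x
    have "emeasure lborel Y = (\<integral>\<^sup>+z. indicator Y z \<partial>lborel)" by simp
    also have "\<dots> = (\<integral>\<^sup>+z. indicator Y z \<partial>distr lborel borel ((+) x))" by (simp add: lborel_distr_plus)
    also have "\<dots> = (\<integral>\<^sup>+z. indicator Y (x + z) \<partial>lborel)" by (subst nn_integral_distr) simp_all
    finally have "emeasure lborel Y = (\<integral>\<^sup>+z. indicator Y (x + z) \<partial>lborel)" .
    then show "indicator X x * emeasure lborel Y = (\<integral>\<^sup>+z. indicator X x * indicator Y (x + z) \<partial>lborel)"
      by (subst nn_integral_cmult) simp_all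
  qed
  also have "\<dots> = (\<integral>\<^sup>+z. (\<integral>\<^sup>+x. indicator X x * indicator Y (x + z) \<partial>lborel) \<partial>lborel)"
    by (rule lborel_pair.Fubini') simp
  finally show ?thesis .
qed

definition hitting :: "'a::euclidean_space \<Rightarrow> 'a set \<Rightarrow> 'a set" where
  "hitting z F = {x. closed_segment x (x + z) \<inter> F \<noteq> {}}"

lemma hitting_iff: "x \<in> hitting z F \<longleftrightarrow> (\<exists>t\<in>{0..1}. x + t *\<^sub>R z \<in> F)"
proof -
  have "(1 - t) *\<^sub>R x + t *\<^sub>R (x + z) = x + t *\<^sub>R z" for t by (simp add: algebra_simps)
  then have "closed_segment x (x + z) = (\<lambda>t. x + t *\<^sub>R z) ` {0..1}"
    by (simp add: closed_segment_image_interval)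
  then show ?thesis by (auto simp: hitting_def)
qed

lemma hitting_eq: "hitting z F = (\<lambda>(y, t). y - t *\<^sub>R z) ` (F \<times> {0..1})"
proof (intro set_eqI iffI)
  fix x assume "x \<in> hitting z F"
  then obtain t where "t \<in> {0..1}" "x + t *\<^sub>R z \<in> F" by (auto simp: hitting_iff)
  then show "x \<in> (\<lambda>(y, t). y - t *\<^sub>R z) ` (F \<times> {0..1})"
    by (intro image_eqI[of _ _ "(x + t *\<^sub>R z, t)"]) auto
qed (auto simp: hitting_iff intro!: bexI)

lemma compact_hitting: "compact F \<Longrightarrow> compact (hitting z F)"
  unfolding hitting_eq split_def by (intro compact_continuous_image compact_Times continuous_intros) auto

text \<open>The set is \<open>F\<close> swept along \<open>z\<close>. One more direction raises the
  affine dimension by at most one, so in codimension two the swept set stays in a hyperplane; the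
  additional point \<open>f - z\<close> is there to record the direction.\<close>

lemma negligible_hitting:
  fixes F :: "'a::euclidean_space set"
  assumes "aff_dim F \<le> int DIM('a) - 2" shows "negligible (hitting z F)"
proof (cases "F = {}")
  case True
  then show ?thesis by (simp add: hitting_eq)
next
  case False
  then obtain f where f: "f \<in> F" by blast
  let ?S = "insert (f - z) F"
  have "aff_dim ?S < int DIM('a)" using assms by (simp add: aff_dim_insert)
  then obtain a b where ab: "a \<noteq> 0" "?S \<subseteq> {x. a \<bullet> x = b}"
    using aff_lowdim_subset_hyperplane by metis
  have "hitting z F \<subseteq> {x. a \<bullet> x = b}"
  proof
    fix x assume "x \<in> hitting z F"
    then obtain t where t: "x + t *\<^sub>R z \<in> F" by (auto simp: hitting_iff)
    have "a \<bullet> (x + t *\<^sub>R z) = b" "a \<bullet> f = b" "a \<bullet> (f - z) = b" using ab t f by auto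
    then show "x \<in> {x. a \<bullet> x = b}" by (simp add: inner_add_right inner_diff_right)
  qed
  then show ?thesis using negligible_subset[OF negligible_hyperplane] ab(1) by blast
qed

text \<open>The volume bound in terms of the global \<open>h\<close> replaces shape regularity and
  quasi-uniformity together. The constants defined inside the locale are expressions in
  \<open>\<mu>\<close>, \<open>D\<close> and the dimension, hence common to all meshes sharing these
  numbers.\<close>

locale uniform_mesh =
  fixes T :: "'a::euclidean_space set set" and h \<mu> D :: real
  assumes fin: "finite T"
    and simplex: "K \<in> T \<Longrightarrow> int DIM('a) simplex K"
    and conforming: "K \<in> T \<Longrightarrow> K' \<in> T \<Longrightarrow> (K \<inter> K') face_of K"
    and h: "0 < h" "h \<le> D"
    and diam: "K \<in> T \<Longrightarrow> x \<in> K \<Longrightarrow> y \<in> K \<Longrightarrow> dist x y \<le> h"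
    and vol: "K \<in> T \<Longrightarrow> measure lebesgue K \<ge> \<mu> * h ^ DIM('a)"
    and mu: "\<mu> > 0"
    and bound: "x \<in> \<Union>T \<Longrightarrow> y \<in> \<Union>T \<Longrightarrow> dist x y \<le> D"
begin

lemma cell_compact: "K \<in> T \<Longrightarrow> compact K" and cell_convex: "K \<in> T \<Longrightarrow> convex K"
  using simplex compact_simplex convex_simplex by blast+

lemma cell_borel [measurable]: "K \<in> T \<Longrightarrow> K \<in> sets borel"
  using cell_compact by (simp add: compact_imp_closed)

lemma cell_lmeasurable: "K \<in> T \<Longrightarrow> K \<in> lmeasurable"
  using cell_compact lmeasurable_compact by blast

lemma cell_aff_dim: "K \<in> T \<Longrightarrow> aff_dim K = int DIM('a)"
  using simplex aff_dim_simplex by blast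

text \<open>A face of full dimension is the whole cell, which excludes full dimension for two
  distinct cells; a common face of dimension one less is a facet of both.\<close>

lemma intersection_dim:
  assumes "K \<in> T" "K' \<in> T" "K \<noteq> K'"
  shows "aff_dim (K \<inter> K') < int DIM('a)" "aff_dim (K \<inter> K') \<le> int DIM('a) - 2 \<or> (K, K') \<in> adjacent_cells T"
proof -
  have f: "(K \<inter> K') face_of K" "(K \<inter> K') face_of K'" using conforming[of K K'] conforming[of K' K] assms by (auto simp: Int_commute)
  show *: "aff_dim (K \<inter> K') < int DIM('a)"
  proof (rule ccontr)
    assume "\<not> ?thesis"
    then have "aff_dim (K \<inter> K') = int DIM('a)" using aff_dim_le_DIM[of "K \<inter> K'"] by linarith
    then have "K \<inter> K' = K" "K \<inter> K' = K'"
      using face_of_aff_dim_lt[OF cell_convex f(1)] face_of_aff_dim_lt[OF cell_convex f(2)] assms cell_aff_dim by force+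
    then show False using assms by blast
  qed
  show "aff_dim (K \<inter> K') \<le> int DIM('a) - 2 \<or> (K, K') \<in> adjacent_cells T"
  proof (cases "aff_dim (K \<inter> K') = int DIM('a) - 1")
    case True
    then have "K \<inter> K' \<noteq> {}" using DIM_positive[where 'a='a] by (intro notI) (simp)
    then show ?thesis using True f assms cell_aff_dim by (auto simp: adjacent_cells_def facet_of_def)
  qed (use * in linarith)
qed

lemma negligible_intersection: "K \<in> T \<Longrightarrow> K' \<in> T \<Longrightarrow> K \<noteq> K' \<Longrightarrow> negligible (K \<inter> K')"
  using intersection_dim(1) aff_lowdim_subset_hyperplane negligible_subset[OF negligible_hyperplane] by metis

lemma finite_adjacent: "finite (adjacent_cells T)"
  by (rule finite_subset[of _ "T \<times> T"]) (use fin in \<open>auto simp: adjacent_cells_def\<close>)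

lemma sym_adjacent: "(K, K') \<in> adjacent_cells T \<Longrightarrow> (K', K) \<in> adjacent_cells T"
  by (auto simp: adjacent_cells_def Int_commute)

text \<open>
  A segment that avoids all lower-dimensional intersections of cells passes from cell to cell only
  through facets; as it is connected, the cells it meets form a single facet-connected class.
\<close>

lemma segment_variation:
  assumes seg: "closed_segment x (x + z) \<subseteq> \<Union>T"
    and generic: "\<And>K K'. K \<in> T \<Longrightarrow> K' \<in> T \<Longrightarrow> K \<noteq> K' \<Longrightarrow> (K, K') \<notin> adjacent_cells T \<Longrightarrow> x \<notin> hitting z (K \<inter> K')"
    and K: "K \<in> T" "x \<in> K" "K' \<in> T" "x + z \<in> K'"
  shows "(a K - a K')\<^sup>2 \<le> real (card {(L, L') \<in> adjacent_cells T. x \<in> hitting z (L \<inter> L')}) *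
     (\<Sum>(L, L') \<in> adjacent_cells T. (a L - a L')\<^sup>2 * indicator (hitting z (L \<inter> L')) x)"
proof -
  define R where "R = {(L, L') \<in> adjacent_cells T. x \<in> hitting z (L \<inter> L')}"
  have R: "finite R" "sym R" using finite_adjacent by (auto simp: R_def sym_def Int_commute sym_adjacent intro: finite_subset[of _ "adjacent_cells T"])
  define S where "S = {L \<in> T. (K, L) \<in> R\<^sup>*}"
  let ?s = "closed_segment x (x + z)"
  have clo: "closed (\<Union>S)" "closed (\<Union>(T - S))"
    using fin cell_compact by (auto simp: S_def intro!: closed_Union compact_imp_closed)
  have disj: "\<Union>S \<inter> \<Union>(T - S) \<inter> ?s = {}"
  proof (rule ccontr)
    assume "\<not> ?thesis"
    then obtain p L L' where p: "p \<in> ?s" "p \<in> L" "p \<in> L'" "L \<in> S" "L' \<in> T" "L' \<notin> S" by auto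
    then have hit: "x \<in> hitting z (L \<inter> L')" by (auto simp: hitting_def)
    have "L \<noteq> L'" "L \<in> T" using p by (auto simp: S_def)
    then have "(L, L') \<in> R" using generic[of L L'] hit p by (auto simp: R_def)
    then show False using p by (auto simp: S_def intro: rtrancl_into_rtrancl)
  qed
  have "?s \<subseteq> \<Union>S \<union> \<Union>(T - S)" using seg by (auto simp: S_def)
  moreover have "\<Union>S \<inter> ?s \<noteq> {}" using K by (auto simp: S_def)
  moreover have "connected ?s" by simp
  ultimately have "\<Union>(T - S) \<inter> ?s = {}" using clo disj unfolding connected_closed by blast
  then have "K' \<in> S" using K by auto
  then have "(K, K') \<in> R\<^sup>*" by (simp add: S_def)
  then have "\<bar>a K - a K'\<bar> \<le> (\<Sum>(L, L')\<in>R. \<bar>a L - a L'\<bar>)" by (rule path_variation[OF R])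
  then have "\<bar>a K - a K'\<bar>\<^sup>2 \<le> (\<Sum>(L, L')\<in>R. \<bar>a L - a L'\<bar>)\<^sup>2" by (rule power_mono) simp
  then have "(a K - a K')\<^sup>2 \<le> (\<Sum>(L, L')\<in>R. \<bar>a L - a L'\<bar>)\<^sup>2" by simp
  \<comment> \<open>Cauchy-Schwarz: squaring costs the number of facet crossings available to the
    path.\<close>
  also have "\<dots> \<le> (\<Sum>r\<in>R. (case r of (L, L') \<Rightarrow> \<bar>a L - a L'\<bar>)\<^sup>2) * card R"
    by (rule sum_squared_le_sum_of_squares)
  also have "(\<Sum>r\<in>R. (case r of (L, L') \<Rightarrow> \<bar>a L - a L'\<bar>)\<^sup>2) = (\<Sum>(L, L')\<in>R. (a L - a L')\<^sup>2)"
    by (intro sum.cong) auto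
  also have "\<dots> = (\<Sum>(L, L') \<in> adjacent_cells T. (a L - a L')\<^sup>2 * indicator (hitting z (L \<inter> L')) x)"
    using finite_adjacent unfolding R_def
    by (intro sum.mono_neutral_cong_left) (auto simp: indicator_def split: if_splits)
  finally show ?thesis by (simp add: R_def mult.commute)
qed

text \<open>For fixed \<open>z\<close> almost every starting point is generic, so the variation
  along its segment is bounded by the jumps at facets that it meets. Integrating over
  \<open>x\<close> gives a factor \<open>S\<close> for each facet, and \<open>z\<close> ranges over
  a ball of radius \<open>D\<close>. The bounds \<open>N\<close> and \<open>S\<close> stay abstract
  because the interior and the boundary layer differ in \<open>S\<close>; \<open>L\<close> restricts
  the cells where segments start.\<close>

lemma translation_estimate:
  fixes a :: "'a set \<Rightarrow> real" and N S :: real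
  assumes p: "convex p" "p \<subseteq> \<Union>T" and A: "A \<in> sets borel" "A \<subseteq> p" and B: "B \<in> sets borel" "B \<subseteq> p" and L: "L \<subseteq> T"
    and N: "\<And>x z. x \<in> p \<Longrightarrow> x + z \<in> p \<Longrightarrow> real (card {(K, K') \<in> adjacent_cells T. x \<in> hitting z (K \<inter> K')}) \<le> N"
    and S: "\<And>z K K'. (K, K') \<in> adjacent_cells T \<Longrightarrow> emeasure lborel {x \<in> A \<inter> \<Union>L. x + z \<in> B \<and> x \<in> hitting z (K \<inter> K')} \<le> ennreal S"
    and NS: "0 \<le> N" "0 \<le> S"
  shows "(\<Sum>K\<in>L. \<Sum>K'\<in>T. measure lebesgue (K \<inter> A) * measure lebesgue (K' \<inter> B) * (a K - a K')\<^sup>2)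
    \<le> measure lebesgue (cball (0::'a) D) * (N * S * jump_energy T a)"
proof -
  note [measurable] = A(1) B(1)
  have LT: "K \<in> L \<Longrightarrow> K \<in> T" for K using L by blast
  have finL: "finite L" using L fin finite_subset by blast
  have TT[measurable]: "\<Union>L \<in> sets borel" using finL LT cell_borel by auto
  have em: "emeasure lborel (K \<inter> A) = ennreal (measure lebesgue (K \<inter> A))" if "K \<in> T" "A \<in> sets borel" for K A
  proof -
    have "bounded (K \<inter> A)" using that cell_compact compact_imp_bounded bounded_Int by blast
    then have "emeasure lborel (K \<inter> A) < \<infinity>" by (rule emeasure_bounded_finite)
    then show ?thesis using that by (simp add: emeasure_eq_ennreal_measure less_top)
  qed
  define c where "c K K' = ennreal ((a K - a K')\<^sup>2)" for K K'
  define f where "f r z x = c (fst r) (snd r) * (indicator (fst r \<inter> A) x * indicator (snd r \<inter> B) (x + z))" for r z x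
  define F where "F z x = (\<Sum>r\<in>L \<times> T. f r z x)" for z x
  define Hs where "Hs z r = {x \<in> A \<inter> \<Union>L. x + z \<in> B \<and> x \<in> hitting z (fst r \<inter> snd r)}" for z r
  define G where "G z x = (\<Sum>r\<in>adjacent_cells T. ennreal N * c (fst r) (snd r) * indicator (Hs z r) x)" for z x
  have mf: "f r z \<in> borel_measurable borel" "(\<lambda>z. \<integral>\<^sup>+x. f r z x \<partial>lborel) \<in> borel_measurable borel" if "r \<in> L \<times> T" for r z
  proof -
    have [measurable]: "fst r \<in> sets borel" "snd r \<in> sets borel" using that cell_borel LT by auto
    show "f r z \<in> borel_measurable borel" "(\<lambda>z. \<integral>\<^sup>+x. f r z x \<partial>lborel) \<in> borel_measurable borel"
      unfolding f_def by measurable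
  qed
  have hitm: "Hs z (K, K') \<in> sets borel" if "(K, K') \<in> adjacent_cells T" for z K K'
  proof -
    have "compact (K \<inter> K')" using that cell_compact by (auto simp: adjacent_cells_def intro: compact_Int)
    then have "hitting z (K \<inter> K') \<in> sets borel" by (rule borel_closed[OF compact_imp_closed[OF compact_hitting]])
    moreover have "{x. x + z \<in> B} \<in> sets borel" by measurable
    ultimately have "(A \<inter> \<Union>L) \<inter> {x. x + z \<in> B} \<inter> hitting z (K \<inter> K') \<in> sets borel" by (intro sets.Int A(1) TT)
    moreover have "(A \<inter> \<Union>L) \<inter> {x. x + z \<in> B} \<inter> hitting z (K \<inter> K') = Hs z (K, K')" by (auto simp: Hs_def)
    ultimately show ?thesis by simp
  qed
  have FG: "AE x in lborel. F z x \<le> G z x" for z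
  proof -
    \<comment> \<open>Exceptional starting points for the given \<open>z\<close>: the start lies in
      two cells, the end lies in two cells, or the segment passes through an intersection that is
      not a common facet. These are finitely many null sets.\<close>
    define bad where "bad = (\<Union>(K, K')\<in>{(K, K'). K \<in> T \<and> K' \<in> T \<and> K \<noteq> K'}. (K \<inter> K') \<union> ((+) (- z)) ` (K \<inter> K') \<union> (if (K, K') \<in> adjacent_cells T then {} else hitting z (K \<inter> K')))"
    have finp: "finite {(K, K'). K \<in> T \<and> K' \<in> T \<and> K \<noteq> K'}" by (rule finite_subset[of _ "T \<times> T"]) (use fin in auto)
    have "negligible bad" unfolding bad_def
    proof (intro negligible_Union ballI, goal_cases)
      case (2 t)
      then obtain K K' where KK: "K \<in> T" "K' \<in> T" "K \<noteq> K'" and t: "t = (K \<inter> K') \<union> ((+) (- z)) ` (K \<inter> K') \<union> (if (K, K') \<in> adjacent_cells T then {} else hitting z (K \<inter> K'))" by auto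
      have "negligible (hitting z (K \<inter> K'))" if "(K, K') \<notin> adjacent_cells T"
        using intersection_dim(2)[OF KK] that by (intro negligible_hitting) auto
      then have "negligible (if (K, K') \<in> adjacent_cells T then {} else hitting z (K \<inter> K'))" by simp
      moreover have "negligible ((+) (- z) ` (K \<inter> K'))" by (rule negligible_translation[OF negligible_intersection[OF KK]])
      ultimately show ?case unfolding t by (intro negligible_Un negligible_intersection[OF KK])
    qed (use finp in auto)
    then have "AE x in lebesgue. x \<notin> bad" by (simp add: negligible_iff_null_sets AE_not_in)
    moreover have "F z x \<le> G z x" if x: "x \<notin> bad" for x
    proof (cases "x \<in> A \<inter> \<Union>L \<and> x + z \<in> B")
      case False
      then have "F z x = 0" unfolding F_def by (intro sum.neutral ballI) (auto simp: indicator_def f_def)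
      then show ?thesis by simp
    next
      case True
      then obtain K0 where K0: "x \<in> K0" "K0 \<in> L" by blast
      have sg: "closed_segment x (x + z) \<subseteq> \<Union>T"
        using True A(2) B(2) p convex_contains_segment by blast
      then obtain K1 where K1: "x + z \<in> K1" "K1 \<in> T" by (meson UnionE ends_in_segment(2) subsetD)
      \<comment> \<open>Off the exceptional set the two ends determine their cells, so the double
        sum collapses to a single term.\<close>
      have u0: "K = K0" if "x \<in> K" "K \<in> T" for K
        using that K0 x LT[OF K0(2)] unfolding bad_def by blast
      have u1: "K = K1" if "x + z \<in> K" "K \<in> T" for K
      proof (rule ccontr)
        assume "K \<noteq> K1"
        moreover have "x \<in> ((+) (- z)) ` (K \<inter> K1)" using that K1 by (intro image_eqI[of _ _ "x + z"]) auto
        ultimately show False using that K1 x unfolding bad_def by blast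
      qed
      have "F z x = (\<Sum>r\<in>L \<times> T. if r = (K0, K1) then c K0 K1 else 0)"
        unfolding F_def
      proof (intro sum.cong refl)
        fix r assume r: "r \<in> L \<times> T"
        then have "x \<in> fst r \<longleftrightarrow> fst r = K0" "x + z \<in> snd r \<longleftrightarrow> snd r = K1"
          using u0[of "fst r"] u1[of "snd r"] LT K0 K1 by auto
        then show "f r z x = (if r = (K0, K1) then c K0 K1 else 0)"
          using True by (cases r) (auto simp: indicator_def f_def)
      qed
      also have "\<dots> = c K0 K1" using finL fin K0 K1 by (simp add: sum.delta)
      also have "\<dots> \<le> ennreal (N * (\<Sum>(K, K')\<in>adjacent_cells T. (a K - a K')\<^sup>2 * indicator (hitting z (K \<inter> K')) x))"
        unfolding c_def
      proof (intro ennreal_leI)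
        have "(a K0 - a K1)\<^sup>2 \<le> real (card {(L, L') \<in> adjacent_cells T. x \<in> hitting z (L \<inter> L')}) *
          (\<Sum>(L, L') \<in> adjacent_cells T. (a L - a L')\<^sup>2 * indicator (hitting z (L \<inter> L')) x)"
        proof (rule segment_variation[OF sg _ LT[OF K0(2)] K0(1) K1(2,1)])
          fix K K' assume "K \<in> T" "K' \<in> T" "K \<noteq> K'" "(K, K') \<notin> adjacent_cells T"
          then show "x \<notin> hitting z (K \<inter> K')" using x unfolding bad_def by force
        qed
        also have "\<dots> \<le> N * (\<Sum>(K, K')\<in>adjacent_cells T. (a K - a K')\<^sup>2 * indicator (hitting z (K \<inter> K')) x)"
          using True A(2) B(2) by (intro mult_right_mono N sum_nonneg) auto
        finally show "(a K0 - a K1)\<^sup>2 \<le> N * (\<Sum>(K, K')\<in>adjacent_cells T. (a K - a K')\<^sup>2 * indicator (hitting z (K \<inter> K')) x)" .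
      qed
      also have "\<dots> = (\<Sum>r\<in>adjacent_cells T. ennreal (case r of (K, K') \<Rightarrow> N * ((a K - a K')\<^sup>2 * indicator (hitting z (K \<inter> K')) x)))"
        using NS by (subst sum_ennreal) (auto simp: sum_distrib_left split_def)
      also have "\<dots> = G z x"
        unfolding G_def
      proof (intro sum.cong refl)
        fix r :: "'a set \<times> 'a set"
        show "ennreal (case r of (K, K') \<Rightarrow> N * ((a K - a K')\<^sup>2 * indicator (hitting z (K \<inter> K')) x)) =
          ennreal N * c (fst r) (snd r) * indicator (Hs z r) x"
          using True NS by (cases r) (auto simp: indicator_def c_def ennreal_mult Hs_def)
      qed
      finally show ?thesis .
    qed
    ultimately have "AE x in lebesgue. F z x \<le> G z x" by auto
    then show ?thesis by (simp add: AE_completion_iff)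
  qed
  have G_int: "(\<integral>\<^sup>+x. G z x \<partial>lborel) \<le> ennreal (N * S * jump_energy T a)" for z
  proof -
    have "(\<integral>\<^sup>+x. G z x \<partial>lborel) = (\<Sum>r\<in>adjacent_cells T. \<integral>\<^sup>+x. ennreal N * c (fst r) (snd r) * indicator (Hs z r) x \<partial>lborel)"
      unfolding G_def using hitm by (intro nn_integral_sum) auto
    also have "\<dots> = (\<Sum>r\<in>adjacent_cells T. ennreal N * c (fst r) (snd r) * emeasure lborel (Hs z r))"
      using hitm by (intro sum.cong refl nn_integral_cmult_indicator) auto
    also have "\<dots> \<le> (\<Sum>r\<in>adjacent_cells T. ennreal N * c (fst r) (snd r) * ennreal S)"
      using S unfolding Hs_def by (intro sum_mono mult_left_mono) auto
    also have "\<dots> = (\<Sum>r\<in>adjacent_cells T. ennreal (case r of (K, K') \<Rightarrow> N * S * (a K - a K')\<^sup>2))"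
      using NS by (intro sum.cong) (auto simp: c_def ennreal_mult[symmetric] mult_ac)
    also have "\<dots> = ennreal (N * S * jump_energy T a)"
      using NS by (subst sum_ennreal) (auto simp: jump_energy_def sum_distrib_left split_def)
    finally show ?thesis .
  qed
  \<comment> \<open>Only translations between points of the mesh contribute, which makes the
    integral over \<open>z\<close> finite.\<close>
  have F0: "F z x = 0" if "z \<notin> cball 0 D" for z x
  proof -
    have "\<not> (x \<in> A \<and> x + z \<in> B)"
    proof
      assume "x \<in> A \<and> x + z \<in> B"
      then have "dist x (x + z) \<le> D" using A(2) B(2) p(2) by (intro bound) auto
      then show False using that by (simp add: dist_norm)
    qed
    then show ?thesis unfolding F_def by (intro sum.neutral ballI) (auto simp: indicator_def f_def)
  qed
  let ?lhs = "\<Sum>K\<in>L. \<Sum>K'\<in>T. measure lebesgue (K \<inter> A) * measure lebesgue (K' \<inter> B) * (a K - a K')\<^sup>2"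
  have "ennreal ?lhs = (\<Sum>K\<in>L. \<Sum>K'\<in>T. c K K' * (emeasure lborel (K \<inter> A) * emeasure lborel (K' \<inter> B)))"
  proof -
    have "ennreal ?lhs = (\<Sum>K\<in>L. \<Sum>K'\<in>T. ennreal (measure lebesgue (K \<inter> A) * measure lebesgue (K' \<inter> B) * (a K - a K')\<^sup>2))"
      by (simp add: sum_ennreal sum_nonneg)
    also have "\<dots> = (\<Sum>K\<in>L. \<Sum>K'\<in>T. c K K' * (emeasure lborel (K \<inter> A) * emeasure lborel (K' \<inter> B)))"
      using LT by (intro sum.cong refl) (simp add: em A B c_def ennreal_mult[symmetric] mult_ac)
    finally show ?thesis .
  qed
  also have "\<dots> = (\<Sum>r\<in>L \<times> T. c (fst r) (snd r) * (emeasure lborel (fst r \<inter> A) * emeasure lborel (snd r \<inter> B)))"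
    unfolding sum.cartesian_product by (intro sum.cong) auto
  also have "\<dots> = (\<Sum>r\<in>L \<times> T. \<integral>\<^sup>+z. (\<integral>\<^sup>+x. f r z x \<partial>lborel) \<partial>lborel)"
  proof (intro sum.cong refl)
    fix r assume "r \<in> L \<times> T"
    then have [measurable]: "fst r \<in> sets borel" "snd r \<in> sets borel" using cell_borel LT by auto
    show "c (fst r) (snd r) * (emeasure lborel (fst r \<inter> A) * emeasure lborel (snd r \<inter> B)) = (\<integral>\<^sup>+z. (\<integral>\<^sup>+x. f r z x \<partial>lborel) \<partial>lborel)"
      unfolding f_def by (subst product_measure_eq_translation_integral) (simp_all add: nn_integral_cmult)
  qed
  also have "\<dots> = (\<integral>\<^sup>+z. (\<Sum>r\<in>L \<times> T. \<integral>\<^sup>+x. f r z x \<partial>lborel) \<partial>lborel)"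
    using mf(2) by (intro nn_integral_sum[symmetric]) auto
  also have "\<dots> = (\<integral>\<^sup>+z. (\<integral>\<^sup>+x. F z x \<partial>lborel) \<partial>lborel)"
    unfolding F_def using mf(1) by (intro nn_integral_cong nn_integral_sum[symmetric]) auto
  also have "\<dots> \<le> (\<integral>\<^sup>+z. ennreal (N * S * jump_energy T a) * indicator (cball (0::'a) D) z \<partial>lborel)"
  proof (intro nn_integral_mono)
    fix z :: 'a
    show "(\<integral>\<^sup>+x. F z x \<partial>lborel) \<le> ennreal (N * S * jump_energy T a) * indicator (cball 0 D) z"
    proof (cases "z \<in> cball 0 D")
      case True
      have "(\<integral>\<^sup>+x. F z x \<partial>lborel) \<le> (\<integral>\<^sup>+x. G z x \<partial>lborel)" by (rule nn_integral_mono_AE[OF FG])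
      also have "\<dots> \<le> ennreal (N * S * jump_energy T a)" by (rule G_int)
      finally show ?thesis using True by simp
    qed (simp add: F0)
  qed
  also have "\<dots> = ennreal (N * S * jump_energy T a) * emeasure lborel (cball (0::'a) D)"
    by (rule nn_integral_cmult_indicator) simp
  also have "emeasure lborel (cball (0::'a) D) = ennreal (measure lebesgue (cball (0::'a) D))"
    using emeasure_bounded_finite[of "cball (0::'a) D"] by (simp add: emeasure_eq_ennreal_measure less_top)
  also have "ennreal (N * S * jump_energy T a) * ennreal (measure lebesgue (cball (0::'a) D)) = ennreal (measure lebesgue (cball (0::'a) D) * (N * S * jump_energy T a))"
    using NS by (subst ennreal_mult[symmetric]) (auto simp: jump_energy_def mult.commute intro!: mult_nonneg_nonneg sum_nonneg)
  finally have fin: "ennreal ?lhs \<le> ennreal (measure lebesgue (cball (0::'a) D) * (N * S * jump_energy T a))" .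
  have "0 \<le> measure lebesgue (cball (0::'a) D) * (N * S * jump_energy T a)"
    using NS by (auto simp: jump_energy_def intro!: mult_nonneg_nonneg sum_nonneg)
  with fin show ?thesis by (simp add: ennreal_le_iff)
qed

end

section \<open>Counting cells and facets at scale h\<close>

context uniform_mesh begin

definition ball_const :: real where "ball_const = unit_ball_vol (real DIM('a))"

lemma ball_const_pos: "ball_const > 0" by (simp add: ball_const_def)

lemma measure_cball: "r \<ge> 0 \<Longrightarrow> measure lebesgue (cball (x::'a) r) = ball_const * r ^ DIM('a)"
  by (simp add: content_cball ball_const_def)

lemma measure_Union_cells:
  assumes "Q \<subseteq> T" "X \<in> sets borel"
  shows "measure lebesgue (\<Union>Q \<inter> X) = (\<Sum>K\<in>Q. measure lebesgue (K \<inter> X))"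
proof -
  have "(\<Union>K\<in>Q. K \<inter> X) = \<Union>Q \<inter> X" by blast
  moreover have "measure lebesgue (\<Union>K\<in>Q. K \<inter> X) = (\<Sum>K\<in>Q. measure lebesgue (K \<inter> X))"
  proof (rule measure_negligible_finite_Union_image)
    show "finite Q" using assms fin finite_subset by blast
    show "K \<inter> X \<in> lmeasurable" if "K \<in> Q" for K
      using that assms cell_lmeasurable by (intro fmeasurable_Int_fmeasurable) auto
    show "pairwise (\<lambda>K K'. negligible ((K \<inter> X) \<inter> (K' \<inter> X))) Q"
    proof (intro pairwiseI)
      fix K K' assume "K \<in> Q" "K' \<in> Q" "K \<noteq> K'"
      then have "negligible (K \<inter> K')" using assms by (intro negligible_intersection) auto
      then show "negligible ((K \<inter> X) \<inter> (K' \<inter> X))" by (rule negligible_subset) auto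
    qed
  qed
  ultimately show ?thesis by simp
qed

text \<open>Comparison of volumes: the cells overlap in null sets, each has volume at least
  \<open>\<mu> * h ^ DIM('a)\<close>, and all lie in a ball of radius
  \<open>(R + 1) * h\<close>.\<close>

lemma packing:
  assumes R: "R \<ge> 0"
  shows "real (card {K \<in> T. K \<inter> cball p (R * h) \<noteq> {}}) \<le> ball_const * (R + 1) ^ DIM('a) / \<mu>"
proof -
  define Q where "Q = {K \<in> T. K \<inter> cball p (R * h) \<noteq> {}}"
  have Q: "Q \<subseteq> T" by (auto simp: Q_def)
  have sub: "\<Union>Q \<subseteq> cball p ((R + 1) * h)"
  proof
    fix x assume "x \<in> \<Union>Q"
    then obtain K y where "K \<in> T" "x \<in> K" "y \<in> K" "dist p y \<le> R * h" by (auto simp: Q_def)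
    then show "x \<in> cball p ((R + 1) * h)" using diam[of K y x] dist_triangle[of p x y] by (simp add: algebra_simps)
  qed
  have "real (card Q) * (\<mu> * h ^ DIM('a)) \<le> (\<Sum>K\<in>Q. measure lebesgue K)"
    using Q vol by (intro sum_bounded_below[where K = "\<mu> * h ^ DIM('a)" and f = "measure lebesgue", THEN order_trans[rotated]]) auto
  also have "\<dots> = measure lebesgue (\<Union>Q)" using measure_Union_cells[OF Q, of UNIV] by simp
  also have "\<dots> \<le> measure lebesgue (cball p ((R + 1) * h))"
    using sub Q cell_borel fin by (intro measure_mono_fmeasurable) (auto intro!: sets.finite_Union finite_subset[of Q T])
  also have "\<dots> = ball_const * (R + 1) ^ DIM('a) * h ^ DIM('a)"
    using R h by (subst measure_cball) (auto simp: power_mult_distrib)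
  finally have "real (card Q) * \<mu> * h ^ DIM('a) \<le> ball_const * (R + 1) ^ DIM('a) * h ^ DIM('a)" by (simp add: mult_ac)
  then have "real (card Q) * \<mu> \<le> ball_const * (R + 1) ^ DIM('a)" using h by simp
  then show ?thesis using mu by (simp add: Q_def field_simps)
qed

definition pack :: real where "pack = ball_const * 2 ^ DIM('a) / \<mu>"

lemma pack_pos: "pack > 0" using ball_const_pos mu by (simp add: pack_def)

lemma packing1: "real (card {K \<in> T. K \<inter> cball p h \<noteq> {}}) \<le> pack"
  using packing[of 1 p] by (simp add: pack_def)

definition nsteps :: nat where "nsteps = nat \<lceil>D / h\<rceil>"

text \<open>Cutting a vector of length at most \<open>D\<close> into \<open>nsteps\<close> equal
  pieces makes each piece no longer than \<open>h\<close>. The third bound counts the division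
  points including the start; this point and rounding up cost 2, which is at most
  \<open>2 * D / h\<close>.\<close>

lemma nsteps: "nsteps \<ge> 1" "real nsteps \<ge> D / h" "real nsteps + 1 \<le> 3 * D / h"
proof -
  have 1: "D / h \<ge> 1" using h by simp
  then have "\<lceil>D / h\<rceil> \<ge> 1" by linarith
  then show "nsteps \<ge> 1" unfolding nsteps_def by linarith
  have e: "real nsteps = of_int \<lceil>D / h\<rceil>" using \<open>\<lceil>D / h\<rceil> \<ge> 1\<close> by (simp add: nsteps_def)
  show "real nsteps \<ge> D / h" unfolding e by linarith
  have "real nsteps \<le> D / h + 1" unfolding e by linarith
  then show "real nsteps + 1 \<le> 3 * D / h" using 1 by simp
qed

lemma step_cover:
  assumes t: "t \<in> {0..1}" and z: "norm (z::'a) \<le> D"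
  obtains j where "j \<le> nsteps" "dist (x + t *\<^sub>R z) (x + (real j / real nsteps) *\<^sub>R z) \<le> h"
proof -
  define j where "j = nat \<lfloor>t * real nsteps\<rfloor>"
  have j: "real j \<le> t * real nsteps" "t * real nsteps \<le> real j + 1" using t by (auto simp: j_def)
  have n0: "real nsteps > 0" using nsteps(1) by linarith
  have "real j \<le> real nsteps" using j(1) t mult_right_mono[of t 1 "real nsteps"] by simp
  moreover have "dist (x + t *\<^sub>R z) (x + (real j / real nsteps) *\<^sub>R z) \<le> h"
  proof -
    have "\<bar>t - real j / real nsteps\<bar> \<le> 1 / real nsteps" 
    proof -
      have "t - real j / real nsteps = (t * real nsteps - real j) / real nsteps" using n0 by (simp add: diff_divide_distrib)
      moreover have "\<bar>t * real nsteps - real j\<bar> \<le> 1" using j by linarith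
      ultimately show ?thesis using n0 by (simp add: abs_divide divide_right_mono)
    qed
    then have "\<bar>t - real j / real nsteps\<bar> * norm z \<le> 1 / real nsteps * D" using z h by (intro mult_mono) auto
    also have "\<dots> \<le> h" using nsteps(2) n0 h by (simp add: field_simps)
    finally show ?thesis by (simp add: dist_norm scaleR_diff_left[symmetric])
  qed
  ultimately show ?thesis using that by simp
qed

text \<open>Every point of the segment is within \<open>h\<close> of one of about
  \<open>D / h\<close> division points. Both cells of a facet that is met therefore meet the ball
  about such a point, and the ball allows at most \<open>pack\<close> choices for each of
  them.\<close>

lemma card_hitting:
  assumes "x \<in> \<Union>T" "x + z \<in> \<Union>T"
  shows "real (card {(K, K') \<in> adjacent_cells T. x \<in> hitting z (K \<inter> K')}) \<le> 3 * D / h * pack\<^sup>2"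
proof -
  have z: "norm z \<le> D" using bound[OF assms] by (simp add: dist_norm)
  define Q where "Q j = {K \<in> T. K \<inter> cball (x + (real j / real nsteps) *\<^sub>R z) h \<noteq> {}}" for j
  have finQ: "finite (Q j)" for j using fin by (simp add: Q_def)
  have "{(K, K') \<in> adjacent_cells T. x \<in> hitting z (K \<inter> K')} \<subseteq> (\<Union>j\<le>nsteps. Q j \<times> Q j)"
  proof clarify
    fix K K' assume *: "(K, K') \<in> adjacent_cells T" "x \<in> hitting z (K \<inter> K')"
    then obtain t where t: "t \<in> {0..1}" "x + t *\<^sub>R z \<in> K \<inter> K'" by (auto simp: hitting_iff)
    obtain j where "j \<le> nsteps" "dist (x + t *\<^sub>R z) (x + (real j / real nsteps) *\<^sub>R z) \<le> h"
      using step_cover[OF t(1) z] by metis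
    then show "(K, K') \<in> (\<Union>j\<le>nsteps. Q j \<times> Q j)"
      using t * by (intro UN_I[of j]) (auto simp: Q_def adjacent_cells_def dist_commute)
  qed
  then have "card {(K, K') \<in> adjacent_cells T. x \<in> hitting z (K \<inter> K')} \<le> card (\<Union>j\<le>nsteps. Q j \<times> Q j)"
    using finQ by (intro card_mono) auto
  also have "\<dots> \<le> (\<Sum>j\<le>nsteps. card (Q j \<times> Q j))" by (rule card_UN_le) simp
  finally have "real (card {(K, K') \<in> adjacent_cells T. x \<in> hitting z (K \<inter> K')}) \<le> (\<Sum>j\<le>nsteps. real (card (Q j)) * real (card (Q j)))"
    unfolding card_cartesian_product by (metis (mono_tags, lifting) of_nat_le_iff of_nat_mult of_nat_sum sum.cong)
  also have "\<dots> \<le> (\<Sum>j\<le>nsteps. pack * pack)"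
    using packing1 unfolding Q_def by (intro sum_mono mult_mono) (auto intro: less_imp_le pack_pos)
  also have "\<dots> = (real nsteps + 1) * pack\<^sup>2" by (simp add: power2_eq_square algebra_simps)
  also have "\<dots> \<le> 3 * D / h * pack\<^sup>2" using nsteps(3) by (rule mult_right_mono) simp
  finally show ?thesis .
qed

text \<open>Sweeping a facet, of diameter at most \<open>h\<close>, backwards along \<open>z\<close>
  gives a thin tube, covered by about \<open>D / h\<close> balls of radius \<open>2 * h\<close>: one
  \<open>h\<close> for the facet and one for the rounding to a division point.\<close>

lemma hitting_measure:
  assumes K: "(K, K') \<in> adjacent_cells T" and "A \<subseteq> \<Union>T" "B \<subseteq> \<Union>T"
  shows "emeasure lborel {x \<in> A. x + z \<in> B \<and> x \<in> hitting z (K \<inter> K')} \<le> ennreal (3 * D / h * (ball_const * 2 ^ DIM('a) * h ^ DIM('a)))"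
proof (cases "\<exists>x\<in>A. x + z \<in> B")
  case True
  then have z: "norm z \<le> D" using bound assms(2,3) by (force simp: dist_norm)
  obtain q where q: "q \<in> K \<inter> K'" using K by (auto simp: adjacent_cells_def facet_of_def)
  define P where "P j = cball (q - (real j / real nsteps) *\<^sub>R z) (2 * h)" for j
  have "{x \<in> A. x + z \<in> B \<and> x \<in> hitting z (K \<inter> K')} \<subseteq> (\<Union>j\<le>nsteps. P j)"
  proof clarify
    fix x assume "x \<in> hitting z (K \<inter> K')"
    then obtain t where t: "t \<in> {0..1}" "x + t *\<^sub>R z \<in> K \<inter> K'" by (auto simp: hitting_iff)
    obtain j where j: "j \<le> nsteps" "dist (x + t *\<^sub>R z) (x + (real j / real nsteps) *\<^sub>R z) \<le> h"
      using step_cover[OF t(1) z] by metis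
    have "dist q (x + t *\<^sub>R z) \<le> h" using K t q by (intro diam[of K]) (auto simp: adjacent_cells_def)
    then have "dist q (x + (real j / real nsteps) *\<^sub>R z) \<le> 2 * h" using j(2) dist_triangle[of q "x + (real j / real nsteps) *\<^sub>R z" "x + t *\<^sub>R z"] by linarith
    then have "dist (q - (real j / real nsteps) *\<^sub>R z) x \<le> 2 * h" by (simp add: dist_norm algebra_simps)
    then show "x \<in> (\<Union>j\<le>nsteps. P j)" using j(1) by (auto simp: P_def)
  qed
  then have "emeasure lborel {x \<in> A. x + z \<in> B \<and> x \<in> hitting z (K \<inter> K')} \<le> emeasure lborel (\<Union>j\<le>nsteps. P j)"
    by (rule emeasure_mono) (auto simp: P_def)
  also have "\<dots> \<le> (\<Sum>j\<le>nsteps. emeasure lborel (P j))" by (rule emeasure_subadditive_finite) (auto simp: P_def)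
  also have "\<dots> = (\<Sum>j\<le>nsteps. ennreal (ball_const * (2 * h) ^ DIM('a)))"
    using h by (intro sum.cong) (auto simp: P_def emeasure_cball ball_const_def)
  also have "\<dots> = ennreal ((real nsteps + 1) * (ball_const * (2 * h) ^ DIM('a)))"
    using ball_const_pos h by (subst sum_ennreal) (auto simp: algebra_simps)
  also have "\<dots> \<le> ennreal (3 * D / h * (ball_const * 2 ^ DIM('a) * h ^ DIM('a)))"
    unfolding power_mult_distrib mult.assoc[symmetric]
    using nsteps(3) ball_const_pos h by (intro ennreal_leI mult_right_mono) auto
  finally show ?thesis .
next
  case False
  then have "{x \<in> A. x + z \<in> B \<and> x \<in> hitting z (K \<inter> K')} = {}" by blast
  then show ?thesis by (simp only: emeasure_empty zero_le)
qed

text \<open>The scaling is that of a squared gradient integrated over a cell: jump divided by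
  \<open>h\<close>, squared, times the volume \<open>h ^ DIM('a)\<close>.\<close>

definition energy :: "('a set \<Rightarrow> real) \<Rightarrow> real" where
  "energy a = h ^ DIM('a) / h\<^sup>2 * jump_energy T a"

lemma D_nonneg: "D \<ge> 0" using h by simp

text \<open>For \<open>L = T\<close> and sets covered by the mesh this is the double integral over
  \<open>A\<close> and \<open>B\<close> of the squared difference of the piecewise constant function
  with values \<open>a K\<close>.\<close>

definition variation :: "'a set set \<Rightarrow> 'a set \<Rightarrow> 'a set \<Rightarrow> ('a set \<Rightarrow> real) \<Rightarrow> real" where
  "variation L A B a = (\<Sum>K\<in>L. \<Sum>K'\<in>T. measure lebesgue (K \<inter> A) * measure lebesgue (K' \<inter> B) * (a K - a K')\<^sup>2)"

text \<open>Convexity of \<open>p\<close> keeps the segments between points of \<open>A\<close> and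
  \<open>B\<close> inside the mesh. The counts of order \<open>1 / h\<close> and volumes of order
  \<open>h ^ DIM('a) / h\<close> multiply to exactly the weight in \<open>energy\<close>.\<close>

lemma convex_variation:
  assumes p: "convex p" "p \<subseteq> \<Union>T" and A: "A \<in> sets borel" "A \<subseteq> p" and B: "B \<in> sets borel" "B \<subseteq> p"
  shows "variation T A B a \<le> ball_const * D ^ DIM('a) * (3 * D * pack\<^sup>2) * (3 * D * ball_const * 2 ^ DIM('a)) * energy a"
proof -
  have "variation T A B a \<le> measure lebesgue (cball (0::'a) D) *
     (3 * D / h * pack\<^sup>2 * (3 * D / h * (ball_const * 2 ^ DIM('a) * h ^ DIM('a))) * jump_energy T a)"
    unfolding variation_def
  proof (rule translation_estimate[OF p A B order_refl])
    show "real (card {(K, K') \<in> adjacent_cells T. x \<in> hitting z (K \<inter> K')}) \<le> 3 * D / h * pack\<^sup>2" if "x \<in> p" "x + z \<in> p" for x z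
      using that p by (intro card_hitting) auto
    show "emeasure lborel {x \<in> A \<inter> \<Union>T. x + z \<in> B \<and> x \<in> hitting z (K \<inter> K')} \<le> ennreal (3 * D / h * (ball_const * 2 ^ DIM('a) * h ^ DIM('a)))"
      if "(K, K') \<in> adjacent_cells T" for z K K'
      using that p B by (intro hitting_measure) auto
  qed (use h ball_const_pos in auto)
  also have "\<dots> = ball_const * D ^ DIM('a) * (3 * D * pack\<^sup>2) * (3 * D * ball_const * 2 ^ DIM('a)) * energy a"
    unfolding measure_cball[OF D_nonneg] using h by (simp add: energy_def field_simps power2_eq_square)
  finally show ?thesis .
qed

text \<open>Here the starting points for one facet fill only a volume of order
  \<open>h ^ DIM('a)\<close>; compared with \<open>convex_variation\<close> a factor
  \<open>h\<close> remains.\<close>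

lemma layer_variation:
  assumes p: "convex p" "p \<subseteq> \<Union>T" and A: "A \<in> sets borel" "A \<subseteq> p" and B: "B \<in> sets borel" "B \<subseteq> p" and L: "L \<subseteq> T"
    and c: "c \<ge> 0" and S: "\<And>z K K'. (K, K') \<in> adjacent_cells T \<Longrightarrow> emeasure lborel {x \<in> A \<inter> \<Union>L. x + z \<in> B \<and> x \<in> hitting z (K \<inter> K')} \<le> ennreal (c * h ^ DIM('a))"
  shows "variation L A B a \<le> ball_const * D ^ DIM('a) * (3 * D * pack\<^sup>2) * c * h * energy a"
proof -
  have "variation L A B a \<le> measure lebesgue (cball (0::'a) D) *
     (3 * D / h * pack\<^sup>2 * (c * h ^ DIM('a)) * jump_energy T a)"
    unfolding variation_def
  proof (rule translation_estimate[OF p A B L _ S])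
    show "real (card {(K, K') \<in> adjacent_cells T. x \<in> hitting z (K \<inter> K')}) \<le> 3 * D / h * pack\<^sup>2" if "x \<in> p" "x + z \<in> p" for x z
      using that p by (intro card_hitting) auto
  qed (use h c in auto)
  also have "\<dots> = ball_const * D ^ DIM('a) * (3 * D * pack\<^sup>2) * c * h * energy a"
    unfolding measure_cball[OF D_nonneg] using h by (simp add: energy_def field_simps power2_eq_square)
  finally show ?thesis .
qed

end

text \<open>Two of the translates differ by a multiple of \<open>w\<close>, so it suffices that no
  such multiple carries a point of \<open>S\<close> into \<open>S\<close>. Stacks of this kind give
  both the bound for barycentric gradients and the lower bound for face areas.\<close>

lemma disjoint_translates_measure:
  fixes S B :: "'a::euclidean_space set"
  assumes S: "S \<in> lmeasurable" and B: "B \<in> lmeasurable"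
    and sub: "\<And>j. j < N \<Longrightarrow> (+) (real j *\<^sub>R w) ` S \<subseteq> B"
    and disj: "\<And>j x y. 0 < j \<Longrightarrow> j < N \<Longrightarrow> x \<in> S \<Longrightarrow> y \<in> S \<Longrightarrow> x + real j *\<^sub>R w \<noteq> y"
  shows "real N * measure lebesgue S \<le> measure lebesgue B"
proof -
  let ?f = "\<lambda>j. (+) (real j *\<^sub>R w) ` S"
  have m: "?f j \<in> lmeasurable" for j by (rule measurable_translation[OF S])
  have d: "?f i \<inter> ?f j = {}" if "i < j" "j < N" for i j
  proof (rule ccontr)
    assume "?f i \<inter> ?f j \<noteq> {}"
    then obtain x y where xy: "x \<in> S" "y \<in> S" "real i *\<^sub>R w + x = real j *\<^sub>R w + y" by blast
    have "x = real j *\<^sub>R w + y - real i *\<^sub>R w" using xy(3) by (metis add_diff_cancel_left')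
    also have "\<dots> = y + real (j - i) *\<^sub>R w" using that by (simp add: of_nat_diff scaleR_diff_left)
    finally have "y + real (j - i) *\<^sub>R w = x" by simp
    moreover have "0 < j - i" "j - i < N" using that by auto
    ultimately show False using disj[of "j - i" y x] xy by blast
  qed
  have "real N * measure lebesgue S = (\<Sum>j\<in>{..<N}. measure lebesgue (?f j))"
    by (simp add: measure_translation)
  also have "\<dots> = measure lebesgue (\<Union>j\<in>{..<N}. ?f j)"
  proof (rule measure_negligible_finite_Union_image[symmetric])
    show "pairwise (\<lambda>i j. negligible (?f i \<inter> ?f j)) {..<N}"
    proof (intro pairwiseI)
      fix i j assume "i \<in> {..<N}" "j \<in> {..<N}" "i \<noteq> j"
      then have "?f i \<inter> ?f j = {}" using d[of i j] d[of j i] by (cases "i < j") auto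
      then show "negligible (?f i \<inter> ?f j)" by simp
    qed
  qed (use m in auto)
  also have "\<dots> \<le> measure lebesgue B"
    using sub m by (intro measure_mono_fmeasurable B) (auto intro!: sets.finite_UN fmeasurableD)
  finally show ?thesis .
qed

section \<open>Barycentric gradients and inscribed balls of cells\<close>

context uniform_mesh begin

lemma cell_vertices:
  assumes "K \<in> T"
  obtains C \<beta> where "finite C" "\<not> affine_dependent C" "card C = DIM('a) + 1" "K = convex hull C" "affine hull C = UNIV"
    "is_barycentric C \<beta>"
proof -
  obtain C where C: "\<not> affine_dependent C" "int (card C) = int DIM('a) + 1" "K = convex hull C"
    using simplex[OF assms] unfolding simplex_def by blast
  have fin: "finite C" using C(1) aff_independent_finite by blast
  have "aff_dim C = int DIM('a)" using aff_dim_affine_independent[OF C(1)] C(2) by simp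
  then have U: "affine hull C = UNIV" by (simp add: aff_dim_eq_full)
  obtain \<beta> where "is_barycentric C \<beta>" using barycentric_exists[OF C(1)] by blast
  then show ?thesis using that fin C U by simp
qed

definition grad_const :: real where "grad_const = 1 + 2 * ball_const * 3 ^ DIM('a) / \<mu>"

lemma grad_const: "grad_const \<ge> 1" using ball_const_pos mu by (simp add: grad_const_def)

text \<open>
  The cell lies in a slab of width \<open>1 / norm b\<close>. Disjoint translates of it across the slab fill a ball of
  radius \<open>3 * h\<close>, so the volume bound keeps the slab from being thin.
\<close>

lemma barycentric_gradient:
  assumes K: "K \<in> T" and C: "finite C" "K = convex hull C" "affine hull C = UNIV" "is_barycentric C \<beta>" and v: "v \<in> C"
    and b: "\<And>x. \<beta> v x = a + b \<bullet> x"
  shows "norm b * h \<le> grad_const"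
proof (cases "norm b * h \<le> 1")
  case True
  then show ?thesis using grad_const by linarith
next
  case False
  then have b0: "b \<noteq> 0" by auto
  have rng: "0 \<le> \<beta> v x \<and> \<beta> v x \<le> 1" if "x \<in> K" for x
  proof -
    have xa: "x \<in> affine hull C" using C by simp
    have nn: "\<forall>u\<in>C. 0 \<le> \<beta> u x" using barycentric_combination(4)[OF C(4,1) xa] that C by simp
    have "\<beta> v x \<le> (\<Sum>u\<in>C. \<beta> u x)" using nn v C(1) by (intro member_le_sum) auto
    then show ?thesis using nn v barycentric_combination(1)[OF C(4,1) xa] by simp
  qed
  \<comment> \<open>Translation by \<open>w\<close> raises the coordinate by 2, more than the length
    of its range [0,1] on the cell, so the translates are disjoint. As
    \<open>norm w = 2 / norm b\<close>, fewer than \<open>norm b * h\<close> of them move the cell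
    by at most \<open>2 * h\<close>.\<close>
  define w where "w = (2 / (norm b)\<^sup>2) *\<^sub>R b"
  have bw: "b \<bullet> w = 2" using b0 by (simp add: w_def power2_norm_eq_inner)
  have nw: "norm w = 2 / norm b" using b0 by (simp add: w_def power2_eq_square)
  \<comment> \<open>In this case \<open>norm b * h\<close> exceeds 1, so rounding down loses at most
    a factor 2.\<close>
  define N where "N = nat \<lfloor>norm b * h\<rfloor>"
  have N: "real N \<le> norm b * h" "norm b * h \<le> 2 * real N"
  proof -
    have "\<lfloor>norm b * h\<rfloor> \<ge> 1" using False by linarith
    then have e: "real N = of_int \<lfloor>norm b * h\<rfloor>" by (simp add: N_def)
    show "real N \<le> norm b * h" unfolding e by linarith
    show "norm b * h \<le> 2 * real N" unfolding e using \<open>\<lfloor>norm b * h\<rfloor> \<ge> 1\<close> by linarith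
  qed
  obtain x0 where x0: "x0 \<in> K" using v C hull_inc by metis
  have "real N * measure lebesgue K \<le> measure lebesgue (cball x0 (3 * h))"
  proof (rule disjoint_translates_measure[where w = w])
    show "K \<in> lmeasurable" using cell_lmeasurable[OF K] .
    fix j assume j: "j < N"
    show "(+) (real j *\<^sub>R w) ` K \<subseteq> cball x0 (3 * h)"
    proof clarify
      fix x assume "x \<in> K"
      then have "dist x0 x \<le> h" using diam K x0 by blast
      moreover have "norm (real j *\<^sub>R w) \<le> 2 * h"
      proof -
        have "real j * (2 / norm b) \<le> norm b * h * (2 / norm b)" using j N(1) by (intro mult_right_mono) auto
        then show ?thesis using b0 by (simp add: nw)
      qed
      moreover have "dist x0 (real j *\<^sub>R w + x) \<le> dist x0 x + norm (real j *\<^sub>R w)"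
        using norm_triangle_ineq4[of "x0 - x" "real j *\<^sub>R w"] by (simp add: dist_norm algebra_simps)
      ultimately show "real j *\<^sub>R w + x \<in> cball x0 (3 * h)" by simp
    qed
    fix x y assume "0 < j" "x \<in> K" "y \<in> K"
    show "x + real j *\<^sub>R w \<noteq> y"
    proof
      assume "x + real j *\<^sub>R w = y"
      then have "\<beta> v y = \<beta> v x + real j * 2" using bw by (auto simp: b inner_add_right)
      moreover have "real j \<ge> 1" using \<open>0 < j\<close> by simp
      ultimately show False using rng[OF \<open>x \<in> K\<close>] rng[OF \<open>y \<in> K\<close>] by linarith
    qed
  qed simp
  moreover have "measure lebesgue (cball x0 (3 * h)) = ball_const * (3 * h) ^ DIM('a)" using h by (intro measure_cball) simp
  moreover have "real N * (\<mu> * h ^ DIM('a)) \<le> real N * measure lebesgue K" by (intro mult_left_mono vol K) simp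
  ultimately have "real N * (\<mu> * h ^ DIM('a)) \<le> ball_const * (3 * h) ^ DIM('a)" by linarith
  also have "\<dots> = ball_const * 3 ^ DIM('a) * h ^ DIM('a)" by (simp add: power_mult_distrib)
  finally have "real N * (\<mu> * h ^ DIM('a)) \<le> ball_const * 3 ^ DIM('a) * h ^ DIM('a)" .
  then have "real N * \<mu> \<le> ball_const * 3 ^ DIM('a)" using h by (simp add: mult.assoc[symmetric])
  then have "real N \<le> ball_const * 3 ^ DIM('a) / \<mu>" using mu by (simp add: field_simps)
  then show ?thesis using N(2) unfolding grad_const_def by simp
qed

definition inradius :: real where "inradius = 1 / (real (DIM('a) + 1) * grad_const)"

lemma inradius: "0 < inradius" "inradius \<le> 1"
proof -
  have "real (DIM('a) + 1) * grad_const \<ge> 1 * 1" using grad_const by (intro mult_mono) auto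
  then show "0 < inradius" "inradius \<le> 1" by (auto simp: inradius_def)
qed

text \<open>At the barycenter of the cell all barycentric coordinates equal
  \<open>1 / (DIM('a) + 1)\<close>, and each changes by at most \<open>grad_const / h\<close> per
  unit length; \<open>inradius\<close> is chosen so that none becomes negative.\<close>

lemma cell_inball:
  assumes K: "K \<in> T" obtains c where "cball c (inradius * h) \<subseteq> K"
proof -
  obtain C \<beta> where C: "finite C" "\<not> affine_dependent C" "card C = DIM('a) + 1" "K = convex hull C" "affine hull C = UNIV"
    "is_barycentric C \<beta>" using cell_vertices[OF K] by metis
  define c where "c = (\<Sum>v\<in>C. (1 / real (card C)) *\<^sub>R v)"
  have \<beta>c: "\<beta> v c = 1 / real (DIM('a) + 1)" if "v \<in> C" for v
    using barycentric_combination(5)[OF C(6,1) _ _ c_def that] C by simp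
  have "cball c (inradius * h) \<subseteq> K"
  proof
    fix x assume x: "x \<in> cball c (inradius * h)"
    have "0 \<le> \<beta> v x" if v: "v \<in> C" for v
    proof -
      obtain a b where b: "\<And>x. \<beta> v x = a + b \<bullet> x" using C(6) v by (auto simp: is_barycentric_def affine_function_def)
      have g: "norm b * h \<le> grad_const" by (rule barycentric_gradient[OF K C(1,4,5,6) v b])
      have "\<bar>\<beta> v x - \<beta> v c\<bar> = \<bar>b \<bullet> (x - c)\<bar>" by (simp add: b inner_diff_right)
      also have "\<dots> \<le> norm b * norm (x - c)" by (rule Cauchy_Schwarz_ineq2)
      also have "\<dots> \<le> norm b * (inradius * h)" using x by (intro mult_left_mono) (auto simp: dist_norm norm_minus_commute)
      also have "\<dots> \<le> grad_const * inradius" using mult_right_mono[OF g, of inradius] inradius by (simp add: mult_ac)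
      also have "\<dots> = 1 / real (DIM('a) + 1)" using grad_const by (simp add: inradius_def)
      finally show ?thesis using \<beta>c[OF v] by linarith
    qed
    then show "x \<in> K" using barycentric_combination(4)[OF C(6,1), of x] C by simp
  qed
  then show ?thesis by (rule that)
qed

end

section \<open>The area of faces\<close>

lemma closest_point_hyperplane:
  fixes n :: "'a::euclidean_space"
  assumes n: "norm n = 1" and H: "H = {x. n \<bullet> x = c}"
  shows "closest_point H x = x - (n \<bullet> x - c) *\<^sub>R n" "infdist x H = \<bar>n \<bullet> x - c\<bar>"
proof -
  have nn: "n \<bullet> n = 1" using n by (simp add: norm_eq_1)
  show 1: "closest_point H x = x - (n \<bullet> x - c) *\<^sub>R n"
  proof (rule closest_point_affine_eq)
    show "affine H" unfolding H by (rule affine_hyperplane)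
    show "x - (n \<bullet> x - c) *\<^sub>R n \<in> H" by (simp add: H inner_diff_right nn)
    fix z assume "z \<in> H"
    then show "(x - (x - (n \<bullet> x - c) *\<^sub>R n)) \<bullet> (z - (x - (n \<bullet> x - c) *\<^sub>R n)) = 0"
      by (simp add: H inner_diff_right nn algebra_simps)
  qed
  have "c *\<^sub>R n \<in> H" by (simp add: H nn)
  moreover have "closed H" unfolding H by (rule closed_hyperplane)
  ultimately have "infdist x H = dist x (closest_point H x)"
    using setdist_closest_point[of H x] by (auto simp: infdist_eq_setdist)
  then show "infdist x H = \<bar>n \<bullet> x - c\<bar>" by (simp add: 1 n dist_norm)
qed

lemma hyperplane_of_aff_dim:
  fixes e :: "'a::euclidean_space set"
  assumes "aff_dim e = int DIM('a) - 1"
  obtains n c where "norm n = 1" "affine hull e = {x. n \<bullet> x = c}"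
proof -
  obtain a b where ab: "a \<noteq> 0" "affine hull e = {x. a \<bullet> x = b}" using assms aff_dim_eq_hyperplane[of e] DIM_positive[where 'a='a] by (auto simp: of_nat_diff)
  show ?thesis
  proof (rule that[of "(1 / norm a) *\<^sub>R a" "b / norm a"])
    show "affine hull e = {x. ((1 / norm a) *\<^sub>R a) \<bullet> x = b / norm a}" using ab by auto
  qed (use ab in auto)
qed

text \<open>The prism over \<open>F\<close> adds only the normal direction to \<open>F\<close>, so
  it lies in a hyperplane and has volume 0. The inserted point \<open>f + n\<close> makes that
  hyperplane contain the normal direction.\<close>

lemma hyperplane_measure_lowdim:
  fixes e F :: "'a::euclidean_space set"
  assumes e: "aff_dim e = int DIM('a) - 1" "closed e" and F: "closed F" "F \<subseteq> affine hull e" "aff_dim F \<le> int DIM('a) - 2"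
  shows "emeasure (hyperplane_measure (affine hull e)) F = 0"
proof (cases "F = {}")
  case False
  then obtain f where f: "f \<in> F" by blast
  obtain n c where nc: "norm n = 1" "affine hull e = {x. n \<bullet> x = c}" using hyperplane_of_aff_dim[OF e(1)] by metis
  let ?S = "insert (f + n) F"
  have "aff_dim ?S < int DIM('a)" using F(3) by (simp add: aff_dim_insert)
  then obtain a b where ab: "a \<noteq> 0" "?S \<subseteq> {x. a \<bullet> x = b}" using aff_lowdim_subset_hyperplane by metis
  let ?P = "{x. infdist x (affine hull e) \<le> 1 / 2 \<and> closest_point (affine hull e) x \<in> F}"
  have "?P \<subseteq> {x. a \<bullet> x = b}"
  proof clarify
    fix x assume "closest_point (affine hull e) x \<in> F"
    then have "x - (n \<bullet> x - c) *\<^sub>R n \<in> F" by (simp add: closest_point_hyperplane[OF nc])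
    then have "a \<bullet> (x - (n \<bullet> x - c) *\<^sub>R n) = b" "a \<bullet> f = b" "a \<bullet> (f + n) = b" using ab f by auto
    then show "a \<bullet> x = b" by (simp add: inner_diff_right inner_add_right)
  qed
  then have "negligible ?P" using negligible_subset[OF negligible_hyperplane] ab(1) by blast
  then have "emeasure lebesgue ?P = 0" by (simp add: negligible_iff_null_sets null_setsD1)
  moreover have e0: "e \<noteq> {}" using e(1) DIM_positive[where 'a='a] by (intro notI) simp
  moreover have "?P \<in> sets borel"
  proof -
    have "closed {x. infdist x (affine hull e) \<le> 1 / 2}" by (intro closed_Collect_le continuous_intros)
    moreover have "closed (closest_point (affine hull e) -` F)"
      using continuous_on_closest_point_affine_hull[OF e0] F(1) by (intro closed_vimage) auto
    ultimately have "closed ({x. infdist x (affine hull e) \<le> 1 / 2} \<inter> (closest_point (affine hull e) -` F))" by (rule closed_Int)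
    moreover have "{x. infdist x (affine hull e) \<le> 1 / 2} \<inter> (closest_point (affine hull e) -` F) = ?P" by blast
    ultimately show ?thesis by simp
  qed
  ultimately show ?thesis using face_area_prism[OF e(2) e0, of F] F(1) by simp
qed simp

text \<open>Everything is measured on the hyperplane of \<open>e0\<close>. A member of
  \<open>E\<close> in the same hyperplane contributes at most its area; one in another hyperplane
  meets \<open>e0\<close> in dimension at most \<open>DIM('a) - 2\<close>, hence in a null set. This
  compares faces belonging to different meshes.\<close>

lemma face_area_le_sum:
  fixes e0 :: "'a::euclidean_space set"
  assumes E: "finite E" "\<And>e. e \<in> E \<Longrightarrow> compact e \<and> convex e \<and> aff_dim e = int DIM('a) - 1"
    and e0: "compact e0" "convex e0" "aff_dim e0 = int DIM('a) - 1" and sub: "e0 \<subseteq> \<Union>E"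
  shows "face_area e0 \<le> (\<Sum>e\<in>E. face_area e)"
proof -
  let ?M = "hyperplane_measure (affine hull e0)"
  have ne: "e \<noteq> {}" if "aff_dim e = int DIM('a) - 1" for e :: "'a set"
    using that DIM_positive[where 'a='a] by (intro notI) simp
  have setsM: "sets (hyperplane_measure H) = sets borel" for H :: "'a set" by (simp add: hyperplane_measure_def)
  have fin: "emeasure (hyperplane_measure (affine hull e)) e = ennreal (face_area e)" if "compact e" "aff_dim e = int DIM('a) - 1" for e :: "'a set"
  proof -
    have c: "closed e" "e \<noteq> {}" using that ne compact_imp_closed by auto
    have "emeasure (hyperplane_measure (affine hull e)) e = emeasure lborel (prism e)"
      using face_area_prism[OF c, of e] c by (simp add: prism_def)
    also have "\<dots> < \<infinity>" using compact_prism[OF that(1) c(2)] compact_imp_bounded emeasure_bounded_finite by blast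
    finally show ?thesis unfolding face_area_def by (intro emeasure_eq_ennreal_measure) auto
  qed
  have part: "emeasure ?M (e \<inter> e0) \<le> ennreal (face_area e)" if e: "e \<in> E" for e
  proof (cases "affine hull e = affine hull e0")
    case True
    have "emeasure ?M (e \<inter> e0) \<le> emeasure ?M e"
      using E(2)[OF e] by (intro emeasure_mono) (auto simp: setsM compact_imp_closed)
    then show ?thesis using fin[of e] E(2)[OF e] True by simp
  next
    case False
    have "affine hull (e \<inter> e0) \<subseteq> affine hull e \<inter> affine hull e0"
      by (simp add: hull_mono)
    have d: "aff_dim (e \<inter> e0) \<le> int DIM('a) - 2"
    proof (rule ccontr)
      assume "\<not> ?thesis"
      then have ge: "aff_dim (e \<inter> e0) \<ge> int DIM('a) - 1" by simp
      have "aff_dim (e \<inter> e0) = aff_dim e" "aff_dim (e \<inter> e0) = aff_dim e0"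
        using ge E(2)[OF e] e0(3) aff_dim_subset[of "e \<inter> e0" e] aff_dim_subset[of "e \<inter> e0" e0] by auto
      then have "affine hull (e \<inter> e0) = affine hull e" "affine hull (e \<inter> e0) = affine hull e0"
        using affine_dim_equal[OF affine_affine_hull affine_affine_hull] ne[of "e \<inter> e0"] E(2)[OF e]
        by (metis aff_dim_affine_hull affine_hull_eq_empty hull_mono inf_le1, metis aff_dim_affine_hull affine_hull_eq_empty hull_mono inf_le2)
      then show False using False by simp
    qed
    have "emeasure ?M (e \<inter> e0) = 0"
      using E(2)[OF e] e0 d by (intro hyperplane_measure_lowdim) (auto simp: compact_imp_closed hull_inc)
    then show ?thesis by simp
  qed
  have "ennreal (face_area e0) = emeasure ?M e0" using fin e0 by simp
  also have "\<dots> = emeasure ?M (\<Union>e\<in>E. e \<inter> e0)" using sub by (intro arg_cong[where f = "emeasure ?M"]) blast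
  also have "\<dots> \<le> (\<Sum>e\<in>E. emeasure ?M (e \<inter> e0))"
    using E e0 by (intro emeasure_subadditive_finite) (auto simp: setsM compact_imp_closed intro!: closed_Int)
  also have "\<dots> \<le> (\<Sum>e\<in>E. ennreal (face_area e))" by (intro sum_mono part)
  also have "\<dots> = ennreal (\<Sum>e\<in>E. face_area e)" by (intro sum_ennreal) (simp add: face_area_def)
  finally show ?thesis by (simp add: ennreal_le_iff sum_nonneg face_area_def)
qed

section \<open>Facets of cells: hyperplanes, inscribed balls and areas\<close>

context uniform_mesh begin

text \<open>The barycentric coordinate of the opposite vertex \<open>v\<close> is an equation for
  the hyperplane of the facet; inscribed balls and normals are computed with it.\<close>

lemma facet_structure:
  assumes K: "K \<in> T" and e: "e facet_of K"
  obtains C \<beta> v where "finite C" "\<not> affine_dependent C" "card C = DIM('a) + 1" "K = convex hull C" "affine hull C = UNIV"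
    "is_barycentric C \<beta>" "v \<in> C" "e = convex hull (C - {v})" "C - {v} \<noteq> {}" "affine hull e = {x. \<beta> v x = 0}"
proof -
  obtain C \<beta> where C: "finite C" "\<not> affine_dependent C" "card C = DIM('a) + 1" "K = convex hull C" "affine hull C = UNIV"
    "is_barycentric C \<beta>" using cell_vertices[OF K] by metis
  have "e facet_of convex hull C" using e C(4) by simp
  then have "e \<noteq> {} \<and> (\<exists>u. u \<in> C \<and> e = convex hull (C - {u}))"
    using facet_of_convex_hull_affine_independent[OF C(2), of e] by blast
  then obtain v where v: "v \<in> C" "e = convex hull (C - {v})" "e \<noteq> {}" by blast
  have "affine hull e = {x. \<beta> v x = 0}"
  proof (intro set_eqI iffI)
    fix x assume "x \<in> affine hull e"
    then have x: "x \<in> affine hull (C - {v})" by (simp add: v)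
    have z: "affine_function (\<lambda>x::'a. 0)" unfolding affine_function_def by (intro exI[of _ 0]) simp
    have "\<beta> v x = 0"
      by (rule affine_function_eq_on_hull[OF _ z _ _ x]) (use C(1,6) v in \<open>auto simp: is_barycentric_def\<close>)
    then show "x \<in> {x. \<beta> v x = 0}" by simp
  next
    fix x assume "x \<in> {x. \<beta> v x = 0}"
    then have b0: "\<beta> v x = 0" by simp
    have xa: "x \<in> affine hull C" using C by simp
    have "(\<Sum>u\<in>C - {v}. \<beta> u x) = 1" "(\<Sum>u\<in>C - {v}. \<beta> u x *\<^sub>R u) = x"
      using barycentric_combination(1,2)[OF C(6,1) xa] b0 C(1) v(1) by (simp_all add: sum_diff1)
    then have "\<exists>u. sum u (C - {v}) = 1 \<and> (\<Sum>w\<in>C - {v}. u w *\<^sub>R w) = x"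
      by (intro exI[of _ "\<lambda>u. \<beta> u x"]) simp
    then have "x \<in> affine hull (C - {v})" using affine_hull_finite[of "C - {v}"] C(1) by simp
    then show "x \<in> affine hull e" by (simp add: v)
  qed
  moreover have "C - {v} \<noteq> {}" using v(2,3) by auto
  ultimately show ?thesis using that[OF C v(1,2)] by blast
qed

lemma facet_props:
  assumes K: "K \<in> T" and e: "e facet_of K"
  shows "compact e" "convex e" "e \<subseteq> K" "e \<noteq> {}" "aff_dim e = int DIM('a) - 1" "barycenter e \<in> e"
proof -
  show "e \<subseteq> K" "e \<noteq> {}" "convex e" using e by (auto simp: facet_of_def face_of_imp_subset face_of_imp_convex)
  show "aff_dim e = int DIM('a) - 1" using e cell_aff_dim[OF K] by (simp add: facet_of_def)
  obtain C v where C: "finite C" "\<not> affine_dependent C" "e = convex hull (C - {v})" "C - {v} \<noteq> {}"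
    using facet_structure[OF K e] by metis
  then show "compact e" by (simp add: finite_imp_compact_convex_hull)
  have ind: "\<not> affine_dependent (C - {v})" using C(2) affine_independent_Diff by blast
  have "barycenter e = (\<Sum>u\<in>C - {v}. (1 / real (card (C - {v}))) *\<^sub>R u)"
    unfolding C(3) barycenter_convex_hull[OF ind] by (simp add: scaleR_sum_right divide_inverse)
  also have "\<dots> \<in> convex hull (C - {v})"
    using C(1,4) by (intro convex_sum) (auto simp: hull_inc card_gt_0_iff)
  finally show "barycenter e \<in> e" using C(3) by simp
qed

text \<open>The inscribed ball of the cell is projected from the opposite vertex \<open>v\<close>
  onto the hyperplane of the facet. With \<open>s\<close> the coordinate of the centre
  \<open>c\<close> for \<open>v\<close>, lengths in planes parallel to the facet are multiplied by
  \<open>1 / (1 - s)\<close>, which is at least 1, so the radius survives.\<close>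

lemma facet_inball:
  assumes K: "K \<in> T" and e: "e facet_of K"
  obtains y where "y \<in> e" "cball y (inradius * h) \<inter> affine hull e \<subseteq> e"
proof -
  obtain C \<beta> v where C: "finite C" "\<not> affine_dependent C" "card C = DIM('a) + 1" "K = convex hull C" "affine hull C = UNIV"
    "is_barycentric C \<beta>" "v \<in> C" "e = convex hull (C - {v})" "C - {v} \<noteq> {}" "affine hull e = {x. \<beta> v x = 0}"
    using facet_structure[OF K e] by metis
  obtain c where c: "cball c (inradius * h) \<subseteq> K" using cell_inball[OF K] by blast
  have r0: "inradius * h > 0" using inradius h by simp
  have aff: "affine_function (\<beta> u)" if "u \<in> C" for u using C(6) that by (simp add: is_barycentric_def)
  have inK: "x \<in> K \<longleftrightarrow> (\<forall>u\<in>C. 0 \<le> \<beta> u x)" for x using barycentric_combination(4)[OF C(6,1), of x] C(4,5) by simp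
  have ine: "x \<in> e" if "\<beta> v x = 0" "\<And>u. u \<in> C - {v} \<Longrightarrow> 0 \<le> \<beta> u x" for x
  proof -
    have xa: "x \<in> affine hull C" using C by simp
    have "(\<Sum>u\<in>C - {v}. \<beta> u x) = 1" "(\<Sum>u\<in>C - {v}. \<beta> u x *\<^sub>R u) = x"
      using barycentric_combination(1,2)[OF C(6,1) xa] that(1) C(1,7) by (simp_all add: sum_diff1)
    then have "\<exists>u. (\<forall>w\<in>C - {v}. 0 \<le> u w) \<and> sum u (C - {v}) = 1 \<and> (\<Sum>w\<in>C - {v}. u w *\<^sub>R w) = x"
      using that(2) by (intro exI[of _ "\<lambda>u. \<beta> u x"]) simp
    then show ?thesis unfolding C(8) using convex_hull_finite[of "C - {v}"] C(1) by simp
  qed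
  have comb: "\<beta> u (v + t *\<^sub>R (x - v)) = \<beta> u v + t * (\<beta> u x - \<beta> u v)" if "u \<in> C" for u t x
  proof -
    have "\<exists>a b. \<forall>x. \<beta> u x = a + b \<bullet> x" using aff[OF that] unfolding affine_function_def .
    then obtain a b where "\<And>x. \<beta> u x = a + b \<bullet> x" by blast
    then show ?thesis by (simp add: inner_add_right inner_diff_right)
  qed
  define s where "s = \<beta> v c"
  have \<beta>vv: "\<beta> v v = 1" and \<beta>uv: "u \<in> C \<Longrightarrow> u \<noteq> v \<Longrightarrow> \<beta> u v = 0" for u using C(6,7) by (auto simp: is_barycentric_def)
  have s1: "s < 1"
  proof -
    have cK: "c \<in> K" using c r0 by auto
    then have nn: "\<forall>u\<in>C. 0 \<le> \<beta> u c" using inK by blast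
    obtain u where u: "u \<in> C" "u \<noteq> v" using C(9) by blast
    have le: "\<beta> u x + \<beta> v x \<le> 1" if "x \<in> K" for x
    proof -
      have "(\<Sum>w\<in>{u, v}. \<beta> w x) \<le> (\<Sum>w\<in>C. \<beta> w x)"
        using that inK C u by (intro sum_mono2) auto
      then show ?thesis using u barycentric_combination(1)[OF C(6,1), of x] C(5) by simp
    qed
    have pos: "\<beta> u c > 0"
    proof (rule ccontr)
      assume "\<not> \<beta> u c > 0"
      then have bu: "\<beta> u c = 0" using nn u by force
      obtain a b where b: "\<And>x. \<beta> u x = a + b \<bullet> x" using aff[OF u(1)] unfolding affine_function_def by blast
      have "b \<noteq> 0"
      proof
        assume "b = 0"
        then have "\<beta> u u = \<beta> u v" by (simp add: b)
        then show False using C(6) u \<beta>uv by (auto simp: is_barycentric_def)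
      qed
      \<comment> \<open>A step of the length of the radius against the gradient stays in the cell
        but would make the coordinate negative if it vanished at the centre.\<close>
      define x where "x = c - (inradius * h / norm b) *\<^sub>R b"
      have "x \<in> cball c (inradius * h)" using \<open>b \<noteq> 0\<close> r0 by (simp add: x_def dist_norm)
      then have "0 \<le> \<beta> u x" using c inK u by blast
      moreover have "\<beta> u x = \<beta> u c - inradius * h * norm b"
        using \<open>b \<noteq> 0\<close> by (simp add: b x_def inner_diff_right power2_norm_eq_inner[symmetric] power2_eq_square)
      moreover have "0 < inradius * h * norm b" using r0 \<open>b \<noteq> 0\<close> by simp
      ultimately show False using bu by linarith
    qed
    then show ?thesis using le[OF cK] by (simp add: s_def)
  qed
  define y where "y = v + (1 / (1 - s)) *\<^sub>R (c - v)"
  have \<beta>y: "\<beta> v y = 0" unfolding y_def comb[OF C(7)] \<beta>vv s_def[symmetric] using s1 by (simp add: field_simps)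
  have key: "z \<in> e" if z: "z \<in> cball y (inradius * h) \<inter> affine hull e" for z
  proof (rule ine)
    show "\<beta> v z = 0" using z C(10) by simp
    define x where "x = v + (1 - s) *\<^sub>R (z - v)"
    have "x - c = (1 - s) *\<^sub>R (z - y)" using s1 by (simp add: x_def y_def algebra_simps)
    moreover have "0 \<le> s"
    proof -
      have "c \<in> K" using c r0 by auto
      then show ?thesis using inK C(7) by (simp add: s_def)
    qed
    ultimately have "norm (x - c) \<le> 1 * norm (z - y)" using s1 by (simp add: mult_left_le_one_le)
    then have "x \<in> K" using z c by (auto simp: dist_norm norm_minus_commute)
    fix u assume u: "u \<in> C - {v}"
    then have "0 \<le> \<beta> u x" using \<open>x \<in> K\<close> inK by blast
    also have "\<beta> u x = (1 - s) * \<beta> u z" unfolding x_def using u by (subst comb) (auto simp: \<beta>uv)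
    finally show "0 \<le> \<beta> u z" using s1 by (simp add: zero_le_mult_iff)
  qed
  moreover have "y \<in> e" using key \<beta>y r0 C(10) by simp
  ultimately show ?thesis using that by blast
qed

text \<open>The second bound gives \<open>face_radius * h \<le> 1 / 4\<close>, so that balls of this
  radius fit into the slab of half thickness \<open>1 / 2\<close> around a face.\<close>

definition face_radius :: real where "face_radius = min inradius (1 / (4 * D))"

lemma face_radius: "0 < face_radius" "face_radius \<le> inradius" "face_radius * h \<le> 1 / 4"
proof -
  show "0 < face_radius" "face_radius \<le> inradius" using inradius h by (auto simp: face_radius_def)
  have "face_radius * h \<le> 1 / (4 * D) * D" using h by (intro mult_mono) (auto simp: face_radius_def)
  then show "face_radius * h \<le> 1 / 4" using h by simp
qed

text \<open>
  The prism over a face contains a stack of about \<open>1 / h\<close> disjoint balls of radius comparable to \<open>h\<close>.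
\<close>

lemma face_area_lower:
  assumes K: "K \<in> T" and e: "e facet_of K"
  shows "face_area e * h \<ge> ball_const * face_radius ^ DIM('a) / (4 * face_radius) * h ^ DIM('a)"
proof -
  note fp = facet_props[OF K e]
  obtain y where y: "y \<in> e" "cball y (inradius * h) \<inter> affine hull e \<subseteq> e" using facet_inball[OF K e] by metis
  obtain n c where nc: "norm n = 1" "affine hull e = {x. n \<bullet> x = c}" using hyperplane_of_aff_dim[OF fp(5)] by metis
  have nn: "n \<bullet> n = 1" using nc(1) by (simp add: norm_eq_1)
  have yH: "n \<bullet> y = c" using y(1) nc(2) hull_inc[of y e affine] by simp
  define r where "r = face_radius * h"
  have r: "r > 0" "r \<le> 1 / 4" "r \<le> inradius * h" using face_radius h by (auto simp: r_def mult_right_mono)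
  \<comment> \<open>The centres climb from height \<open>- 1 / 4\<close> in steps of
    \<open>2 * r\<close> to at most \<open>1 / 4\<close>; with radius at most \<open>1 / 4\<close>
    the balls stay in the slab.\<close>
  define N where "N = nat \<lfloor>1 / (4 * r)\<rfloor> + 1"
  have N: "real N \<ge> 1 / (4 * r)" "\<And>j. j < N \<Longrightarrow> real j \<le> 1 / (4 * r)"
  proof -
    have "\<lfloor>1 / (4 * r)\<rfloor> \<ge> 0" using r by simp
    then have e: "real N = of_int \<lfloor>1 / (4 * r)\<rfloor> + 1" by (simp add: N_def)
    show "real N \<ge> 1 / (4 * r)" unfolding e by linarith
    fix j assume "j < N"
    then have "real j + 1 \<le> real N" by linarith
    then show "real j \<le> 1 / (4 * r)" unfolding e by linarith
  qed
  have "real N * measure lebesgue (ball (y - (1/4) *\<^sub>R n) r) \<le> measure lebesgue (prism e)"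
  proof (rule disjoint_translates_measure[where w = "(2 * r) *\<^sub>R n"])
    show "prism e \<in> lmeasurable" using compact_prism[OF fp(1,4)] lmeasurable_compact by blast
    fix j assume j: "j < N"
    show "(+) (real j *\<^sub>R (2 * r) *\<^sub>R n) ` ball (y - (1/4) *\<^sub>R n) r \<subseteq> prism e"
    proof clarify
      fix x assume x: "x \<in> ball (y - (1/4) *\<^sub>R n) r"
      define s where "s = real j * (2 * r) - 1 / 4"
      have s: "\<bar>s\<bar> \<le> 1 / 4" using N(2)[OF j] r by (simp add: s_def field_simps abs_le_iff)
      define d where "d = x - (y - (1/4) *\<^sub>R n)"
      have d: "norm d \<le> r" using x by (simp add: d_def dist_norm norm_minus_commute)
      have xe: "real j *\<^sub>R (2 * r) *\<^sub>R n + x = y + s *\<^sub>R n + d" by (simp add: d_def s_def algebra_simps)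
      have nd: "\<bar>n \<bullet> d\<bar> \<le> r" using Cauchy_Schwarz_ineq2[of n d] nc(1) d by simp
      have "n \<bullet> (y + s *\<^sub>R n + d) - c = s + n \<bullet> d" by (simp add: inner_add_right yH nn)
      then have "infdist (y + s *\<^sub>R n + d) (affine hull e) = \<bar>s + n \<bullet> d\<bar>"
        "closest_point (affine hull e) (y + s *\<^sub>R n + d) = y + s *\<^sub>R n + d - (s + n \<bullet> d) *\<^sub>R n"
        using closest_point_hyperplane[OF nc, of "y + s *\<^sub>R n + d"] by (simp_all only:)
      moreover have "\<bar>s + n \<bullet> d\<bar> \<le> 1 / 2" using s nd r by linarith
      moreover have "y + s *\<^sub>R n + d - (s + n \<bullet> d) *\<^sub>R n = y + (d - (n \<bullet> d) *\<^sub>R n)" by (simp add: algebra_simps)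
      moreover have "y + (d - (n \<bullet> d) *\<^sub>R n) \<in> e"
      proof -
        have "(norm (d - (n \<bullet> d) *\<^sub>R n))\<^sup>2 = (norm d)\<^sup>2 - (n \<bullet> d)\<^sup>2"
          unfolding power2_norm_eq_inner by (simp add: inner_diff_left inner_diff_right nn inner_commute power2_eq_square)
        then have "(norm (d - (n \<bullet> d) *\<^sub>R n))\<^sup>2 \<le> (norm d)\<^sup>2" by simp
        then have "norm (d - (n \<bullet> d) *\<^sub>R n) \<le> norm d" by (rule power2_le_imp_le) simp
        then have "norm (d - (n \<bullet> d) *\<^sub>R n) \<le> inradius * h" using d r by linarith
        moreover have "dist y (y + w) = norm w" for w by (simp add: dist_norm)
        ultimately have "y + (d - (n \<bullet> d) *\<^sub>R n) \<in> cball y (inradius * h)" by simp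
        moreover have "y + (d - (n \<bullet> d) *\<^sub>R n) \<in> affine hull e" unfolding nc(2) by (simp add: inner_add_right inner_diff_right yH nn)
        ultimately show ?thesis using y(2) by blast
      qed
      ultimately show "real j *\<^sub>R (2 * r) *\<^sub>R n + x \<in> prism e" unfolding xe prism_def by simp
    qed
    fix x z assume "0 < j" and xz: "x \<in> ball (y - (1/4) *\<^sub>R n) r" "z \<in> ball (y - (1/4) *\<^sub>R n) r"
    show "x + real j *\<^sub>R (2 * r) *\<^sub>R n \<noteq> z"
    proof
      assume "x + real j *\<^sub>R (2 * r) *\<^sub>R n = z"
      then have "dist x z = real j * (2 * r)" using nc(1) r by (auto simp: dist_norm)
      moreover have "dist x z < r + r" using xz dist_triangle_less_add[of x "y - (1/4) *\<^sub>R n" r z r] by (simp add: dist_commute)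
      moreover have "real j * (2 * r) \<ge> 1 * (2 * r)" using \<open>0 < j\<close> r by (intro mult_right_mono) auto
      ultimately show False by linarith
    qed
  qed simp
  moreover have "1 / (4 * r) * (ball_const * r ^ DIM('a)) \<le> real N * measure lebesgue (ball (y - (1/4) *\<^sub>R n) r)"
  proof -
    have "measure lebesgue (ball (y - (1/4) *\<^sub>R n) r) = ball_const * r ^ DIM('a)"
      using r by (simp add: content_ball ball_const_def)
    then show ?thesis using N(1) r ball_const_pos by (simp only:) (intro mult_right_mono, auto)
  qed
  moreover have "face_area e = measure lebesgue (prism e)"
    using face_area_eq_prism[of e] fp(1,4) compact_prism[OF fp(1,4)] by (simp add: compact_imp_closed)
  ultimately have "1 / (4 * r) * (ball_const * r ^ DIM('a)) \<le> face_area e" by linarith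
  then have "1 / (4 * r) * (ball_const * r ^ DIM('a)) * h \<le> face_area e * h" using h by (intro mult_right_mono) auto
  moreover have "1 / (4 * r) * (ball_const * r ^ DIM('a)) * h = ball_const * face_radius ^ DIM('a) / (4 * face_radius) * h ^ DIM('a)"
    using h face_radius by (simp add: r_def power_mult_distrib)
  ultimately show ?thesis by simp
qed

text \<open>The prism has height 1 over a set of diameter at most \<open>h\<close>, so about
  \<open>1 / h\<close> balls of radius \<open>2 * h\<close> along the normal cover it;
  \<open>1 \<le> D / h\<close> absorbs the additional ball. Multiplication of the area by
  \<open>h\<close> avoids the exponent \<open>DIM('a) - 1\<close>.\<close>

lemma face_area_upper:
  assumes K: "K \<in> T" and e: "e facet_of K"
  shows "face_area e * h \<le> (1 + D) * ball_const * 2 ^ DIM('a) * h ^ DIM('a)"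
proof -
  note fp = facet_props[OF K e]
  obtain y where y: "y \<in> e" using fp(4) by blast
  obtain n c where nc: "norm n = 1" "affine hull e = {x. n \<bullet> x = c}" using hyperplane_of_aff_dim[OF fp(5)] by metis
  define N where "N = nat \<lfloor>1 / h\<rfloor>"
  have N: "real N \<le> 1 / h" using h by (simp add: N_def)
  have "prism e \<subseteq> (\<Union>j\<le>N. cball (y + (real j * h - 1/2) *\<^sub>R n) (2 * h))"
  proof
    fix x assume x: "x \<in> prism e"
    define s where "s = n \<bullet> x - c"
    have s: "\<bar>s\<bar> \<le> 1 / 2" "x - s *\<^sub>R n \<in> e"
      using x unfolding prism_def by (auto simp: closest_point_hyperplane[OF nc] s_def)
    define j where "j = nat \<lfloor>(s + 1/2) / h\<rfloor>"
    have nn: "0 \<le> (s + 1/2) / h" using s h by simp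
    have j: "real j \<le> (s + 1/2) / h" "(s + 1/2) / h \<le> real j + 1" using nn by (auto simp: j_def)
    have "(s + 1/2) / h \<le> 1 / h" using s h by (simp add: divide_right_mono)
    then have "\<lfloor>(s + 1/2) / h\<rfloor> \<le> \<lfloor>1 / h\<rfloor>" by (rule floor_mono)
    then have "j \<le> N" unfolding j_def N_def by (rule nat_mono)
    have "\<bar>s - (real j * h - 1/2)\<bar> \<le> h" using j h by (simp add: field_simps abs_le_iff)
    moreover have "dist y (x - s *\<^sub>R n) \<le> h" using diam[OF K] y s(2) fp(3) by blast
    moreover have "dist (y + (real j * h - 1/2) *\<^sub>R n) x \<le> dist y (x - s *\<^sub>R n) + norm ((s - (real j * h - 1/2)) *\<^sub>R n)"
    proof -
      have "y + (real j * h - 1/2) *\<^sub>R n - x = (y - (x - s *\<^sub>R n)) - (s - (real j * h - 1/2)) *\<^sub>R n" by (simp add: algebra_simps)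
      then show ?thesis unfolding dist_norm by (metis norm_triangle_ineq4)
    qed
    ultimately have "x \<in> cball (y + (real j * h - 1/2) *\<^sub>R n) (2 * h)" using nc(1) by simp
    then show "x \<in> (\<Union>j\<le>N. cball (y + (real j * h - 1/2) *\<^sub>R n) (2 * h))" using \<open>j \<le> N\<close> by blast
  qed
  then have "measure lebesgue (prism e) \<le> measure lebesgue (\<Union>j\<le>N. cball (y + (real j * h - 1/2) *\<^sub>R n) (2 * h))"
    using compact_prism[OF fp(1,4)] by (intro measure_mono_fmeasurable lmeasurable_compact compact_UN) (auto simp: compact_imp_closed)
  also have "\<dots> \<le> (\<Sum>j\<le>N. measure lebesgue (cball (y + (real j * h - 1/2) *\<^sub>R n) (2 * h)))"
    by (intro measure_UNION_le) auto
  also have "\<dots> = (real N + 1) * (ball_const * (2 * h) ^ DIM('a))"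
    using measure_cball[of "2 * h"] h by simp
  also have "\<dots> \<le> (1 + D) / h * (ball_const * (2 * h) ^ DIM('a))"
  proof (rule mult_right_mono)
    have "1 \<le> D / h" using h by simp
    then show "real N + 1 \<le> (1 + D) / h" using N by (simp add: add_divide_distrib)
  qed (use ball_const_pos h in simp)
  finally have "measure lebesgue (prism e) * h \<le> (1 + D) / h * (ball_const * (2 * h) ^ DIM('a)) * h" using h by (intro mult_right_mono) auto
  moreover have "face_area e = measure lebesgue (prism e)"
    using face_area_eq_prism[of e] fp(1,4) compact_prism[OF fp(1,4)] by (simp add: compact_imp_closed)
  ultimately show ?thesis using h by (simp add: power_mult_distrib mult_ac)
qed

end

section \<open>Composition of variations\<close>

lemma variation_chain:
  fixes a :: "'b \<Rightarrow> real" and p q r :: "'b \<Rightarrow> real"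
  assumes "\<And>K. K \<in> L \<Longrightarrow> 0 \<le> p K" "\<And>K. K \<in> T \<Longrightarrow> 0 \<le> q K" "\<And>K. K \<in> T \<Longrightarrow> 0 \<le> r K"
  shows "sum r T * (\<Sum>K\<in>L. \<Sum>K'\<in>T. p K * q K' * (a K - a K')\<^sup>2) \<le>
     2 * sum q T * (\<Sum>K\<in>L. \<Sum>K'\<in>T. p K * r K' * (a K - a K')\<^sup>2) + 2 * sum p L * (\<Sum>K\<in>T. \<Sum>K'\<in>T. r K * q K' * (a K - a K')\<^sup>2)"
proof -
  have "sum r T * (\<Sum>K\<in>L. \<Sum>K'\<in>T. p K * q K' * (a K - a K')\<^sup>2) =
      (\<Sum>K\<in>L. \<Sum>K'\<in>T. \<Sum>M\<in>T. p K * q K' * r M * (a K - a K')\<^sup>2)"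
    by (simp add: sum_distrib_left sum_distrib_right mult_ac)
  \<comment> \<open>Each difference is split at the value on a third cell \<open>M\<close>, and the
    result is averaged over \<open>M\<close> with the weights \<open>r\<close>.\<close>
  also have "\<dots> \<le> (\<Sum>K\<in>L. \<Sum>K'\<in>T. \<Sum>M\<in>T. p K * q K' * r M * (2 * (a K - a M)\<^sup>2 + 2 * (a M - a K')\<^sup>2))"
  proof (intro sum_mono mult_left_mono)
    fix K K' M
    have "0 \<le> ((a K - a M) - (a M - a K'))\<^sup>2" by simp
    then show "(a K - a K')\<^sup>2 \<le> 2 * (a K - a M)\<^sup>2 + 2 * (a M - a K')\<^sup>2" by (simp add: power2_eq_square algebra_simps)
  qed (use assms in auto)
  also have "\<dots> = (\<Sum>K\<in>L. \<Sum>K'\<in>T. \<Sum>M\<in>T. 2 * (q K' * (p K * r M * (a K - a M)\<^sup>2))) + (\<Sum>K\<in>L. \<Sum>K'\<in>T. \<Sum>M\<in>T. 2 * (p K * (r M * q K' * (a M - a K')\<^sup>2)))"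
    by (simp add: sum.distrib distrib_left mult_ac)
  also have "(\<Sum>K\<in>L. \<Sum>K'\<in>T. \<Sum>M\<in>T. 2 * (q K' * (p K * r M * (a K - a M)\<^sup>2))) = (\<Sum>K'\<in>T. \<Sum>K\<in>L. \<Sum>M\<in>T. 2 * (q K' * (p K * r M * (a K - a M)\<^sup>2)))"
    by (rule sum.swap)
  also have "\<dots> = 2 * sum q T * (\<Sum>K\<in>L. \<Sum>K'\<in>T. p K * r K' * (a K - a K')\<^sup>2)"
    by (simp add: sum_distrib_left[symmetric] sum_distrib_right)
  also have "(\<Sum>K\<in>L. \<Sum>K'\<in>T. \<Sum>M\<in>T. 2 * (p K * (r M * q K' * (a M - a K')\<^sup>2))) = (\<Sum>K\<in>L. \<Sum>M\<in>T. \<Sum>K'\<in>T. 2 * (p K * (r M * q K' * (a M - a K')\<^sup>2)))"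
    by (intro sum.cong refl sum.swap)
  also have "\<dots> = 2 * sum p L * (\<Sum>K\<in>T. \<Sum>K'\<in>T. r K * q K' * (a K - a K')\<^sup>2)"
    by (simp add: sum_distrib_left[symmetric] sum_distrib_right)
  finally show ?thesis .
qed

text \<open>With the same weights in both places the variation is twice the total mass times a
  variance. This turns pairwise differences into deviations from the mean, and nonnegativity of the
  left side is the weighted Cauchy-Schwarz inequality.\<close>

lemma variation_total:
  fixes a m :: "'b \<Rightarrow> real"
  shows "(\<Sum>K\<in>T. \<Sum>K'\<in>T. m K * m K' * (a K - a K')\<^sup>2) = 2 * sum m T * (\<Sum>K\<in>T. m K * (a K)\<^sup>2) - 2 * (\<Sum>K\<in>T. m K * a K)\<^sup>2"
proof -
  have "(\<Sum>K\<in>T. \<Sum>K'\<in>T. m K * m K' * (a K - a K')\<^sup>2) =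
     (\<Sum>K\<in>T. \<Sum>K'\<in>T. (m K * (a K)\<^sup>2) * m K' + m K * (m K' * (a K')\<^sup>2) - 2 * ((m K * a K) * (m K' * a K')))"
    by (intro sum.cong) (auto simp: power2_eq_square algebra_simps)
  also have "\<dots> = (\<Sum>K\<in>T. m K * (a K)\<^sup>2) * sum m T + sum m T * (\<Sum>K\<in>T. m K * (a K)\<^sup>2) - 2 * ((\<Sum>K\<in>T. m K * a K) * (\<Sum>K\<in>T. m K * a K))"
    by (simp add: sum_subtractf sum.distrib sum_distrib_left[symmetric] sum_distrib_right[symmetric])
  finally show ?thesis by (simp add: power2_eq_square)
qed

context uniform_mesh begin

lemma measure_cells:
  assumes "A \<in> sets borel" "A \<subseteq> \<Union>T" shows "(\<Sum>K\<in>T. measure lebesgue (K \<inter> A)) = measure lebesgue A"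
  using measure_Union_cells[of T A] assms by (simp add: Int_absorb1)

lemma cell_Int_lmeasurable: "K \<in> T \<Longrightarrow> A \<in> sets borel \<Longrightarrow> K \<inter> A \<in> lmeasurable"
  using cell_lmeasurable by (intro fmeasurable_Int_fmeasurable) auto

lemma variation_sym: "variation T A B a = variation T B A a"
  unfolding variation_def by (subst sum.swap) (simp add: mult_ac power2_commute)

lemma variation_trans:
  assumes "A \<in> sets borel" "B \<in> sets borel" "M \<in> sets borel" "A \<subseteq> \<Union>T" "B \<subseteq> \<Union>T" "M \<subseteq> \<Union>T"
  shows "measure lebesgue M * variation T A B a \<le>
    2 * measure lebesgue B * variation T A M a + 2 * measure lebesgue A * variation T M B a"
  using variation_chain[of T "\<lambda>K. measure lebesgue (K \<inter> A)" T "\<lambda>K. measure lebesgue (K \<inter> B)" "\<lambda>K. measure lebesgue (K \<inter> M)" a]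
  unfolding variation_def by (simp only: measure_cells assms measure_nonneg)

text \<open>The pieces may overlap, so measures are only subadditive; for the same reason all pairs
  of pieces appear.\<close>

lemma variation_Union:
  assumes P: "finite P" "\<And>p. p \<in> P \<Longrightarrow> p \<in> sets borel" "\<And>p. p \<in> P \<Longrightarrow> p \<subseteq> \<Union>T"
  shows "variation T (\<Union>P) (\<Union>P) a \<le> (\<Sum>p\<in>P. \<Sum>q\<in>P. variation T p q a)"
proof -
  have le: "measure lebesgue (K \<inter> \<Union>P) \<le> (\<Sum>p\<in>P. measure lebesgue (K \<inter> p))" if "K \<in> T" for K
  proof -
    have "measure lebesgue (\<Union>p\<in>P. K \<inter> p) \<le> (\<Sum>p\<in>P. measure lebesgue (K \<inter> p))"
      using P that cell_Int_lmeasurable by (intro measure_UNION_le) (auto intro!: fmeasurableD)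
    moreover have "(\<Union>p\<in>P. K \<inter> p) = K \<inter> \<Union>P" by blast
    ultimately show ?thesis by simp
  qed
  have "variation T (\<Union>P) (\<Union>P) a \<le> (\<Sum>K\<in>T. \<Sum>K'\<in>T. (\<Sum>p\<in>P. measure lebesgue (K \<inter> p)) * (\<Sum>q\<in>P. measure lebesgue (K' \<inter> q)) * (a K - a K')\<^sup>2)"
    unfolding variation_def by (intro sum_mono mult_right_mono mult_mono le) (auto intro: sum_nonneg)
  also have "\<dots> = (\<Sum>K\<in>T. \<Sum>K'\<in>T. \<Sum>p\<in>P. \<Sum>q\<in>P. measure lebesgue (K \<inter> p) * measure lebesgue (K' \<inter> q) * (a K - a K')\<^sup>2)"
    by (simp only: sum_product) (simp only: sum_distrib_right)
  also have "\<dots> = (\<Sum>K\<in>T. \<Sum>p\<in>P. \<Sum>K'\<in>T. \<Sum>q\<in>P. measure lebesgue (K \<inter> p) * measure lebesgue (K' \<inter> q) * (a K - a K')\<^sup>2)"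
    by (intro sum.cong refl sum.swap)
  also have "\<dots> = (\<Sum>p\<in>P. \<Sum>K\<in>T. \<Sum>K'\<in>T. \<Sum>q\<in>P. measure lebesgue (K \<inter> p) * measure lebesgue (K' \<inter> q) * (a K - a K')\<^sup>2)"
    by (rule sum.swap)
  also have "\<dots> = (\<Sum>p\<in>P. \<Sum>K\<in>T. \<Sum>q\<in>P. \<Sum>K'\<in>T. measure lebesgue (K \<inter> p) * measure lebesgue (K' \<inter> q) * (a K - a K')\<^sup>2)"
    by (intro sum.cong refl sum.swap)
  also have "\<dots> = (\<Sum>p\<in>P. \<Sum>q\<in>P. variation T p q a)"
    unfolding variation_def by (intro sum.cong refl sum.swap)
  finally show ?thesis .
qed

end

section \<open>Chaining over the domain\<close>

text \<open>The constant is chosen before the mesh and the function, so finitely many links can be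
  composed without losing uniformity over the meshes.\<close>

definition linked :: "'a::euclidean_space set \<Rightarrow> real \<Rightarrow> real \<Rightarrow> 'a set \<Rightarrow> 'a set \<Rightarrow> bool" where
  "linked \<Omega> \<mu> D A B \<longleftrightarrow> (\<exists>C\<ge>0. \<forall>T h a. uniform_mesh T h \<mu> D \<and> \<Union>T = closure \<Omega> \<longrightarrow>
      uniform_mesh.variation T T A B a \<le> C * uniform_mesh.energy T h a)"

lemma linked_convex:
  fixes \<Omega> p :: "'a::euclidean_space set"
  assumes "convex p" "p \<subseteq> closure \<Omega>" "A \<in> sets borel" "A \<subseteq> p" "B \<in> sets borel" "B \<subseteq> p" "\<mu> > 0" "D \<ge> 0"
  shows "linked \<Omega> \<mu> D A B"
proof -
  \<comment> \<open>Copies of \<open>ball_const\<close> and \<open>pack\<close>, which live inside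
    the locale, because the constant has to be named before a mesh is fixed.\<close>
  define b where "b = unit_ball_vol (real DIM('a))"
  define k where "k = b * 2 ^ DIM('a) / \<mu>"
  have b: "b > 0" by (simp add: b_def)
  show ?thesis unfolding linked_def
  proof (intro exI conjI allI impI)
    show "0 \<le> b * D ^ DIM('a) * (3 * D * k\<^sup>2) * (3 * D * b * 2 ^ DIM('a))" using b assms by simp
    fix T h a assume T: "uniform_mesh T h \<mu> D \<and> \<Union>T = closure \<Omega>"
    then interpret uniform_mesh T h \<mu> D by blast
    show "variation T A B a \<le> b * D ^ DIM('a) * (3 * D * k\<^sup>2) * (3 * D * b * 2 ^ DIM('a)) * energy a"
      using convex_variation[of p A B a] assms T by (simp add: b_def k_def ball_const_def pack_def)
  qed
qed

lemma linked_sym: "linked \<Omega> \<mu> D A B \<Longrightarrow> linked \<Omega> \<mu> D B A"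
  unfolding linked_def using uniform_mesh.variation_sym by metis

text \<open>Differences are passed through an intermediate point averaged over \<open>M\<close>; the
  price is the inverse of the volume of \<open>M\<close>.\<close>

lemma linked_trans:
  fixes \<Omega> :: "'a::euclidean_space set"
  assumes l: "linked \<Omega> \<mu> D A M" "linked \<Omega> \<mu> D M B" and M: "measure lebesgue M > 0"
    and s: "A \<in> sets borel" "B \<in> sets borel" "M \<in> sets borel" "A \<subseteq> closure \<Omega>" "B \<subseteq> closure \<Omega>" "M \<subseteq> closure \<Omega>"
  shows "linked \<Omega> \<mu> D A B"
proof -
  obtain C1 where C1: "C1 \<ge> 0" "\<And>T h a. uniform_mesh T h \<mu> D \<and> \<Union>T = closure \<Omega> \<Longrightarrow>
      uniform_mesh.variation T T A M a \<le> C1 * uniform_mesh.energy T h a"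
    using l(1) unfolding linked_def by metis
  obtain C2 where C2: "C2 \<ge> 0" "\<And>T h a. uniform_mesh T h \<mu> D \<and> \<Union>T = closure \<Omega> \<Longrightarrow>
      uniform_mesh.variation T T M B a \<le> C2 * uniform_mesh.energy T h a"
    using l(2) unfolding linked_def by metis
  define C where "C = (2 * measure lebesgue B * C1 + 2 * measure lebesgue A * C2) / measure lebesgue M"
  show ?thesis unfolding linked_def
  proof (intro exI[of _ C] conjI allI impI)
    show "C \<ge> 0" using C1(1) C2(1) M by (simp add: C_def)
    fix T h a assume T: "uniform_mesh T h \<mu> D \<and> \<Union>T = closure \<Omega>"
    then interpret uniform_mesh T h \<mu> D by blast
    have "measure lebesgue M * variation T A B a \<le> 2 * measure lebesgue B * variation T A M a + 2 * measure lebesgue A * variation T M B a"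
      using s T by (intro variation_trans) auto
    also have "\<dots> \<le> 2 * measure lebesgue B * (C1 * energy a) + 2 * measure lebesgue A * (C2 * energy a)"
      by (intro add_mono mult_left_mono C1 C2 T) auto
    also have "\<dots> = measure lebesgue M * (C * energy a)" using M by (simp add: C_def field_simps)
    finally show "variation T A B a \<le> C * energy a" using M by simp
  qed
qed

lemma measure_open_pos:
  fixes U :: "'a::euclidean_space set"
  assumes "open U" "U \<noteq> {}" "bounded U" shows "measure lebesgue U > 0"
proof -
  have "U \<in> lmeasurable" using assms lmeasurable_open by blast
  then show ?thesis
    using open_not_negligible[OF assms(1,2)] negligible_iff_measure0[of U] measure_nonneg[of lebesgue U] by (metis less_eq_real_def)
qed

text \<open>
  Being linked is transitive through sets of positive measure, hence an equivalence relation on small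
  balls; connectedness of the domain leaves a single class.
\<close>

lemma linked_open_convex:
  fixes \<Omega> :: "'a::euclidean_space set"
  assumes \<Omega>: "open \<Omega>" "connected \<Omega>" "bounded \<Omega>" and c: "\<mu> > 0" "D \<ge> 0"
    and U: "open U" "convex U" "U \<noteq> {}" "U \<subseteq> \<Omega>" and V: "open V" "convex V" "V \<noteq> {}" "V \<subseteq> \<Omega>"
  shows "linked \<Omega> \<mu> D U V"
proof -
  have sub: "U \<subseteq> closure \<Omega>" if "U \<subseteq> \<Omega>" for U using that closure_subset by blast
  have tr: "linked \<Omega> \<mu> D A B" if "linked \<Omega> \<mu> D A M" "linked \<Omega> \<mu> D M B" "open A" "open B" "open M" "M \<noteq> {}" "A \<subseteq> \<Omega>" "B \<subseteq> \<Omega>" "M \<subseteq> \<Omega>" for A B M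
  proof (rule linked_trans[OF that(1,2)])
    have "bounded M" using that(9) \<Omega>(3) bounded_subset by blast
    then show "measure lebesgue M > 0" using that by (intro measure_open_pos)
  qed (use that sub in auto)
  have meet: "linked \<Omega> \<mu> D U V" if "open U" "convex U" "U \<subseteq> \<Omega>" "open V" "convex V" "V \<subseteq> \<Omega>" "U \<inter> V \<noteq> {}" for U V
  proof (rule tr[where M = "U \<inter> V"])
    show "linked \<Omega> \<mu> D U (U \<inter> V)" using that c sub by (intro linked_convex[of U]) auto
    show "linked \<Omega> \<mu> D (U \<inter> V) V" using that c sub by (intro linked_convex[of V]) auto
  qed (use that in auto)
  define R where "R x y \<longleftrightarrow> (\<forall>r s. 0 < r \<longrightarrow> 0 < s \<longrightarrow> ball x r \<subseteq> \<Omega> \<longrightarrow> ball y s \<subseteq> \<Omega> \<longrightarrow> linked \<Omega> \<mu> D (ball x r) (ball y s))" for x y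
  have R: "R x y" if "x \<in> \<Omega>" "y \<in> \<Omega>" for x y
  proof (rule connected_equivalence_relation[OF \<Omega>(2) that])
    show "R y x" if "R x y" for x y using that linked_sym unfolding R_def by blast
    show "R x z" if xyz: "R x y" "R y z" "x \<in> \<Omega>" "y \<in> \<Omega>" "z \<in> \<Omega>" for x y z
    proof -
      obtain t where t: "t > 0" "ball y t \<subseteq> \<Omega>" using \<Omega>(1) xyz(4) openE by blast
      show ?thesis unfolding R_def
      proof (intro allI impI)
        fix r s :: real assume rs: "0 < r" "0 < s" "ball x r \<subseteq> \<Omega>" "ball z s \<subseteq> \<Omega>"
        have 1: "linked \<Omega> \<mu> D (ball x r) (ball y t)" using xyz(1) t rs(1,3) unfolding R_def by blast
        have 2: "linked \<Omega> \<mu> D (ball y t) (ball z s)" using xyz(2) t rs(2,4) unfolding R_def by blast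
        have "ball y t \<noteq> {}" using t by simp
        then show "linked \<Omega> \<mu> D (ball x r) (ball z s)" by (rule tr[OF 1 2 open_ball open_ball open_ball _ rs(3,4) t(2)])
      qed
    qed
    fix x assume x: "x \<in> \<Omega>"
    obtain t where t: "t > 0" "ball x t \<subseteq> \<Omega>" using \<Omega>(1) x openE by blast
    show "\<exists>S. openin (top_of_set \<Omega>) S \<and> x \<in> S \<and> (\<forall>y\<in>S. R x y)"
    proof (intro exI[of _ "ball x t"] conjI ballI)
      show "openin (top_of_set \<Omega>) (ball x t)" using t by (simp add: open_subset)
      \<comment> \<open>The fixed ball \<open>ball x t\<close> contains \<open>y\<close>, so it
        meets every ball around \<open>x\<close> and every ball around \<open>y\<close>;
        intersecting convex sets are linked through their intersection.\<close>
      fix y assume y: "y \<in> ball x t"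
      show "R x y" unfolding R_def
      proof (intro allI impI)
        fix r s :: real assume rs: "0 < r" "0 < s" "ball x r \<subseteq> \<Omega>" "ball y s \<subseteq> \<Omega>"
        have "ball x t \<noteq> {}" "x \<in> ball x r \<inter> ball x t" "y \<in> ball x t \<inter> ball y s" using rs t y by auto
        then have ne: "ball x t \<noteq> {}" "ball x r \<inter> ball x t \<noteq> {}" "ball x t \<inter> ball y s \<noteq> {}" by blast+
        have 1: "linked \<Omega> \<mu> D (ball x r) (ball x t)" by (intro meet open_ball convex_ball rs t ne)
        have 2: "linked \<Omega> \<mu> D (ball x t) (ball y s)" by (intro meet open_ball convex_ball rs t ne)
        show "linked \<Omega> \<mu> D (ball x r) (ball y s)" by (rule tr[OF 1 2 open_ball open_ball open_ball ne(1) rs(3,4) t(2)])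
      qed
    qed (use t in auto)
  qed
  obtain u v where uv: "u \<in> U" "v \<in> V" using U V by blast
  obtain r where r: "r > 0" "ball u r \<subseteq> U" using U(1) uv(1) openE by blast
  obtain s where s: "s > 0" "ball v s \<subseteq> V" using V(1) uv(2) openE by blast
  have b: "ball u r \<subseteq> \<Omega>" "ball v s \<subseteq> \<Omega>" using r s U V by auto
  have 1: "linked \<Omega> \<mu> D U (ball u r)" using r b U uv by (intro meet) auto
  have 2: "linked \<Omega> \<mu> D (ball u r) (ball v s)" using R[of u v] uv U V r s b unfolding R_def by blast
  have "ball v s \<inter> V \<noteq> {}" using s(1) uv(2) by force
  then have 3: "linked \<Omega> \<mu> D (ball v s) V" using b V by (intro meet) simp_all
  have 4: "linked \<Omega> \<mu> D U (ball v s)" using r U b by (intro tr[OF 1 2]) auto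
  show ?thesis using s U V b by (intro tr[OF 4 3]) auto
qed

text \<open>Polytopes without interior are discarded. They are null sets, so what they alone would
  cover is open and null, hence empty. The remaining pieces are closed and reach the boundary, where
  the layer estimates take place.\<close>

lemma polyhedral_domain_pieces:
  fixes \<Omega> :: "'a::euclidean_space set"
  assumes "polyhedral_domain \<Omega>"
  obtains P where "finite P" "\<And>p. p \<in> P \<Longrightarrow> compact p \<and> convex p \<and> interior p \<noteq> {} \<and> interior p \<subseteq> \<Omega>" "\<Union>P = closure \<Omega>"
proof -
  obtain Q where Q: "finite Q" "\<And>p. p \<in> Q \<Longrightarrow> polytope p" "\<Omega> = interior (\<Union>Q)" and op: "open \<Omega>"
    using assms unfolding polyhedral_domain_def by blast
  have cc: "compact p" "convex p" if "p \<in> Q" for p using Q(2)[OF that] polytope_imp_compact polytope_imp_convex by auto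
  define P where "P = {p \<in> Q. interior p \<noteq> {}}"
  have finP: "finite P" using Q by (simp add: P_def)
  have int: "interior p \<subseteq> \<Omega>" if "p \<in> P" for p
    using that unfolding Q(3) P_def by (intro interior_mono) auto
  have 1: "\<Union>P \<subseteq> closure \<Omega>"
  proof (intro Union_least)
    fix p assume p: "p \<in> P"
    have "p \<subseteq> closure p" by (rule closure_subset)
    also have "closure p = closure (interior p)" using p cc by (intro convex_closure_interior[symmetric]) (auto simp: P_def)
    also have "\<dots> \<subseteq> closure \<Omega>" using int[OF p] by (rule closure_mono)
    finally show "p \<subseteq> closure \<Omega>" .
  qed
  have clP: "closed (\<Union>P)" using finP cc by (intro closed_Union) (auto simp: P_def compact_imp_closed)
  have "\<Omega> - \<Union>P = {}"
  proof (rule ccontr)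
    assume ne: "\<Omega> - \<Union>P \<noteq> {}"
    have "\<Omega> - \<Union>P \<subseteq> \<Union>(Q - P)" using Q(3) interior_subset by blast
    moreover have "negligible (\<Union>(Q - P))"
      using Q(1) cc by (intro negligible_Union) (auto simp: P_def negligible_convex_interior)
    ultimately have "negligible (\<Omega> - \<Union>P)" using negligible_subset by blast
    moreover have "open (\<Omega> - \<Union>P)" using op clP by (rule open_Diff)
    ultimately show False using open_not_negligible ne by blast
  qed
  then have "\<Omega> \<subseteq> \<Union>P" by blast
  then have "closure \<Omega> \<subseteq> \<Union>P" using clP by (rule closure_minimal)
  with 1 have eq: "\<Union>P = closure \<Omega>" by blast
  have "compact p \<and> convex p \<and> interior p \<noteq> {} \<and> interior p \<subseteq> \<Omega>" if p: "p \<in> P" for p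
  proof -
    have "p \<in> Q" "interior p \<noteq> {}" using p by (auto simp: P_def)
    then show ?thesis using cc int[OF p] by simp
  qed
  from that[OF finP this eq] show ?thesis .
qed

text \<open>A closed piece is linked to its own interior by convexity, and interiors of different
  pieces are linked by chains through the domain. The segments used within a piece may thus run up
  to the boundary.\<close>

lemma domain_linked:
  fixes \<Omega> :: "'a::euclidean_space set"
  assumes \<Omega>: "polyhedral_domain \<Omega>" and c: "\<mu> > 0" "D \<ge> 0"
  shows "linked \<Omega> \<mu> D (closure \<Omega>) (closure \<Omega>)"
proof -
  obtain P where P: "finite P" "\<And>p. p \<in> P \<Longrightarrow> compact p \<and> convex p \<and> interior p \<noteq> {} \<and> interior p \<subseteq> \<Omega>" "\<Union>P = closure \<Omega>"
    using polyhedral_domain_pieces[OF \<Omega>] by metis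
  have O: "open \<Omega>" "connected \<Omega>" "bounded \<Omega>" using \<Omega> by (auto simp: polyhedral_domain_def)
  have sb: "p \<in> sets borel" "p \<subseteq> closure \<Omega>" "interior p \<subseteq> closure \<Omega>" "measure lebesgue (interior p) > 0" if "p \<in> P" for p
  proof -
    note p = P(2)[OF that]
    show "p \<in> sets borel" using p by (simp add: compact_imp_closed)
    show "p \<subseteq> closure \<Omega>" using P(3) that by blast
    show "interior p \<subseteq> closure \<Omega>" using p closure_subset by blast
    have "bounded (interior p)" using p bounded_subset[OF compact_imp_bounded interior_subset] by blast
    then show "measure lebesgue (interior p) > 0" using p by (intro measure_open_pos) simp_all
  qed
  have "linked \<Omega> \<mu> D p q" if pq: "p \<in> P" "q \<in> P" for p q
  proof -
    have 1: "linked \<Omega> \<mu> D p (interior p)" if "p \<in> P" for p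
      using P(2)[OF that] sb[OF that] c interior_subset by (intro linked_convex[of p]) auto
    have "linked \<Omega> \<mu> D (interior p) (interior q)"
      using P(2)[OF pq(1)] P(2)[OF pq(2)] by (intro linked_open_convex O c) (auto intro: convex_interior)
    then have "linked \<Omega> \<mu> D p (interior q)"
      using sb[OF pq(1)] sb[OF pq(2)] by (intro linked_trans[OF 1[OF pq(1)]]) auto
    then show ?thesis
      using sb[OF pq(1)] sb[OF pq(2)] by (intro linked_trans[OF _ linked_sym[OF 1[OF pq(2)]]]) auto
  qed
  then have "\<forall>p q. \<exists>C. p \<in> P \<longrightarrow> q \<in> P \<longrightarrow> C \<ge> 0 \<and> (\<forall>T h a. uniform_mesh T h \<mu> D \<and> \<Union>T = closure \<Omega> \<longrightarrow>
      uniform_mesh.variation T T p q a \<le> C * uniform_mesh.energy T h a)"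
    unfolding linked_def by blast
  then obtain C where C: "\<And>p q. p \<in> P \<Longrightarrow> q \<in> P \<Longrightarrow> C p q \<ge> 0 \<and> (\<forall>T h a. uniform_mesh T h \<mu> D \<and> \<Union>T = closure \<Omega> \<longrightarrow>
      uniform_mesh.variation T T p q a \<le> C p q * uniform_mesh.energy T h a)" by metis
  show ?thesis unfolding linked_def
  proof (intro exI[of _ "\<Sum>p\<in>P. \<Sum>q\<in>P. C p q"] conjI allI impI)
    show "0 \<le> (\<Sum>p\<in>P. \<Sum>q\<in>P. C p q)" using C by (intro sum_nonneg) auto
    fix T h a assume T: "uniform_mesh T h \<mu> D \<and> \<Union>T = closure \<Omega>"
    then interpret uniform_mesh T h \<mu> D by blast
    have "variation T (\<Union>P) (\<Union>P) a \<le> (\<Sum>p\<in>P. \<Sum>q\<in>P. variation T p q a)"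
      using P(1) sb T by (intro variation_Union) auto
    also have "\<dots> \<le> (\<Sum>p\<in>P. \<Sum>q\<in>P. C p q * energy a)" using C T by (intro sum_mono) blast
    finally show "variation T (closure \<Omega>) (closure \<Omega>) a \<le> (\<Sum>p\<in>P. \<Sum>q\<in>P. C p q) * energy a"
      using P(3) by (simp add: sum_distrib_right)
  qed
qed

text \<open>The variation of the closed domain against itself is twice its volume times the squared
  deviation from the mean.\<close>

theorem discrete_poincare:
  fixes \<Omega> :: "'a::euclidean_space set"
  assumes \<Omega>: "polyhedral_domain \<Omega>" and c: "\<mu> > 0" "D \<ge> 0"
  obtains C where "C \<ge> 0" "\<And>T h a. uniform_mesh T h \<mu> D \<Longrightarrow> \<Union>T = closure \<Omega> \<Longrightarrow>
    (\<Sum>K\<in>T. measure lebesgue K * (a K - (\<Sum>K\<in>T. measure lebesgue K * a K) / measure lebesgue (closure \<Omega>))\<^sup>2) \<le> C * uniform_mesh.energy T h a"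
proof -
  obtain C where C: "C \<ge> 0" "\<And>T h a. uniform_mesh T h \<mu> D \<and> \<Union>T = closure \<Omega> \<Longrightarrow>
      uniform_mesh.variation T T (closure \<Omega>) (closure \<Omega>) a \<le> C * uniform_mesh.energy T h a"
    using domain_linked[OF assms] unfolding linked_def by metis
  have pos: "measure lebesgue (closure \<Omega>) > 0"
  proof -
    have "\<Omega> \<noteq> {}" "open \<Omega>" "bounded \<Omega>" using \<Omega> by (auto simp: polyhedral_domain_def)
    then have "0 < measure lebesgue \<Omega>" by (intro measure_open_pos)
    also have "\<dots> \<le> measure lebesgue (closure \<Omega>)"
      using \<open>open \<Omega>\<close> \<open>bounded \<Omega>\<close> closure_subset by (intro measure_mono_fmeasurable) (auto intro: lmeasurable_compact)
    finally show ?thesis .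
  qed
  show ?thesis
  proof (rule that[of "C / (2 * measure lebesgue (closure \<Omega>))"])
    show "C / (2 * measure lebesgue (closure \<Omega>)) \<ge> 0" using C pos by simp
    fix T h a assume T: "uniform_mesh T h \<mu> D" "\<Union>T = closure \<Omega>"
    then interpret uniform_mesh T h \<mu> D by blast
    define m where "m K = measure lebesgue K" for K :: "'a set"
    define w where "w = measure lebesgue (closure \<Omega>)"
    have w: "sum m T = w" using measure_Union_cells[of T UNIV] T by (simp add: m_def w_def)
    have e: "K \<inter> closure \<Omega> = K" if "K \<in> T" for K using T(2) that by blast
    define s where "s = (\<Sum>K\<in>T. m K * a K)"
    define c where "c = s / w"
    have "(\<Sum>K\<in>T. m K * (a K - c)\<^sup>2) = (\<Sum>K\<in>T. m K * (a K)\<^sup>2 - 2 * c * (m K * a K) + m K * c\<^sup>2)"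
      by (intro sum.cong) (auto simp: power2_eq_square algebra_simps)
    also have "\<dots> = (\<Sum>K\<in>T. m K * (a K)\<^sup>2) - 2 * c * s + sum m T * c\<^sup>2"
      unfolding s_def by (simp only: sum.distrib sum_subtractf sum_distrib_left[symmetric] sum_distrib_right[symmetric])
    finally have "2 * w * (\<Sum>K\<in>T. m K * (a K - s / w)\<^sup>2) = 2 * w * ((\<Sum>K\<in>T. m K * (a K)\<^sup>2) - 2 * (s / w) * s + sum m T * (s / w)\<^sup>2)"
      by (simp add: c_def)
    also have "\<dots> = 2 * sum m T * (\<Sum>K\<in>T. m K * (a K)\<^sup>2) - 2 * s\<^sup>2"
      unfolding w using pos by (simp add: w_def[symmetric] power2_eq_square field_simps)
    also have "\<dots> = (\<Sum>K\<in>T. \<Sum>K'\<in>T. m K * m K' * (a K - a K')\<^sup>2)" unfolding s_def by (rule variation_total[symmetric])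
    also have "\<dots> = variation T (closure \<Omega>) (closure \<Omega>) a" unfolding variation_def m_def by (intro sum.cong refl) (simp add: e)
    also have "\<dots> \<le> C * energy a" using C(2) T by blast
    finally have "(\<Sum>K\<in>T. m K * (a K - s / w)\<^sup>2) \<le> C / (2 * w) * energy a" using pos by (simp add: w_def field_simps)
    then show "(\<Sum>K\<in>T. measure lebesgue K * (a K - (\<Sum>K\<in>T. measure lebesgue K * a K) / measure lebesgue (closure \<Omega>))\<^sup>2)
       \<le> C / (2 * measure lebesgue (closure \<Omega>)) * energy a" by (simp add: m_def w_def s_def)
  qed
qed

section \<open>The boundary layer\<close>

text \<open>The ball of radius \<open>r / 2\<close> about \<open>x + z\<close> lies in
  \<open>p\<close>. The homothety with centre \<open>x\<close> and factor \<open>s\<close> maps it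
  to the ball of radius \<open>s * r / 2\<close> about \<open>x + s z\<close>, which stays in
  \<open>p\<close> by convexity, so its open part misses the complement of the domain.\<close>

lemma push_inside:
  fixes \<Omega> p :: "'a::euclidean_space set"
  assumes p: "convex p" "cball c r \<subseteq> p" "interior p \<subseteq> \<Omega>" and x: "x \<in> p" "x + z \<in> cball c (r / 2)"
    and s: "0 \<le> s" "s \<le> 1" and b: "b \<notin> \<Omega>"
  shows "s * r / 2 \<le> dist (x + s *\<^sub>R z) b"
proof (cases "s = 0")
  case False
  with s have s0: "s > 0" by simp
  have "ball (x + s *\<^sub>R z) (s * r / 2) \<subseteq> p"
  proof
    fix q assume q: "q \<in> ball (x + s *\<^sub>R z) (s * r / 2)"
    \<comment> \<open>The preimage of \<open>q\<close> under the homothety with centre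
      \<open>x\<close> and factor \<open>s\<close>.\<close>
    define w where "w = x + z + (1 / s) *\<^sub>R (q - (x + s *\<^sub>R z))"
    have "norm (q - (x + s *\<^sub>R z)) \<le> s * r / 2" using q by (simp add: dist_norm norm_minus_commute)
    then have "norm (q - (x + s *\<^sub>R z)) / s \<le> r / 2" using s0 by (simp add: pos_divide_le_eq mult.commute)
    then have 1: "norm ((1 / s) *\<^sub>R (q - (x + s *\<^sub>R z))) \<le> r / 2" using s0 by (simp only: norm_scaleR) simp
    have 2: "norm (c - (x + z)) \<le> r / 2" using x(2) by (simp add: dist_norm)
    have "c - w = (c - (x + z)) - (1 / s) *\<^sub>R (q - (x + s *\<^sub>R z))" by (simp add: w_def)
    then have "norm (c - w) \<le> norm (c - (x + z)) + norm ((1 / s) *\<^sub>R (q - (x + s *\<^sub>R z)))" by (metis norm_triangle_ineq4)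
    then have "norm (c - w) \<le> r" using 1 2 by linarith
    then have "w \<in> cball c r" by (simp add: dist_norm)
    then have "w \<in> p" using p by blast
    then have "(1 - s) *\<^sub>R x + s *\<^sub>R w \<in> p" using s x(1) p(1) by (intro convexD_alt)
    moreover have "s *\<^sub>R w = s *\<^sub>R (x + z) + (q - (x + s *\<^sub>R z))" using s0 by (simp add: w_def scaleR_add_right del: scaleR_diff_right)
    then have "(1 - s) *\<^sub>R x + s *\<^sub>R w = q" by (simp add: algebra_simps)
    ultimately show "q \<in> p" by simp
  qed
  then have "ball (x + s *\<^sub>R z) (s * r / 2) \<subseteq> interior p" by (rule interior_maximal) simp
  then have "b \<notin> ball (x + s *\<^sub>R z) (s * r / 2)" using p(3) b by blast
  then show ?thesis by (simp add: not_less)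
qed simp

context uniform_mesh begin

text \<open>
  If two segments in the direction \<open>z\<close> start in the layer and meet the same face, the later one has, at
  the difference of the hitting times, come back near the boundary, although it has been moving
  inwards at a fixed rate; hence the starting points are close.
\<close>

lemma layer_shadow:
  assumes p: "convex p" "cball c r \<subseteq> p" "interior p \<subseteq> \<Omega>" "p \<subseteq> \<Union>T" and r: "r > 0"
    and L: "\<And>K. K \<in> L \<Longrightarrow> K \<in> T \<and> \<not> K \<subseteq> \<Omega>" and KK: "(K, K') \<in> adjacent_cells T"
  shows "emeasure lborel {x \<in> p \<inter> \<Union>L. x + z \<in> cball c (r / 2) \<and> x \<in> hitting z (K \<inter> K')}
     \<le> ennreal (ball_const * (1 + 4 * D / r) ^ DIM('a) * h ^ DIM('a))"
proof -
  let ?X = "{x \<in> p \<inter> \<Union>L. x + z \<in> cball c (r / 2) \<and> x \<in> hitting z (K \<inter> K')}"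
  have KT: "K \<in> T" using KK by (simp add: adjacent_cells_def)
  have close: "dist x x' \<le> (1 + 4 * D / r) * h"
    if x: "x \<in> ?X" "x + t *\<^sub>R z \<in> K \<inter> K'" "t \<in> {0..1}" and x': "x' \<in> ?X" "x' + t' *\<^sub>R z \<in> K \<inter> K'" "t' \<in> {0..1}" and le: "t \<le> t'" for x x' t t'
  proof -
    obtain M where "M \<in> L" "x \<in> M" using x(1) by blast
    then have M: "M \<in> T" "x \<in> M" "\<not> M \<subseteq> \<Omega>" using L by auto
    obtain b where b: "b \<in> M" "b \<notin> \<Omega>" using M by blast
    have db: "dist x b \<le> h" using diam[OF M(1,2) b(1)] .
    define q q' where "q = x + t *\<^sub>R z" and "q' = x' + t' *\<^sub>R z"
    have qq: "dist q q' \<le> h" using x(2) x'(2) diam[OF KT] by (simp add: q_def q'_def)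
    \<comment> \<open>After the difference of the hitting times the segment from \<open>x'\<close>
      is at a point within \<open>h\<close> of \<open>x\<close>, hence within \<open>2 * h\<close>
      of the point \<open>b\<close> outside the domain. The distance gained by moving inwards
      therefore bounds \<open>t' - t\<close> by a multiple of \<open>h\<close>.\<close>
    have e: "x' + (t' - t) *\<^sub>R z = x + (q' - q)" by (simp add: q_def q'_def algebra_simps)
    have "(t' - t) * r / 2 \<le> dist (x' + (t' - t) *\<^sub>R z) b"
      by (rule push_inside[OF p(1-3) _ _ _ _ b(2)]) (use x x' le in auto)
    also have "\<dots> \<le> dist x b + dist q q'"
    proof -
      have "x + (q' - q) - b = (x - b) + (q' - q)" by simp
      then show ?thesis unfolding e dist_norm by (metis norm_triangle_ineq norm_minus_commute)
    qed
    also have "\<dots> \<le> 2 * h" using db qq by simp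
    finally have tt: "t' - t \<le> 4 * h / r" using r by (simp add: field_simps)
    have z: "norm z \<le> D"
    proof -
      have "cball c (r / 2) \<subseteq> cball c r" using r by (intro subset_cball) simp
      moreover have "x + z \<in> cball c (r / 2)" "x \<in> p" using x(1) by auto
      ultimately have "x \<in> \<Union>T" "x + z \<in> \<Union>T" using p(2,4) by blast+
      from bound[OF this] show ?thesis by (simp add: dist_norm)
    qed
    have "x - x' = (t' - t) *\<^sub>R z - (q' - q)" using e by (simp add: algebra_simps)
    then have "dist x x' \<le> norm ((t' - t) *\<^sub>R z) + norm (q' - q)" unfolding dist_norm by (metis norm_triangle_ineq4)
    also have "norm ((t' - t) *\<^sub>R z) \<le> 4 * h / r * D" 
    proof -
      have "(t' - t) * norm z \<le> 4 * h / r * D" using tt z le h r by (intro mult_mono) auto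
      then show ?thesis using le by simp
    qed
    also have "norm (q' - q) \<le> h" using qq by (simp add: dist_norm norm_minus_commute)
    finally show ?thesis by (simp add: algebra_simps)
  qed
  show ?thesis
  proof (cases "?X = {}")
    case True
    then show ?thesis by (simp only: emeasure_empty zero_le)
  next
    case False
    then obtain x0 where x0: "x0 \<in> ?X" by blast
    then obtain t0 where t0: "x0 + t0 *\<^sub>R z \<in> K \<inter> K'" "t0 \<in> {0..1}" by (auto simp: hitting_iff)
    have "?X \<subseteq> cball x0 ((1 + 4 * D / r) * h)"
    proof
      fix x assume x: "x \<in> ?X"
      then obtain t where t: "x + t *\<^sub>R z \<in> K \<inter> K'" "t \<in> {0..1}" by (auto simp: hitting_iff)
      show "x \<in> cball x0 ((1 + 4 * D / r) * h)"
        using close[OF x0 t0 x t] close[OF x t x0 t0] by (cases "t0 \<le> t") (auto simp: dist_commute)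
    qed
    then have "emeasure lborel ?X \<le> emeasure lborel (cball x0 ((1 + 4 * D / r) * h))" by (rule emeasure_mono) simp
    also have "\<dots> = ennreal (ball_const * ((1 + 4 * D / r) * h) ^ DIM('a))"
      using h r by (subst emeasure_cball) (auto simp: ball_const_def)
    finally show ?thesis by (simp only: power_mult_distrib mult.assoc)
  qed
qed

text \<open>
  The layer misses the copy of \<open>p\<close> shrunk towards \<open>c\<close> by the factor \<open>1 - 4 * h / r\<close>.
\<close>

lemma layer_measure:
  assumes p: "convex p" "compact p" "cball c r \<subseteq> p" "interior p \<subseteq> \<Omega>" and r: "r > 0"
    and L: "L \<subseteq> T" "\<And>K. K \<in> L \<Longrightarrow> \<not> K \<subseteq> \<Omega>"
  shows "measure lebesgue (p \<inter> \<Union>L) \<le> measure lebesgue p * (real DIM('a) * (4 * h / r))"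
proof -
  \<comment> \<open>With this factor the points of the shrunk copy have distance at least
    \<open>2 * h\<close> from the complement of the domain, while a point of the layer is within
    \<open>h\<close> of it.\<close>
  define s where "s = 4 * h / r"
  have s0: "s > 0" using h r by (simp add: s_def)
  have pm: "p \<in> lmeasurable" using p lmeasurable_compact by blast
  have LL: "\<Union>L \<in> sets borel" using L(1) fin finite_subset cell_borel by (intro sets.finite_Union) blast+
  have pL: "p \<inter> \<Union>L \<in> lmeasurable" using pm LL by (intro fmeasurable_Int_fmeasurable) auto
  have le: "measure lebesgue (p \<inter> \<Union>L) \<le> measure lebesgue p" using pm pL by (intro measure_mono_fmeasurable) (auto intro: fmeasurableD)
  show ?thesis
  proof (cases "s \<le> 1")
    \<comment> \<open>For large \<open>h\<close> the claimed bound exceeds the volume of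
      \<open>p\<close>.\<close>
    case False
    have "real DIM('a) * s \<ge> 1 * 1" using False by (intro mult_mono) (auto simp: Suc_leI)
    then have "measure lebesgue p * 1 \<le> measure lebesgue p * (real DIM('a) * s)" by (intro mult_left_mono) auto
    then show ?thesis using le by (simp add: s_def)
  next
    case True
    define q where "q = (\<lambda>x. (1 - s) *\<^sub>R x + s *\<^sub>R c) ` p"
    have c: "c \<in> p" using p(3) r by auto
    have qp: "q \<subseteq> p" using p(1) c True s0 by (auto simp: q_def intro!: convexD)
    have mq: "measure lebesgue q = (1 - s) ^ DIM('a) * measure lebesgue p"
      unfolding q_def using measure_lebesgue_affine[of "1 - s" "s *\<^sub>R c" p] True by simp
    have qc: "compact q" unfolding q_def by (intro compact_continuous_image continuous_intros p)
    have disj: "p \<inter> \<Union>L \<subseteq> p - q"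
    proof clarify
      fix y K assume y: "y \<in> p" "y \<in> K" "K \<in> L" "y \<in> q"
      then obtain x where x: "x \<in> p" "y = (1 - s) *\<^sub>R x + s *\<^sub>R c" by (auto simp: q_def)
      obtain b where b: "b \<in> K" "b \<notin> \<Omega>" using L(2) y(3) by blast
      have "s * r / 2 \<le> dist (x + s *\<^sub>R (c - x)) b"
        by (rule push_inside[OF p(1,3,4) x(1) _ _ True b(2)]) (use r s0 in auto)
      also have "x + s *\<^sub>R (c - x) = y" using x(2) by (simp add: algebra_simps)
      also have "dist y b \<le> h" using diam y b L(1) by blast
      finally show False using r h by (simp add: s_def)
    qed
    have "measure lebesgue (p \<inter> \<Union>L) \<le> measure lebesgue (p - q)"
      using disj pm pL qc by (intro measure_mono_fmeasurable) (auto intro: fmeasurableD fmeasurable_Diff simp: compact_imp_closed)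
    also have "\<dots> = measure lebesgue p - measure lebesgue q"
      using pm qc qp lmeasurable_compact by (intro measurable_measure_Diff) (auto intro: fmeasurableD)
    also have "\<dots> = measure lebesgue p * (1 - (1 - s) ^ DIM('a))" by (simp add: mq algebra_simps)
    also have "\<dots> \<le> measure lebesgue p * (real DIM('a) * s)"
    proof (intro mult_left_mono)
      have "1 + real DIM('a) * (- s) \<le> (1 + (- s)) ^ DIM('a)" using True by (intro Bernoulli_inequality) simp
      then show "1 - (1 - s) ^ DIM('a) \<le> real DIM('a) * s" by simp
    qed simp
    finally show ?thesis by (simp add: s_def)
  qed
qed

text \<open>The deviation on a layer cell is split at the value on a cell \<open>K'\<close>,
  averaged over the inner ball. The difference to \<open>K'\<close> is a layer variation and carries
  a factor \<open>h\<close>; the deviation on \<open>K'\<close> is a global sum multiplied by the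
  volume of the layer, again of order \<open>h\<close>.\<close>

lemma layer_piece:
  assumes p: "convex p" "compact p" "cball c r \<subseteq> p" "interior p \<subseteq> \<Omega>" "p \<subseteq> \<Union>T" and r: "r > 0"
    and L: "L \<subseteq> T" "\<And>K. K \<in> L \<Longrightarrow> \<not> K \<subseteq> \<Omega>"
  shows "measure lebesgue (cball c (r / 2)) * (\<Sum>K\<in>L. measure lebesgue (K \<inter> p) * (a K - m)\<^sup>2) \<le>
     2 * (ball_const * D ^ DIM('a) * (3 * D * pack\<^sup>2) * (ball_const * (1 + 4 * D / r) ^ DIM('a)) * h * energy a)
     + 2 * (measure lebesgue p * (real DIM('a) * (4 * h / r))) * (\<Sum>K\<in>T. measure lebesgue K * (a K - m)\<^sup>2)"
proof -
  let ?B = "cball c (r / 2)"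
  have B: "?B \<in> sets borel" "?B \<subseteq> p" using p(3) r by (auto intro: order_trans[OF subset_cball])
  have pb: "p \<in> sets borel" using p(2) by (simp add: compact_imp_closed)
  have var: "variation L p ?B a \<le> ball_const * D ^ DIM('a) * (3 * D * pack\<^sup>2) * (ball_const * (1 + 4 * D / r) ^ DIM('a)) * h * energy a"
  proof (rule layer_variation[OF p(1,5) pb order_refl B L(1)])
    show "0 \<le> ball_const * (1 + 4 * D / r) ^ DIM('a)" using ball_const_pos D_nonneg r by simp
    show "emeasure lborel {x \<in> p \<inter> \<Union>L. x + z \<in> ?B \<and> x \<in> hitting z (K \<inter> K')} \<le> ennreal (ball_const * (1 + 4 * D / r) ^ DIM('a) * h ^ DIM('a))"
      if "(K, K') \<in> adjacent_cells T" for z K K'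
      using L by (intro layer_shadow[OF p(1,3,4,5) r _ that]) auto
  qed
  have mB: "measure lebesgue ?B = (\<Sum>K\<in>T. measure lebesgue (K \<inter> ?B))"
    using measure_cells[of ?B] B p(5) by simp
  have mL: "measure lebesgue (p \<inter> \<Union>L) = (\<Sum>K\<in>L. measure lebesgue (K \<inter> p))"
    using measure_Union_cells[OF L(1) pb] by (simp add: Int_commute)
  have "measure lebesgue ?B * (\<Sum>K\<in>L. measure lebesgue (K \<inter> p) * (a K - m)\<^sup>2) =
     (\<Sum>K\<in>L. \<Sum>K'\<in>T. measure lebesgue (K \<inter> p) * measure lebesgue (K' \<inter> ?B) * (a K - m)\<^sup>2)"
    unfolding mB by (simp add: sum_distrib_left sum_distrib_right mult_ac)
  also have "\<dots> \<le> (\<Sum>K\<in>L. \<Sum>K'\<in>T. measure lebesgue (K \<inter> p) * measure lebesgue (K' \<inter> ?B) * (2 * (a K - a K')\<^sup>2 + 2 * (a K' - m)\<^sup>2))"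
  proof (intro sum_mono mult_left_mono)
    fix K K'
    have "0 \<le> ((a K - a K') - (a K' - m))\<^sup>2" by simp
    then show "(a K - m)\<^sup>2 \<le> 2 * (a K - a K')\<^sup>2 + 2 * (a K' - m)\<^sup>2" by (simp add: power2_eq_square algebra_simps)
  qed auto
  also have "\<dots> = (\<Sum>K\<in>L. \<Sum>K'\<in>T. 2 * (measure lebesgue (K \<inter> p) * measure lebesgue (K' \<inter> ?B) * (a K - a K')\<^sup>2)) +
     (\<Sum>K\<in>L. \<Sum>K'\<in>T. measure lebesgue (K \<inter> p) * (2 * (measure lebesgue (K' \<inter> ?B) * (a K' - m)\<^sup>2)))"
    by (simp add: sum.distrib distrib_left mult_ac)
  also have "\<dots> = 2 * variation L p ?B a + 2 * measure lebesgue (p \<inter> \<Union>L) * (\<Sum>K\<in>T. measure lebesgue (K \<inter> ?B) * (a K - m)\<^sup>2)"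
    unfolding variation_def mL by (simp add: sum_distrib_left[symmetric] sum_distrib_right[symmetric])
  also have "\<dots> \<le> 2 * (ball_const * D ^ DIM('a) * (3 * D * pack\<^sup>2) * (ball_const * (1 + 4 * D / r) ^ DIM('a)) * h * energy a)
     + 2 * (measure lebesgue p * (real DIM('a) * (4 * h / r))) * (\<Sum>K\<in>T. measure lebesgue K * (a K - m)\<^sup>2)"
  proof (intro add_mono mult_left_mono var mult_mono)
    show "measure lebesgue (p \<inter> \<Union>L) \<le> measure lebesgue p * (real DIM('a) * (4 * h / r))"
      by (rule layer_measure[OF p(1-4) r L])
    show "(\<Sum>K\<in>T. measure lebesgue (K \<inter> ?B) * (a K - m)\<^sup>2) \<le> (\<Sum>K\<in>T. measure lebesgue K * (a K - m)\<^sup>2)"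
      using cell_Int_lmeasurable[OF _ B(1)] cell_lmeasurable
      by (intro sum_mono mult_right_mono measure_mono_fmeasurable) (auto intro: fmeasurableD)
  qed (use h r in \<open>auto intro!: sum_nonneg\<close>)
  finally show ?thesis .
qed

end

text \<open>A discrete trace inequality: the cells that are not contained in the open domain, among
  them all cells with a boundary face, carry only a fraction of order \<open>h\<close> of the energy
  bound. The piecewise estimates need the global Poincare inequality for their second term.\<close>

theorem layer_poincare:
  fixes \<Omega> :: "'a::euclidean_space set"
  assumes \<Omega>: "polyhedral_domain \<Omega>" and c: "\<mu> > 0" "D \<ge> 0"
  obtains C where "C \<ge> 0" "\<And>T h a. uniform_mesh T h \<mu> D \<Longrightarrow> \<Union>T = closure \<Omega> \<Longrightarrow>
    (\<Sum>K | K \<in> T \<and> \<not> K \<subseteq> \<Omega>. measure lebesgue K * (a K - (\<Sum>K\<in>T. measure lebesgue K * a K) / measure lebesgue (closure \<Omega>))\<^sup>2) \<le> C * h * uniform_mesh.energy T h a"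
proof -
  have "\<exists>C0\<ge>0. \<forall>T h a. uniform_mesh T h \<mu> D \<longrightarrow> \<Union>T = closure \<Omega> \<longrightarrow>
    (\<Sum>K\<in>T. measure lebesgue K * (a K - (\<Sum>K\<in>T. measure lebesgue K * a K) / measure lebesgue (closure \<Omega>))\<^sup>2) \<le> C0 * uniform_mesh.energy T h a"
    by (rule discrete_poincare[OF \<Omega> c]) blast
  then obtain C0 where C0: "C0 \<ge> 0" "\<And>T h a. uniform_mesh T h \<mu> D \<Longrightarrow> \<Union>T = closure \<Omega> \<Longrightarrow>
    (\<Sum>K\<in>T. measure lebesgue K * (a K - (\<Sum>K\<in>T. measure lebesgue K * a K) / measure lebesgue (closure \<Omega>))\<^sup>2) \<le> C0 * uniform_mesh.energy T h a"
    by blast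
  obtain P where P: "finite P" "\<And>p. p \<in> P \<Longrightarrow> compact p \<and> convex p \<and> interior p \<noteq> {} \<and> interior p \<subseteq> \<Omega>" "\<Union>P = closure \<Omega>"
    using polyhedral_domain_pieces[OF \<Omega>] by metis
  have "\<exists>c r. r > 0 \<and> cball c r \<subseteq> p" if "p \<in> P" for p
    using P(2)[OF that] by (metis ex_in_conv mem_interior_cball)
  then obtain c r where cr: "\<And>p. p \<in> P \<Longrightarrow> r p > 0 \<and> cball (c p) (r p) \<subseteq> p" by metis
  define b where "b = unit_ball_vol (real DIM('a))"
  define k where "k = b * 2 ^ DIM('a) / \<mu>"
  have b: "b > 0" by (simp add: b_def)
  then have k: "k \<ge> 0" using c(1) by (simp add: k_def)
  define Cp where "Cp p = (2 * (b * D ^ DIM('a) * (3 * D * k\<^sup>2) * (b * (1 + 4 * D / r p) ^ DIM('a)))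
     + 2 * (measure lebesgue p * (real DIM('a) * (4 / r p))) * C0) / measure lebesgue (cball (c p) (r p / 2))" for p
  have mpos: "measure lebesgue (cball (c p) (r p / 2)) > 0" if "p \<in> P" for p
    using cr[OF that] by (simp add: content_cball)
  show ?thesis
  proof (rule that[of "\<Sum>p\<in>P. Cp p"])
    show "(\<Sum>p\<in>P. Cp p) \<ge> 0" unfolding Cp_def using b k \<open>D \<ge> 0\<close> C0(1) cr
      by (intro sum_nonneg divide_nonneg_nonneg add_nonneg_nonneg mult_nonneg_nonneg zero_le_power) (auto intro: less_imp_le)
    fix T h a assume T: "uniform_mesh T h \<mu> D" "\<Union>T = closure \<Omega>"
    then interpret uniform_mesh T h \<mu> D by blast
    define m where "m = (\<Sum>K\<in>T. measure lebesgue K * a K) / measure lebesgue (closure \<Omega>)"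
    let ?L = "{K. K \<in> T \<and> \<not> K \<subseteq> \<Omega>}"
    have piece: "(\<Sum>K\<in>?L. measure lebesgue (K \<inter> p) * (a K - m)\<^sup>2) \<le> Cp p * (h * energy a)" if p: "p \<in> P" for p
    proof -
      have "measure lebesgue (cball (c p) (r p / 2)) * (\<Sum>K\<in>?L. measure lebesgue (K \<inter> p) * (a K - m)\<^sup>2) \<le>
        2 * (ball_const * D ^ DIM('a) * (3 * D * pack\<^sup>2) * (ball_const * (1 + 4 * D / r p) ^ DIM('a)) * h * energy a)
        + 2 * (measure lebesgue p * (real DIM('a) * (4 * h / r p))) * (\<Sum>K\<in>T. measure lebesgue K * (a K - m)\<^sup>2)"
        using P(2)[OF p] cr[OF p] p T(2) P(3) by (intro layer_piece[where \<Omega> = \<Omega>]) auto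
      also have "\<dots> \<le> 2 * (ball_const * D ^ DIM('a) * (3 * D * pack\<^sup>2) * (ball_const * (1 + 4 * D / r p) ^ DIM('a)) * h * energy a)
        + 2 * (measure lebesgue p * (real DIM('a) * (4 * h / r p))) * (C0 * energy a)"
        unfolding m_def using C0(2)[OF T, of a] cr[OF p] h by (intro add_left_mono mult_left_mono) auto
      also have "\<dots> = measure lebesgue (cball (c p) (r p / 2)) * (Cp p * (h * energy a))"
      proof -
        have cancel: "x * (y / x * z) = y * z" if "x > 0" for x y z :: real using that by simp
        show ?thesis unfolding Cp_def cancel[OF mpos[OF p]]
          by (simp add: b_def k_def ball_const_def pack_def algebra_simps)
      qed
      finally show ?thesis using mpos[OF p] by simp
    qed
    have le: "measure lebesgue K \<le> (\<Sum>p\<in>P. measure lebesgue (K \<inter> p))" if "K \<in> T" for K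
    proof -
      have "measure lebesgue (\<Union>p\<in>P. K \<inter> p) \<le> (\<Sum>p\<in>P. measure lebesgue (K \<inter> p))"
        using P that cell_Int_lmeasurable by (intro measure_UNION_le) (auto intro!: fmeasurableD simp: compact_imp_closed)
      moreover have "(\<Union>p\<in>P. K \<inter> p) = K" using that T(2) P(3) by blast
      ultimately show ?thesis by simp
    qed
    have "(\<Sum>K\<in>?L. measure lebesgue K * (a K - m)\<^sup>2) \<le> (\<Sum>K\<in>?L. (\<Sum>p\<in>P. measure lebesgue (K \<inter> p)) * (a K - m)\<^sup>2)"
      by (intro sum_mono mult_right_mono le) auto
    also have "\<dots> = (\<Sum>p\<in>P. \<Sum>K\<in>?L. measure lebesgue (K \<inter> p) * (a K - m)\<^sup>2)"
      unfolding sum_distrib_right by (rule sum.swap)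
    also have "\<dots> \<le> (\<Sum>p\<in>P. Cp p * (h * energy a))" by (intro sum_mono piece)
    finally show "(\<Sum>K | K \<in> T \<and> \<not> K \<subseteq> \<Omega>. measure lebesgue K * (a K - (\<Sum>K\<in>T. measure lebesgue K * a K) / measure lebesgue (closure \<Omega>))\<^sup>2)
      \<le> (\<Sum>p\<in>P. Cp p) * h * energy a" by (simp add: m_def sum_distrib_right mult.assoc)
  qed
qed

section \<open>Rules for integrals over a face\<close>

lemma set_integrable_face:
  fixes f :: "'a::euclidean_space \<Rightarrow> real"
  assumes e: "compact e" "e \<noteq> {}" and f: "continuous_on UNIV f"
  shows "set_integrable (hyperplane_measure (affine hull e)) e f"
proof -
  have c: "closed e" using e compact_imp_closed by blast
  have sets: "sets (hyperplane_measure (affine hull e)) = sets borel" by (simp add: hyperplane_measure_def)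
  have "emeasure (hyperplane_measure (affine hull e)) e = emeasure lborel (prism e)"
    using face_area_prism[OF c e(2), of e] c by (simp add: prism_def)
  also have "\<dots> < \<infinity>" using compact_prism[OF e] compact_imp_bounded emeasure_bounded_finite by blast
  finally have fin: "emeasure (hyperplane_measure (affine hull e)) e < \<infinity>" .
  have "compact (f ` e)" using e f continuous_on_subset by (intro compact_continuous_image) auto
  then obtain B where B: "\<And>x. x \<in> e \<Longrightarrow> norm (f x) \<le> B" using compact_imp_bounded bounded_iff by (metis imageI)
  show ?thesis unfolding set_integrable_def
  proof (rule integrableI_bounded_set_indicator[where B = B])
    show "f \<in> borel_measurable (hyperplane_measure (affine hull e))"
      using borel_measurable_continuous_onI[OF f] by (simp add: hyperplane_measure_def)
  qed (use c fin B sets in auto)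
qed

lemma face_integral_const:
  fixes c :: real
  assumes e: "compact e" "e \<noteq> {}" shows "face_integral e (\<lambda>x. c) = face_area e * c"
proof -
  have c: "closed e" using e compact_imp_closed by blast
  have "face_integral e (\<lambda>x. c) = (LINT x:prism e|lborel. c)" using face_integral_prism[OF c e(2), of "\<lambda>x. c"] by simp
  also have "\<dots> = measure lborel (prism e) * c"
    by (subst set_integral_const) (use compact_prism[OF e] compact_imp_bounded emeasure_bounded_finite in \<open>auto simp: compact_imp_closed less_top[symmetric]\<close>)
  finally show ?thesis using face_area_eq_prism[OF c e(2)] by simp
qed

lemma face_integral_diff:
  fixes f g :: "'a::euclidean_space \<Rightarrow> real"
  assumes "compact e" "e \<noteq> {}" "continuous_on UNIV f" "continuous_on UNIV g"
  shows "face_integral e (\<lambda>x. f x - g x) = face_integral e f - face_integral e g"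
  unfolding face_integral_def using assms by (intro set_integral_diff(2) set_integrable_face)

lemma face_integral_mono:
  fixes f g :: "'a::euclidean_space \<Rightarrow> real"
  assumes "compact e" "e \<noteq> {}" "continuous_on UNIV f" "continuous_on UNIV g" "\<And>x. x \<in> e \<Longrightarrow> f x \<le> g x"
  shows "face_integral e f \<le> face_integral e g"
  unfolding face_integral_def using assms by (intro set_integral_mono set_integrable_face)

lemma face_integral_cmult:
  fixes f :: "'a::euclidean_space \<Rightarrow> real"
  shows "face_integral e (\<lambda>x. c * f x) = c * face_integral e f"
  unfolding face_integral_def by simp

lemma face_integral_nonneg:
  fixes f :: "'a::euclidean_space \<Rightarrow> real"
  assumes "\<And>x. x \<in> e \<Longrightarrow> 0 \<le> f x" shows "0 \<le> face_integral e f"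
  unfolding face_integral_def set_lebesgue_integral_def using assms
  by (intro integral_nonneg_AE) (auto simp: indicator_def)

text \<open>Nonnegativity of the integral of the squared deviation from the mean. On a face of area
  0 the mean makes no sense, but there bounded functions have integral 0.\<close>

lemma face_integral_square_le:
  fixes f :: "'a::euclidean_space \<Rightarrow> real"
  assumes e: "compact e" "e \<noteq> {}" and f: "continuous_on UNIV f"
  shows "(face_integral e f)\<^sup>2 \<le> face_area e * face_integral e (\<lambda>x. (f x)\<^sup>2)"
proof (cases "face_area e = 0")
  case True
  obtain B where B: "\<And>x. x \<in> e \<Longrightarrow> norm (f x) \<le> B"
  proof -
    have "compact (f ` e)" using e f continuous_on_subset by (intro compact_continuous_image) auto
    then show ?thesis using that compact_imp_bounded bounded_iff by (metis imageI)
  qed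
  have "face_integral e f \<le> face_integral e (\<lambda>x. B)"
    using B by (intro face_integral_mono e f) (auto simp: abs_le_iff)
  moreover have "face_integral e (\<lambda>x. - B) \<le> face_integral e f"
    using B by (intro face_integral_mono e f) (auto simp: abs_le_iff minus_le_iff)
  ultimately show ?thesis using True by (simp add: face_integral_const[OF e])
next
  case False
  define a where "a = face_area e"
  have a: "a > 0" using False by (simp add: a_def face_area_def zero_less_measure_iff)
  define m where "m = face_integral e f / a"
  have "0 \<le> face_integral e (\<lambda>x. (f x - m)\<^sup>2)" by (intro face_integral_nonneg) auto
  also have "(\<lambda>x. (f x - m)\<^sup>2) = (\<lambda>x. (f x)\<^sup>2 - (2 * m * f x - m\<^sup>2))"
    by (auto simp: power2_eq_square algebra_simps)
  also have "face_integral e \<dots> = face_integral e (\<lambda>x. (f x)\<^sup>2) - face_integral e (\<lambda>x. 2 * m * f x - m\<^sup>2)"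
    by (intro face_integral_diff e continuous_intros f)
  also have "face_integral e (\<lambda>x. 2 * m * f x - m\<^sup>2) = face_integral e (\<lambda>x. 2 * m * f x) - face_integral e (\<lambda>x. m\<^sup>2)"
    by (intro face_integral_diff e continuous_intros f)
  also have "\<dots> = 2 * m * face_integral e f - a * m\<^sup>2"
    by (simp add: face_integral_cmult face_integral_const[OF e] a_def)
  also have "\<dots> = (face_integral e f)\<^sup>2 / a" using a by (simp add: m_def power2_eq_square field_simps)
  finally show ?thesis using a by (simp add: a_def[symmetric] field_simps)
qed

section \<open>Polynomials of degree at most one\<close>

lemma polynomial_index_finite: "finite {\<alpha> \<in> (Basis::'a::euclidean_space set) \<rightarrow>\<^sub>E {..k::nat}. (\<Sum>i\<in>Basis. \<alpha> i) \<le> k}"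
  by (intro finite_subset[OF _ finite_PiE[of Basis "\<lambda>_. {..k}"]]) auto

lemma affine_function_sum:
  assumes "\<And>j. j \<in> J \<Longrightarrow> affine_function (f j)" shows "affine_function (\<lambda>x. \<Sum>j\<in>J. c j * f j x)"
proof -
  have "\<exists>a b. \<forall>x. f j x = a + b \<bullet> x" if "j \<in> J" for j using assms[OF that] unfolding affine_function_def .
  then obtain a b where ab: "\<And>j x. j \<in> J \<Longrightarrow> f j x = a j + b j \<bullet> x" by metis
  have "(\<Sum>j\<in>J. c j * f j x) = (\<Sum>j\<in>J. c j * a j) + (\<Sum>j\<in>J. c j *\<^sub>R b j) \<bullet> x" for x
    using ab by (simp add: inner_sum_left distrib_left sum.distrib)
  then show ?thesis unfolding affine_function_def by blast
qed

lemma polynomial_degree_one_affine: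
  fixes p :: "'a::euclidean_space \<Rightarrow> real"
  assumes "polynomial_of_degree_le 1 p" shows "affine_function p"
proof -
  define I where "I = {\<alpha> \<in> (Basis::'a set) \<rightarrow>\<^sub>E {..1::nat}. (\<Sum>i\<in>Basis. \<alpha> i) \<le> 1}"
  obtain c where c: "\<And>x. p x = (\<Sum>\<alpha>\<in>I. c \<alpha> * (\<Prod>i\<in>Basis. (x \<bullet> i) ^ \<alpha> i))"
    using assms unfolding polynomial_of_degree_le_def I_def by auto
  have "affine_function (\<lambda>x::'a. \<Prod>i\<in>Basis. (x \<bullet> i) ^ \<alpha> i)" if \<alpha>: "\<alpha> \<in> I" for \<alpha>
  proof (cases "\<exists>j\<in>Basis. \<alpha> j \<noteq> 0")
    case False
    then have "(\<Prod>i\<in>(Basis::'a set). (x \<bullet> i) ^ \<alpha> i) = 1 + 0 \<bullet> x" for x :: 'a by simp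
    then show ?thesis unfolding affine_function_def by blast
  next
    case True
    then obtain j where j: "j \<in> Basis" "\<alpha> j \<noteq> 0" by blast
    have le: "(\<Sum>i\<in>(Basis::'a set). \<alpha> i) \<le> 1" using \<alpha> by (simp add: I_def)
    have "(\<Sum>i\<in>(Basis::'a set). \<alpha> i) = \<alpha> j + (\<Sum>i\<in>Basis - {j}. \<alpha> i)" using j by (simp add: sum.remove)
    then have 1: "\<alpha> j = 1 \<and> (\<Sum>i\<in>Basis - {j}. \<alpha> i) = 0" using le j(2) by linarith
    then have "\<forall>i\<in>Basis - {j}. \<alpha> i = 0" by (subst (asm) sum_eq_0_iff) auto
    then have 0: "\<alpha> i = 0" if "i \<in> Basis - {j}" for i using that by blast
    have "(\<Prod>i\<in>Basis. (x \<bullet> i) ^ \<alpha> i) = 0 + j \<bullet> x" for x :: 'a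
    proof -
      have "(\<Prod>i\<in>Basis. (x \<bullet> i) ^ \<alpha> i) = (x \<bullet> j) ^ \<alpha> j * (\<Prod>i\<in>Basis - {j}. (x \<bullet> i) ^ \<alpha> i)" using j by (simp add: prod.remove)
      also have "(\<Prod>i\<in>Basis - {j}. (x \<bullet> i) ^ \<alpha> i) = 1" using 0 by (intro prod.neutral) auto
      finally show ?thesis using 1 by (simp add: inner_commute)
    qed
    then show ?thesis unfolding affine_function_def by blast
  qed
  then have "affine_function (\<lambda>x. \<Sum>\<alpha>\<in>I. c \<alpha> * (\<Prod>i\<in>Basis. (x \<bullet> i) ^ \<alpha> i))" by (rule affine_function_sum)
  moreover have "p = (\<lambda>x. \<Sum>\<alpha>\<in>I. c \<alpha> * (\<Prod>i\<in>Basis. (x \<bullet> i) ^ \<alpha> i))" using c by (rule ext)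
  ultimately show ?thesis by metis
qed

lemma affine_polynomial_degree_one:
  fixes p :: "'a::euclidean_space \<Rightarrow> real"
  assumes "affine_function p" shows "polynomial_of_degree_le 1 p"
proof -
  obtain a b where ab: "\<And>x. p x = a + b \<bullet> x" using assms unfolding affine_function_def by blast
  define I where "I = {\<alpha> \<in> (Basis::'a set) \<rightarrow>\<^sub>E {..1::nat}. (\<Sum>i\<in>Basis. \<alpha> i) \<le> 1}"
  have finI: "finite I" unfolding I_def by (rule polynomial_index_finite)
  \<comment> \<open>The multi-indices 0 and \<open>d j\<close>, the j-th unit. The restriction to
    \<open>Basis\<close> is what membership in the extensional function space requires.\<close>
  define z :: "'a \<Rightarrow> nat" where "z = (\<lambda>i\<in>Basis. 0)"
  define d :: "'a \<Rightarrow> 'a \<Rightarrow> nat" where "d j = (\<lambda>i\<in>Basis. if i = j then 1 else 0)" for j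
  have zI: "z \<in> I" by (auto simp: I_def z_def)
  have dI: "d j \<in> I" if "j \<in> Basis" for j using that by (auto simp: I_def d_def)
  have dj: "d j j = 1" if "j \<in> Basis" for j using that by (simp add: d_def)
  have dinj: "inj_on d Basis"
  proof (rule inj_onI)
    fix i j :: 'a assume "i \<in> Basis" "j \<in> Basis" "d i = d j"
    then have "d i j = 1" using dj by simp
    then show "i = j" using \<open>j \<in> Basis\<close> by (simp add: d_def split: if_splits)
  qed
  have zd: "z \<notin> d ` Basis"
  proof
    assume "z \<in> d ` Basis"
    then obtain j where "j \<in> Basis" "z = d j" by blast
    then have "z j = 1" using dj by metis
    moreover have "z j = 0" using \<open>j \<in> Basis\<close> by (simp add: z_def)
    ultimately show False by simp
  qed
  define m where "m \<alpha> x = (\<Prod>i\<in>Basis. (x \<bullet> i) ^ \<alpha> i)" for \<alpha> and x :: 'a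
  have mz: "m z x = 1" for x by (simp add: m_def z_def)
  have md: "m (d j) x = x \<bullet> j" if "j \<in> Basis" for j x
  proof -
    have "m (d j) x = (\<Prod>i\<in>Basis. if i = j then x \<bullet> i else 1)" unfolding m_def d_def by (intro prod.cong) auto
    then show ?thesis using that by simp
  qed
  define c where "c \<alpha> = (if \<alpha> = z then a else if \<alpha> \<in> d ` Basis then b \<bullet> the_inv_into Basis d \<alpha> else 0)" for \<alpha>
  have "p x = (\<Sum>\<alpha>\<in>I. c \<alpha> * m \<alpha> x)" for x
  proof -
    have "(\<Sum>\<alpha>\<in>I. c \<alpha> * m \<alpha> x) = (\<Sum>\<alpha>\<in>insert z (d ` Basis). c \<alpha> * m \<alpha> x)"
      using finI zI dI by (intro sum.mono_neutral_right) (auto simp: c_def)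
    also have "\<dots> = c z * m z x + (\<Sum>\<alpha>\<in>d ` Basis. c \<alpha> * m \<alpha> x)" using zd by (subst sum.insert) auto
    also have "(\<Sum>\<alpha>\<in>d ` Basis. c \<alpha> * m \<alpha> x) = (\<Sum>j\<in>Basis. c (d j) * m (d j) x)" using dinj by (simp add: sum.reindex)
    also have "\<dots> = (\<Sum>j\<in>Basis. (b \<bullet> j) * (x \<bullet> j))"
    proof (intro sum.cong refl)
      fix j :: 'a assume j: "j \<in> Basis"
      have "d j \<noteq> z" using zd j by blast
      then show "c (d j) * m (d j) x = (b \<bullet> j) * (x \<bullet> j)" using j dinj by (simp add: c_def md the_inv_into_f_f)
    qed
    also have "\<dots> = b \<bullet> x" by (rule euclidean_inner[symmetric])
    finally show ?thesis by (simp add: ab mz c_def)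
  qed
  then show ?thesis unfolding polynomial_of_degree_le_def I_def m_def by blast
qed

section \<open>Existence of the Crouzeix--Raviart lifting\<close>

context uniform_mesh begin

lemma facet_integral_affine_function:
  assumes K: "K \<in> T" and e: "e facet_of K" and f: "affine_function f"
  shows "face_integral e f = face_area e * f (barycenter e)"
proof -
  obtain C v where C: "finite C" "\<not> affine_dependent C" "e = convex hull (C - {v})" "C - {v} \<noteq> {}"
    using facet_structure[OF K e] by metis
  have "\<not> affine_dependent (C - {v})" using C(2) affine_independent_Diff by blast
  from face_integral_affine_function[OF this C(4) f] show ?thesis using C(3) by simp
qed

text \<open>
  The vertex values \<open>B - d * t v\<close> solve the linear system saying that the mean of the values at all
  vertices but \<open>v\<close> is \<open>t v\<close>.
\<close>

lemma cell_CR_interpolation: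
  assumes K: "K \<in> T"
  obtains f where "affine_function f" "\<And>e. e facet_of K \<Longrightarrow> f (barycenter e) = \<mu>' e"
proof -
  obtain C \<beta> where C: "finite C" "\<not> affine_dependent C" "card C = DIM('a) + 1" "K = convex hull C"
    using cell_vertices[OF K] by metis
  define t where "t v = \<mu>' (convex hull (C - {v}))" for v
  define B where "B = (\<Sum>v\<in>C. t v)"
  obtain f where f: "affine_function f" "\<And>v. v \<in> C \<Longrightarrow> f v = B - real DIM('a) * t v"
    using affine_interpolation[OF C(2), of "\<lambda>v. B - real DIM('a) * t v"] by metis
  have "f (barycenter e) = \<mu>' e" if e: "e facet_of K" for e
  proof -
    obtain v where v: "v \<in> C" "e = convex hull (C - {v})" "e \<noteq> {}"
    proof -
      have "e facet_of convex hull C" using e C(4) by simp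
      then have "e \<noteq> {} \<and> (\<exists>u. u \<in> C \<and> e = convex hull (C - {u}))"
        using facet_of_convex_hull_affine_independent[OF C(2), of e] by blast
      then show ?thesis using that by blast
    qed
    have ind: "\<not> affine_dependent (C - {v})" using C(2) affine_independent_Diff by blast
    have cd: "card (C - {v}) = DIM('a)" using C(1,3) v(1) by simp
    have "f (barycenter e) = (\<Sum>u\<in>C - {v}. 1 / real DIM('a) * f u)"
      unfolding v(2) barycenter_convex_hull[OF ind] cd
      using cd by (intro affine_function_combination f) (auto simp: scaleR_sum_right divide_inverse)
    also have "\<dots> = (\<Sum>u\<in>C - {v}. B / real DIM('a) - t u)"
      using f(2) by (intro sum.cong) (auto simp: diff_divide_distrib)
    also have "\<dots> = B - (\<Sum>u\<in>C - {v}. t u)" using cd by (simp add: sum_subtractf)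
    also have "\<dots> = t v" using C(1) v(1) by (simp add: B_def sum.remove)
    finally show ?thesis by (simp add: t_def v(2))
  qed
  then show ?thesis using that f(1) by blast
qed

text \<open>The definite description of the normal requires uniqueness. If a candidate
  \<open>n\<close> had a component \<open>d\<close> tangential to the facet, a small step from the
  relative centre \<open>y\<close> along \<open>d\<close> would stay in the cell and contradict the
  inequality, as \<open>n \<bullet> d = d \<bullet> d\<close>. The opposite vertex then fixes the
  sign.\<close>

lemma facet_inequality:
  assumes K: "K \<in> T" and e: "e facet_of K"
  obtains a b where "b \<noteq> 0" "affine hull e = {x. a + b \<bullet> x = 0}" "\<And>x. x \<in> K \<Longrightarrow> 0 \<le> a + b \<bullet> x"
    "outward_normal K e = - (1 / norm b) *\<^sub>R b"
proof -
  obtain C \<beta> v where C: "finite C" "\<not> affine_dependent C" "card C = DIM('a) + 1" "K = convex hull C" "affine hull C = UNIV"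
    "is_barycentric C \<beta>" "v \<in> C" "e = convex hull (C - {v})" "C - {v} \<noteq> {}" "affine hull e = {x. \<beta> v x = 0}"
    using facet_structure[OF K e] by metis
  obtain a b where ab: "\<And>x. \<beta> v x = a + b \<bullet> x" using C(6,7) by (auto simp: is_barycentric_def affine_function_def)
  note fp = facet_props[OF K e]
  have vv: "a + b \<bullet> v = 1" using C(6,7) by (simp add: ab[symmetric] is_barycentric_def)
  have vK: "v \<in> K" using C(4,7) by (simp add: hull_inc)
  have eH: "a + b \<bullet> x = 0" if "x \<in> e" for x using C(10) hull_inc[OF that, of affine] by (simp add: ab)
  have b0: "b \<noteq> 0"
  proof
    assume "b = 0"
    moreover obtain x where "x \<in> e" using fp(4) by blast
    ultimately show False using vv eH by simp
  qed
  have pos: "0 \<le> a + b \<bullet> x" if "x \<in> K" for x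
  proof -
    have "\<forall>u\<in>C. 0 \<le> \<beta> u x" using barycentric_combination(4)[OF C(6,1), of x] C(4,5) that by simp
    then have "0 \<le> \<beta> v x" using C(7) by blast
    then show ?thesis by (simp add: ab)
  qed
  obtain y where y: "y \<in> e" "cball y (inradius * h) \<inter> affine hull e \<subseteq> e" using facet_inball[OF K e] by metis
  have r0: "inradius * h > 0" using inradius h by simp
  have "outward_normal K e = - (1 / norm b) *\<^sub>R b"
    unfolding outward_normal_def
  proof (rule the_equality)
    show "norm (- (1 / norm b) *\<^sub>R b) = 1 \<and> (\<forall>x\<in>e. \<forall>y\<in>K. - (1 / norm b) *\<^sub>R b \<bullet> (y - x) \<le> 0)"
    proof (intro conjI ballI)
      fix x z assume "x \<in> e" "z \<in> K"
      then have "0 \<le> b \<bullet> (z - x)" using eH[of x] pos[of z] by (simp add: inner_diff_right)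
      then show "- (1 / norm b) *\<^sub>R b \<bullet> (z - x) \<le> 0" using b0 by (simp add: zero_le_divide_iff)
    qed (use b0 in simp)
    fix n assume n: "norm n = 1 \<and> (\<forall>x\<in>e. \<forall>y\<in>K. n \<bullet> (y - x) \<le> 0)"
    define t where "t = (n \<bullet> b) / (norm b)\<^sup>2"
    define d where "d = n - t *\<^sub>R b"
    have bd: "b \<bullet> d = 0" using b0 by (simp add: d_def t_def inner_diff_right power2_norm_eq_inner inner_commute)
    have "d = 0"
    proof (rule ccontr)
      assume d0: "d \<noteq> 0"
      define s where "s = inradius * h / norm d"
      have s: "s > 0" using r0 d0 by (simp add: s_def)
      have "y + s *\<^sub>R d \<in> cball y (inradius * h) \<inter> affine hull e"
        using d0 r0 eH[OF y(1)] bd by (simp add: C(10) ab s_def dist_norm inner_add_right)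
      then have "y + s *\<^sub>R d \<in> K" using y(2) fp(3) by blast
      then have "n \<bullet> (y + s *\<^sub>R d - y) \<le> 0" using n y(1) by blast
      then have "n \<bullet> d \<le> 0" using s by (simp add: mult_le_0_iff)
      moreover have "n \<bullet> d = d \<bullet> d + t * (b \<bullet> d)" by (simp add: d_def inner_diff_left)
      ultimately have "d \<bullet> d \<le> 0" using bd by simp
      then show False using d0 inner_gt_zero_iff[of d] by linarith
    qed
    then have nt: "n = t *\<^sub>R b" by (simp add: d_def)
    then have "\<bar>t\<bar> * norm b = 1" using n by (metis norm_scaleR)
    moreover have "t \<le> 0"
    proof -
      have "n \<bullet> (v - y) \<le> 0" using n y(1) vK by blast
      moreover have "b \<bullet> (v - y) = 1" using vv eH[OF y(1)] by (simp add: inner_diff_right)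
      ultimately show ?thesis by (simp add: nt)
    qed
    ultimately have "t = - (1 / norm b)" using b0 by (simp add: field_simps)
    then show "n = - (1 / norm b) *\<^sub>R b" using nt by simp
  qed
  then show ?thesis using that[OF b0 _ pos] C(10) by (simp add: ab)
qed

text \<open>
  If both cells were on the same side of their common facet, points near it would be interior to one
  cell and belong to the other.
\<close>

lemma outward_normals_opposite:
  assumes K: "K \<in> T" "e facet_of K" and K': "K' \<in> T" "e facet_of K'" and ne: "K \<noteq> K'"
  shows "outward_normal K' e = - outward_normal K e"
proof -
  obtain a b where ab: "b \<noteq> 0" "affine hull e = {x. a + b \<bullet> x = 0}" "\<And>x. x \<in> K \<Longrightarrow> 0 \<le> a + b \<bullet> x"
    "outward_normal K e = - (1 / norm b) *\<^sub>R b" using facet_inequality[OF K] by metis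
  obtain a' b' where ab': "b' \<noteq> 0" "affine hull e = {x. a' + b' \<bullet> x = 0}" "\<And>x. x \<in> K' \<Longrightarrow> 0 \<le> a' + b' \<bullet> x"
    "outward_normal K' e = - (1 / norm b') *\<^sub>R b'" using facet_inequality[OF K'] by metis
  note fp = facet_props[OF K]
  obtain y where y: "y \<in> e" "cball y (inradius * h) \<inter> affine hull e \<subseteq> e" using facet_inball[OF K] by metis
  have r0: "inradius * h > 0" using inradius h by simp
  have yH: "a + b \<bullet> y = 0" "a' + b' \<bullet> y = 0" using hull_inc[OF y(1), of affine] ab(2) ab'(2) by auto
  \<comment> \<open>The two equations describe the same hyperplane, so their gradients are parallel;
    the sign of the factor \<open>t\<close> decides on which sides the cells lie.\<close>
  define t where "t = (b' \<bullet> b) / (norm b)\<^sup>2"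
  have "b' - t *\<^sub>R b = 0"
  proof -
    define d where "d = b' - t *\<^sub>R b"
    have bd: "b \<bullet> d = 0" using ab(1) by (simp add: d_def t_def inner_diff_right power2_norm_eq_inner inner_commute)
    have "y + d \<in> affine hull e" using yH(1) bd unfolding ab(2) by (simp add: inner_add_right)
    then have "b' \<bullet> d = 0" using yH(2) unfolding ab'(2) by (simp add: inner_add_right)
    moreover have "b' \<bullet> d = d \<bullet> d + t * (b \<bullet> d)" by (simp add: d_def inner_diff_left)
    ultimately show ?thesis using bd by (simp add: d_def)
  qed
  then have b': "b' = t *\<^sub>R b" by simp
  then have t0: "t \<noteq> 0" using ab'(1) by auto
  have a': "a' = t * a" using yH b' by (metis add.inverse_inverse add_eq_0_iff inner_scaleR_left mult_minus_right)
  have "t < 0"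
  proof (rule ccontr)
    assume "\<not> t < 0"
    with t0 have t: "t > 0" by simp
    obtain w where w: "cball w (inradius * h) \<subseteq> K" using cell_inball[OF K(1)] by blast
    obtain w' where w': "cball w' (inradius * h) \<subseteq> K'" using cell_inball[OF K'(1)] by blast
    have ineq: "b \<bullet> (w - y) > 0" if "cball w (inradius * h) \<subseteq> K \<or> cball w (inradius * h) \<subseteq> K'" for w
    proof -
      define x where "x = w - (inradius * h / norm b) *\<^sub>R b"
      have "x \<in> cball w (inradius * h)" using ab(1) r0 by (simp add: x_def dist_norm)
      then have "0 \<le> a + b \<bullet> x"
        using that ab(3)[of x] ab'(3)[of x] t a' b' by (auto simp: zero_le_mult_iff distrib_left[symmetric])
      moreover have "b \<bullet> x = b \<bullet> w - inradius * h * norm b"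
        using ab(1) by (simp add: x_def inner_diff_right power2_norm_eq_inner[symmetric] power2_eq_square)
      moreover have "inradius * h * norm b > 0" using r0 ab(1) by simp
      ultimately show ?thesis using yH(1) by (simp add: inner_diff_right)
    qed
    have p: "b \<bullet> (w - y) > 0" "b \<bullet> (w' - y) > 0" using ineq w w' by auto
    \<comment> \<open>The factor that brings \<open>w' - y\<close> to the same height above the
      facet as \<open>w - y\<close>, so that the difference \<open>d\<close> is tangential.\<close>
    define l where "l = (b \<bullet> (w - y)) / (b \<bullet> (w' - y))"
    have l: "l > 0" using p by (simp add: l_def)
    define d where "d = (w - y) - l *\<^sub>R (w' - y)"
    have bd: "b \<bullet> d = 0" using p by (simp add: d_def inner_diff_right[of b "w - y"] l_def)
    \<comment> \<open>Small enough that \<open>1 - s * l\<close> stays at least \<open>1 / 2\<close>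
      and that the tangential displacement of \<open>q\<close> below stays within the relative ball
      contained in the facet.\<close>
    define s where "s = min (1 / 2) (min (1 / (2 * l)) (inradius * h / (2 * (norm d + 1))))"
    have s: "0 < s" "s \<le> 1 / 2" "s * l \<le> 1 / 2" "2 * s * norm d \<le> inradius * h"
    proof -
      show "s \<le> 1 / 2" unfolding s_def by (rule min.cobounded1)
      have "0 < 2 * (norm d + 1)" by (simp add: add_nonneg_pos)
      then have "0 < inradius * h / (2 * (norm d + 1))" using r0 by (rule divide_pos_pos[rotated])
      then show "0 < s" using l by (simp add: s_def)
      have "s * l \<le> 1 / (2 * l) * l" using l by (intro mult_right_mono) (auto simp: s_def)
      then show "s * l \<le> 1 / 2" using l by simp
      have "2 * s * norm d \<le> 2 * s * (norm d + 1)" using \<open>0 < s\<close> by (intro mult_left_mono) auto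
      also have "\<dots> \<le> 2 * (inradius * h / (2 * (norm d + 1))) * (norm d + 1)" by (intro mult_right_mono) (auto simp: s_def)
      also have "\<dots> = inradius * h" using norm_ge_zero[of d] by (simp add: field_simps add_nonneg_eq_0_iff)
      finally show "2 * s * norm d \<le> inradius * h" .
    qed
    define x where "x = y + s *\<^sub>R (w - y)"
    have "x \<in> interior K"
    proof -
      have "w \<in> interior K" using w r0 by (meson mem_interior_cball)
      moreover have "y \<in> K" using y(1) fp(3) by blast
      ultimately have "(1 - s) *\<^sub>R y + s *\<^sub>R w \<in> interior K"
        using s mem_interior_convex_shrink[OF cell_convex[OF K(1)], of w y s] by (simp add: algebra_simps)
      then show ?thesis by (simp add: x_def algebra_simps)
    qed
    moreover have "x \<in> K'"
    proof -
      \<comment> \<open>The point of the facet for which \<open>x\<close> is the convex combination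
        of \<open>q\<close> and \<open>w'\<close> with weight \<open>s * l\<close> at
        \<open>w'\<close>. Thus \<open>x\<close>, an interior point of \<open>K\<close>, also
        belongs to \<open>K'\<close>.\<close>
      define q where "q = y + (s / (1 - s * l)) *\<^sub>R d"
      have "norm ((s / (1 - s * l)) *\<^sub>R d) \<le> 2 * s * norm d"
      proof -
        have "s / (1 - s * l) \<le> s / (1 / 2)" using s by (intro divide_left_mono) auto
        then have "s / (1 - s * l) \<le> 2 * s" by simp
        moreover have "0 \<le> s / (1 - s * l)" using s by simp
        ultimately show ?thesis by (simp only: norm_scaleR abs_of_nonneg) (simp only: mult_right_mono norm_ge_zero)
      qed
      then have "q \<in> cball y (inradius * h)" using s(4) by (simp add: q_def dist_norm)
      moreover have "q \<in> affine hull e" using yH(1) bd unfolding ab(2) q_def by (simp add: inner_add_right)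
      ultimately have "q \<in> K'" using y(2) facet_props(3)[OF K'] by blast
      moreover have "w' \<in> K'" using w' r0 by auto
      ultimately have "(1 - s * l) *\<^sub>R q + (s * l) *\<^sub>R w' \<in> K'"
        using s l by (intro convexD[OF cell_convex[OF K'(1)]]) auto
      also have "(1 - s * l) *\<^sub>R q = (1 - s * l) *\<^sub>R y + s *\<^sub>R d"
        using s by (simp add: q_def scaleR_add_right)
      also have "(1 - s * l) *\<^sub>R y + s *\<^sub>R d + (s * l) *\<^sub>R w' = x"
        by (simp add: x_def d_def algebra_simps)
      finally show ?thesis .
    qed
    moreover have "(K \<inter> K') face_of K" using conforming K(1) K'(1) by blast
    moreover have "K \<inter> K' \<noteq> K"
      using intersection_dim(1)[OF K(1) K'(1) ne] cell_aff_dim[OF K(1)] by auto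
    ultimately show False using face_of_disjoint_interior[of "K \<inter> K'" K] interior_subset by blast
  qed
  then have "- (1 / norm b') *\<^sub>R b' = (1 / norm b) *\<^sub>R b" using ab(1) by (simp add: b')
  then show ?thesis using ab(4) ab'(4) by simp
qed

text \<open>The choice in the definition is meaningful because affine interpolants chosen on each
  cell separately already satisfy the jump conditions: the normals are opposite, and by the
  barycenter rule the integrals from both sides are the area times the common prescribed
  value.\<close>

lemma CR_lift_exists:
  "CR_lift T \<mu>' \<in> CR_space T" "K \<in> T \<Longrightarrow> e facet_of K \<Longrightarrow> CR_lift T \<mu>' K (barycenter e) = \<mu>' e (barycenter e)"
proof -
  have "\<exists>f. affine_function f \<and> (\<forall>e. e facet_of K \<longrightarrow> f (barycenter e) = \<mu>' e (barycenter e))" if "K \<in> T" for K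
    using cell_CR_interpolation[OF that, of "\<lambda>e. \<mu>' e (barycenter e)"] by metis
  then obtain f where f: "\<And>K. K \<in> T \<Longrightarrow> affine_function (f K)"
    "\<And>K e. K \<in> T \<Longrightarrow> e facet_of K \<Longrightarrow> f K (barycenter e) = \<mu>' e (barycenter e)" by metis
  have "f \<in> cell_space 1 T"
    using f(1) affine_polynomial_degree_one unfolding cell_space_def poly_space_def by blast
  moreover have "face_integral e (jump f K K' e) = 0" if K: "K \<in> T" "K' \<in> T" "K \<noteq> K'" "e facet_of K" "e facet_of K'" for K K' e
  proof -
    note fp = facet_props[OF K(1,4)]
    define n where "n = outward_normal K e"
    have op: "outward_normal K' e = - n" using outward_normals_opposite[OF K(1,4,2,5,3)] by (simp add: n_def)
    have cont: "continuous_on UNIV (f K)" "continuous_on UNIV (f K')" using affine_function_continuous f(1) K by auto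
    have "jump f K K' e = (\<lambda>x. (f K x - f K' x) *\<^sub>R n)"
      unfolding jump_def op by (simp add: n_def scaleR_diff_left)
    then have "face_integral e (jump f K K' e) = face_integral e (\<lambda>x. f K x - f K' x) *\<^sub>R n"
      using set_integrable_face[OF fp(1,4), of "\<lambda>x. f K x - f K' x"] cont
      unfolding face_integral_def set_lebesgue_integral_def set_integrable_def
      by (simp add: continuous_on_diff)
    also have "face_integral e (\<lambda>x. f K x - f K' x) = face_integral e (f K) - face_integral e (f K')"
      by (rule face_integral_diff[OF fp(1,4) cont])
    also have "\<dots> = 0" using facet_integral_affine_function[OF K(1,4) f(1)] facet_integral_affine_function[OF K(2,5) f(1)] f(2) K by simp
    finally show ?thesis by simp
  qed
  ultimately have "f \<in> CR_space T \<and> (\<forall>K\<in>T. \<forall>e. e facet_of K \<longrightarrow> f K (barycenter e) = \<mu>' e (barycenter e))"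
    using f(2) by (simp add: CR_space_def)
  then have *: "CR_lift T \<mu>' \<in> CR_space T \<and> (\<forall>K\<in>T. \<forall>e. e facet_of K \<longrightarrow> CR_lift T \<mu>' K (barycenter e) = \<mu>' e (barycenter e))"
    unfolding CR_lift_def
    by (rule someI[where P = "\<lambda>f. f \<in> CR_space T \<and> (\<forall>K\<in>T. \<forall>e. e facet_of K \<longrightarrow> f K (barycenter e) = \<mu>' e (barycenter e))"])
  then show "CR_lift T \<mu>' \<in> CR_space T" by blast
  show "CR_lift T \<mu>' K (barycenter e) = \<mu>' e (barycenter e)" if "K \<in> T" "e facet_of K" using * that by blast
qed

end

section \<open>Estimates on a cell and the theorem\<close>

lemma admissible_uniform_mesh:
  fixes \<Omega> :: "'a::euclidean_space set"
  assumes \<Omega>: "polyhedral_domain \<Omega>" and \<kappa>: "\<kappa> > 0" and T: "admissible_mesh \<Omega> \<kappa> A T"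
  shows "uniform_mesh T (mesh_size T) (\<kappa> / max A 1 ^ DIM('a)) (diameter (closure \<Omega>))" "\<Union>T = closure \<Omega>"
proof -
  \<comment> \<open>The maximum with 1 makes the divisor positive for every real
    \<open>A\<close>.\<close>
  define M where "M = max A 1"
  have M: "M \<ge> 1" "A \<le> M" by (auto simp: M_def)
  have T': "triangulation T" "\<And>K. K \<in> T \<Longrightarrow> int DIM('a) simplex K" and U: "\<Union>T = closure \<Omega>"
    and sr: "\<And>K. K \<in> T \<Longrightarrow> measure lebesgue K / diameter K ^ DIM('a) \<ge> \<kappa>"
    and qu: "\<And>K K'. K \<in> T \<Longrightarrow> K' \<in> T \<Longrightarrow> diameter K / diameter K' \<le> A"
    using T by (auto simp: admissible_mesh_def simplicial_mesh_def shape_regular_def quasi_uniform_def)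
  show "\<Union>T = closure \<Omega>" by (rule U)
  have fin: "finite T" using T'(1) by (simp add: triangulation_def)
  have bd: "bounded (closure \<Omega>)" "\<Omega> \<noteq> {}" using \<Omega> by (auto simp: polyhedral_domain_def)
  have ne: "T \<noteq> {}" using U bd(2) closure_subset by force
  have comp: "compact K" if "K \<in> T" for K using T'(2)[OF that] compact_simplex by blast
  have dpos: "diameter K > 0" if "K \<in> T" for K
  proof -
    have "diameter K \<noteq> 0"
    proof
      assume "diameter K = 0"
      \<comment> \<open>Division by zero yields 0, which contradicts the positive lower bound
        \<kappa>.\<close>
      then show False using sr[OF that] \<kappa> DIM_positive[where 'a = 'a] by (simp add: power_0_left)
    qed
    then show ?thesis using diameter_ge_0[OF compact_imp_bounded[OF comp[OF that]]] by simp
  qed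
  have "mesh_size T \<in> diameter ` T" unfolding mesh_size_def using fin ne by (intro Max_in) auto
  then obtain K0 where K0: "K0 \<in> T" "mesh_size T = diameter K0" by blast
  have dle: "diameter K \<le> mesh_size T" if "K \<in> T" for K
    unfolding mesh_size_def using fin that by (intro Max_ge) auto
  show "uniform_mesh T (mesh_size T) (\<kappa> / max A 1 ^ DIM('a)) (diameter (closure \<Omega>))"
  proof (unfold_locales)
    show "finite T" by (rule fin)
    show "int DIM('a) simplex K" if "K \<in> T" for K using T'(2)[OF that] .
    show "(K \<inter> K') face_of K" if "K \<in> T" "K' \<in> T" for K K' using T'(1) that by (auto simp: triangulation_def)
    show "0 < mesh_size T" using K0 dpos by simp
    have "diameter K0 \<le> diameter (closure \<Omega>)" using K0(1) U bd(1) by (intro diameter_subset) auto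
    then show "mesh_size T \<le> diameter (closure \<Omega>)" using K0(2) by simp
    show "dist x y \<le> mesh_size T" if "K \<in> T" "x \<in> K" "y \<in> K" for K x y
      using diameter_bounded_bound[OF compact_imp_bounded[OF comp[OF that(1)]] that(2,3)] dle[OF that(1)] by linarith
    show "dist x y \<le> diameter (closure \<Omega>)" if "x \<in> \<Union>T" "y \<in> \<Union>T" for x y
      using that U bd(1) by (intro diameter_bounded_bound) auto
    show "0 < \<kappa> / max A 1 ^ DIM('a)" using \<kappa> by simp
    show "\<kappa> / max A 1 ^ DIM('a) * mesh_size T ^ DIM('a) \<le> measure lebesgue K" if K: "K \<in> T" for K
    proof -
      have "mesh_size T / diameter K \<le> M" using qu[OF K0(1) K] K0(2) M by simp
      then have "mesh_size T \<le> M * diameter K" using dpos[OF K] by (simp add: field_simps)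
      then have "mesh_size T ^ DIM('a) \<le> (M * diameter K) ^ DIM('a)" using K0 dpos by (intro power_mono) (auto simp: less_imp_le)
      then have "mesh_size T ^ DIM('a) / M ^ DIM('a) \<le> diameter K ^ DIM('a)" using M by (simp add: power_mult_distrib field_simps)
      then have "\<kappa> * (mesh_size T ^ DIM('a) / M ^ DIM('a)) \<le> \<kappa> * diameter K ^ DIM('a)" using \<kappa> by (intro mult_left_mono) auto
      also have "\<dots> \<le> measure lebesgue K" using sr[OF K] dpos[OF K] by (simp add: field_simps)
      finally show ?thesis by (simp add: M_def)
    qed
  qed
qed

text \<open>Completeness of Lebesgue measure. The gradient of \<open>u K\<close> has no controlled
  values on the boundary of the cell, so measurability has to be independent of them.\<close>

lemma borel_measurable_lebesgue_eq_off_negligible: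
  fixes f g :: "'a::euclidean_space \<Rightarrow> real"
  assumes g: "g \<in> borel_measurable lebesgue" and N: "negligible N" and eq: "\<And>x. x \<notin> N \<Longrightarrow> f x = g x"
  shows "f \<in> borel_measurable lebesgue"
proof (rule measurableI)
  fix S :: "real set" assume S: "S \<in> sets borel"
  have "g -` S \<in> sets lebesgue" using measurable_sets[OF g S] by simp
  moreover have "N \<in> sets lebesgue" "f -` S \<inter> N \<in> sets lebesgue"
    using N negligible_subset[OF N] by (auto intro!: negligible_imp_sets)
  moreover have "f -` S \<inter> space lebesgue = (g -` S - N) \<union> (f -` S \<inter> N)" using eq by auto
  ultimately show "f -` S \<inter> space lebesgue \<in> sets lebesgue" by (simp only:) (intro sets.Un sets.Diff)
qed simp

text \<open>Derivatives are local, hence agree in the interior, and the frontier of a convex set is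
  a null set. This replaces a cell function by the polynomial that represents it.\<close>

lemma integral_gradient_cong:
  fixes f p :: "'a::euclidean_space \<Rightarrow> real"
  assumes K: "compact K" "convex K" and p: "polynomial_of_degree_le k p" and eq: "\<And>x. x \<in> K \<Longrightarrow> f x = p x"
  shows "(LINT x:K|lebesgue. (norm (gradient f x))\<^sup>2) = (LINT x:K|lebesgue. (norm (gradient p x))\<^sup>2)"
proof -
  have neg: "negligible (frontier K)" by (rule negligible_convex_frontier[OF K(2)])
  have g: "gradient f x = gradient p x" if x: "x \<in> interior K" for x
  proof -
    have "frechet_derivative p (at x) = frechet_derivative f (at x)"
      by (rule frechet_derivative_transform_within_open[OF differentiable_polynomial[OF p] open_interior x])
        (metis eq interior_subset subsetD)
    then show ?thesis by (simp add: gradient_def)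
  qed
  have e: "indicator K x *\<^sub>R (norm (gradient f x))\<^sup>2 = indicator K x *\<^sub>R (norm (gradient p x))\<^sup>2" if "x \<notin> frontier K" for x
    using that g[of x] K(1) by (auto simp: indicator_def frontier_def compact_imp_closed)
  have m: "(\<lambda>x. indicator K x *\<^sub>R (norm (gradient p x))\<^sup>2) \<in> borel_measurable lebesgue"
    using set_integrable_continuous_compact[OF K(1) continuous_on_gradient[OF p]] unfolding set_integrable_def by (rule borel_measurable_integrable)
  have m': "(\<lambda>x. indicator K x *\<^sub>R (norm (gradient f x))\<^sup>2) \<in> borel_measurable lebesgue"
    by (rule borel_measurable_lebesgue_eq_off_negligible[OF m neg e])
  have ae: "AE x in lebesgue. x \<notin> frontier K" using neg by (simp add: negligible_iff_null_sets AE_not_in)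
  show ?thesis unfolding set_lebesgue_integral_def
    by (rule integral_cong_AE[OF m' m]) (use ae e in \<open>auto elim: eventually_mono\<close>)
qed

lemma gradient_affine:
  fixes b :: "'a::euclidean_space"
  shows "gradient (\<lambda>x. a + b \<bullet> x) x = b"
proof -
  have "((\<lambda>x. a + b \<bullet> x) has_derivative (\<lambda>v. b \<bullet> v)) (at x)" by (auto intro!: derivative_eq_intros)
  then have "frechet_derivative (\<lambda>x. a + b \<bullet> x) (at x) = (\<lambda>v. b \<bullet> v)" by (rule frechet_derivative_at[symmetric])
  then show ?thesis by (simp add: gradient_def euclidean_representation)
qed

lemma set_lebesgue_integral_cong_on:
  assumes "\<And>x. x \<in> S \<Longrightarrow> f x = g x"
  shows "(LINT x:S|M. f x) = (LINT x:S|M. g x)"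
  unfolding set_lebesgue_integral_def using assms by (intro Bochner_Integration.integral_cong) (auto simp: indicator_def)

lemma weighted_square_sum_le:
  fixes m f :: "'b \<Rightarrow> real"
  assumes "\<And>i. i \<in> I \<Longrightarrow> 0 \<le> m i"
  shows "(\<Sum>i\<in>I. m i * f i)\<^sup>2 \<le> sum m I * (\<Sum>i\<in>I. m i * (f i)\<^sup>2)"
proof -
  have "0 \<le> (\<Sum>i\<in>I. \<Sum>j\<in>I. m i * m j * (f i - f j)\<^sup>2)" using assms by (intro sum_nonneg) auto
  then show ?thesis using variation_total[of m f I] by simp
qed

lemma set_integral_le_measure_mult:
  fixes f g :: "'a::euclidean_space \<Rightarrow> real"
  assumes S: "compact S" and f: "continuous_on S f" and le: "\<And>x. x \<in> S \<Longrightarrow> (f x)\<^sup>2 \<le> B"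
  shows "(LINT x:S|lebesgue. (f x)\<^sup>2) \<le> measure lebesgue S * B"
proof -
  have "(LINT x:S|lebesgue. (f x)\<^sup>2) \<le> (LINT x:S|lebesgue. B)"
    by (intro set_integral_mono set_integrable_continuous_compact S continuous_intros f le)
  also have "\<dots> = measure lebesgue S * B" using lmeasurable_compact[OF S] by (rule set_integral_const_lebesgue)
  finally show ?thesis .
qed

lemma integral_square_le:
  fixes f :: "'a::euclidean_space \<Rightarrow> real"
  assumes S: "compact S" and f: "continuous_on S f"
  shows "(LINT x:S|lebesgue. f x)\<^sup>2 \<le> measure lebesgue S * (LINT x:S|lebesgue. (f x)\<^sup>2)"
proof (cases "measure lebesgue S = 0")
  case True
  then have "negligible S" using lmeasurable_compact[OF S] by (simp add: negligible_iff_measure)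
  then have "AE x in lebesgue. x \<notin> S" by (simp add: negligible_iff_null_sets AE_not_in)
  then have "AE x in lebesgue. indicator S x *\<^sub>R f x = 0" by (auto elim!: eventually_mono)
  then have "(LINT x:S|lebesgue. f x) = 0" unfolding set_lebesgue_integral_def by (rule integral_eq_zero_AE)
  then show ?thesis using True by simp
next
  case False
  define a where "a = measure lebesgue S"
  have a: "a > 0" using False by (simp add: a_def zero_less_measure_iff)
  define m where "m = (LINT x:S|lebesgue. f x) / a"
  have i: "set_integrable lebesgue S (\<lambda>x. (f x)\<^sup>2)" "set_integrable lebesgue S (\<lambda>x. 2 * m * f x)" "set_integrable lebesgue S (\<lambda>x. m\<^sup>2)"
    by (intro set_integrable_continuous_compact S continuous_intros f)+
  have "0 \<le> (LINT x:S|lebesgue. (f x - m)\<^sup>2)" unfolding set_lebesgue_integral_def by (intro integral_nonneg_AE) auto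
  also have "(\<lambda>x. (f x - m)\<^sup>2) = (\<lambda>x. (f x)\<^sup>2 - (2 * m * f x - m\<^sup>2))"
    by (auto simp: power2_eq_square algebra_simps)
  also have "(LINT x:S|lebesgue. (f x)\<^sup>2 - (2 * m * f x - m\<^sup>2)) = (LINT x:S|lebesgue. (f x)\<^sup>2) - ((LINT x:S|lebesgue. 2 * m * f x) - (LINT x:S|lebesgue. m\<^sup>2))"
    using i by (simp add: set_integral_diff)
  also have "(LINT x:S|lebesgue. 2 * m * f x) = 2 * m * (LINT x:S|lebesgue. f x)" by simp
  also have "(LINT x:S|lebesgue. m\<^sup>2) = a * m\<^sup>2" unfolding a_def using lmeasurable_compact[OF S] by (rule set_integral_const_lebesgue)
  also have "2 * m * (LINT x:S|lebesgue. f x) - a * m\<^sup>2 = (LINT x:S|lebesgue. f x)\<^sup>2 / a" using a by (simp add: m_def power2_eq_square field_simps)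
  finally show ?thesis using a by (simp add: a_def[symmetric] field_simps)
qed

section \<open>Estimates on a single cell and sums over cells\<close>

context uniform_mesh begin

lemma cell_nonempty: "K \<in> T \<Longrightarrow> K \<noteq> {}"
proof
  assume "K \<in> T" "K = {}"
  then have "\<mu> * h ^ DIM('a) \<le> 0" using vol[of K] by simp
  moreover have "0 < \<mu> * h ^ DIM('a)" using mu h by simp
  ultimately show False by linarith
qed

lemma facet_exists: assumes "K \<in> T" obtains e where "e facet_of K"
proof -
  obtain C where C: "finite C" "\<not> affine_dependent C" "card C = DIM('a) + 1" "K = convex hull C"
    using cell_vertices[OF assms] by metis
  obtain v where "v \<in> C" using C(3) by fastforce
  then have "convex hull (C - {v}) facet_of K"
    using C DIM_positive[where 'a='a] unfolding C(4) facet_of_convex_hull_affine_independent_alt[OF C(2)] by (auto simp: Suc_le_eq)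
  then show ?thesis by (rule that)
qed

lemma facets_finite: assumes "K \<in> T" shows "finite {e. e facet_of K}" "card {e. e facet_of K} \<le> DIM('a) + 1"
proof -
  obtain C where C: "finite C" "\<not> affine_dependent C" "card C = DIM('a) + 1" "K = convex hull C"
    using cell_vertices[OF assms] by metis
  have sub: "{e. e facet_of K} \<subseteq> (\<lambda>v. convex hull (C - {v})) ` C"
    unfolding C(4) facet_of_convex_hull_affine_independent[OF C(2)] by blast
  then show "finite {e. e facet_of K}" using C(1) finite_surj by blast
  have "card {e. e facet_of K} \<le> card ((\<lambda>v. convex hull (C - {v})) ` C)" using sub C(1) by (intro card_mono) auto
  also have "\<dots> \<le> card C" using C(1) by (rule card_image_le)
  finally show "card {e. e facet_of K} \<le> DIM('a) + 1" using C(3) by simp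
qed

lemma cell_measure_le: "K \<in> T \<Longrightarrow> measure lebesgue K \<le> ball_const * h ^ DIM('a)"
proof -
  assume K: "K \<in> T"
  obtain x where x: "x \<in> K" using cell_nonempty[OF K] by blast
  have "measure lebesgue K \<le> measure lebesgue (cball x h)"
    using diam[OF K x] cell_lmeasurable[OF K] by (intro measure_mono_fmeasurable) (auto intro: fmeasurableD)
  also have "\<dots> = ball_const * h ^ DIM('a)" using h by (intro measure_cball) simp
  finally show ?thesis .
qed

definition area_const :: real where "area_const = ball_const * face_radius ^ DIM('a) / (4 * face_radius)"

lemma area_const_pos: "area_const > 0" using ball_const_pos face_radius by (simp add: area_const_def)

lemma face_area_pos: "K \<in> T \<Longrightarrow> e facet_of K \<Longrightarrow> face_area e > 0"
proof -
  assume "K \<in> T" "e facet_of K"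
  then have "area_const * h ^ DIM('a) \<le> face_area e * h" unfolding area_const_def by (rule face_area_lower)
  moreover have "0 < area_const * h ^ DIM('a)" using area_const_pos h by simp
  ultimately have "0 < face_area e * h" by linarith
  then show ?thesis using h by (simp add: zero_less_mult_iff)
qed

text \<open>Three comparisons: \<open>p x\<close> with the mean of \<open>p\<close> over the facet
  (oscillation), this mean with the mean of \<open>q\<close> (Cauchy-Schwarz), and the latter, which
  is the lifting at the barycenter, with the lifting at \<open>x0\<close> (slope \<open>b\<close>).
  The oscillation estimate is an assumption so that its constant can be obtained once, before any
  mesh is given; \<open>R * inradius = 1\<close> makes the outer ball have radius
  \<open>h\<close>.\<close>

lemma cell_value_bound:
  assumes osc: "\<And>(p :: 'a \<Rightarrow> real) K c r x y. polynomial_of_degree_le k p \<Longrightarrow> r > 0 \<Longrightarrow> convex K \<Longrightarrow> compact K \<Longrightarrow>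
      cball c r \<subseteq> K \<Longrightarrow> K \<subseteq> cball c (R * r) \<Longrightarrow> x \<in> K \<Longrightarrow> y \<in> K \<Longrightarrow>
      (p x - p y)\<^sup>2 \<le> C0 * r\<^sup>2 / r ^ DIM('a) * (LINT x:K|lebesgue. (norm (gradient p x))\<^sup>2)"
    and R: "R * inradius = 1" and C0: "C0 > 0"
    and K: "K \<in> T" and e: "e facet_of K" and p: "polynomial_of_degree_le k p" and q: "polynomial_of_degree_le k q"
    and avg: "\<alpha> + b \<bullet> barycenter e = face_integral e q / face_area e"
    and x: "x \<in> K" and x0: "x0 \<in> K"
  shows "(p x - (\<alpha> + b \<bullet> x0))\<^sup>2 \<le> 3 * (C0 * (inradius * h)\<^sup>2 / (inradius * h) ^ DIM('a) * (LINT x:K|lebesgue. (norm (gradient p x))\<^sup>2)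
     + face_integral e (\<lambda>x. (p x - q x)\<^sup>2) / face_area e + h\<^sup>2 * (norm b)\<^sup>2)"
proof -
  note fp = facet_props[OF K e]
  have A: "face_area e > 0" by (rule face_area_pos[OF K e])
  define G where "G = C0 * (inradius * h)\<^sup>2 / (inradius * h) ^ DIM('a) * (LINT x:K|lebesgue. (norm (gradient p x))\<^sup>2)"
  obtain c where c: "cball c (inradius * h) \<subseteq> K" using cell_inball[OF K] by blast
  have r0: "inradius * h > 0" using inradius h by simp
  have cK: "c \<in> K" using c r0 by auto
  have Kc: "K \<subseteq> cball c (R * (inradius * h))"
    using diam[OF K cK] R by (auto simp: mult.assoc[symmetric])
  have o: "(p x - p y)\<^sup>2 \<le> G" if "y \<in> K" for y
    unfolding G_def by (rule osc[OF p r0 cell_convex[OF K] cell_compact[OF K] c Kc x that])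
  have G0: "G \<ge> 0" using o[OF x] by simp
  have o': "\<bar>p x - p y\<bar> \<le> sqrt G" if "y \<in> K" for y using o[OF that] real_sqrt_le_mono[of "(p x - p y)\<^sup>2" G] by simp
  have cp: "continuous_on UNIV p" "continuous_on UNIV q" using continuous_on_polynomial p q by blast+
  define P where "P = face_integral e p / face_area e"
  have 1: "(p x - P)\<^sup>2 \<le> G"
  proof -
    have bd: "p x - sqrt G \<le> p y \<and> p y \<le> p x + sqrt G" if "y \<in> e" for y
      using o'[of y] that fp(3) by (auto simp: abs_le_iff)
    have "face_integral e p \<le> face_integral e (\<lambda>y. p x + sqrt G)"
      using bd by (intro face_integral_mono fp cp continuous_intros) auto
    moreover have "face_integral e (\<lambda>y. p x - sqrt G) \<le> face_integral e p"
      using bd by (intro face_integral_mono fp cp continuous_intros) auto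
    ultimately have "face_area e * (p x - sqrt G) \<le> face_integral e p" "face_integral e p \<le> face_area e * (p x + sqrt G)"
      using face_integral_const[OF fp(1,4)] by auto
    then have "p x - sqrt G \<le> P" "P \<le> p x + sqrt G" using A by (auto simp: P_def field_simps)
    then have "\<bar>p x - P\<bar> \<le> sqrt G" by (simp add: abs_le_iff)
    then have "\<bar>p x - P\<bar>\<^sup>2 \<le> (sqrt G)\<^sup>2" by (rule power_mono) simp
    then show ?thesis using G0 by simp
  qed
  have 2: "(P - face_integral e q / face_area e)\<^sup>2 \<le> face_integral e (\<lambda>x. (p x - q x)\<^sup>2) / face_area e"
  proof -
    have "P - face_integral e q / face_area e = face_integral e (\<lambda>x. p x - q x) / face_area e"
      unfolding P_def face_integral_diff[OF fp(1,4) cp] by (simp add: diff_divide_distrib)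
    then have "(P - face_integral e q / face_area e)\<^sup>2 = (face_integral e (\<lambda>x. p x - q x))\<^sup>2 / (face_area e)\<^sup>2" by (simp add: power_divide)
    also have "\<dots> \<le> (face_area e * face_integral e (\<lambda>x. (p x - q x)\<^sup>2)) / (face_area e)\<^sup>2"
      using cp by (intro divide_right_mono face_integral_square_le fp continuous_intros) auto
    also have "\<dots> = face_integral e (\<lambda>x. (p x - q x)\<^sup>2) / face_area e" using A by (simp add: power2_eq_square)
    finally show ?thesis .
  qed
  have 3: "(face_integral e q / face_area e - (\<alpha> + b \<bullet> x0))\<^sup>2 \<le> h\<^sup>2 * (norm b)\<^sup>2"
  proof -
    have "\<bar>b \<bullet> (barycenter e - x0)\<bar> \<le> norm b * norm (barycenter e - x0)" by (rule Cauchy_Schwarz_ineq2)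
    also have "\<dots> \<le> norm b * h" using diam[OF K _ x0, of "barycenter e"] fp(3,6) by (intro mult_left_mono) (auto simp: dist_norm)
    finally have "\<bar>b \<bullet> (barycenter e - x0)\<bar>\<^sup>2 \<le> (norm b * h)\<^sup>2" by (rule power_mono) simp
    moreover have "face_integral e q / face_area e - (\<alpha> + b \<bullet> x0) = b \<bullet> (barycenter e - x0)" unfolding avg[symmetric] by (simp add: inner_diff_right)
    ultimately show ?thesis by (simp add: power_mult_distrib mult.commute)
  qed
  have sq3: "(u + v + w)\<^sup>2 \<le> 3 * (u\<^sup>2 + v\<^sup>2 + w\<^sup>2)" for u v w :: real
  proof -
    have "0 \<le> (u - v)\<^sup>2 + (v - w)\<^sup>2 + (u - w)\<^sup>2" by simp
    then show ?thesis by (simp add: power2_eq_square algebra_simps)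
  qed
  have "(p x - (\<alpha> + b \<bullet> x0))\<^sup>2 = ((p x - P) + (P - face_integral e q / face_area e) + (face_integral e q / face_area e - (\<alpha> + b \<bullet> x0)))\<^sup>2"
    by (intro arg_cong[where f = "\<lambda>t. t\<^sup>2"]) simp
  also have "\<dots> \<le> 3 * ((p x - P)\<^sup>2 + (P - face_integral e q / face_area e)\<^sup>2 + (face_integral e q / face_area e - (\<alpha> + b \<bullet> x0))\<^sup>2)" by (rule sq3)
  also have "\<dots> \<le> 3 * (G + face_integral e (\<lambda>x. (p x - q x)\<^sup>2) / face_area e + h\<^sup>2 * (norm b)\<^sup>2)"
    using 1 2 3 by (intro mult_left_mono add_mono) auto
  finally show ?thesis by (simp add: G_def)
qed

text \<open>The pointwise bound multiplied by the volume of the cell. A single facet suffices, and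
  its contribution is bounded by the sum over all facets.\<close>

lemma cell_estimate:
  assumes osc: "\<And>(p :: 'a \<Rightarrow> real) K c r x y. polynomial_of_degree_le k p \<Longrightarrow> r > 0 \<Longrightarrow> convex K \<Longrightarrow> compact K \<Longrightarrow>
      cball c r \<subseteq> K \<Longrightarrow> K \<subseteq> cball c (R * r) \<Longrightarrow> x \<in> K \<Longrightarrow> y \<in> K \<Longrightarrow>
      (p x - p y)\<^sup>2 \<le> C0 * r\<^sup>2 / r ^ DIM('a) * (LINT x:K|lebesgue. (norm (gradient p x))\<^sup>2)"
    and R: "R * inradius = 1" and C0: "C0 > 0"
    and K: "K \<in> T" and u: "(u, uh) \<in> hdg_space k T" and x0: "x0 \<in> K"
    and w: "\<And>x. x \<in> K \<Longrightarrow> CR_lift T (face_average uh) K x = \<alpha> + b \<bullet> x"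
  shows "(LINT x:K|lebesgue. (u K x - (\<alpha> + b \<bullet> x0))\<^sup>2) \<le>
    3 * (ball_const * C0 * inradius\<^sup>2 / inradius ^ DIM('a) * (h\<^sup>2 * (LINT x:K|lebesgue. (norm (gradient (u K) x))\<^sup>2))
     + ball_const / area_const * (h * (\<Sum>e | e facet_of K. face_integral e (\<lambda>x. (u K x - uh e x)\<^sup>2))) + D\<^sup>2 * (measure lebesgue K * (norm b)\<^sup>2))"
proof -
  obtain e where e: "e facet_of K" using facet_exists[OF K] by blast
  note fp = facet_props[OF K e]
  have eT: "e \<in> faces T" using K e by (auto simp: faces_def)
  obtain p where p: "polynomial_of_degree_le k p" "\<And>x. x \<in> K \<Longrightarrow> u K x = p x"
    using u K by (auto simp: hdg_space_def cell_space_def poly_space_def)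
  obtain q where q: "polynomial_of_degree_le k q" "\<And>x. x \<in> e \<Longrightarrow> uh e x = q x"
    using u eT by (auto simp: hdg_space_def face_space_def poly_space_def)
  have qi: "face_integral e (uh e) = face_integral e q" using q(2) by (rule face_integral_cong)
  have avg: "\<alpha> + b \<bullet> barycenter e = face_integral e q / face_area e"
    using w[of "barycenter e"] fp(3,6) CR_lift_exists(2)[OF K e, of "face_average uh"] by (auto simp: face_average_def qi)
  define G where "G = (LINT x:K|lebesgue. (norm (gradient p x))\<^sup>2)"
  define F where "F = face_integral e (\<lambda>x. (p x - q x)\<^sup>2)"
  define S where "S = (\<Sum>e | e facet_of K. face_integral e (\<lambda>x. (u K x - uh e x)\<^sup>2))"
  have Geq: "(LINT x:K|lebesgue. (norm (gradient (u K) x))\<^sup>2) = G"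
    unfolding G_def by (rule integral_gradient_cong[OF cell_compact[OF K] cell_convex[OF K] p])
  have G0: "G \<ge> 0" unfolding G_def set_lebesgue_integral_def by (intro integral_nonneg_AE) auto
  have F0: "F \<ge> 0" unfolding F_def by (intro face_integral_nonneg) auto
  have FS: "F \<le> S"
  proof -
    have "F = face_integral e (\<lambda>x. (u K x - uh e x)\<^sup>2)" unfolding F_def using p(2) q(2) fp(3) by (intro face_integral_cong) auto
    also have "\<dots> \<le> S" unfolding S_def using facets_finite(1)[OF K] e by (intro member_le_sum[of e]) (auto intro: face_integral_nonneg)
    finally show ?thesis .
  qed
  define m where "m = measure lebesgue K"
  have m: "0 \<le> m" "m \<le> ball_const * h ^ DIM('a)" using cell_measure_le[OF K] by (auto simp: m_def)
  have A: "face_area e > 0" by (rule face_area_pos[OF K e])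
  have AL: "area_const * h ^ DIM('a) \<le> face_area e * h" unfolding area_const_def by (rule face_area_lower[OF K e])
  have pv: "(p x - (\<alpha> + b \<bullet> x0))\<^sup>2 \<le> 3 * (C0 * (inradius * h)\<^sup>2 / (inradius * h) ^ DIM('a) * G + F / face_area e + h\<^sup>2 * (norm b)\<^sup>2)"
    if "x \<in> K" for x
    unfolding G_def F_def by (rule cell_value_bound[OF _ R C0 K e p(1) q(1) avg that x0]) (rule osc)
  have "(LINT x:K|lebesgue. (u K x - (\<alpha> + b \<bullet> x0))\<^sup>2) = (LINT x:K|lebesgue. (p x - (\<alpha> + b \<bullet> x0))\<^sup>2)"
    using p(2) by (intro set_lebesgue_integral_cong_on) simp
  also have "\<dots> \<le> m * (3 * (C0 * (inradius * h)\<^sup>2 / (inradius * h) ^ DIM('a) * G + F / face_area e + h\<^sup>2 * (norm b)\<^sup>2))"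
    unfolding m_def
    by (intro set_integral_le_measure_mult cell_compact K continuous_intros continuous_on_polynomial[OF p(1)] pv)
  also have "\<dots> = 3 * (m * (C0 * (inradius * h)\<^sup>2 / (inradius * h) ^ DIM('a) * G) + m * (F / face_area e) + h\<^sup>2 * (m * (norm b)\<^sup>2))"
    by (simp add: algebra_simps)
  also have "\<dots> \<le> 3 * (ball_const * C0 * inradius\<^sup>2 / inradius ^ DIM('a) * (h\<^sup>2 * G) + ball_const / area_const * (h * S) + D\<^sup>2 * (m * (norm b)\<^sup>2))"
  proof (intro mult_left_mono add_mono)
    have "m * (C0 * (inradius * h)\<^sup>2 / (inradius * h) ^ DIM('a) * G) \<le> ball_const * h ^ DIM('a) * (C0 * (inradius * h)\<^sup>2 / (inradius * h) ^ DIM('a) * G)"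
      using m G0 C0 inradius h by (intro mult_right_mono) auto
    also have "\<dots> = ball_const * C0 * inradius\<^sup>2 / inradius ^ DIM('a) * (h\<^sup>2 * G)"
      using h inradius by (simp add: power_mult_distrib field_simps)
    finally show "m * (C0 * (inradius * h)\<^sup>2 / (inradius * h) ^ DIM('a) * G) \<le> ball_const * C0 * inradius\<^sup>2 / inradius ^ DIM('a) * (h\<^sup>2 * G)" .
    \<comment> \<open>Volume of a cell over area of a facet is of order \<open>h\<close>; this is
      the weight of the skeleton term.\<close>
    have "m / face_area e \<le> ball_const / area_const * h"
    proof -
      have "m * area_const \<le> ball_const * h ^ DIM('a) * area_const" using m area_const_pos by (intro mult_right_mono) auto
      also have "\<dots> \<le> ball_const * (face_area e * h)" using AL ball_const_pos by (simp add: mult_ac)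
      finally show ?thesis using A area_const_pos by (simp add: field_simps)
    qed
    then have "m / face_area e * F \<le> ball_const / area_const * h * S"
      using FS F0 h ball_const_pos area_const_pos by (intro mult_mono) auto
    then show "m * (F / face_area e) \<le> ball_const / area_const * (h * S)" by simp
    \<comment> \<open>The factor \<open>h\<^sup>2\<close> is given away here, since the lifting
      enters the final inequalities without a power of \<open>h\<close>.\<close>
    show "h\<^sup>2 * (m * (norm b)\<^sup>2) \<le> D\<^sup>2 * (m * (norm b)\<^sup>2)" using h m by (intro mult_right_mono power_mono) auto
  qed simp
  finally show ?thesis unfolding Geq S_def m_def .
qed

text \<open>Each cell has at most \<open>pack\<close> neighbours, the factor
  \<open>h\<^sup>2\<close> from the jumps cancels the one in \<open>energy\<close>, and
  \<open>h ^ DIM('a)\<close> is at most the volume of a cell divided by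
  \<open>\<mu>\<close>.\<close>

lemma energy_bound:
  assumes g: "\<And>K. K \<in> T \<Longrightarrow> 0 \<le> g K"
    and a: "\<And>K K'. (K, K') \<in> adjacent_cells T \<Longrightarrow> (a K - a K')\<^sup>2 \<le> 2 * h\<^sup>2 * (g K + g K')"
  shows "energy a \<le> 4 * pack / \<mu> * (\<Sum>K\<in>T. measure lebesgue K * g K)"
proof -
  let ?N = "\<lambda>K. {K'. (K, K') \<in> adjacent_cells T}"
  have NT: "?N K \<subseteq> T" for K by (auto simp: adjacent_cells_def)
  then have finN: "finite (?N K)" for K using fin finite_subset by blast
  have cN: "real (card (?N K)) \<le> pack" if K: "K \<in> T" for K
  proof -
    obtain x where x: "x \<in> K" using cell_nonempty[OF K] by blast
    have "?N K \<subseteq> {K' \<in> T. K' \<inter> cball x h \<noteq> {}}"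
    proof clarify
      fix K' assume *: "(K, K') \<in> adjacent_cells T"
      then obtain y where "y \<in> K" "y \<in> K'" by (auto simp: adjacent_cells_def facet_of_def)
      then show "K' \<in> T \<and> K' \<inter> cball x h \<noteq> {}" using * diam[OF K x] by (auto simp: adjacent_cells_def)
    qed
    then have "card (?N K) \<le> card {K' \<in> T. K' \<inter> cball x h \<noteq> {}}" using fin by (intro card_mono) auto
    then show ?thesis using packing1[of x] by linarith
  qed
  have Sig: "adjacent_cells T = (SIGMA K:T. ?N K)" by (auto simp: adjacent_cells_def)
  have swap: "(\<Sum>(K, K')\<in>adjacent_cells T. g K') = (\<Sum>(K, K')\<in>adjacent_cells T. g K)"
    by (rule sum.reindex_bij_witness[where i = prod.swap and j = prod.swap]) (auto intro: sym_adjacent)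
  have "jump_energy T a \<le> (\<Sum>(K, K')\<in>adjacent_cells T. 2 * h\<^sup>2 * (g K + g K'))"
    unfolding jump_energy_def split_def by (intro sum_mono a) simp
  also have "\<dots> = 2 * h\<^sup>2 * ((\<Sum>(K, K')\<in>adjacent_cells T. g K) + (\<Sum>(K, K')\<in>adjacent_cells T. g K'))"
    unfolding split_def by (simp only: sum.distrib[symmetric] sum_distrib_left)
  also have "\<dots> = 4 * h\<^sup>2 * (\<Sum>(K, K')\<in>adjacent_cells T. g K)" unfolding swap by simp
  finally have 1: "jump_energy T a \<le> 4 * h\<^sup>2 * (\<Sum>(K, K')\<in>adjacent_cells T. g K)" .
  have "(\<Sum>(K, K')\<in>adjacent_cells T. g K) = (\<Sum>K\<in>T. \<Sum>K'\<in>?N K. g K)"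
    by (subst Sig, rule sum.Sigma[symmetric]) (use fin finN in auto)
  also have "\<dots> \<le> (\<Sum>K\<in>T. pack * g K)"
  proof (intro sum_mono)
    fix K assume K: "K \<in> T"
    have "(\<Sum>K'\<in>?N K. g K) = real (card (?N K)) * g K" by simp
    also have "\<dots> \<le> pack * g K" by (intro mult_right_mono cN g K)
    finally show "(\<Sum>K'\<in>?N K. g K) \<le> pack * g K" .
  qed
  finally have 2: "(\<Sum>(K, K')\<in>adjacent_cells T. g K) \<le> (\<Sum>K\<in>T. pack * g K)" .
  have "4 * h\<^sup>2 * (\<Sum>(K, K')\<in>adjacent_cells T. g K) \<le> 4 * h\<^sup>2 * (\<Sum>K\<in>T. pack * g K)"
    using 2 by (rule mult_left_mono) simp
  with 1 have J: "jump_energy T a \<le> 4 * h\<^sup>2 * (\<Sum>K\<in>T. pack * g K)" by (rule order_trans)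
  have "energy a \<le> h ^ DIM('a) / h\<^sup>2 * (4 * h\<^sup>2 * (\<Sum>K\<in>T. pack * g K))"
    unfolding energy_def using h by (intro mult_left_mono J) auto
  also have "\<dots> = 4 * pack * (\<Sum>K\<in>T. h ^ DIM('a) * g K)" using h by (simp add: sum_distrib_left mult_ac)
  also have "\<dots> \<le> 4 * pack * (\<Sum>K\<in>T. measure lebesgue K / \<mu> * g K)"
  proof (intro mult_left_mono sum_mono mult_right_mono)
    fix K assume "K \<in> T"
    then show "h ^ DIM('a) \<le> measure lebesgue K / \<mu>" "0 \<le> g K" using vol[of K] mu g by (auto simp: field_simps)
  qed (use pack_pos in auto)
  also have "\<dots> = 4 * pack / \<mu> * (\<Sum>K\<in>T. measure lebesgue K * g K)" by (simp add: sum_distrib_left)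
  finally show ?thesis .
qed

text \<open>Replacing the area of a face by the volume of a cell behind it costs a factor of order
  \<open>1 / h\<close>, and a cell is charged for at most \<open>DIM('a) + 1\<close> facets.\<close>

lemma boundary_sum_bound:
  assumes E: "\<And>e. e \<in> E \<Longrightarrow> c e \<in> L \<and> e facet_of (c e)" and L: "L \<subseteq> T" and f: "\<And>K. K \<in> L \<Longrightarrow> 0 \<le> f K"
  shows "(\<Sum>e\<in>E. face_area e * f (c e)) \<le> real (DIM('a) + 1) * ((1 + D) * ball_const * 2 ^ DIM('a)) / (\<mu> * h) * (\<Sum>K\<in>L. measure lebesgue K * f K)"
proof -
  define U where "U = (1 + D) * ball_const * 2 ^ DIM('a)"
  have U0: "U \<ge> 0" using D_nonneg ball_const_pos by (simp add: U_def)
  have LT: "K \<in> T" if "K \<in> L" for K using L that by blast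
  have finL: "finite L" using L fin finite_subset by blast
  \<comment> \<open>Pairing each face with its cell is injective, so the sum embeds into the sum
    over all pairs of a cell in \<open>L\<close> and one of its facets.\<close>
  have "(\<Sum>e\<in>E. face_area e * f (c e)) = (\<Sum>(K, e)\<in>(\<lambda>e. (c e, e)) ` E. face_area e * f K)"
    by (subst sum.reindex) (auto simp: inj_on_def)
  also have "\<dots> \<le> (\<Sum>(K, e)\<in>(SIGMA K:L. {e. e facet_of K}). face_area e * f K)"
    using E finL facets_finite(1)[OF LT] f by (intro sum_mono2) (auto simp: face_area_def)
  also have "\<dots> = (\<Sum>K\<in>L. \<Sum>e | e facet_of K. face_area e * f K)"
    using finL facets_finite(1)[OF LT] by (subst sum.Sigma) auto
  also have "\<dots> \<le> (\<Sum>K\<in>L. real (DIM('a) + 1) * U / (\<mu> * h) * (measure lebesgue K * f K))"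
  proof (intro sum_mono)
    fix K assume K: "K \<in> L"
    have fa: "face_area e \<le> U * h ^ DIM('a) / h" if "e facet_of K" for e
      using face_area_upper[OF LT[OF K] that] h by (simp add: U_def field_simps)
    have "(\<Sum>e | e facet_of K. face_area e * f K) \<le> (\<Sum>e | e facet_of K. U * h ^ DIM('a) / h * f K)"
      using fa f[OF K] by (intro sum_mono mult_right_mono) auto
    also have "\<dots> = real (card {e. e facet_of K}) * (U * h ^ DIM('a) / h * f K)" by simp
    also have "\<dots> \<le> real (DIM('a) + 1) * (U * h ^ DIM('a) / h * f K)"
      using facets_finite(2)[OF LT[OF K]] U0 h f[OF K] by (intro mult_right_mono) auto
    also have "\<dots> = real (DIM('a) + 1) * U / h * f K * h ^ DIM('a)" by simp
    also have "\<dots> \<le> real (DIM('a) + 1) * U / h * f K * (measure lebesgue K / \<mu>)"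
      using vol[OF LT[OF K]] mu U0 h f[OF K] by (intro mult_left_mono) (auto simp: field_simps)
    also have "\<dots> = real (DIM('a) + 1) * U / (\<mu> * h) * (measure lebesgue K * f K)" using mu h by (simp add: field_simps)
    finally show "(\<Sum>e | e facet_of K. face_area e * f K) \<le> real (DIM('a) + 1) * U / (\<mu> * h) * (measure lebesgue K * f K)" .
  qed
  finally show ?thesis by (simp only: U_def sum_distrib_left)
qed

end

lemma adjacent_value_jump:
  assumes T: "uniform_mesh T h \<mu> D" and KK: "(K, K') \<in> adjacent_cells T"
    and w: "\<And>K x. K \<in> T \<Longrightarrow> x \<in> K \<Longrightarrow> (CR_lift T m K x - a K)\<^sup>2 \<le> h\<^sup>2 * g K"
  shows "(a K - a K')\<^sup>2 \<le> 2 * h\<^sup>2 * (g K + g K')"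
proof -
  interpret uniform_mesh T h \<mu> D by fact
  let ?e = "K \<inter> K'"
  have K: "K \<in> T" "K' \<in> T" "?e facet_of K" "?e facet_of K'" using KK by (auto simp: adjacent_cells_def)
  have be: "barycenter ?e \<in> K" "barycenter ?e \<in> K'" using facet_props(6)[OF K(1,3)] by auto
  define t where "t = m ?e (barycenter ?e)"
  have 1: "(t - a K)\<^sup>2 \<le> h\<^sup>2 * g K" "(t - a K')\<^sup>2 \<le> h\<^sup>2 * g K'"
    using w[OF K(1) be(1)] w[OF K(2) be(2)] CR_lift_exists(2)[OF K(1,3), of m] CR_lift_exists(2)[OF K(2,4), of m] by (auto simp: t_def)
  have "0 \<le> ((t - a K') + (t - a K))\<^sup>2" by simp
  then have "(a K - a K')\<^sup>2 \<le> 2 * (t - a K)\<^sup>2 + 2 * (t - a K')\<^sup>2" by (simp add: power2_eq_square algebra_simps)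
  then show ?thesis using 1 by (simp add: algebra_simps)
qed

lemma CR_lift_affine:
  fixes T :: "'a::euclidean_space set set"
  assumes T: "uniform_mesh T h \<mu> D" and K: "K \<in> T"
  obtains \<alpha> b where "\<And>x. x \<in> K \<Longrightarrow> CR_lift T m K x = \<alpha> + b \<bullet> x"
proof -
  interpret uniform_mesh T h \<mu> D by fact
  obtain p where "polynomial_of_degree_le 1 p" "\<And>x. x \<in> K \<Longrightarrow> CR_lift T m K x = p x"
    using CR_lift_exists(1)[of m] K by (auto simp: CR_space_def cell_space_def poly_space_def)
  moreover from this obtain \<alpha> b where "\<And>x. p x = \<alpha> + b \<bullet> x"
    using polynomial_degree_one_affine unfolding affine_function_def by blast
  ultimately show ?thesis using that by simp
qed

lemma H1_seminorm_square: "(H1_seminorm T u)\<^sup>2 = (\<Sum>K\<in>T. LINT x:K|lebesgue. (norm (gradient (u K) x))\<^sup>2)"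
proof -
  have "0 \<le> (LINT x:K|lebesgue. (norm (gradient (u K) x))\<^sup>2)" for K
    unfolding set_lebesgue_integral_def by (intro integral_nonneg_AE) auto
  then show ?thesis unfolding H1_seminorm_def by (simp add: sum_nonneg)
qed

lemma L2_norm_square: "(L2_norm T u)\<^sup>2 = (\<Sum>K\<in>T. LINT x:K|lebesgue. (u K x)\<^sup>2)"
proof -
  have "0 \<le> (LINT x:K|lebesgue. (u K x)\<^sup>2)" for K
    unfolding set_lebesgue_integral_def by (intro integral_nonneg_AE) auto
  then show ?thesis unfolding L2_norm_def by (simp add: sum_nonneg)
qed

lemma L2_skeleton_norm_square:
  "(L2_skeleton_norm T (\<lambda>K e x. u K x - uh e x))\<^sup>2 = (\<Sum>K\<in>T. \<Sum>e | e facet_of K. face_integral e (\<lambda>x. (u K x - uh e x)\<^sup>2))"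
  unfolding L2_skeleton_norm_def by (simp add: sum_nonneg face_integral_nonneg)

lemma CR_lift_gradient_integral:
  fixes T :: "'a::euclidean_space set set"
  assumes T: "uniform_mesh T h \<mu> D" and K: "K \<in> T" and w: "\<And>x. x \<in> K \<Longrightarrow> w x = \<alpha> + b \<bullet> x"
  shows "(LINT x:K|lebesgue. (norm (gradient w x))\<^sup>2) = measure lebesgue K * (norm b)\<^sup>2"
proof -
  interpret uniform_mesh T h \<mu> D by fact
  have "affine_function (\<lambda>x. \<alpha> + b \<bullet> x)" unfolding affine_function_def by blast
  then have "polynomial_of_degree_le 1 (\<lambda>x. \<alpha> + b \<bullet> x)" by (rule affine_polynomial_degree_one)
  from integral_gradient_cong[OF cell_compact[OF K] cell_convex[OF K] this w]
  have "(LINT x:K|lebesgue. (norm (gradient w x))\<^sup>2) = (LINT x:K|lebesgue. (norm b)\<^sup>2)" by (simp add: gradient_affine)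
  also have "\<dots> = measure lebesgue K * (norm b)\<^sup>2" by (rule set_integral_const_lebesgue[OF cell_lmeasurable[OF K]])
  finally show ?thesis .
qed

text \<open>All constants are collected outside the locale, and the mesh is left behind with two
  families: \<open>a K\<close>, a value of the lifting somewhere in \<open>K\<close>, and
  \<open>g K\<close>, the squared norm of its constant gradient. Everything that follows is algebra
  with these numbers.\<close>

lemma cell_values_exist:
  fixes \<Omega> :: "'a::euclidean_space set" and k :: nat
  assumes \<Omega>: "polyhedral_domain \<Omega>" and mu: "\<mu> > 0" and D: "D \<ge> 0"
  shows "\<exists>C\<ge>0. \<forall>T h u uh. uniform_mesh T h \<mu> D \<longrightarrow> \<Union>T = closure \<Omega> \<longrightarrow> (u, uh) \<in> hdg_space k T \<longrightarrow>
    (\<exists>a g. (\<forall>K\<in>T. 0 \<le> g K) \<and> (\<forall>K\<in>T. \<forall>x\<in>K. (CR_lift T (face_average uh) K x - a K)\<^sup>2 \<le> h\<^sup>2 * g K) \<and>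
      (H1_seminorm T (CR_lift T (face_average uh)))\<^sup>2 = (\<Sum>K\<in>T. measure lebesgue K * g K) \<and>
      (\<Sum>K\<in>T. LINT x:K|lebesgue. (u K x - a K)\<^sup>2) \<le> C * (h\<^sup>2 * (H1_seminorm T u)\<^sup>2
         + h * (L2_skeleton_norm T (\<lambda>K e x. u K x - uh e x))\<^sup>2 + (H1_seminorm T (CR_lift T (face_average uh)))\<^sup>2) \<and>
      (\<Sum>K\<in>T. measure lebesgue K * (a K - (\<Sum>K\<in>T. measure lebesgue K * a K) / measure lebesgue (closure \<Omega>))\<^sup>2)
        \<le> C * (H1_seminorm T (CR_lift T (face_average uh)))\<^sup>2 \<and>
      (\<Sum>K | K \<in> T \<and> \<not> K \<subseteq> \<Omega>. measure lebesgue K * (a K - (\<Sum>K\<in>T. measure lebesgue K * a K) / measure lebesgue (closure \<Omega>))\<^sup>2)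
        \<le> C * h * (H1_seminorm T (CR_lift T (face_average uh)))\<^sup>2)"
proof -
  define b where "b = unit_ball_vol (real DIM('a))"
  have b: "b > 0" by (simp add: b_def)
  \<comment> \<open>Here \<open>\<rho>\<close>, \<open>fr\<close> and \<open>ac\<close> repeat
    \<open>inradius\<close>, \<open>face_radius\<close> and \<open>area_const\<close> as expressions
    in \<open>\<mu>\<close> and \<open>D\<close> alone.\<close>
  define \<rho> where "\<rho> = 1 / (real (DIM('a) + 1) * (1 + 2 * b * 3 ^ DIM('a) / \<mu>))"
  have "1 + 2 * b * 3 ^ DIM('a) / \<mu> > 0" using b mu by (simp add: add_pos_nonneg)
  then have \<rho>: "\<rho> > 0" by (simp add: \<rho>_def)
  define fr where "fr = min \<rho> (1 / (4 * D))"
  define ac where "ac = b * fr ^ DIM('a) / (4 * fr)"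
  obtain C0 where C0: "C0 > 0"
    "\<And>(p :: 'a \<Rightarrow> real) K c r x y. polynomial_of_degree_le k p \<Longrightarrow> r > 0 \<Longrightarrow> convex K \<Longrightarrow> compact K \<Longrightarrow>
      cball c r \<subseteq> K \<Longrightarrow> K \<subseteq> cball c (1 / \<rho> * r) \<Longrightarrow> x \<in> K \<Longrightarrow> y \<in> K \<Longrightarrow>
      (p x - p y)\<^sup>2 \<le> C0 * r\<^sup>2 / r ^ DIM('a) * (LINT x:K|lebesgue. (norm (gradient p x))\<^sup>2)"
    using polynomial_oscillation[where k = k and R = "1 / \<rho>" and ?'a = 'a] by blast
  have "\<exists>C0\<ge>0. \<forall>T h a. uniform_mesh T h \<mu> D \<longrightarrow> \<Union>T = closure \<Omega> \<longrightarrow>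
    (\<Sum>K\<in>T. measure lebesgue K * (a K - (\<Sum>K\<in>T. measure lebesgue K * a K) / measure lebesgue (closure \<Omega>))\<^sup>2) \<le> C0 * uniform_mesh.energy T h a"
    by (rule discrete_poincare[OF \<Omega> mu D]) blast
  then obtain C1 where C1: "C1 \<ge> 0" "\<And>T h a. uniform_mesh T h \<mu> D \<Longrightarrow> \<Union>T = closure \<Omega> \<Longrightarrow>
    (\<Sum>K\<in>T. measure lebesgue K * (a K - (\<Sum>K\<in>T. measure lebesgue K * a K) / measure lebesgue (closure \<Omega>))\<^sup>2) \<le> C1 * uniform_mesh.energy T h a"
    by blast
  have "\<exists>C0\<ge>0. \<forall>T h a. uniform_mesh T h \<mu> D \<longrightarrow> \<Union>T = closure \<Omega> \<longrightarrow>
    (\<Sum>K | K \<in> T \<and> \<not> K \<subseteq> \<Omega>. measure lebesgue K * (a K - (\<Sum>K\<in>T. measure lebesgue K * a K) / measure lebesgue (closure \<Omega>))\<^sup>2) \<le> C0 * h * uniform_mesh.energy T h a"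
    by (rule layer_poincare[OF \<Omega> mu D]) blast
  then obtain C2 where C2: "C2 \<ge> 0" "\<And>T h a. uniform_mesh T h \<mu> D \<Longrightarrow> \<Union>T = closure \<Omega> \<Longrightarrow>
    (\<Sum>K | K \<in> T \<and> \<not> K \<subseteq> \<Omega>. measure lebesgue K * (a K - (\<Sum>K\<in>T. measure lebesgue K * a K) / measure lebesgue (closure \<Omega>))\<^sup>2) \<le> C2 * h * uniform_mesh.energy T h a"
    by blast
  define C3 where "C3 = 3 * (b * C0 * \<rho>\<^sup>2 / \<rho> ^ DIM('a) + b / ac + D\<^sup>2)"
  define C4 where "C4 = 4 * (b * 2 ^ DIM('a) / \<mu>) / \<mu>"
  have C4: "C4 \<ge> 0" using b mu by (simp add: C4_def)
  have ac0: "ac \<ge> 0" using b \<rho> D by (simp add: ac_def fr_def)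
  have C3p: "0 \<le> b * C0 * \<rho>\<^sup>2 / \<rho> ^ DIM('a)" "0 \<le> b / ac" "0 \<le> D\<^sup>2" using b C0(1) \<rho> ac0 by auto
  then have C3: "C3 \<ge> 0" by (simp add: C3_def)
  \<comment> \<open>A sum of nonnegative terms, so that one constant serves all three
    estimates.\<close>
  define C where "C = C3 + C1 * C4 + C2 * C4"
  have Cle: "C \<ge> 0" "C3 \<le> C" "C1 * C4 \<le> C" "C2 * C4 \<le> C" using C3 C1(1) C2(1) C4 by (auto simp: C_def)
  show ?thesis
  proof (intro exI[of _ C] conjI allI impI)
    show "0 \<le> C" by (rule Cle)
    fix T h u uh
    assume T: "uniform_mesh T h \<mu> D" and U: "\<Union>T = closure \<Omega>" and u: "(u, uh) \<in> hdg_space k T"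
    interpret uniform_mesh T h \<mu> D by fact
    have eqs: "ball_const = b" "inradius = \<rho>" "area_const = ac" "pack = b * 2 ^ DIM('a) / \<mu>"
      by (simp_all add: ball_const_def b_def inradius_def grad_const_def \<rho>_def area_const_def ac_def face_radius_def fr_def pack_def)
    let ?w = "CR_lift T (face_average uh)"
    have "\<exists>\<alpha> \<beta>. \<forall>x\<in>K. ?w K x = \<alpha> + \<beta> \<bullet> x" if "K \<in> T" for K
      by (rule CR_lift_affine[OF T that]) blast
    then obtain \<alpha> \<beta> where w: "\<And>K x. K \<in> T \<Longrightarrow> x \<in> K \<Longrightarrow> ?w K x = \<alpha> K + \<beta> K \<bullet> x" by metis
    have "\<exists>x. x \<in> K" if "K \<in> T" for K using cell_nonempty[OF that] by blast
    then obtain x0 where x0: "\<And>K. K \<in> T \<Longrightarrow> x0 K \<in> K" by metis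
    define a where "a K = \<alpha> K + \<beta> K \<bullet> x0 K" for K
    define g where "g K = (norm (\<beta> K))\<^sup>2" for K
    have wa: "(?w K x - a K)\<^sup>2 \<le> h\<^sup>2 * g K" if K: "K \<in> T" "x \<in> K" for K x
    proof -
      have "\<bar>\<beta> K \<bullet> (x - x0 K)\<bar> \<le> norm (\<beta> K) * norm (x - x0 K)" by (rule Cauchy_Schwarz_ineq2)
      also have "\<dots> \<le> norm (\<beta> K) * h" using diam[OF K x0[OF K(1)]] by (intro mult_left_mono) (auto simp: dist_norm)
      finally have "\<bar>\<beta> K \<bullet> (x - x0 K)\<bar>\<^sup>2 \<le> (norm (\<beta> K) * h)\<^sup>2" by (rule power_mono) simp
      moreover have "?w K x - a K = \<beta> K \<bullet> (x - x0 K)" using w[OF K] by (simp add: a_def inner_diff_right)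
      ultimately show ?thesis by (simp add: g_def power_mult_distrib mult.commute)
    qed
    have gn: "0 \<le> g K" for K by (simp add: g_def)
    have W: "(H1_seminorm T ?w)\<^sup>2 = (\<Sum>K\<in>T. measure lebesgue K * g K)"
      unfolding H1_seminorm_square g_def
      by (intro sum.cong refl CR_lift_gradient_integral[OF T _ w]) auto
    define W where "W = (\<Sum>K\<in>T. measure lebesgue K * g K)"
    have W0: "W \<ge> 0" using gn by (simp add: W_def sum_nonneg)
    have en: "energy a \<le> C4 * W"
      using energy_bound[of g a, OF gn adjacent_value_jump[OF T _ wa]] by (simp add: C4_def eqs W_def)
    have 1: "(\<Sum>K\<in>T. measure lebesgue K * (a K - (\<Sum>K\<in>T. measure lebesgue K * a K) / measure lebesgue (closure \<Omega>))\<^sup>2) \<le> C * W"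
    proof -
      have "C1 * energy a \<le> C1 * (C4 * W)" using en C1(1) by (rule mult_left_mono)
      also have "\<dots> \<le> C * W" using mult_right_mono[OF Cle(3) W0] by (simp add: mult.assoc)
      finally show ?thesis using C1(2)[OF T U, of a] by linarith
    qed
    have 2: "(\<Sum>K | K \<in> T \<and> \<not> K \<subseteq> \<Omega>. measure lebesgue K * (a K - (\<Sum>K\<in>T. measure lebesgue K * a K) / measure lebesgue (closure \<Omega>))\<^sup>2) \<le> C * h * W"
    proof -
      have "C2 * h * energy a \<le> C2 * h * (C4 * W)" using C2(1) h by (intro mult_left_mono en) auto
      also have "\<dots> = (C2 * C4) * (h * W)" by simp
      also have "\<dots> \<le> C * (h * W)" using W0 h by (intro mult_right_mono Cle) auto
      finally show ?thesis using C2(2)[OF T U, of a] by (simp add: mult.assoc)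
    qed
    define G where "G = (H1_seminorm T u)\<^sup>2"
    define S where "S = (L2_skeleton_norm T (\<lambda>K e x. u K x - uh e x))\<^sup>2"
    have R: "1 / \<rho> * inradius = 1" using \<rho> eqs by simp
    have 3: "(\<Sum>K\<in>T. LINT x:K|lebesgue. (u K x - a K)\<^sup>2) \<le> C * (h\<^sup>2 * G + h * S + W)"
    proof -
      have ce: "(LINT x:K|lebesgue. (u K x - (\<alpha> K + \<beta> K \<bullet> x0 K))\<^sup>2) \<le>
        3 * (ball_const * C0 * inradius\<^sup>2 / inradius ^ DIM('a) * (h\<^sup>2 * (LINT x:K|lebesgue. (norm (gradient (u K) x))\<^sup>2))
         + ball_const / area_const * (h * (\<Sum>e | e facet_of K. face_integral e (\<lambda>x. (u K x - uh e x)\<^sup>2))) + D\<^sup>2 * (measure lebesgue K * (norm (\<beta> K))\<^sup>2))"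
        if K: "K \<in> T" for K
        by (rule cell_estimate[OF _ R C0(1) K u x0[OF K] w[OF K]]) (rule C0(2))
      have "(\<Sum>K\<in>T. LINT x:K|lebesgue. (u K x - a K)\<^sup>2) \<le> (\<Sum>K\<in>T.
        3 * (ball_const * C0 * inradius\<^sup>2 / inradius ^ DIM('a) * (h\<^sup>2 * (LINT x:K|lebesgue. (norm (gradient (u K) x))\<^sup>2))
         + ball_const / area_const * (h * (\<Sum>e | e facet_of K. face_integral e (\<lambda>x. (u K x - uh e x)\<^sup>2))) + D\<^sup>2 * (measure lebesgue K * (norm (\<beta> K))\<^sup>2)))"
        unfolding a_def by (intro sum_mono ce)
      also have "\<dots> = 3 * (b * C0 * \<rho>\<^sup>2 / \<rho> ^ DIM('a) * (h\<^sup>2 * G) + b / ac * (h * S) + D\<^sup>2 * W)"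
        unfolding eqs G_def S_def W_def g_def H1_seminorm_square L2_skeleton_norm_square
        by (simp only: sum.distrib sum_distrib_left[symmetric])
      also have "\<dots> \<le> 3 * ((b * C0 * \<rho>\<^sup>2 / \<rho> ^ DIM('a) + b / ac + D\<^sup>2) * (h\<^sup>2 * G + h * S + W))"
      proof -
        have nn: "0 \<le> h\<^sup>2 * G" "0 \<le> h * S" "0 \<le> W" using h W0 by (auto simp: G_def S_def)
        have "x * p + y * q + z * r \<le> (x + y + z) * (p + q + r)" if "0 \<le> x" "0 \<le> y" "0 \<le> z" "0 \<le> p" "0 \<le> q" "0 \<le> r" for x y z p q r :: real
          using that by (simp add: algebra_simps)
        from this[OF C3p nn] show ?thesis by simp
      qed
      also have "\<dots> = C3 * (h\<^sup>2 * G + h * S + W)" by (simp add: C3_def)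
      also have "\<dots> \<le> C * (h\<^sup>2 * G + h * S + W)"
        using Cle(2) h W0 by (intro mult_right_mono) (auto simp: G_def S_def)
      finally show ?thesis .
    qed
    show "\<exists>a g. (\<forall>K\<in>T. 0 \<le> g K) \<and> (\<forall>K\<in>T. \<forall>x\<in>K. (CR_lift T (face_average uh) K x - a K)\<^sup>2 \<le> h\<^sup>2 * g K) \<and>
      (H1_seminorm T (CR_lift T (face_average uh)))\<^sup>2 = (\<Sum>K\<in>T. measure lebesgue K * g K) \<and>
      (\<Sum>K\<in>T. LINT x:K|lebesgue. (u K x - a K)\<^sup>2) \<le> C * (h\<^sup>2 * (H1_seminorm T u)\<^sup>2
         + h * (L2_skeleton_norm T (\<lambda>K e x. u K x - uh e x))\<^sup>2 + (H1_seminorm T (CR_lift T (face_average uh)))\<^sup>2) \<and>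
      (\<Sum>K\<in>T. measure lebesgue K * (a K - (\<Sum>K\<in>T. measure lebesgue K * a K) / measure lebesgue (closure \<Omega>))\<^sup>2)
        \<le> C * (H1_seminorm T (CR_lift T (face_average uh)))\<^sup>2 \<and>
      (\<Sum>K | K \<in> T \<and> \<not> K \<subseteq> \<Omega>. measure lebesgue K * (a K - (\<Sum>K\<in>T. measure lebesgue K * a K) / measure lebesgue (closure \<Omega>))\<^sup>2)
        \<le> C * h * (H1_seminorm T (CR_lift T (face_average uh)))\<^sup>2"
      using gn wa W 1 2 3 unfolding W_def G_def S_def by (intro exI[of _ a] exI[of _ g]) simp
  qed
qed

section \<open>From cell values back to norms and integrals\<close>

context uniform_mesh begin

lemma L2_norm_le_cell_values:
  assumes u: "\<And>K. K \<in> T \<Longrightarrow> continuous_on K (u K)"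
  shows "(L2_norm T u)\<^sup>2 \<le> 2 * (\<Sum>K\<in>T. LINT x:K|lebesgue. (u K x - a K)\<^sup>2) + 4 * (\<Sum>K\<in>T. measure lebesgue K * (a K - m)\<^sup>2) + 4 * measure lebesgue (\<Union>T) * m\<^sup>2"
proof -
  have vol: "measure lebesgue (\<Union>T) = (\<Sum>K\<in>T. measure lebesgue K)" using measure_Union_cells[of T UNIV] by simp
  have "(L2_norm T u)\<^sup>2 \<le> (\<Sum>K\<in>T. 2 * (LINT x:K|lebesgue. (u K x - a K)\<^sup>2) + (4 * (measure lebesgue K * (a K - m)\<^sup>2) + 4 * (measure lebesgue K * m\<^sup>2)))"
    unfolding L2_norm_square
  proof (intro sum_mono)
    fix K assume K: "K \<in> T"
    have i: "set_integrable lebesgue K (\<lambda>x. 2 * (u K x - a K)\<^sup>2)" "set_integrable lebesgue K (\<lambda>x. 4 * (a K - m)\<^sup>2 + 4 * m\<^sup>2)"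
      by (intro set_integrable_continuous_compact cell_compact K continuous_intros u)+
    have "(LINT x:K|lebesgue. (u K x)\<^sup>2) \<le> (LINT x:K|lebesgue. 2 * (u K x - a K)\<^sup>2 + (4 * (a K - m)\<^sup>2 + 4 * m\<^sup>2))"
    proof (intro set_integral_mono set_integrable_continuous_compact cell_compact K continuous_intros u)
      fix x
      \<comment> \<open>This sum of squares is exactly the difference between the two sides of the
        inequality below, which splits \<open>u\<close> as
        \<open>(u - a) + (a - m) + m\<close>.\<close>
      have "0 \<le> (u K x - a K - a K)\<^sup>2 + 2 * (a K - m - m)\<^sup>2" by simp
      then show "(u K x)\<^sup>2 \<le> 2 * (u K x - a K)\<^sup>2 + (4 * (a K - m)\<^sup>2 + 4 * m\<^sup>2)" by (simp add: power2_eq_square algebra_simps)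
    qed
    also have "\<dots> = (LINT x:K|lebesgue. 2 * (u K x - a K)\<^sup>2) + (LINT x:K|lebesgue. 4 * (a K - m)\<^sup>2 + 4 * m\<^sup>2)"
      by (rule set_integral_add(2)[OF i])
    also have "(LINT x:K|lebesgue. 4 * (a K - m)\<^sup>2 + 4 * m\<^sup>2) = measure lebesgue K * (4 * (a K - m)\<^sup>2 + 4 * m\<^sup>2)"
      by (rule set_integral_const_lebesgue[OF cell_lmeasurable[OF K]])
    finally show "(LINT x:K|lebesgue. (u K x)\<^sup>2) \<le> 2 * (LINT x:K|lebesgue. (u K x - a K)\<^sup>2) + (4 * (measure lebesgue K * (a K - m)\<^sup>2) + 4 * (measure lebesgue K * m\<^sup>2))"
      by (simp add: algebra_simps)
  qed
  also have "\<dots> = 2 * (\<Sum>K\<in>T. LINT x:K|lebesgue. (u K x - a K)\<^sup>2) + (4 * (\<Sum>K\<in>T. measure lebesgue K * (a K - m)\<^sup>2) + 4 * (measure lebesgue (\<Union>T) * m\<^sup>2))"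
    unfolding vol by (simp only: sum.distrib sum_distrib_left[symmetric] sum_distrib_right[symmetric])
  finally show ?thesis by simp
qed

text \<open>Cauchy-Schwarz twice, over each cell and over the sum with the volumes as weights. It is
  applied with \<open>v\<close> equal to the lifting and to \<open>u\<close> itself, to trade the
  mean of the cell values for the integral in the respective inequality.\<close>

lemma cell_sum_minus_integral:
  assumes v: "\<And>K. K \<in> T \<Longrightarrow> continuous_on K (v K)"
  shows "((\<Sum>K\<in>T. measure lebesgue K * a K) - domain_integral T v)\<^sup>2 \<le> measure lebesgue (\<Union>T) * (\<Sum>K\<in>T. LINT x:K|lebesgue. (v K x - a K)\<^sup>2)"
proof -
  have mv: "measure lebesgue (\<Union>T) = (\<Sum>K\<in>T. measure lebesgue K)" using measure_Union_cells[of T UNIV] by simp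
  have mp: "measure lebesgue K > 0" if "K \<in> T" for K
  proof -
    have "0 < \<mu> * h ^ DIM('a)" using mu h by simp
    then show ?thesis using vol[OF that] by linarith
  qed
  define f where "f K = (LINT x:K|lebesgue. v K x - a K) / measure lebesgue K" for K
  have d: "(LINT x:K|lebesgue. v K x - a K) = (LINT x:K|lebesgue. v K x) - measure lebesgue K * a K" if K: "K \<in> T" for K
  proof -
    have "(LINT x:K|lebesgue. v K x - a K) = (LINT x:K|lebesgue. v K x) - (LINT x:K|lebesgue. a K)"
      by (intro set_integral_diff set_integrable_continuous_compact cell_compact K continuous_intros v)
    then show ?thesis using set_integral_const_lebesgue[OF cell_lmeasurable[OF K]] by simp
  qed
  have "domain_integral T v - (\<Sum>K\<in>T. measure lebesgue K * a K) = (\<Sum>K\<in>T. measure lebesgue K * f K)"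
    unfolding domain_integral_def sum_subtractf[symmetric]
  proof (intro sum.cong refl)
    fix K assume K: "K \<in> T"
    show "(LINT x:K|lebesgue. v K x) - measure lebesgue K * a K = measure lebesgue K * f K" using d[OF K] mp[OF K] by (simp add: f_def)
  qed
  then have "((\<Sum>K\<in>T. measure lebesgue K * a K) - domain_integral T v)\<^sup>2 = (\<Sum>K\<in>T. measure lebesgue K * f K)\<^sup>2" by (metis power2_commute)
  also have "\<dots> \<le> (\<Sum>K\<in>T. measure lebesgue K) * (\<Sum>K\<in>T. measure lebesgue K * (f K)\<^sup>2)" by (intro weighted_square_sum_le) simp
  also have "\<dots> \<le> (\<Sum>K\<in>T. measure lebesgue K) * (\<Sum>K\<in>T. LINT x:K|lebesgue. (v K x - a K)\<^sup>2)"
  proof (intro mult_left_mono sum_mono sum_nonneg)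
    fix K assume K: "K \<in> T"
    have "(LINT x:K|lebesgue. v K x - a K)\<^sup>2 \<le> measure lebesgue K * (LINT x:K|lebesgue. (v K x - a K)\<^sup>2)"
      by (intro integral_square_le cell_compact K continuous_intros v)
    moreover have "measure lebesgue K * (f K)\<^sup>2 = (LINT x:K|lebesgue. v K x - a K)\<^sup>2 / measure lebesgue K"
      unfolding f_def using mp[OF K] by (simp add: power2_eq_square)
    ultimately show "measure lebesgue K * (f K)\<^sup>2 \<le> (LINT x:K|lebesgue. (v K x - a K)\<^sup>2)"
      using mp[OF K] by (simp add: pos_divide_le_eq mult.commute)
  qed simp
  finally show ?thesis by (simp add: mv)
qed

text \<open>The mean \<open>m\<close> is compared with the face means \<open>t e\<close> through the
  values of cells behind the faces. Passing from faces to cells costs \<open>1 / h\<close> in both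
  errors; it is paid by the factor \<open>h\<^sup>2\<close> in the bound for
  \<open>t e - a (c e)\<close>, and by the layer inequality for \<open>a (c e) - m\<close>. The
  number \<open>s0\<close> stands for a lower bound of the area that is common to all
  meshes.\<close>

lemma boundary_mean_bound:
  assumes E: "\<And>e. e \<in> E \<Longrightarrow> c e \<in> L \<and> e facet_of (c e)" and L: "L \<subseteq> T"
    and s0: "0 < s0" "s0 \<le> (\<Sum>e\<in>E. face_area e)"
    and g: "\<And>K. K \<in> T \<Longrightarrow> 0 \<le> g K" and t: "\<And>e. e \<in> E \<Longrightarrow> (t e - a (c e))\<^sup>2 \<le> h\<^sup>2 * g (c e)"
    and V: "(\<Sum>K\<in>L. measure lebesgue K * (a K - m)\<^sup>2) \<le> C * h * W" and W: "(\<Sum>K\<in>T. measure lebesgue K * g K) = W" and C: "C \<ge> 0"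
  shows "m\<^sup>2 \<le> 3 / s0\<^sup>2 * (\<Sum>e\<in>E. face_area e * t e)\<^sup>2 +
    3 / s0 * (real (DIM('a) + 1) * ((1 + D) * ball_const * 2 ^ DIM('a)) / \<mu>) * (D + C) * W"
proof -
  define B where "B = real (DIM('a) + 1) * ((1 + D) * ball_const * 2 ^ DIM('a))"
  have B: "B \<ge> 0" using D_nonneg ball_const_pos by (simp add: B_def)
  define S where "S = (\<Sum>e\<in>E. face_area e)"
  have S: "S > 0" "s0 \<le> S" using s0 by (auto simp: S_def)
  have an: "face_area e \<ge> 0" for e :: "'a set" by (simp add: face_area_def)
  have LT: "K \<in> T" if "K \<in> L" for K using that L by blast
  have W0: "W \<ge> 0" unfolding W[symmetric] using g by (intro sum_nonneg) auto
  define Q1 where "Q1 = (\<Sum>e\<in>E. face_area e * (t e - a (c e))\<^sup>2)"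
  define Q2 where "Q2 = (\<Sum>e\<in>E. face_area e * (a (c e) - m)\<^sup>2)"
  have Q1: "Q1 \<le> B / \<mu> * D * W"
  proof -
    have "Q1 \<le> (\<Sum>e\<in>E. face_area e * (h\<^sup>2 * g (c e)))" unfolding Q1_def using t an by (intro sum_mono mult_left_mono) auto
    also have "\<dots> \<le> B / (\<mu> * h) * (\<Sum>K\<in>L. measure lebesgue K * (h\<^sup>2 * g K))"
      unfolding B_def using E L g LT by (intro boundary_sum_bound) auto
    also have "\<dots> \<le> B / (\<mu> * h) * (\<Sum>K\<in>T. measure lebesgue K * (h\<^sup>2 * g K))"
      using B mu h g L fin by (intro mult_left_mono sum_mono2) auto
    also have "(\<Sum>K\<in>T. measure lebesgue K * (h\<^sup>2 * g K)) = h\<^sup>2 * W"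
      unfolding W[symmetric] sum_distrib_left by (intro sum.cong) auto
    also have "B / (\<mu> * h) * (h\<^sup>2 * W) = B / \<mu> * h * W" using h by (simp add: power2_eq_square)
    also have "\<dots> \<le> B / \<mu> * D * W" using h B mu W0 by (intro mult_right_mono mult_left_mono) auto
    finally show ?thesis .
  qed
  have Q2: "Q2 \<le> B / \<mu> * C * W"
  proof -
    have "Q2 \<le> B / (\<mu> * h) * (\<Sum>K\<in>L. measure lebesgue K * (a K - m)\<^sup>2)"
      unfolding B_def Q2_def using E L by (intro boundary_sum_bound[where f = "\<lambda>K. (a K - m)\<^sup>2"]) auto
    also have "\<dots> \<le> B / (\<mu> * h) * (C * h * W)" using B mu h by (intro mult_left_mono V) auto
    also have "\<dots> = B / \<mu> * C * W" using h by simp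
    finally show ?thesis .
  qed
  define I where "I = (\<Sum>e\<in>E. face_area e * t e)"
  define P where "P = (\<Sum>e\<in>E. face_area e * (t e - a (c e)))"
  define R where "R = (\<Sum>e\<in>E. face_area e * (a (c e) - m))"
  \<comment> \<open>The area-weighted sum of
    \<open>t e = (t e - a (c e)) + (a (c e) - m) + m\<close>, solved for the last term.\<close>
  have "S * m = I - P - R"
    by (simp add: S_def I_def P_def R_def right_diff_distrib sum_subtractf sum_distrib_right)
  then have "S\<^sup>2 * m\<^sup>2 = (I - P - R)\<^sup>2" by (metis power_mult_distrib)
  also have "\<dots> \<le> 3 * I\<^sup>2 + 3 * P\<^sup>2 + 3 * R\<^sup>2"
  proof -
    have "0 \<le> (I + P)\<^sup>2 + (I + R)\<^sup>2 + (P - R)\<^sup>2" by simp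
    then show ?thesis by (simp add: power2_eq_square algebra_simps)
  qed
  also have "\<dots> \<le> 3 * I\<^sup>2 + 3 * (S * Q1) + 3 * (S * Q2)"
    unfolding P_def R_def S_def Q1_def Q2_def using an by (intro add_mono mult_left_mono weighted_square_sum_le order_refl) auto
  also have "\<dots> \<le> 3 * I\<^sup>2 + 3 * (S * (B / \<mu> * D * W)) + 3 * (S * (B / \<mu> * C * W))"
    using S by (intro add_mono mult_left_mono Q1 Q2 order_refl) auto
  also have "\<dots> = 3 * I\<^sup>2 + S * (3 * (B / \<mu>) * (D + C) * W)" by (simp add: algebra_simps add_divide_distrib)
  finally have main: "S\<^sup>2 * m\<^sup>2 \<le> 3 * I\<^sup>2 + S * (3 * (B / \<mu>) * (D + C) * W)" .
  have "m\<^sup>2 = (S\<^sup>2 * m\<^sup>2) / S\<^sup>2" using S by simp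
  also have "\<dots> \<le> (3 * I\<^sup>2 + S * (3 * (B / \<mu>) * (D + C) * W)) / S\<^sup>2" using main by (rule divide_right_mono) simp
  also have "\<dots> = 3 * I\<^sup>2 / S\<^sup>2 + 3 * (B / \<mu>) * (D + C) * W / S" using S by (simp add: add_divide_distrib power2_eq_square)
  also have "\<dots> \<le> 3 * I\<^sup>2 / s0\<^sup>2 + 3 * (B / \<mu>) * (D + C) * W / s0"
  proof (intro add_mono divide_left_mono)
    show "s0\<^sup>2 \<le> S\<^sup>2" using S s0 by (intro power_mono) auto
    show "0 \<le> 3 * (B / \<mu>) * (D + C) * W" using B mu D_nonneg C W0 by simp
  qed (use S s0 in auto)
  finally show ?thesis by (simp add: B_def I_def mult_ac)
qed

end

section \<open>Choice of the constants and the three inequalities\<close>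

theorem theorem3p6:
  fixes \<Omega> :: "'a::euclidean_space set" and k :: nat and \<kappa> A :: real
  assumes "DIM('a) \<in> {2, 3}"
    and "polyhedral_domain \<Omega>"
    and "\<kappa> > 0"
  shows
    "(\<exists>C>0. \<forall>T u uh.
        admissible_mesh \<Omega> \<kappa> A T \<and> (u, uh) \<in> hdg_space k T \<longrightarrow>
        (L2_norm T u)\<^sup>2 \<le>
          C * ((mesh_size T)\<^sup>2 * (H1_seminorm T u)\<^sup>2
             + mesh_size T * (L2_skeleton_norm T (\<lambda>K e x. u K x - uh e x))\<^sup>2
             + (H1_seminorm T (CR_lift T (face_average uh)))\<^sup>2
             + (domain_integral T (CR_lift T (face_average uh)))\<^sup>2)) \<and>
     (\<forall>\<Gamma>. \<exists>C>0. \<forall>T E u uh.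
        admissible_mesh \<Omega> \<kappa> A T \<and> E \<subseteq> boundary_faces \<Omega> T \<and> \<Gamma> = \<Union>E \<and>
        (\<Sum>e\<in>E. face_area e) > 0 \<and> (u, uh) \<in> hdg_space k T \<longrightarrow>
        (L2_norm T u)\<^sup>2 \<le>
          C * ((mesh_size T)\<^sup>2 * (H1_seminorm T u)\<^sup>2
             + mesh_size T * (L2_skeleton_norm T (\<lambda>K e x. u K x - uh e x))\<^sup>2
             + (H1_seminorm T (CR_lift T (face_average uh)))\<^sup>2
             + (\<Sum>e\<in>E. face_integral e (uh e))\<^sup>2)) \<and>
     (\<exists>C>0. \<forall>T u uh.
        admissible_mesh \<Omega> \<kappa> A T \<and> (u, uh) \<in> hdg_space k T \<longrightarrow>
        (L2_norm T u)\<^sup>2 \<le>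
          C * ((mesh_size T)\<^sup>2 * (H1_seminorm T u)\<^sup>2
             + mesh_size T * (L2_skeleton_norm T (\<lambda>K e x. u K x - uh e x))\<^sup>2
             + (H1_seminorm T (CR_lift T (face_average uh)))\<^sup>2
             + (domain_integral T u)\<^sup>2))"
proof -
  define \<mu> where "\<mu> = \<kappa> / max A 1 ^ DIM('a)"
  define D where "D = diameter (closure \<Omega>)"
  define V where "V = measure lebesgue (closure \<Omega>)"
  have mu: "\<mu> > 0" using assms(3) by (simp add: \<mu>_def)
  have O: "\<Omega> \<noteq> {}" "open \<Omega>" "bounded \<Omega>" using assms(2) by (auto simp: polyhedral_domain_def)
  have D: "D \<ge> 0" unfolding D_def using O by (intro diameter_ge_0 bounded_closure)
  have V: "V > 0"
  proof -
    have "0 < measure lebesgue \<Omega>" using O by (intro measure_open_pos)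
    also have "\<dots> \<le> V"
      unfolding V_def using O closure_subset by (intro measure_mono_fmeasurable) (auto intro: lmeasurable_compact)
    finally show ?thesis .
  qed
  define hu where "hu T u uh = (mesh_size T)\<^sup>2 * (H1_seminorm T u)\<^sup>2 + mesh_size T * (L2_skeleton_norm T (\<lambda>K e x. u K x - uh e x))\<^sup>2"
    for T :: "'a set set" and u uh
  define w where "w T uh = CR_lift T (face_average uh)" for T :: "'a set set" and uh
  define W where "W T uh = (H1_seminorm T (w T uh))\<^sup>2" for T :: "'a set set" and uh
  obtain C where C: "C \<ge> 0" and val: "\<forall>T h u uh. uniform_mesh T h \<mu> D \<longrightarrow> \<Union>T = closure \<Omega> \<longrightarrow> (u, uh) \<in> hdg_space k T \<longrightarrow>
    (\<exists>a g. (\<forall>K\<in>T. 0 \<le> g K) \<and> (\<forall>K\<in>T. \<forall>x\<in>K. (CR_lift T (face_average uh) K x - a K)\<^sup>2 \<le> h\<^sup>2 * g K) \<and>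
      (H1_seminorm T (CR_lift T (face_average uh)))\<^sup>2 = (\<Sum>K\<in>T. measure lebesgue K * g K) \<and>
      (\<Sum>K\<in>T. LINT x:K|lebesgue. (u K x - a K)\<^sup>2) \<le> C * (h\<^sup>2 * (H1_seminorm T u)\<^sup>2
         + h * (L2_skeleton_norm T (\<lambda>K e x. u K x - uh e x))\<^sup>2 + (H1_seminorm T (CR_lift T (face_average uh)))\<^sup>2) \<and>
      (\<Sum>K\<in>T. measure lebesgue K * (a K - (\<Sum>K\<in>T. measure lebesgue K * a K) / measure lebesgue (closure \<Omega>))\<^sup>2)
        \<le> C * (H1_seminorm T (CR_lift T (face_average uh)))\<^sup>2 \<and>
      (\<Sum>K | K \<in> T \<and> \<not> K \<subseteq> \<Omega>. measure lebesgue K * (a K - (\<Sum>K\<in>T. measure lebesgue K * a K) / measure lebesgue (closure \<Omega>))\<^sup>2)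
        \<le> C * h * (H1_seminorm T (CR_lift T (face_average uh)))\<^sup>2)"
    using cell_values_exist[OF assms(2) mu D, of k] by (elim exE conjE) (rule that)
  \<comment> \<open>The common part: \<open>m\<close> is the mean of the cell values, and the norm
    of \<open>u\<close> is controlled up to \<open>m\<^sup>2\<close>. The three inequalities differ
    only in how they bound \<open>m\<close>.\<close>
  have core: "\<exists>a g m. (\<forall>K\<in>T. 0 \<le> g K) \<and> (\<forall>K\<in>T. \<forall>x\<in>K. (w T uh K x - a K)\<^sup>2 \<le> (mesh_size T)\<^sup>2 * g K) \<and>
      W T uh = (\<Sum>K\<in>T. measure lebesgue K * g K) \<and> V * m = (\<Sum>K\<in>T. measure lebesgue K * a K) \<and>
      (\<Sum>K\<in>T. LINT x:K|lebesgue. (u K x - a K)\<^sup>2) \<le> C * (hu T u uh + W T uh) \<and>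
      (\<Sum>K\<in>T. LINT x:K|lebesgue. (w T uh K x - a K)\<^sup>2) \<le> D\<^sup>2 * W T uh \<and>
      (\<Sum>K | K \<in> T \<and> \<not> K \<subseteq> \<Omega>. measure lebesgue K * (a K - m)\<^sup>2) \<le> C * mesh_size T * W T uh \<and>
      (L2_norm T u)\<^sup>2 \<le> 6 * C * (hu T u uh + W T uh) + 4 * V * m\<^sup>2 \<and>
      0 \<le> hu T u uh \<and> 0 \<le> W T uh \<and> (\<forall>K\<in>T. continuous_on K (u K)) \<and> (\<forall>K\<in>T. continuous_on K (w T uh K)) \<and>
      uniform_mesh T (mesh_size T) \<mu> D \<and> measure lebesgue (\<Union>T) = V"
    if T: "admissible_mesh \<Omega> \<kappa> A T" and u: "(u, uh) \<in> hdg_space k T" for T u uh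
  proof -
    have um: "uniform_mesh T (mesh_size T) \<mu> D" and U: "\<Union>T = closure \<Omega>"
      using admissible_uniform_mesh[OF assms(2,3) T] by (auto simp: \<mu>_def D_def)
    then interpret uniform_mesh T "mesh_size T" \<mu> D by blast
    obtain a g where ag: "\<forall>K\<in>T. 0 \<le> g K" "\<forall>K\<in>T. \<forall>x\<in>K. (w T uh K x - a K)\<^sup>2 \<le> (mesh_size T)\<^sup>2 * g K"
      "W T uh = (\<Sum>K\<in>T. measure lebesgue K * g K)" "(\<Sum>K\<in>T. LINT x:K|lebesgue. (u K x - a K)\<^sup>2) \<le> C * (hu T u uh + W T uh)"
      "(\<Sum>K\<in>T. measure lebesgue K * (a K - (\<Sum>K\<in>T. measure lebesgue K * a K) / V)\<^sup>2) \<le> C * W T uh"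
      "(\<Sum>K | K \<in> T \<and> \<not> K \<subseteq> \<Omega>. measure lebesgue K * (a K - (\<Sum>K\<in>T. measure lebesgue K * a K) / V)\<^sup>2) \<le> C * mesh_size T * W T uh"
      using val[rule_format, OF um U u] unfolding W_def w_def hu_def V_def by blast
    define m where "m = (\<Sum>K\<in>T. measure lebesgue K * a K) / V"
    have cu: "continuous_on K (u K)" if K: "K \<in> T" for K
    proof -
      have "u K \<in> poly_space k K" using u K by (simp add: hdg_space_def cell_space_def)
      then obtain p where "polynomial_of_degree_le k p" "\<And>x. x \<in> K \<Longrightarrow> u K x = p x"
        unfolding poly_space_def by blast
      then show ?thesis using continuous_on_polynomial continuous_on_cong[of K K "u K" p] by blast
    qed
    have cw: "continuous_on K (w T uh K)" if K: "K \<in> T" for K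
    proof -
      obtain \<alpha> b where "\<And>x. x \<in> K \<Longrightarrow> w T uh K x = \<alpha> + b \<bullet> x"
        unfolding w_def by (rule CR_lift_affine[OF um K]) blast
      moreover have "continuous_on K (\<lambda>x. \<alpha> + b \<bullet> x)" by (intro continuous_intros)
      ultimately show ?thesis using continuous_on_cong[of K K "w T uh K" "\<lambda>x. \<alpha> + b \<bullet> x"] by blast
    qed
    have nn: "0 \<le> hu T u uh" "0 \<le> W T uh" using h by (auto simp: hu_def W_def)
    have w2: "(\<Sum>K\<in>T. LINT x:K|lebesgue. (w T uh K x - a K)\<^sup>2) \<le> D\<^sup>2 * W T uh"
    proof -
      have "(\<Sum>K\<in>T. LINT x:K|lebesgue. (w T uh K x - a K)\<^sup>2) \<le> (\<Sum>K\<in>T. measure lebesgue K * ((mesh_size T)\<^sup>2 * g K))"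
        using ag(2) cw by (intro sum_mono set_integral_le_measure_mult cell_compact continuous_intros) auto
      also have "\<dots> = (mesh_size T)\<^sup>2 * W T uh" unfolding ag(3) sum_distrib_left by (intro sum.cong) auto
      also have "\<dots> \<le> D\<^sup>2 * W T uh" using h nn by (intro mult_right_mono power_mono) auto
      finally show ?thesis .
    qed
    have VU: "measure lebesgue (\<Union>T) = V" by (simp only: U V_def)
    have "(L2_norm T u)\<^sup>2 \<le> 2 * (\<Sum>K\<in>T. LINT x:K|lebesgue. (u K x - a K)\<^sup>2) + 4 * (\<Sum>K\<in>T. measure lebesgue K * (a K - m)\<^sup>2) + 4 * V * m\<^sup>2"
      using L2_norm_le_cell_values[OF cu, of a m] unfolding VU .
    also have "\<dots> \<le> 2 * (C * (hu T u uh + W T uh)) + 4 * (C * (hu T u uh + W T uh)) + 4 * V * m\<^sup>2"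
    proof -
      have "C * W T uh \<le> C * (hu T u uh + W T uh)" using C nn by (intro mult_left_mono) auto
      then show ?thesis using ag(4,5) unfolding m_def by linarith
    qed
    finally have L2: "(L2_norm T u)\<^sup>2 \<le> 6 * C * (hu T u uh + W T uh) + 4 * V * m\<^sup>2" by simp
    have Vm: "V * m = (\<Sum>K\<in>T. measure lebesgue K * a K)" using V by (simp add: m_def)
    show ?thesis
      using ag(1-4,6) w2 L2 nn cu cw um VU Vm unfolding m_def[symmetric]
      by (intro exI[of _ a] exI[of _ g] exI[of _ m] conjI) auto
  qed
  \<comment> \<open>In the application \<open>s\<close> is the sum of the cell values weighted by
    volume, \<open>i\<close> is the integral from the inequality, and \<open>Q\<close> bounds the
    mean square distance between the integrand and the cell values.\<close>
  have split: "4 * V * m\<^sup>2 \<le> 8 / V * i\<^sup>2 + 8 * Q" if "V * m = s" "(s - i)\<^sup>2 \<le> V * Q" for m s i Q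
  proof -
    have "0 \<le> (s - i - i)\<^sup>2" by simp
    then have "s\<^sup>2 \<le> 2 * (s - i)\<^sup>2 + 2 * i\<^sup>2" by (simp add: power2_eq_square algebra_simps)
    then have "s\<^sup>2 \<le> 2 * (V * Q) + 2 * i\<^sup>2" using that(2) by linarith
    then have "4 / V * s\<^sup>2 \<le> 4 / V * (2 * (V * Q) + 2 * i\<^sup>2)" using V by (intro mult_left_mono) auto
    also have "\<dots> = 8 / V * i\<^sup>2 + 8 * Q" using V by (simp add: field_simps)
    also have "4 / V * s\<^sup>2 = 4 * V * m\<^sup>2" using V that(1)[symmetric] by (simp add: power2_eq_square)
    finally show ?thesis .
  qed
  have combine: "x \<le> (c1 + c2 + 1) * (y + z + t)" if "x \<le> c1 * (y + z) + c2 * t" "0 \<le> c1" "0 \<le> c2" "0 \<le> y" "0 \<le> z" "0 \<le> t" for x y z t c1 c2 :: real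
  proof -
    have "0 \<le> c1 * t" "0 \<le> c2 * y" "0 \<le> c2 * z" using that by auto
    then have "c1 * (y + z) + c2 * t \<le> (c1 + c2 + 1) * (y + z + t)" using that by (simp add: algebra_simps)
    then show ?thesis using that(1) by linarith
  qed
  have goal1: "\<exists>C>0. \<forall>T u uh. admissible_mesh \<Omega> \<kappa> A T \<and> (u, uh) \<in> hdg_space k T \<longrightarrow>
      (L2_norm T u)\<^sup>2 \<le> C * (hu T u uh + W T uh + (domain_integral T (w T uh))\<^sup>2)"
  proof (intro exI[of _ "(6 * C + 8 * D\<^sup>2) + 8 / V + 1"] conjI allI impI)
    show "0 < (6 * C + 8 * D\<^sup>2) + 8 / V + 1" using C V by (simp add: add_nonneg_pos)
    fix T u uh assume "admissible_mesh \<Omega> \<kappa> A T \<and> (u, uh) \<in> hdg_space k T"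
    then obtain a g m where *: "V * m = (\<Sum>K\<in>T. measure lebesgue K * a K)"
      "(\<Sum>K\<in>T. LINT x:K|lebesgue. (w T uh K x - a K)\<^sup>2) \<le> D\<^sup>2 * W T uh"
      "(L2_norm T u)\<^sup>2 \<le> 6 * C * (hu T u uh + W T uh) + 4 * V * m\<^sup>2"
      "0 \<le> hu T u uh" "0 \<le> W T uh" "\<forall>K\<in>T. continuous_on K (w T uh K)"
      "uniform_mesh T (mesh_size T) \<mu> D" "measure lebesgue (\<Union>T) = V" using core[of T u uh] by blast
    interpret uniform_mesh T "mesh_size T" \<mu> D by fact
    have "((\<Sum>K\<in>T. measure lebesgue K * a K) - domain_integral T (w T uh))\<^sup>2 \<le> V * (\<Sum>K\<in>T. LINT x:K|lebesgue. (w T uh K x - a K)\<^sup>2)"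
      using cell_sum_minus_integral[of "w T uh" a] *(6,8) by simp
    from split[OF *(1) this]
    have "4 * V * m\<^sup>2 \<le> 8 / V * (domain_integral T (w T uh))\<^sup>2 + 8 * (D\<^sup>2 * W T uh)" using *(2) by linarith
    moreover have "8 * (D\<^sup>2 * W T uh) \<le> 8 * D\<^sup>2 * (hu T u uh + W T uh)" using *(4) by (simp add: distrib_left)
    ultimately have "(L2_norm T u)\<^sup>2 \<le> (6 * C + 8 * D\<^sup>2) * (hu T u uh + W T uh) + 8 / V * (domain_integral T (w T uh))\<^sup>2"
      using *(3) unfolding distrib_right[of "6 * C"] by linarith
    then show "(L2_norm T u)\<^sup>2 \<le> ((6 * C + 8 * D\<^sup>2) + 8 / V + 1) * (hu T u uh + W T uh + (domain_integral T (w T uh))\<^sup>2)"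
      using C V *(4,5) by (intro combine) auto
  qed
  have goal3: "\<exists>C>0. \<forall>T u uh. admissible_mesh \<Omega> \<kappa> A T \<and> (u, uh) \<in> hdg_space k T \<longrightarrow>
      (L2_norm T u)\<^sup>2 \<le> C * (hu T u uh + W T uh + (domain_integral T u)\<^sup>2)"
  proof (intro exI[of _ "14 * C + 8 / V + 1"] conjI allI impI)
    show "0 < 14 * C + 8 / V + 1" using C V by (simp add: add_nonneg_pos)
    fix T u uh assume "admissible_mesh \<Omega> \<kappa> A T \<and> (u, uh) \<in> hdg_space k T"
    then obtain a g m where *: "V * m = (\<Sum>K\<in>T. measure lebesgue K * a K)"
      "(\<Sum>K\<in>T. LINT x:K|lebesgue. (u K x - a K)\<^sup>2) \<le> C * (hu T u uh + W T uh)"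
      "(L2_norm T u)\<^sup>2 \<le> 6 * C * (hu T u uh + W T uh) + 4 * V * m\<^sup>2"
      "0 \<le> hu T u uh" "0 \<le> W T uh" "\<forall>K\<in>T. continuous_on K (u K)"
      "uniform_mesh T (mesh_size T) \<mu> D" "measure lebesgue (\<Union>T) = V" using core[of T u uh] by blast
    interpret uniform_mesh T "mesh_size T" \<mu> D by fact
    have "((\<Sum>K\<in>T. measure lebesgue K * a K) - domain_integral T u)\<^sup>2 \<le> V * (\<Sum>K\<in>T. LINT x:K|lebesgue. (u K x - a K)\<^sup>2)"
      using cell_sum_minus_integral[of u a] *(6,8) by simp
    from split[OF *(1) this]
    have "4 * V * m\<^sup>2 \<le> 8 / V * (domain_integral T u)\<^sup>2 + 8 * (C * (hu T u uh + W T uh))" using *(2) by linarith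
    then have "(L2_norm T u)\<^sup>2 \<le> 14 * C * (hu T u uh + W T uh) + 8 / V * (domain_integral T u)\<^sup>2"
      using *(3) by simp
    then show "(L2_norm T u)\<^sup>2 \<le> (14 * C + 8 / V + 1) * (hu T u uh + W T uh + (domain_integral T u)\<^sup>2)"
      using C V *(4,5) by (intro combine) auto
  qed
  have goal2: "\<exists>C>0. \<forall>T E u uh. admissible_mesh \<Omega> \<kappa> A T \<and> E \<subseteq> boundary_faces \<Omega> T \<and> \<Gamma> = \<Union>E \<and>
        (\<Sum>e\<in>E. face_area e) > 0 \<and> (u, uh) \<in> hdg_space k T \<longrightarrow>
      (L2_norm T u)\<^sup>2 \<le> C * (hu T u uh + W T uh + (\<Sum>e\<in>E. face_integral e (uh e))\<^sup>2)" for \<Gamma>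
  proof (cases "\<exists>T E. admissible_mesh \<Omega> \<kappa> A T \<and> E \<subseteq> boundary_faces \<Omega> T \<and> \<Gamma> = \<Union>E \<and> (\<Sum>e\<in>E. face_area e) > 0")
    \<comment> \<open>No mesh has boundary faces of positive total area with union \<Gamma>, so any
      positive constant serves.\<close>
    case False
    then show ?thesis by (intro exI[of _ 1]) auto
  next
    case True
    then obtain T0 E0 where T0: "admissible_mesh \<Omega> \<kappa> A T0" "E0 \<subseteq> boundary_faces \<Omega> T0" "\<Gamma> = \<Union>E0" "(\<Sum>e\<in>E0. face_area e) > 0" by blast
    have um: "uniform_mesh T (mesh_size T) \<mu> D" if "admissible_mesh \<Omega> \<kappa> A T" for T
      using admissible_uniform_mesh(1)[OF assms(2,3) that] by (simp add: \<mu>_def D_def)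
    have facet: "\<exists>K\<in>T. e facet_of K \<and> \<not> K \<subseteq> \<Omega>" and shape: "compact e \<and> convex e \<and> aff_dim e = int DIM('a) - 1"
      if T: "admissible_mesh \<Omega> \<kappa> A T" and e: "e \<in> boundary_faces \<Omega> T" for T e
    proof -
      interpret uniform_mesh T "mesh_size T" \<mu> D by (rule um[OF T])
      obtain K where K: "K \<in> T" "e facet_of K" "e \<subseteq> frontier \<Omega>" using e by (auto simp: boundary_faces_def faces_def)
      note fp = facet_props[OF K(1,2)]
      obtain x where x: "x \<in> e" using fp(4) by blast
      then have "x \<notin> \<Omega>" using K(3) O(2) by (auto simp: frontier_def interior_open)
      then show "\<exists>K\<in>T. e facet_of K \<and> \<not> K \<subseteq> \<Omega>" using K x fp(3) by blast
      show "compact e \<and> convex e \<and> aff_dim e = int DIM('a) - 1" using fp by simp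
    qed
    \<comment> \<open>A face of positive area in the reference mesh. It depends on \<Gamma> but not
      on the mesh considered later; the faces of any other mesh with union \<Gamma> cover it, so its
      area \<open>s0\<close> is a uniform lower bound for theirs.\<close>
    obtain e0 where e0: "e0 \<in> E0" "face_area e0 > 0"
      using T0(4) by (metis not_less sum_nonpos)
    define s0 where "s0 = face_area e0"
    have s0: "s0 > 0" using e0 by (simp add: s0_def)
    define b where "b = unit_ball_vol (real DIM('a))"
    define B where "B = 3 / s0 * (real (DIM('a) + 1) * ((1 + D) * b * 2 ^ DIM('a)) / \<mu>) * (D + C)"
    have B: "B \<ge> 0" using s0 D C mu by (simp add: B_def b_def)
    show ?thesis
    proof (intro exI[of _ "(6 * C + 4 * V * B) + 12 * V / s0\<^sup>2 + 1"] conjI allI impI)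
      show "0 < (6 * C + 4 * V * B) + 12 * V / s0\<^sup>2 + 1" using C V B by (simp add: add_nonneg_pos)
      fix T E u uh
      assume as: "admissible_mesh \<Omega> \<kappa> A T \<and> E \<subseteq> boundary_faces \<Omega> T \<and> \<Gamma> = \<Union>E \<and> (\<Sum>e\<in>E. face_area e) > 0 \<and> (u, uh) \<in> hdg_space k T"
      then have T: "admissible_mesh \<Omega> \<kappa> A T" and E: "E \<subseteq> boundary_faces \<Omega> T" "\<Gamma> = \<Union>E" and u: "(u, uh) \<in> hdg_space k T" by auto
      interpret uniform_mesh T "mesh_size T" \<mu> D by (rule um[OF T])
      obtain a g m where *: "\<forall>K\<in>T. 0 \<le> g K" "\<forall>K\<in>T. \<forall>x\<in>K. (w T uh K x - a K)\<^sup>2 \<le> (mesh_size T)\<^sup>2 * g K"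
        "W T uh = (\<Sum>K\<in>T. measure lebesgue K * g K)"
        "(\<Sum>K | K \<in> T \<and> \<not> K \<subseteq> \<Omega>. measure lebesgue K * (a K - m)\<^sup>2) \<le> C * mesh_size T * W T uh"
        "(L2_norm T u)\<^sup>2 \<le> 6 * C * (hu T u uh + W T uh) + 4 * V * m\<^sup>2" "0 \<le> hu T u uh" "0 \<le> W T uh"
        using core[OF T u] by blast
      have finE: "finite E"
      proof (rule finite_subset)
        show "E \<subseteq> (\<Union>K\<in>T. {e. e facet_of K})" using E(1) by (auto simp: boundary_faces_def faces_def)
        show "finite (\<Union>K\<in>T. {e. e facet_of K})" using fin facets_finite(1) by blast
      qed
      have sE: "s0 \<le> (\<Sum>e\<in>E. face_area e)"
        unfolding s0_def
      proof (rule face_area_le_sum[OF finE])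
        show "compact e \<and> convex e \<and> aff_dim e = int DIM('a) - 1" if "e \<in> E" for e using shape[OF T] E(1) that by blast
        show "compact e0" "convex e0" "aff_dim e0 = int DIM('a) - 1" using shape[OF T0(1)] T0(2) e0(1) by blast+
        show "e0 \<subseteq> \<Union>E" using e0(1) T0(3) E(2) by blast
      qed
      have "\<forall>e\<in>E. \<exists>K. K \<in> T \<and> e facet_of K \<and> \<not> K \<subseteq> \<Omega>" using facet[OF T] E(1) by blast
      then obtain c where c: "\<And>e. e \<in> E \<Longrightarrow> c e \<in> T \<and> e facet_of (c e) \<and> \<not> c e \<subseteq> \<Omega>" by metis
      define t where "t e = face_integral e (uh e) / face_area e" for e
      have te: "(t e - a (c e))\<^sup>2 \<le> (mesh_size T)\<^sup>2 * g (c e)" if e: "e \<in> E" for e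
      proof -
        have ce: "c e \<in> T" "e facet_of (c e)" using c[OF e] by auto
        have "w T uh (c e) (barycenter e) = t e"
          unfolding w_def CR_lift_exists(2)[OF ce] by (simp add: face_average_def t_def)
        moreover have "barycenter e \<in> c e" using facet_props(3,6)[OF ce] by blast
        ultimately show ?thesis using *(2) ce(1) by metis
      qed
      \<comment> \<open>Positivity of the areas is needed to undo the division in the face
        average.\<close>
      have I: "(\<Sum>e\<in>E. face_area e * t e) = (\<Sum>e\<in>E. face_integral e (uh e))"
      proof (intro sum.cong refl)
        fix e assume "e \<in> E"
        then have "face_area e > 0" using face_area_pos[of "c e" e] c by blast
        then show "face_area e * t e = face_integral e (uh e)" by (simp add: t_def)
      qed
      have "m\<^sup>2 \<le> 3 / s0\<^sup>2 * (\<Sum>e\<in>E. face_area e * t e)\<^sup>2 +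
        3 / s0 * (real (DIM('a) + 1) * ((1 + D) * ball_const * 2 ^ DIM('a)) / \<mu>) * (D + C) * W T uh"
        by (rule boundary_mean_bound[where c = c and L = "{K. K \<in> T \<and> \<not> K \<subseteq> \<Omega>}" and g = g and a = a])
          (use c s0 sE *(1,3,4) te C in auto)
      then have mb: "m\<^sup>2 \<le> 3 / s0\<^sup>2 * (\<Sum>e\<in>E. face_integral e (uh e))\<^sup>2 + B * W T uh"
        by (simp only: I B_def b_def ball_const_def)
      have "4 * V * m\<^sup>2 \<le> 4 * V * (3 / s0\<^sup>2 * (\<Sum>e\<in>E. face_integral e (uh e))\<^sup>2 + B * W T uh)"
        using V by (intro mult_left_mono mb) auto
      also have "\<dots> = 12 * V / s0\<^sup>2 * (\<Sum>e\<in>E. face_integral e (uh e))\<^sup>2 + 4 * V * B * W T uh" by (simp add: distrib_left)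
      also have "4 * V * B * W T uh \<le> 4 * V * B * (hu T u uh + W T uh)" using V B *(6) by (intro mult_left_mono) auto
      finally have "(L2_norm T u)\<^sup>2 \<le> (6 * C + 4 * V * B) * (hu T u uh + W T uh) + 12 * V / s0\<^sup>2 * (\<Sum>e\<in>E. face_integral e (uh e))\<^sup>2"
        using *(5) unfolding distrib_right[of "6 * C"] by linarith
      then show "(L2_norm T u)\<^sup>2 \<le> ((6 * C + 4 * V * B) + 12 * V / s0\<^sup>2 + 1) * (hu T u uh + W T uh + (\<Sum>e\<in>E. face_integral e (uh e))\<^sup>2)"
        using C V B *(6,7) by (intro combine) auto
    qed
  qed
  show ?thesis using goal1 goal2 goal3 unfolding hu_def W_def w_def by blast
qed

end
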